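(* Let $G$ be a compact Lie group, $\rho\colon G\to O(2)$ an orthogonal representation, $S(\rho)$ the unit circle of the corresponding $G$-module, $H=\rho^{-1}(1)$, and let $\chi$ be the character of an irreducible complex $H$-module, with isotropy group $G_\chi$. The triviality, as $G_\chi$-vector bundles over $S(\rho)$, of the generators of the semi-group $\mathrm{Vect}_{G_\chi}(S(\rho),\chi)$ (defined in the context) is as follows. (1) If $\rho(G_\chi)\subset SO(2)$, then $L_\chi$ is trivial. (2) If $\rho(G_\chi)=O(2)$, then $L_\chi^{+}$ and $L_\chi^{-}$ are both trivial or both nontrivial. (3) Otherwise (so that $\rho(G_\chi)$ is a finite dihedral group, of order $|\rho(G_\chi)|$): if $|\rho(G_\chi)|/2$ is odd, then two of the four bundles $L_\chi^{++},L_\chi^{+-},L_\chi^{-+},L_\chi^{--}$ are trivial and the other two are nontrivial; if $|\rho(G_\chi)|/2$ is even, then the four bundles are all trivial or all nontrivial.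
   Context: Modules and vector bundles are complex and finite-dimensional. A $K$-vector bundle over a $K$-space $X$ is trivial if it is isomorphic to a product bundle $X\times W$ with $W$ a $K$-module. For $g\in G$ and a character $\chi$ of $H$, ${}^{g}\chi(h)=\chi(g^{-1}hg)$, and $G_\chi=\{g\in G:{}^{g}\chi=\chi\}\supset H$. $H$ acts trivially on $S(\rho)$, so all fibers of a $G_\chi$-vector bundle over $S(\rho)$ are isomorphic as $H$-modules (the fiber $H$-module). $\mathrm{Vect}_{G_\chi}(S(\rho),\chi)$ is the semi-group (under Whitney sum) of isomorphism classes of $G_\chi$-vector bundles over $S(\rho)$ whose fiber $H$-module has character a multiple of $\chi$. Generators. There is a $G_\chi$-vector bundle $L$ over $S(\rho)$ whose fiber $H$-module has character $\chi$; fix one. Then $F\mapsto L\otimes F$ is an isomorphism of semi-groups from the semi-group $\mathrm{Vect}_{G_\chi/H}(S(\rho))$ of isomorphism classes of $G_\chi/H$-vector bundles over $S(\rho)$ onto $\mathrm{Vect}_{G_\chi}(S(\rho),\chi)$. The generators of $\mathrm{Vect}_{G_\chi}(S(\rho),\chi)$ are the images of the following generators of $\mathrm{Vect}_{G_\chi/H}(S(\rho))$. - If $\rho(G_\chi)\subset SO(2)$: the trivial line bundle with trivial fiber module; its image is $L_\chi$. - If $\rho(G_\chi)=O(2)$: the two product line bundles whose fibers are the two one-dimensional modules of $G_\chi/H\cong O(2)$; their images are $L_\chi^{\pm}$. - Otherwise: let $P=G_\chi\cap\rho^{-1}(SO(2))$. Then $S(\rho)/P$ is a circle on which the order-two group $G_\chi/P$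 acts by a reflection, with two fixed points $p,q$. For $\epsilon,\delta\in\{+,-\}$ there is a unique (up to isomorphism) $G_\chi/P$-line bundle over $S(\rho)/P$ with fiber $\mathbb{C}_\epsilon$ at $p$ and $\mathbb{C}_\delta$ at $q$, where $\mathbb{C}_+$ and $\mathbb{C}_-$ are the trivial and nontrivial one-dimensional modules of the group of order two. The image of its pullback to $S(\rho)$ is $L_\chi^{\epsilon\delta}$. *)

theory Defs
  imports "HOL-Analysis.Analysis" "HOL-Algebra.Coset"
begin

section \<open>Compact Lie groups\<close>

text \<open>
  Manifolds are modelled on \<^term>\<open>Euclidean_space n\<close> with \<open>n\<close> a natural number rather than on
  a type of class \<^class>\<open>euclidean_space\<close>, because the latter excludes dimension 0 and hence
  finite groups.
\<close>

definition partial_deriv :: "nat \<Rightarrow> ((nat \<Rightarrow> real) \<Rightarrow> real) \<Rightarrow> (nat \<Rightarrow> real) \<Rightarrow> real" where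
  "partial_deriv i f x = deriv (\<lambda>t. f (x(i := t))) (x i)"

text \<open>\<open>Ck_on n k f D\<close>: all partial derivatives of \<open>f\<close> up to order \<open>k\<close> exist and are continuous
  on \<open>D\<close>, which is meant to be an open subset of \<^term>\<open>Euclidean_space n\<close>.\<close>

fun Ck_on :: "nat \<Rightarrow> nat \<Rightarrow> ((nat \<Rightarrow> real) \<Rightarrow> real) \<Rightarrow> (nat \<Rightarrow> real) set \<Rightarrow> bool" where
  "Ck_on n 0 f D \<longleftrightarrow> continuous_map (subtopology (Euclidean_space n) D) euclideanreal f"
| "Ck_on n (Suc k) f D \<longleftrightarrow>
     continuous_map (subtopology (Euclidean_space n) D) euclideanreal f \<and>
     (\<forall>i<n. (\<forall>x\<in>D. (\<lambda>t. f (x(i := t))) differentiable (at (x i))) \<and>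
            Ck_on n k (partial_deriv i f) D)"

definition smooth_map ::
  "nat \<Rightarrow> nat \<Rightarrow> ((nat \<Rightarrow> real) \<Rightarrow> nat \<Rightarrow> real) \<Rightarrow> (nat \<Rightarrow> real) set \<Rightarrow> bool" where
  "smooth_map m n f D \<longleftrightarrow> (\<forall>j<n. \<forall>k. Ck_on m k (\<lambda>x. f x j) D)"

definition chart :: "nat \<Rightarrow> 'a topology \<Rightarrow> 'a set \<Rightarrow> ('a \<Rightarrow> nat \<Rightarrow> real) \<Rightarrow> bool" where
  "chart n T U \<phi> \<longleftrightarrow> openin T U \<and>
     (\<exists>V. openin (Euclidean_space n) V \<and>
          homeomorphic_map (subtopology T U) (subtopology (Euclidean_space n) V) \<phi>)"

definition smooth_atlas :: "nat \<Rightarrow> 'a topology \<Rightarrow> ('a set \<times> ('a \<Rightarrow> nat \<Rightarrow> real)) set \<Rightarrow> bool" where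
  "smooth_atlas n T A \<longleftrightarrow>
     (\<forall>(U, \<phi>)\<in>A. chart n T U \<phi>) \<and> (\<Union>(fst ` A)) = topspace T \<and>
     (\<forall>(U, \<phi>)\<in>A. \<forall>(V, \<psi>)\<in>A. smooth_map n n (\<psi> \<circ> inv_into U \<phi>) (\<phi> ` (U \<inter> V)))"

text \<open>The two projections of \<open>\<real>\<^sup>2\<^sup>n = \<real>\<^sup>n \<times> \<real>\<^sup>n\<close>.\<close>

definition fst_half :: "nat \<Rightarrow> (nat \<Rightarrow> real) \<Rightarrow> nat \<Rightarrow> real" where
  "fst_half n z = (\<lambda>i. if i < n then z i else 0)"

definition snd_half :: "nat \<Rightarrow> (nat \<Rightarrow> real) \<Rightarrow> nat \<Rightarrow> real" where
  "snd_half n z = (\<lambda>i. if i < n then z (n + i) else 0)"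

definition topological_group :: "('k, 'r) monoid_scheme \<Rightarrow> 'k topology \<Rightarrow> bool" where
  "topological_group K T \<longleftrightarrow> group K \<and> topspace T = carrier K \<and>
     continuous_map (prod_topology T T) T (\<lambda>(x, y). x \<otimes>\<^bsub>K\<^esub> y) \<and>
     continuous_map T T (\<lambda>x. inv\<^bsub>K\<^esub> x)"

definition lie_group :: "('k, 'r) monoid_scheme \<Rightarrow> 'k topology \<Rightarrow> bool" where
  "lie_group K T \<longleftrightarrow> topological_group K T \<and> Hausdorff_space T \<and> second_countable T \<and>
     (\<exists>n A. smooth_atlas n T A \<and>
        (\<forall>(U, \<phi>)\<in>A. \<forall>(V, \<psi>)\<in>A. \<forall>(W, \<theta>)\<in>A.
           smooth_map (2 * n) n
             (\<lambda>z. \<theta> (inv_into U \<phi> (fst_half n z) \<otimes>\<^bsub>K\<^esub> inv_into V \<psi> (snd_half n z)))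
             {z \<in> topspace (Euclidean_space (2 * n)).
                fst_half n z \<in> \<phi> ` U \<and> snd_half n z \<in> \<psi> ` V \<and>
                inv_into U \<phi> (fst_half n z) \<otimes>\<^bsub>K\<^esub> inv_into V \<psi> (snd_half n z) \<in> W}) \<and>
        (\<forall>(U, \<phi>)\<in>A. \<forall>(V, \<psi>)\<in>A.
           smooth_map n n (\<lambda>x. \<psi> (inv\<^bsub>K\<^esub> (inv_into U \<phi> x)))
             (\<phi> ` {g \<in> U. inv\<^bsub>K\<^esub> g \<in> V})))"

definition compact_lie_group :: "('k, 'r) monoid_scheme \<Rightarrow> 'k topology \<Rightarrow> bool" where
  "compact_lie_group K T \<longleftrightarrow> lie_group K T \<and> compact_space T"


section \<open>Quotient spaces and quotient groups\<close>

definition quotient_top :: "'a topology \<Rightarrow> ('a \<Rightarrow> 'b) \<Rightarrow> 'b topology" where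
  "quotient_top X q =
     topology (\<lambda>U. U \<subseteq> q ` topspace X \<and> openin X {x \<in> topspace X. q x \<in> U})"

lemma openin_quotient_top:
  "openin (quotient_top X q) U \<longleftrightarrow>
     U \<subseteq> q ` topspace X \<and> openin X {x \<in> topspace X. q x \<in> U}"
proof -
  have "istopology (\<lambda>U. U \<subseteq> q ` topspace X \<and> openin X {x \<in> topspace X. q x \<in> U})"
    unfolding istopology_def
  proof (intro conjI allI impI)
    fix S T
    assume a: "S \<subseteq> q ` topspace X \<and> openin X {x \<in> topspace X. q x \<in> S}"
      and b: "T \<subseteq> q ` topspace X \<and> openin X {x \<in> topspace X. q x \<in> T}"
    have "{x \<in> topspace X. q x \<in> S \<inter> T} =
        {x \<in> topspace X. q x \<in> S} \<inter> {x \<in> topspace X. q x \<in> T}"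
      by auto
    then show "openin X {x \<in> topspace X. q x \<in> S \<inter> T}"
      using a b by (simp add: openin_Int)
    show "S \<inter> T \<subseteq> q ` topspace X" using a by auto
  next
    fix \<K>
    assume a: "\<forall>K\<in>\<K>. K \<subseteq> q ` topspace X \<and> openin X {x \<in> topspace X. q x \<in> K}"
    have "{x \<in> topspace X. q x \<in> \<Union>\<K>} = (\<Union>K\<in>\<K>. {x \<in> topspace X. q x \<in> K})"
      by auto
    then show "openin X {x \<in> topspace X. q x \<in> \<Union>\<K>}"
      using a by auto
    show "\<Union>\<K> \<subseteq> q ` topspace X" using a by auto
  qed
  then show ?thesis
    unfolding quotient_top_def by (simp add: topology_inverse')
qed

lemma topspace_quotient_top: "topspace (quotient_top X q) = q ` topspace X"
proof -
  have "{x \<in> topspace X. q x \<in> q ` topspace X} = topspace X"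
    by auto
  then have "openin (quotient_top X q) (q ` topspace X)"
    by (simp add: openin_quotient_top)
  then show ?thesis
    by (meson openin_quotient_top openin_subset openin_topspace subset_antisym)
qed

text \<open>The topology of the factor group \<open>K Mod N\<close>, whose elements are the cosets \<open>N #> g\<close>.\<close>

definition quotient_group_top ::
  "('k, 'r) monoid_scheme \<Rightarrow> 'k topology \<Rightarrow> 'k set \<Rightarrow> 'k set topology" where
  "quotient_group_top K T N = quotient_top T (\<lambda>g. N #>\<^bsub>K\<^esub> g)"


section \<open>Spaces with group action and complex modules\<close>

definition K_space ::
  "('k, 'r) monoid_scheme \<Rightarrow> 'k topology \<Rightarrow> 'x topology \<Rightarrow> ('k \<Rightarrow> 'x \<Rightarrow> 'x) \<Rightarrow> bool" where
  "K_space K T X a \<longleftrightarrow>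
     continuous_map (prod_topology T X) X (\<lambda>(g, x). a g x) \<and>
     (\<forall>x\<in>topspace X. a \<one>\<^bsub>K\<^esub> x = x) \<and>
     (\<forall>g\<in>carrier K. \<forall>h\<in>carrier K. \<forall>x\<in>topspace X. a (g \<otimes>\<^bsub>K\<^esub> h) x = a g (a h x))"

text \<open>\<open>\<complex>\<^sup>n\<close>, in the style of \<^term>\<open>Euclidean_space n\<close>. Every finite-dimensional complex module is
  isomorphic to one with underlying space \<open>\<complex>\<^sup>n\<close>.\<close>

definition Cspace :: "nat \<Rightarrow> (nat \<Rightarrow> complex) topology" where
  "Cspace n = subtopology (product_topology (\<lambda>_. euclidean) UNIV) {v. \<forall>i\<ge>n. v i = 0}"

definition K_module ::
  "('k, 'r) monoid_scheme \<Rightarrow> 'k topology \<Rightarrow> nat \<Rightarrow>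
     ('k \<Rightarrow> (nat \<Rightarrow> complex) \<Rightarrow> nat \<Rightarrow> complex) \<Rightarrow> bool" where
  "K_module K T n R \<longleftrightarrow> K_space K T (Cspace n) R \<and>
     (\<forall>g\<in>carrier K. \<forall>v\<in>topspace (Cspace n).
        (\<forall>w\<in>topspace (Cspace n). R g (\<lambda>i. v i + w i) = (\<lambda>i. R g v i + R g w i)) \<and>
        (\<forall>c. R g (\<lambda>i. c * v i) = (\<lambda>i. c * R g v i)))"

definition irreducible_module ::
  "('k, 'r) monoid_scheme \<Rightarrow> 'k topology \<Rightarrow> nat \<Rightarrow>
     ('k \<Rightarrow> (nat \<Rightarrow> complex) \<Rightarrow> nat \<Rightarrow> complex) \<Rightarrow> bool" where
  "irreducible_module K T n R \<longleftrightarrow> K_module K T n R \<and> n > 0 \<and>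
     (\<forall>W. W \<subseteq> topspace (Cspace n) \<and> (\<lambda>i. 0) \<in> W \<and>
          (\<forall>v\<in>W. \<forall>w\<in>W. (\<lambda>i. v i + w i) \<in> W) \<and>
          (\<forall>v\<in>W. \<forall>c. (\<lambda>i. c * v i) \<in> W) \<and>
          (\<forall>g\<in>carrier K. \<forall>v\<in>W. R g v \<in> W)
        \<longrightarrow> W = {\<lambda>i. 0} \<or> W = topspace (Cspace n))"

definition module_iso ::
  "('k, 'r) monoid_scheme \<Rightarrow>
     nat \<Rightarrow> ('k \<Rightarrow> (nat \<Rightarrow> complex) \<Rightarrow> nat \<Rightarrow> complex) \<Rightarrow>
     nat \<Rightarrow> ('k \<Rightarrow> (nat \<Rightarrow> complex) \<Rightarrow> nat \<Rightarrow> complex) \<Rightarrow> bool" where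
  "module_iso K m R n S \<longleftrightarrow>
     (\<exists>f. bij_betw f (topspace (Cspace m)) (topspace (Cspace n)) \<and>
        (\<forall>v\<in>topspace (Cspace m).
           (\<forall>w\<in>topspace (Cspace m). f (\<lambda>i. v i + w i) = (\<lambda>i. f v i + f w i)) \<and>
           (\<forall>c. f (\<lambda>i. c * v i) = (\<lambda>i. c * f v i)) \<and>
           (\<forall>g\<in>carrier K. f (R g v) = S g (f v))))"

text \<open>The trace of \<open>R g\<close> in the standard basis.\<close>

definition module_character ::
  "nat \<Rightarrow> ('k \<Rightarrow> (nat \<Rightarrow> complex) \<Rightarrow> nat \<Rightarrow> complex) \<Rightarrow> 'k \<Rightarrow> complex" where
  "module_character n R g = (\<Sum>i<n. R g (\<lambda>j. if j = i then 1 else 0) i)"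

definition trivial_module :: "'k \<Rightarrow> (nat \<Rightarrow> complex) \<Rightarrow> nat \<Rightarrow> complex" where
  "trivial_module g v = v"

datatype sign = Plus | Minus

text \<open>For a group \<open>Q\<close> of order two: the trivial (\<open>Plus\<close>) and the nontrivial (\<open>Minus\<close>)
  one-dimensional module.\<close>

definition sign_module ::
  "('k, 'r) monoid_scheme \<Rightarrow> sign \<Rightarrow> 'k \<Rightarrow> (nat \<Rightarrow> complex) \<Rightarrow> nat \<Rightarrow> complex" where
  "sign_module Q \<epsilon> g v = (if \<epsilon> = Plus \<or> g = \<one>\<^bsub>Q\<^esub> then v else (\<lambda>i. - v i))"


section \<open>Equivariant complex vector bundles\<close>

record ('k, 'x, 'e) vbundle =
  total :: "'e topology"
  proj :: "'e \<Rightarrow> 'x"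
  fadd :: "'e \<Rightarrow> 'e \<Rightarrow> 'e"
  fscale :: "complex \<Rightarrow> 'e \<Rightarrow> 'e"
  act :: "'k \<Rightarrow> 'e \<Rightarrow> 'e"

definition fiber :: "('k, 'x, 'e) vbundle \<Rightarrow> 'x \<Rightarrow> 'e set" where
  "fiber E x = {e \<in> topspace (total E). proj E e = x}"

text \<open>A linear bijection from the fiber at \<open>x\<close> to \<open>\<complex>\<^sup>n\<close>. Provided that \<open>fadd\<close> and \<open>fscale\<close> preserve
  the fiber, its existence implies that the fiber is a complex vector space of dimension \<open>n\<close>.\<close>

definition fiber_coord :: "('k, 'x, 'e) vbundle \<Rightarrow> 'x \<Rightarrow> nat \<Rightarrow> ('e \<Rightarrow> nat \<Rightarrow> complex) \<Rightarrow> bool" where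
  "fiber_coord E x n \<psi> \<longleftrightarrow> bij_betw \<psi> (fiber E x) (topspace (Cspace n)) \<and>
     (\<forall>e\<in>fiber E x.
        (\<forall>e'\<in>fiber E x. \<psi> (fadd E e e') = (\<lambda>i. \<psi> e i + \<psi> e' i)) \<and>
        (\<forall>c. \<psi> (fscale E c e) = (\<lambda>i. c * \<psi> e i)))"

definition vector_bundle :: "'x topology \<Rightarrow> ('k, 'x, 'e) vbundle \<Rightarrow> bool" where
  "vector_bundle X E \<longleftrightarrow>
     continuous_map (total E) X (proj E) \<and>
     (\<forall>x\<in>topspace X. \<forall>e\<in>fiber E x.
        (\<forall>e'\<in>fiber E x. fadd E e e' \<in> fiber E x) \<and> (\<forall>c. fscale E c e \<in> fiber E x)) \<and>
     (\<forall>x\<in>topspace X. \<exists>U n \<phi>. openin X U \<and> x \<in> U \<and>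
        homeomorphic_map (subtopology (total E) {e \<in> topspace (total E). proj E e \<in> U})
          (prod_topology (subtopology X U) (Cspace n)) \<phi> \<and>
        (\<forall>e\<in>topspace (total E). proj E e \<in> U \<longrightarrow> fst (\<phi> e) = proj E e) \<and>
        (\<forall>y\<in>U. fiber_coord E y n (\<lambda>e. snd (\<phi> e))))"

text \<open>A \<open>K\<close>-vector bundle over the \<open>K\<close>-space \<open>X\<close> with action \<open>a\<close>.\<close>

definition K_bundle ::
  "('k, 'r) monoid_scheme \<Rightarrow> 'k topology \<Rightarrow> 'x topology \<Rightarrow> ('k \<Rightarrow> 'x \<Rightarrow> 'x) \<Rightarrow>
     ('k, 'x, 'e) vbundle \<Rightarrow> bool" where
  "K_bundle K T X a E \<longleftrightarrow>
     K_space K T X a \<and> vector_bundle X E \<and> K_space K T (total E) (act E) \<and>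
     (\<forall>g\<in>carrier K. \<forall>e\<in>topspace (total E). proj E (act E g e) = a g (proj E e)) \<and>
     (\<forall>g\<in>carrier K. \<forall>x\<in>topspace X. \<forall>e\<in>fiber E x.
        (\<forall>e'\<in>fiber E x. act E g (fadd E e e') = fadd E (act E g e) (act E g e')) \<and>
        (\<forall>c. act E g (fscale E c e) = fscale E c (act E g e)))"

definition line_bundle :: "'x topology \<Rightarrow> ('k, 'x, 'e) vbundle \<Rightarrow> bool" where
  "line_bundle X E \<longleftrightarrow> (\<forall>x\<in>topspace X. \<exists>\<psi>. fiber_coord E x 1 \<psi>)"

definition bundle_iso ::
  "('k, 'r) monoid_scheme \<Rightarrow> 'x topology \<Rightarrow> ('k, 'x, 'e) vbundle \<Rightarrow> ('k, 'x, 'f) vbundle \<Rightarrow> bool" where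
  "bundle_iso K X E F \<longleftrightarrow>
     (\<exists>f. homeomorphic_map (total E) (total F) f \<and>
        (\<forall>x\<in>topspace X. \<forall>e\<in>fiber E x.
           f e \<in> fiber F x \<and>
           (\<forall>e'\<in>fiber E x. f (fadd E e e') = fadd F (f e) (f e')) \<and>
           (\<forall>c. f (fscale E c e) = fscale F c (f e)) \<and>
           (\<forall>g\<in>carrier K. f (act E g e) = act F g (f e))))"

text \<open>The product bundle \<open>X \<times> W\<close>, where \<open>W\<close> is \<open>\<complex>\<^sup>n\<close> with the action \<open>R\<close>.\<close>

definition product_bundle ::
  "'x topology \<Rightarrow> ('k \<Rightarrow> 'x \<Rightarrow> 'x) \<Rightarrow> nat \<Rightarrow> ('k \<Rightarrow> (nat \<Rightarrow> complex) \<Rightarrow> nat \<Rightarrow> complex) \<Rightarrow>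
     ('k, 'x, 'x \<times> (nat \<Rightarrow> complex)) vbundle" where
  "product_bundle X a n R =
     \<lparr>total = prod_topology X (Cspace n),
      proj = fst,
      fadd = (\<lambda>(x, v) (y, w). (x, \<lambda>i. v i + w i)),
      fscale = (\<lambda>c (x, v). (x, \<lambda>i. c * v i)),
      act = (\<lambda>g (x, v). (a g x, R g v))\<rparr>"

definition trivial_bundle ::
  "('k, 'r) monoid_scheme \<Rightarrow> 'k topology \<Rightarrow> 'x topology \<Rightarrow> ('k \<Rightarrow> 'x \<Rightarrow> 'x) \<Rightarrow>
     ('k, 'x, 'e) vbundle \<Rightarrow> bool" where
  "trivial_bundle K T X a E \<longleftrightarrow>
     (\<exists>n R. K_module K T n R \<and> bundle_iso K X E (product_bundle X a n R))"

text \<open>The fiber at \<open>x\<close>, as a module over a group \<open>K\<close> fixing \<open>x\<close>, is isomorphic to \<open>\<complex>\<^sup>n\<close> with the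
  action \<open>R\<close>.\<close>

definition fiber_module_iso ::
  "('k, 'r) monoid_scheme \<Rightarrow> ('k, 'x, 'e) vbundle \<Rightarrow> 'x \<Rightarrow>
     nat \<Rightarrow> ('k \<Rightarrow> (nat \<Rightarrow> complex) \<Rightarrow> nat \<Rightarrow> complex) \<Rightarrow> bool" where
  "fiber_module_iso K E x n R \<longleftrightarrow>
     (\<exists>\<psi>. fiber_coord E x n \<psi> \<and>
        (\<forall>g\<in>carrier K. \<forall>e\<in>fiber E x. \<psi> (act E g e) = R g (\<psi> e)))"

text \<open>Pullback along a map \<open>f\<close> from \<open>X\<close> (with action \<open>a\<close>) to the base of \<open>E\<close> which is equivariant
  with respect to the homomorphism \<open>\<pi>\<close>.\<close>

definition pullback_bundle ::
  "'x topology \<Rightarrow> ('k \<Rightarrow> 'x \<Rightarrow> 'x) \<Rightarrow> ('x \<Rightarrow> 'y) \<Rightarrow> ('k \<Rightarrow> 'l) \<Rightarrow>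
     ('l, 'y, 'e) vbundle \<Rightarrow> ('k, 'x, 'x \<times> 'e) vbundle" where
  "pullback_bundle X a f \<pi> E =
     \<lparr>total = subtopology (prod_topology X (total E)) {(x, e). f x = proj E e},
      proj = fst,
      fadd = (\<lambda>(x, e) (y, e'). (x, fadd E e e')),
      fscale = (\<lambda>c (x, e). (x, fscale E c e)),
      act = (\<lambda>g (x, e). (a g x, act E (\<pi> g) e))\<rparr>"

text \<open>A bundle over \<open>Q\<close> regarded as a bundle over \<open>K\<close> through a homomorphism \<open>\<pi>\<close> from \<open>K\<close> to \<open>Q\<close>.\<close>

definition restrict_action :: "('k \<Rightarrow> 'l) \<Rightarrow> ('l, 'x, 'e) vbundle \<Rightarrow> ('k, 'x, 'e) vbundle" where
  "restrict_action \<pi> E =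
     \<lparr>total = total E, proj = proj E, fadd = fadd E, fscale = fscale E,
      act = (\<lambda>g. act E (\<pi> g))\<rparr>"

definition fiber_functional ::
  "('k, 'x, 'e) vbundle \<Rightarrow> 'x \<Rightarrow> ('e \<Rightarrow> complex) \<Rightarrow> bool" where
  "fiber_functional E x l \<longleftrightarrow>
     (\<forall>e\<in>fiber E x. (\<forall>e'\<in>fiber E x. l (fadd E e e') = l e + l e') \<and>
                    (\<forall>c. l (fscale E c e) = c * l e))"

definition fiber_bilinear_form ::
  "('k, 'x, 'e) vbundle \<Rightarrow> ('k, 'x, 'f) vbundle \<Rightarrow> 'x \<Rightarrow> ('e \<Rightarrow> 'f \<Rightarrow> complex) \<Rightarrow> bool" where
  "fiber_bilinear_form E F x b \<longleftrightarrow>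
     (\<forall>e\<in>fiber E x. fiber_functional F x (b e)) \<and>
     (\<forall>f\<in>fiber F x. fiber_functional E x (\<lambda>e. b e f))"

text \<open>\<open>M\<close> is a tensor product of \<open>E\<close> and \<open>F\<close>, which determines it up to isomorphism: there is a
  continuous equivariant map \<open>\<tau>\<close> from the fiber product of \<open>E\<close> and \<open>F\<close> to \<open>M\<close> which on each fiber
  is a universal bilinear map. As the fibers are finite-dimensional, it suffices to require the
  universal property for complex-valued bilinear maps.\<close>

definition is_tensor_bundle ::
  "('k, 'r) monoid_scheme \<Rightarrow> 'k topology \<Rightarrow> 'x topology \<Rightarrow> ('k \<Rightarrow> 'x \<Rightarrow> 'x) \<Rightarrow>
     ('k, 'x, 'e) vbundle \<Rightarrow> ('k, 'x, 'f) vbundle \<Rightarrow> ('k, 'x, 'm) vbundle \<Rightarrow> bool" where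
  "is_tensor_bundle K T X a E F M \<longleftrightarrow> K_bundle K T X a M \<and>
     (\<exists>\<tau>. continuous_map
            (subtopology (prod_topology (total E) (total F)) {(e, f). proj E e = proj F f})
            (total M) (\<lambda>(e, f). \<tau> e f) \<and>
        (\<forall>x\<in>topspace X.
           (\<forall>e\<in>fiber E x. \<forall>f\<in>fiber F x.
              \<tau> e f \<in> fiber M x \<and>
              (\<forall>e'\<in>fiber E x. \<tau> (fadd E e e') f = fadd M (\<tau> e f) (\<tau> e' f)) \<and>
              (\<forall>f'\<in>fiber F x. \<tau> e (fadd F f f') = fadd M (\<tau> e f) (\<tau> e f')) \<and>
              (\<forall>c. \<tau> (fscale E c e) f = fscale M c (\<tau> e f) \<and>
                   \<tau> e (fscale F c f) = fscale M c (\<tau> e f)) \<and>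
              (\<forall>g\<in>carrier K. \<tau> (act E g e) (act F g f) = act M g (\<tau> e f))) \<and>
           (\<forall>b. fiber_bilinear_form E F x b \<longrightarrow>
              (\<exists>!l. l \<in> extensional (fiber M x) \<and> fiber_functional M x l \<and>
                    (\<forall>e\<in>fiber E x. \<forall>f\<in>fiber F x. l (\<tau> e f) = b e f)))))"


section \<open>Orthogonal representations on the plane\<close>

definition SO2 :: "(real^2^2) set" where
  "SO2 = {A. rotation_matrix A}"

definition O2 :: "(real^2^2) set" where
  "O2 = {A. orthogonal_matrix A}"

definition orthogonal_rep ::
  "('k, 'r) monoid_scheme \<Rightarrow> 'k topology \<Rightarrow> ('k \<Rightarrow> real^2^2) \<Rightarrow> bool" where
  "orthogonal_rep K T \<rho> \<longleftrightarrow> continuous_map T euclidean \<rho> \<and> \<rho> ` carrier K \<subseteq> O2 \<and>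
     (\<forall>g\<in>carrier K. \<forall>h\<in>carrier K. \<rho> (g \<otimes>\<^bsub>K\<^esub> h) = \<rho> g ** \<rho> h)"

definition rot :: "real \<Rightarrow> real^2^2" where
  "rot t = vector [vector [cos t, - sin t], vector [sin t, cos t]]"

text \<open>The dihedral subgroups of order \<open>2 * n\<close> of \<open>O(2)\<close>.\<close>

definition dihedral_subgroup :: "nat \<Rightarrow> (real^2^2) set \<Rightarrow> bool" where
  "dihedral_subgroup n D \<longleftrightarrow> n > 0 \<and>
     (\<exists>s. rotoinversion_matrix s \<and>
          D = (\<Union>k<n. {rot (2 * pi * real k / real n), rot (2 * pi * real k / real n) ** s}))"

definition unit_circle :: "(real^2) topology" where
  "unit_circle = top_of_set (sphere 0 1)"

definition circle_action :: "('k \<Rightarrow> real^2^2) \<Rightarrow> 'k \<Rightarrow> real^2 \<Rightarrow> real^2" where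
  "circle_action \<rho> g x = \<rho> g *v x"

text \<open>The action of a factor group on the circle; a coset \<open>C\<close> is assumed to act through any of its
  elements.\<close>

definition coset_circle_action :: "('k \<Rightarrow> real^2^2) \<Rightarrow> 'k set \<Rightarrow> real^2 \<Rightarrow> real^2" where
  "coset_circle_action \<rho> C x = the_elem ((\<lambda>g. circle_action \<rho> g x) ` C)"

definition circle_orbit :: "('k \<Rightarrow> real^2^2) \<Rightarrow> 'k set \<Rightarrow> real^2 \<Rightarrow> (real^2) set" where
  "circle_orbit \<rho> P x = (\<lambda>g. circle_action \<rho> g x) ` P"

definition orbit_space :: "('k \<Rightarrow> real^2^2) \<Rightarrow> 'k set \<Rightarrow> (real^2) set topology" where
  "orbit_space \<rho> P = quotient_top unit_circle (circle_orbit \<rho> P)"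

definition coset_orbit_action :: "('k \<Rightarrow> real^2^2) \<Rightarrow> 'k set \<Rightarrow> (real^2) set \<Rightarrow> (real^2) set" where
  "coset_orbit_action \<rho> C B = (\<Union>g\<in>C. circle_action \<rho> g ` B)"

text \<open>\<open>chi\<close> is only meaningful on the normal subgroup \<open>H\<close>, so equality of \<open>chi\<close> with its conjugate is
  required on \<open>H\<close> only.\<close>

definition character_isotropy ::
  "('k, 'r) monoid_scheme \<Rightarrow> 'k set \<Rightarrow> ('k \<Rightarrow> complex) \<Rightarrow> 'k set" where
  "character_isotropy G H chi =
     {g \<in> carrier G. \<forall>h\<in>H. chi (inv\<^bsub>G\<^esub> g \<otimes>\<^bsub>G\<^esub> h \<otimes>\<^bsub>G\<^esub> g) = chi h}"

text \<open>\<open>M\<close> represents the image of the \<open>K/H\<close>-bundle \<open>F\<close> under \<open>F \<mapsto> L \<otimes> F\<close>.\<close>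

definition is_image_bundle ::
  "('k, 'r) monoid_scheme \<Rightarrow> 'k topology \<Rightarrow> ('k \<Rightarrow> real^2^2) \<Rightarrow> 'k set \<Rightarrow>
     ('k, real^2, 'l) vbundle \<Rightarrow> ('k set, real^2, 'f) vbundle \<Rightarrow> ('k, real^2, 'm) vbundle \<Rightarrow> bool" where
  "is_image_bundle K T \<rho> H L F M \<longleftrightarrow>
     is_tensor_bundle K T unit_circle (circle_action \<rho>) L
       (restrict_action (\<lambda>g. H #>\<^bsub>K\<^esub> g) F) M"

end

theory Submission
  imports Defs "HOL-Library.Function_Algebras" "HOL-Computational_Algebra.Fundamental_Theorem_Algebra"
begin

text \<open>
  Over a small arc, elements of the group algebra of \<open>H\<close> that act on the irreducible module as matrix
  units (Burnside) turn a vector of the fiber into an \<open>H\<close>-equivariant frame of \<open>L\<close>; by Schur's lemma two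
  such frames differ by a scalar function, so the local frames can be glued around the circle. In a
  global frame an element \<open>g\<close> acts by matrices that depend on the base point \<open>x\<close> only through a nonzero
  scalar \<open>c g x\<close>, and \<open>g \<mapsto> c g\<close> is a cocycle up to constants. A line bundle \<open>F\<close> contributes a scalar
  \<open>r g x\<close> in the same way, and \<open>L \<otimes> F\<close> is trivial iff \<open>c g x * r g x = k g * u (g x) / u x\<close> for some
  continuous nowhere zero \<open>u\<close> and constants \<open>k g\<close>.

  For finite cyclic \<open>\<rho>(G\<^sub>\<chi>)\<close> such a \<open>u\<close> arises by averaging a logarithm of the cocycle over the rotations,
  and for \<open>SO(2)\<close> by integrating it; this is (1). A product line bundle has \<open>r\<close> independent of \<open>x\<close>, which
  gives (2). In the dihedral case \<open>u\<close> first removes the rotations, and then the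
  only obstruction is whether a reflection \<open>s\<close> acts by the same scalar at its two fixed points \<open>x\<^sub>0\<close> and
  \<open>- x\<^sub>0\<close> (the parity of a winding number). The scalars \<open>r s x\<^sub>0\<close>, \<open>r s (- x\<^sub>0)\<close> are the signs of the line
  bundle at the images of \<open>x\<^sub>0\<close>, \<open>- x\<^sub>0\<close> in the orbit space. For \<open>n = |\<rho>(G\<^sub>\<chi>)| / 2\<close> odd these images are
  \<open>p\<close> and \<open>q\<close>, so exactly two of the four sign pairs remove the obstruction; for \<open>n\<close> even they coincide, and
  the signs have no influence.
\<close>

section \<open>Linear maps between coordinate spaces\<close>

text \<open>The fibers of \<open>L\<close> are known only pointwise, through their character, and
  nothing relates the isomorphisms at neighbouring points. The argument therefore never assembles
  them: elements of the group algebra act continuously in the base point, and equal characters force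
  equal kernels, so relations checked in the model module \<open>R0\<close> persist in every fiber.
  Constants are tolerated everywhere (\<open>flat\<close>, \<open>pcocycle\<close>) because the
  model of a trivial bundle may be any module and so absorbs every factor that depends on
  \<open>g\<close> alone. Compactness of the group enters twice: the set of rotation angles is
  closed, and the multipliers depend continuously on the angle when the rotations fill the circle.
  The parity arises as follows. Once the rotations are removed, the multiplier \<open>C\<close> of
  the reflection has \<open>C t * C (- t)\<close> constant, so a logarithm \<open>\<psi>\<close> of
  it grows by \<open>2 * (\<psi> pi - \<psi> 0)\<close> over one turn. The correcting factor is a
  square root of \<open>1 / C\<close>, and it closes up exactly if
  \<open>C pi = C 0\<close>.\<close>

definition Cn :: "nat \<Rightarrow> (nat \<Rightarrow> complex) set" where
  "Cn n = {v. \<forall>i\<ge>n. v i = 0}"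

lemma topspace_Cspace [simp]: "topspace (Cspace n) = Cn n"
  by (simp add: Cspace_def Cn_def)

lemma Cn_zero [simp]: "(\<lambda>_. 0) \<in> Cn n"
  and Cn_add: "v \<in> Cn n \<Longrightarrow> w \<in> Cn n \<Longrightarrow> (\<lambda>i. v i + w i) \<in> Cn n"
  and Cn_diff: "v \<in> Cn n \<Longrightarrow> w \<in> Cn n \<Longrightarrow> (\<lambda>i. v i - w i) \<in> Cn n"
  and Cn_scale: "v \<in> Cn n \<Longrightarrow> (\<lambda>i. c * v i) \<in> Cn n"
  by (auto simp: Cn_def)

lemma Cn_sum: "(\<And>j. j \<in> J \<Longrightarrow> g j \<in> Cn n) \<Longrightarrow> (\<lambda>i. \<Sum>j\<in>J. c j * g j i) \<in> Cn n"
  by (simp add: Cn_def)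

definition ev :: "nat \<Rightarrow> nat \<Rightarrow> complex" where
  "ev i = (\<lambda>j. if j = i then 1 else 0)"

lemma ev_Cn [simp]: "i < n \<Longrightarrow> ev i \<in> Cn n"
  by (auto simp: ev_def Cn_def)

lemma Cn_eqI: "v \<in> Cn n \<Longrightarrow> w \<in> Cn n \<Longrightarrow> (\<And>i. i < n \<Longrightarrow> v i = w i) \<Longrightarrow> v = w"
  unfolding Cn_def mem_Collect_eq fun_eq_iff by (metis not_le)

lemma Cn_expand: "v \<in> Cn n \<Longrightarrow> v = (\<lambda>i. \<Sum>j<n. v j * ev j i)"
  by (auto simp: Cn_def ev_def fun_eq_iff if_distrib cong: if_cong)

text \<open>Maps of modules and fibers are unspecified outside the finite-dimensional spaces, so
  linearity is relative to \<open>Cn m\<close>. Identities between such maps are likewise only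
  available on \<open>Cn m\<close>.\<close>

definition lin :: "nat \<Rightarrow> nat \<Rightarrow> ((nat \<Rightarrow> complex) \<Rightarrow> nat \<Rightarrow> complex) \<Rightarrow> bool" where
  "lin m n f \<longleftrightarrow> (\<forall>v\<in>Cn m. f v \<in> Cn n) \<and>
     (\<forall>v\<in>Cn m. \<forall>w\<in>Cn m. f (\<lambda>i. v i + w i) = (\<lambda>i. f v i + f w i)) \<and>
     (\<forall>v\<in>Cn m. \<forall>c. f (\<lambda>i. c * v i) = (\<lambda>i. c * f v i))"

lemma linI:
  assumes "\<And>v. v \<in> Cn m \<Longrightarrow> f v \<in> Cn n"
    and "\<And>v w. v \<in> Cn m \<Longrightarrow> w \<in> Cn m \<Longrightarrow> f (\<lambda>i. v i + w i) = (\<lambda>i. f v i + f w i)"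
    and "\<And>v c. v \<in> Cn m \<Longrightarrow> f (\<lambda>i. c * v i) = (\<lambda>i. c * f v i)"
  shows "lin m n f"
  using assms by (auto simp: lin_def)

lemma lin_Cn: "lin m n f \<Longrightarrow> v \<in> Cn m \<Longrightarrow> f v \<in> Cn n"
  and lin_add: "lin m n f \<Longrightarrow> v \<in> Cn m \<Longrightarrow> w \<in> Cn m \<Longrightarrow> f (\<lambda>i. v i + w i) = (\<lambda>i. f v i + f w i)"
  and lin_scale: "lin m n f \<Longrightarrow> v \<in> Cn m \<Longrightarrow> f (\<lambda>i. c * v i) = (\<lambda>i. c * f v i)"
  by (auto simp: lin_def)

lemma lin_zero: "lin m n f \<Longrightarrow> f (\<lambda>_. 0) = (\<lambda>_. 0)"
  using lin_scale[of m n f "\<lambda>_. 0" 0] by simp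

lemma lin_diff:
  assumes "lin m n f" "v \<in> Cn m" "w \<in> Cn m"
  shows "f (\<lambda>i. v i - w i) = (\<lambda>i. f v i - f w i)"
  using lin_add[OF assms(1,2) Cn_scale[OF assms(3), of "-1"]] lin_scale[OF assms(1,3), of "-1"]
  by simp

lemma lin_sum:
  assumes "lin m n f" "finite J" "\<And>j. j \<in> J \<Longrightarrow> g j \<in> Cn m"
  shows "f (\<lambda>i. \<Sum>j\<in>J. c j * g j i) = (\<lambda>i. \<Sum>j\<in>J. c j * f (g j) i)"
  using assms(2,3)
proof (induction J rule: finite_induct)
  case empty
  then show ?case using lin_zero[OF assms(1)] by simp
next
  case (insert a J)
  then show ?case
    using lin_add[OF assms(1) Cn_scale[of "g a" m "c a"] Cn_sum[of J g m c]]
      lin_scale[OF assms(1), of "g a" "c a"]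
    by simp
qed

lemma lin_expand: "lin m n f \<Longrightarrow> v \<in> Cn m \<Longrightarrow> f v = (\<lambda>i. \<Sum>j<m. v j * f (ev j) i)"
  using lin_sum[of m n f "{..<m}" ev v] Cn_expand[of v m] by simp

lemma lin_comp: "lin m n f \<Longrightarrow> lin n k g \<Longrightarrow> lin m k (\<lambda>v. g (f v))"
  by (simp add: lin_def)

lemma lin_inv_into:
  assumes "lin m n f" "bij_betw f (Cn m) (Cn n)"
  shows "lin n m (inv_into (Cn m) f)"
proof (rule linI)
  let ?g = "inv_into (Cn m) f"
  have g: "?g v \<in> Cn m" "f (?g v) = v" if "v \<in> Cn n" for v
    using that assms(2) by (auto simp: bij_betw_def inv_into_into f_inv_into_f)
  have inj: "x = y" if "f x = f y" "x \<in> Cn m" "y \<in> Cn m" for x y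
    using that assms(2) by (auto simp: bij_betw_def inj_on_def)
  fix v assume v: "v \<in> Cn n"
  show "?g v \<in> Cn m" using g[OF v] by blast
  show "?g (\<lambda>i. v i + w i) = (\<lambda>i. ?g v i + ?g w i)" if "w \<in> Cn n" for w
    by (rule inj) (use g[OF v] g[OF that] g[OF Cn_add[OF v that]] in \<open>simp_all add: lin_add[OF assms(1)] Cn_add\<close>)
  show "?g (\<lambda>i. c * v i) = (\<lambda>i. c * ?g v i)" for c
    by (rule inj) (use g[OF v] g[OF Cn_scale[OF v]] in \<open>simp_all add: lin_scale[OF assms(1)] Cn_scale\<close>)
qed

section \<open>Dimension arguments through linear independence\<close>

definition scv :: "complex \<Rightarrow> (nat \<Rightarrow> complex) \<Rightarrow> nat \<Rightarrow> complex" where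
  "scv c v = (\<lambda>i. c * v i)"

text \<open>Gives access to bases and extension of linear maps: \<open>cvec.vs1\<close> is the space
  of complex sequences, and the second space is the field, so that linear maps of the pair are
  functionals.\<close>

interpretation cvec: vector_space_pair scv "(*) :: complex \<Rightarrow> complex \<Rightarrow> complex"
  by unfold_locales (auto simp: scv_def fun_eq_iff algebra_simps)

lemma sum_scv: "(\<Sum>j\<in>J. scv (c j) (g j)) = (\<lambda>i. \<Sum>j\<in>J. c j * g j i)"
proof (induction J rule: infinite_finite_induct)
  case (insert x F)
  then show ?case by (simp add: scv_def fun_eq_iff)
qed (auto simp: fun_eq_iff)

lemma Cn_subset_span: "Cn n \<subseteq> cvec.vs1.span (ev ` {..<n})"
proof
  fix v assume "v \<in> Cn n"
  then have "v = (\<Sum>j<n. scv (v j) (ev j))"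
    using Cn_expand by (simp add: sum_scv)
  also have "\<dots> \<in> cvec.vs1.span (ev ` {..<n})"
    by (intro cvec.vs1.span_sum cvec.vs1.span_scale cvec.vs1.span_base) auto
  finally show "v \<in> cvec.vs1.span (ev ` {..<n})" .
qed

lemma lin_inj_iff:
  assumes "lin m n f"
  shows "inj_on f (Cn m) \<longleftrightarrow> (\<forall>v\<in>Cn m. f v = (\<lambda>_. 0) \<longrightarrow> v = (\<lambda>_. 0))"
proof
  assume "inj_on f (Cn m)"
  then show "\<forall>v\<in>Cn m. f v = (\<lambda>_. 0) \<longrightarrow> v = (\<lambda>_. 0)"
    using lin_zero[OF assms] by (auto simp: inj_on_def)
next
  assume z: "\<forall>v\<in>Cn m. f v = (\<lambda>_. 0) \<longrightarrow> v = (\<lambda>_. 0)"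
  show "inj_on f (Cn m)"
  proof (rule inj_onI)
    fix v w assume vw: "v \<in> Cn m" "w \<in> Cn m" "f v = f w"
    then have "(\<lambda>i. v i - w i) = (\<lambda>_. 0)"
      using z Cn_diff[OF vw(1,2)] lin_diff[OF assms vw(1,2)] by simp
    then show "v = w" by (auto simp: fun_eq_iff)
  qed
qed

text \<open>The images of the basis vectors stay independent, and an independent set in the span of
  \<open>n\<close> vectors has at most \<open>n\<close> elements.\<close>

lemma lin_inj_le:
  assumes "lin m n f" "inj_on f (Cn m)"
  shows "m \<le> n"
proof -
  have inj: "inj_on (\<lambda>j. f (ev j)) {..<m}"
  proof (rule inj_onI)
    fix i j assume ij: "i \<in> {..<m}" "j \<in> {..<m}" "f (ev i) = f (ev j)"
    then have "ev i = ev j" using assms(2) by (auto dest!: inj_onD)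
    then show "i = j" by (metis ev_def zero_neq_one)
  qed
  let ?B = "(\<lambda>j. f (ev j)) ` {..<m}"
  have "cvec.vs1.independent ?B"
  proof
    assume "cvec.vs1.dependent ?B"
    then obtain u where u: "\<exists>v\<in>?B. u v \<noteq> 0" "(\<Sum>v\<in>?B. scv (u v) v) = 0"
      using cvec.vs1.dependent_finite[of ?B] by auto
    \<comment> \<open>A dependency among the images is the image of the single vector
      \<open>w\<close> with the same coefficients.\<close>
    define w where "w = (\<lambda>i. \<Sum>j<m. u (f (ev j)) * ev j i)"
    have wC: "w \<in> Cn m" unfolding w_def by (rule Cn_sum) auto
    have "f w = (\<Sum>j<m. scv (u (f (ev j))) (f (ev j)))"
      unfolding w_def sum_scv by (rule lin_sum[OF assms(1)]) auto
    also have "\<dots> = (\<Sum>v\<in>?B. scv (u v) v)"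
      by (simp add: sum.reindex[OF inj])
    finally have "w = (\<lambda>_. 0)"
      using u(2) assms wC lin_inj_iff[OF assms(1)] by (auto simp: zero_fun_def)
    moreover have "w j = u (f (ev j))" if "j < m" for j
      using that by (simp add: w_def ev_def if_distrib cong: if_cong)
    ultimately have "u (f (ev j)) = 0" if "j < m" for j using that by metis
    then show False using u(1) by auto
  qed
  moreover have "?B \<subseteq> Cn n" using lin_Cn[OF assms(1)] by auto
  ultimately have "card ?B \<le> card (ev ` {..<n})"
    using cvec.vs1.independent_span_bound[of "ev ` {..<n}" ?B] Cn_subset_span[of n] by blast
  moreover have "card ?B = m" using card_image[OF inj] by simp
  moreover have "card (ev ` {..<n}) \<le> n" using card_image_le[of "{..<n}" ev] by simp
  ultimately show ?thesis by simp
qed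

lemma lin_bij_dim: "lin m n f \<Longrightarrow> bij_betw f (Cn m) (Cn n) \<Longrightarrow> m = n"
  by (metis bij_betw_def bij_betw_inv_into lin_inj_le lin_inv_into le_antisym)

text \<open>A vector \<open>y\<close> missed by \<open>f\<close> could be added as one more column;
  the enlarged map \<open>g\<close> would embed dimension \<open>n + 1\<close> into dimension
  \<open>n\<close>.\<close>

lemma lin_inj_bij:
  assumes "lin n n f" "inj_on f (Cn n)"
  shows "bij_betw f (Cn n) (Cn n)"
proof (rule ccontr)
  assume "\<not> bij_betw f (Cn n) (Cn n)"
  then obtain y where y: "y \<in> Cn n" "y \<notin> f ` Cn n"
    using assms lin_Cn[OF assms(1)] by (auto simp: bij_betw_def)
  define r where "r = (\<lambda>v::nat \<Rightarrow> complex. (\<lambda>i. if i < n then v i else 0))"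
  have r: "r v \<in> Cn n" for v by (auto simp: r_def Cn_def)
  define g where "g = (\<lambda>v. (\<lambda>i. f (r v) i + v n * y i))"
  have "lin (Suc n) n g"
  proof (rule linI)
    show "g v \<in> Cn n" for v
      using lin_Cn[OF assms(1) r[of v]] y(1) by (auto simp: g_def Cn_def)
    show "g (\<lambda>i. v i + w i) = (\<lambda>i. g v i + g w i)" for v w
    proof -
      have "r (\<lambda>i. v i + w i) = (\<lambda>i. r v i + r w i)" by (auto simp: r_def)
      then show ?thesis using lin_add[OF assms(1) r[of v] r[of w]] by (simp add: g_def algebra_simps)
    qed
    show "g (\<lambda>i. c * v i) = (\<lambda>i. c * g v i)" for v c
    proof -
      have "r (\<lambda>i. c * v i) = (\<lambda>i. c * r v i)" by (auto simp: r_def)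
      then show ?thesis using lin_scale[OF assms(1) r[of v]] by (simp add: g_def algebra_simps)
    qed
  qed
  moreover have "inj_on g (Cn (Suc n))"
    unfolding lin_inj_iff[OF \<open>lin (Suc n) n g\<close>]
  proof (intro ballI impI)
    fix v assume v: "v \<in> Cn (Suc n)" and gv: "g v = (\<lambda>_. 0)"
    have vn: "v n = 0"
    proof (rule ccontr)
      assume "v n \<noteq> 0"
      have "f (r v) i + v n * y i = 0" for i using fun_cong[OF gv, of i] by (simp add: g_def)
      then have "y = (\<lambda>i. (- inverse (v n)) * f (r v) i)"
        using \<open>v n \<noteq> 0\<close> by (auto simp: fun_eq_iff field_simps eq_neg_iff_add_eq_0)
      also have "\<dots> = f (\<lambda>i. (- inverse (v n)) * r v i)"
        by (rule lin_scale[OF assms(1) r, symmetric])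
      finally show False using y(2) Cn_scale[OF r] by blast
    qed
    then have "f (r v) = (\<lambda>_. 0)" using gv by (simp add: g_def)
    then have "r v = (\<lambda>_. 0)" using assms lin_inj_iff[OF assms(1)] r by blast
    then have "v i = 0" if "i < n" for i using that unfolding r_def fun_eq_iff by metis
    then show "v = (\<lambda>_. 0)"
      by (intro Cn_eqI[OF v Cn_zero]) (use vn in \<open>auto simp: less_Suc_eq\<close>)
  qed
  ultimately show False using lin_inj_le by force
qed

text \<open>A basis of \<open>W\<close> together with \<open>y\<close> is independent, so some
  functional is 1 at \<open>y\<close> and 0 on \<open>W\<close>; its values on the standard basis
  are the coefficients \<open>a\<close>. This will show that tensors of frame vectors fill the
  fibers of a tensor product.\<close>

lemma functional_separating:
  assumes W: "W \<subseteq> Cn n" "(\<lambda>_. 0) \<in> W" "\<And>v w. v \<in> W \<Longrightarrow> w \<in> W \<Longrightarrow> (\<lambda>i. v i + w i) \<in> W"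
    "\<And>v c. v \<in> W \<Longrightarrow> (\<lambda>i. c * v i) \<in> W"
    and y: "y \<in> Cn n" "y \<notin> W"
  obtains a where "(\<Sum>i<n. y i * a i) \<noteq> (0::complex)" "\<And>w. w \<in> W \<Longrightarrow> (\<Sum>i<n. w i * a i) = 0"
proof -
  have sub: "cvec.vs1.subspace W"
    using W(2-4) by (auto simp: cvec.vs1.subspace_def scv_def zero_fun_def plus_fun_def)
  obtain B where B: "B \<subseteq> W" "cvec.vs1.independent B" "W \<subseteq> cvec.vs1.span B"
    using cvec.vs1.maximal_independent_subset[of W] by blast
  have spB: "cvec.vs1.span B = W"
    using B sub by (metis cvec.vs1.span_minimal subset_antisym)
  have "cvec.vs1.independent (insert y B)"
    using B y spB by (simp add: cvec.vs1.independent_insert)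
  from cvec.linear_independent_extend[OF this, of "\<lambda>v. if v = y then 1 else 0"]
  obtain g where g: "Vector_Spaces.linear scv (*) g" "\<forall>x\<in>insert y B. g x = (if x = y then 1 else 0)"
    by blast
  interpret g: Vector_Spaces.linear scv "(*)" g by fact
  have gexp: "g v = (\<Sum>i<n. v i * g (ev i))" if "v \<in> Cn n" for v
  proof -
    have "v = (\<Sum>j<n. scv (v j) (ev j))"
      using that Cn_expand by (simp add: sum_scv)
    then have "g v = g (\<Sum>j<n. scv (v j) (ev j))" by simp
    also have "\<dots> = (\<Sum>i<n. v i * g (ev i))" by (simp add: g.sum g.scale)
    finally show ?thesis .
  qed
  have "g w = 0" if "w \<in> W" for w
    by (rule g.eq_0_on_span[of B]) (use that g(2) y B spB in auto)
  with that[of "\<lambda>i. g (ev i)"] gexp g(2) y W(1) show ?thesis by force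
qed

text \<open>No determinant is involved. The \<open>n + 1\<close> vectors \<open>x, f x, ...\<close>
  are dependent, so some nonzero polynomial in \<open>f\<close> kills \<open>x\<close>. Writing it
  as \<open>(X - z) q\<close>, either \<open>q (f) x\<close> is an eigenvector for \<open>z\<close>,
  or it vanishes and \<open>q\<close> has smaller degree.\<close>

lemma lin_eigenvector:
  assumes "lin n n f" "0 < n"
  obtains c v where "v \<in> Cn n" "v \<noteq> (\<lambda>_. 0)" "f v = (\<lambda>i. c * v i)"
proof -
  \<comment> \<open>\<open>P N p x\<close> is \<open>p (f) x\<close>. The length \<open>N\<close> of
    the sum is kept apart from the degree of \<open>p\<close>, which makes induction on
    \<open>N\<close> possible.\<close>
  define P where "P N p x = (\<lambda>i. \<Sum>k\<le>N. coeff p k * (f ^^ k) x i)" for N :: nat and p :: "complex poly" and x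
  have fk: "(f ^^ k) x \<in> Cn n" if "x \<in> Cn n" for k x
    using that by (induction k) (auto intro: lin_Cn[OF assms(1)])
  have PC: "P N p x \<in> Cn n" if "x \<in> Cn n" for N p x
    unfolding P_def using fk that by (intro Cn_sum) auto
  have *: "\<exists>c v. v \<in> Cn n \<and> v \<noteq> (\<lambda>_. 0) \<and> f v = (\<lambda>i. c * v i)"
    if "p \<noteq> 0" "degree p \<le> N" "x \<in> Cn n" "x \<noteq> (\<lambda>_. 0)" "P N p x = (\<lambda>_. 0)" for N p x
    using that
  proof (induction N arbitrary: p x)
    case 0
    then have "coeff p 0 \<noteq> 0" using leading_coeff_neq_0[of p] by simp
    then have "x = (\<lambda>_. 0)" using 0 by (auto simp: P_def fun_eq_iff)
    then show ?case using 0 by blast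
  next
    case (Suc N)
    show ?case
    proof (cases "degree p = 0")
      case True
      have "coeff p k = 0" if "k > 0" for k using True that by (simp add: coeff_eq_0)
      then have "P (Suc N) p x = (\<lambda>i. coeff p 0 * x i)"
        unfolding P_def by (subst sum.atMost_shift) simp
      moreover have "coeff p 0 \<noteq> 0" using True Suc.prems(1) by (metis leading_coeff_neq_0)
      ultimately show ?thesis using Suc.prems by (auto simp: fun_eq_iff)
    next
      case False
      then have "\<not> constant (poly p)" by (simp add: constant_degree)
      then obtain z where "poly p z = 0" using fundamental_theorem_of_algebra by blast
      then obtain q where q: "p = [:- z, 1:] * q" by (metis poly_eq_0_iff_dvd dvdE)
      have q0: "q \<noteq> 0" using q Suc.prems(1) by auto
      have dq: "degree q \<le> N" using Suc.prems(2) q0 unfolding q by (subst (asm) degree_mult_eq) auto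
      define y where "y = P N q x"
      have yC: "y \<in> Cn n" unfolding y_def using PC Suc.prems(3) .
      have cp: "coeff p k = (case k of 0 \<Rightarrow> 0 | Suc l \<Rightarrow> coeff q l) - z * coeff q k" for k
        unfolding q by (cases k) (auto simp: coeff_pCons)
      have "P (Suc N) p x = (\<lambda>i. f y i - z * y i)"
      proof -
        have fy: "f y = (\<lambda>i. \<Sum>k\<le>N. coeff q k * (f ^^ Suc k) x i)"
          unfolding y_def P_def by (subst lin_sum[OF assms(1)]) (use fk Suc.prems in auto)
        have "(\<Sum>k\<le>Suc N. (case k of 0 \<Rightarrow> 0 | Suc l \<Rightarrow> coeff q l) * (f ^^ k) x i) = f y i" for i
          unfolding fy by (subst sum.atMost_Suc_shift) simp
        moreover have "(\<Sum>k\<le>Suc N. z * coeff q k * (f ^^ k) x i) = z * y i" for i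
          using dq by (simp add: y_def P_def sum_distrib_left mult.assoc coeff_eq_0)
        ultimately show ?thesis
          unfolding P_def cp by (simp only: left_diff_distrib sum_subtractf)
      qed
      then have fy: "f y = (\<lambda>i. z * y i)" using Suc.prems(5) by (auto simp: fun_eq_iff)
      show ?thesis
      proof (cases "y = (\<lambda>_. 0)")
        case True
        then show ?thesis using Suc.IH[OF q0 dq Suc.prems(3,4)] by (simp add: y_def)
      qed (use yC fy in blast)
    qed
  qed
  define x where "x = ev 0"
  have x: "x \<in> Cn n" "x \<noteq> (\<lambda>_. 0)" using assms(2) by (auto simp: x_def fun_eq_iff) (auto simp: ev_def)
  \<comment> \<open>Sends a vector of \<open>n + 1\<close> coefficients to the corresponding
    combination of iterates of \<open>f\<close>; the kernel of \<open>g\<close> supplies the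
    polynomial.\<close>
  define g where "g = (\<lambda>c::nat \<Rightarrow> complex. \<lambda>i. \<Sum>k\<le>n. c k * (f ^^ k) x i)"
  have "lin (Suc n) n g"
  proof (rule linI)
    show "g c \<in> Cn n" for c unfolding g_def by (rule Cn_sum) (rule fk[OF x(1)])
  qed (simp_all add: g_def distrib_right sum.distrib sum_distrib_left mult.assoc)
  then have "\<not> inj_on g (Cn (Suc n))" using lin_inj_le by force
  then obtain c where c: "c \<in> Cn (Suc n)" "g c = (\<lambda>_. 0)" "c \<noteq> (\<lambda>_. 0)"
    using lin_inj_iff[OF \<open>lin (Suc n) n g\<close>] by blast
  define p where "p = Abs_poly c"
  have "\<forall>\<^sub>\<infinity>k. c k = 0"
    using c(1) unfolding Cn_def MOST_nat_le by auto
  then have cp: "coeff p = c" by (simp add: p_def Abs_poly_inverse)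
  have "p \<noteq> 0" using c(3) cp by (auto simp: fun_eq_iff)
  moreover have "degree p \<le> n" by (rule degree_le) (use c(1) cp in \<open>auto simp: Cn_def\<close>)
  moreover have "P n p x = (\<lambda>_. 0)" using c(2) by (simp add: P_def cp g_def)
  ultimately show ?thesis using *[OF _ _ x] that by metis
qed

section \<open>Irreducible modules and the group algebra\<close>

text \<open>Stated for a set of operators instead of a group, so that it applies both to the
  operators of \<open>H\<close> and to the larger set of operators of its group algebra.\<close>

definition irred :: "nat \<Rightarrow> ((nat \<Rightarrow> complex) \<Rightarrow> nat \<Rightarrow> complex) set \<Rightarrow> bool" where
  "irred n A \<longleftrightarrow> 0 < n \<and>
     (\<forall>W. W \<subseteq> Cn n \<and> (\<lambda>_. 0) \<in> W \<and> (\<forall>v\<in>W. \<forall>w\<in>W. (\<lambda>i. v i + w i) \<in> W) \<and>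
          (\<forall>v\<in>W. \<forall>c. (\<lambda>i. c * v i) \<in> W) \<and> (\<forall>a\<in>A. \<forall>v\<in>W. a v \<in> W)
        \<longrightarrow> W = {\<lambda>_. 0} \<or> W = Cn n)"

lemma irredD:
  assumes "irred n A" "W \<subseteq> Cn n" "(\<lambda>_. 0) \<in> W" "\<And>v w. v \<in> W \<Longrightarrow> w \<in> W \<Longrightarrow> (\<lambda>i. v i + w i) \<in> W"
    "\<And>v c. v \<in> W \<Longrightarrow> (\<lambda>i. c * v i) \<in> W" "\<And>a v. a \<in> A \<Longrightarrow> v \<in> W \<Longrightarrow> a v \<in> W"
    "x \<in> W" "x \<noteq> (\<lambda>_. 0)"
  shows "W = Cn n"
proof -
  have "W = {\<lambda>_. 0} \<or> W = Cn n"
    by (rule assms(1)[unfolded irred_def, THEN conjunct2, THEN spec[of _ W], THEN mp])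
      (use assms(2-6) in simp)
  then show ?thesis using assms(7,8) by auto
qed

lemma irred_pos: "irred n A \<Longrightarrow> 0 < n"
  by (simp add: irred_def)

lemma irred_mono:
  assumes "irred n A" "A \<subseteq> B"
  shows "irred n B"
  unfolding irred_def
proof (intro conjI allI impI irred_pos[OF assms(1)])
  fix W assume "W \<subseteq> Cn n \<and> (\<lambda>_. 0) \<in> W \<and> (\<forall>v\<in>W. \<forall>w\<in>W. (\<lambda>i. v i + w i) \<in> W) \<and>
    (\<forall>v\<in>W. \<forall>c. (\<lambda>i. c * v i) \<in> W) \<and> (\<forall>a\<in>B. \<forall>v\<in>W. a v \<in> W)"
  then show "W = {\<lambda>_. 0} \<or> W = Cn n"
    by (intro assms(1)[unfolded irred_def, THEN conjunct2, THEN spec[of _ W], THEN mp])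
      (use assms(2) in \<open>simp add: subset_iff\<close>)
qed

text \<open>An eigenspace of \<open>T\<close> is invariant under \<open>A\<close> because
  \<open>T\<close> commutes with \<open>A\<close>, and it is not zero.\<close>

lemma Schur:
  assumes A: "irred n A" "\<And>a. a \<in> A \<Longrightarrow> lin n n a"
    and T: "lin n n T" "\<And>a v. a \<in> A \<Longrightarrow> v \<in> Cn n \<Longrightarrow> T (a v) = a (T v)"
  obtains c where "\<And>v. v \<in> Cn n \<Longrightarrow> T v = (\<lambda>i. c * v i)"
proof -
  obtain c x where x: "x \<in> Cn n" "x \<noteq> (\<lambda>_. 0)" "T x = (\<lambda>i. c * x i)"
    using lin_eigenvector[OF T(1) irred_pos[OF A(1)]] .
  let ?W = "{v \<in> Cn n. T v = (\<lambda>i. c * v i)}"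
  have "?W = Cn n"
    by (rule irredD[OF A(1), where x = x])
      (use x in \<open>auto simp: Cn_add Cn_scale lin_add[OF T(1)] lin_scale[OF T(1)] lin_zero[OF T(1)] T(2)
         lin_Cn[OF A(2)] lin_scale[OF A(2)] algebra_simps\<close>)
  then show ?thesis using that by blast
qed

text \<open>The density theorem behind Burnside's theorem, by induction on the number
  \<open>k\<close> of prescribed values. Once some \<open>a0\<close> in \<open>A\<close> kills
  \<open>ev i\<close> for \<open>i < k\<close> but not \<open>ev k\<close>, irreducibility moves
  \<open>a0 (ev k)\<close> to any vector, which corrects the last value without disturbing the
  others. Closure under composition is asked only up to equality on \<open>Cn n\<close>.\<close>

lemma density:
  assumes lin: "\<And>a. a \<in> A \<Longrightarrow> lin n n a"
    and add: "\<And>a b. a \<in> A \<Longrightarrow> b \<in> A \<Longrightarrow> (\<lambda>v i. a v i + b v i) \<in> A"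
    and scale: "\<And>a c. a \<in> A \<Longrightarrow> (\<lambda>v i. c * a v i) \<in> A"
    and comp: "\<And>a b. a \<in> A \<Longrightarrow> b \<in> A \<Longrightarrow> \<exists>c\<in>A. \<forall>v\<in>Cn n. c v = a (b v)"
    and one: "e \<in> A" "\<And>v. v \<in> Cn n \<Longrightarrow> e v = v"
    and irr: "irred n A"
    and k: "k \<le> n"
  shows "\<forall>y. (\<forall>i<k. y i \<in> Cn n) \<longrightarrow> (\<exists>a\<in>A. \<forall>i<k. a (ev i) = y i)"
  using k
proof (induction k)
  case 0
  then show ?case using one by auto
next
  case (Suc k)
  then have IH: "\<exists>a\<in>A. \<forall>i<k. a (ev i) = y i" if "\<forall>i<k. y i \<in> Cn n" for y
    using that by auto
  have evC: "ev i \<in> Cn n" if "i \<le> k" for i using that Suc.prems by simp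
  have diff: "(\<lambda>v i. a v i - b v i) \<in> A" if "a \<in> A" "b \<in> A" for a b
    using add[OF that(1) scale[OF that(2), of "-1"]] by simp
  \<comment> \<open>If there were no such element, then \<open>a (ev k)\<close> would be determined
    by the values \<open>a (ev i)\<close> for \<open>i < k\<close>; this leads to a linear relation
    between basis vectors.\<close>
  have "\<exists>a\<in>A. (\<forall>i<k. a (ev i) = (\<lambda>_. 0)) \<and> a (ev k) \<noteq> (\<lambda>_. 0)"
  proof (rule ccontr)
    assume con: "\<not> ?thesis"
    have uniq: "a (ev k) = b (ev k)" if "a \<in> A" "b \<in> A" "\<And>i. i < k \<Longrightarrow> a (ev i) = b (ev i)" for a b
    proof -
      have "(\<lambda>i. a (ev k) i - b (ev k) i) = (\<lambda>_. 0)"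
        using con diff[OF that(1,2)] that(3) by fastforce
      then show ?thesis by (auto simp: fun_eq_iff)
    qed
    \<comment> \<open>\<open>al j v\<close> sends \<open>ev j\<close> to \<open>v\<close> and the
      other \<open>ev i\<close> with \<open>i < k\<close> to 0. It is a choice, but its value at
      \<open>ev k\<close> is forced by \<open>uniq\<close>.\<close>
    define al where "al j v = (SOME a. a \<in> A \<and> (\<forall>i<k. a (ev i) = (if i = j then v else (\<lambda>_. 0))))" for j :: nat and v :: "nat \<Rightarrow> complex"
    have al: "al j v \<in> A" "\<And>i. i < k \<Longrightarrow> al j v (ev i) = (if i = j then v else (\<lambda>_. 0))"
      if "v \<in> Cn n" for j v
    proof -
      have "\<exists>a. a \<in> A \<and> (\<forall>i<k. a (ev i) = (if i = j then v else (\<lambda>_. 0)))"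
        using IH[of "\<lambda>i. if i = j then v else (\<lambda>_. 0)"] that unfolding Bex_def by simp
      from someI_ex[OF this] show "al j v \<in> A" "\<And>i. i < k \<Longrightarrow> al j v (ev i) = (if i = j then v else (\<lambda>_. 0))"
        unfolding al_def by auto
    qed
    \<comment> \<open>By \<open>uniq\<close>, the forced value depends linearly on \<open>v\<close>
      and commutes with \<open>A\<close>, so it is a scalar multiple of \<open>v\<close> by Schur's
      lemma.\<close>
    have "\<exists>c. \<forall>v\<in>Cn n. al j v (ev k) = (\<lambda>i. c * v i)" if "j < k" for j
    proof -
      let ?T = "\<lambda>v. al j v (ev k)"
      have "lin n n ?T"
      proof (rule linI)
        show "?T v \<in> Cn n" if "v \<in> Cn n" for v
          using lin_Cn[OF lin[OF al(1)[OF that]]] evC by blast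
        show "?T (\<lambda>i. v i + w i) = (\<lambda>i. ?T v i + ?T w i)" if "v \<in> Cn n" "w \<in> Cn n" for v w
          by (rule uniq[OF al(1) add[OF al(1) al(1)]]) (auto simp: that Cn_add al)
        show "?T (\<lambda>i. c * v i) = (\<lambda>i. c * ?T v i)" if "v \<in> Cn n" for v c
          by (rule uniq[OF al(1) scale[OF al(1)]]) (auto simp: that Cn_scale al)
      qed
      moreover have "?T (a v) = a (?T v)" if a: "a \<in> A" and v: "v \<in> Cn n" for a v
      proof -
        obtain b where b: "b \<in> A" "\<forall>u\<in>Cn n. b u = a (al j v u)" using comp[OF a al(1)[OF v]] by blast
        have "?T (a v) = b (ev k)"
          by (rule uniq[OF al(1) b(1)])
            (use evC in \<open>auto simp: b(2) al v lin_Cn[OF lin[OF a]] lin_zero[OF lin[OF a]]\<close>)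
        then show ?thesis using b(2) evC by auto
      qed
      ultimately obtain c where "\<And>v. v \<in> Cn n \<Longrightarrow> ?T v = (\<lambda>i. c * v i)"
        using Schur[OF irr lin, of "?T"] by blast
      then show ?thesis by blast
    qed
    then obtain c where c: "\<And>j v. j < k \<Longrightarrow> v \<in> Cn n \<Longrightarrow> al j v (ev k) = (\<lambda>i. c j * v i)"
      by metis
    \<comment> \<open>The identity minus the sum of the \<open>al j (ev j)\<close> kills every
      \<open>ev i\<close> with \<open>i < k\<close>, so by \<open>uniq\<close> it also kills
      \<open>ev k\<close>. This expresses \<open>ev k\<close> through the earlier basis
      vectors.\<close>
    have "(\<lambda>v i. e v i - (\<Sum>j<l. al j (ev j) v i)) \<in> A" if "l \<le> k" for l
      using that
    proof (induction l)
      case 0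
      then show ?case using one by simp
    next
      case (Suc l)
      then show ?case using diff[of "\<lambda>v i. e v i - (\<Sum>j<l. al j (ev j) v i)" "al l (ev l)"] al(1) evC
        by (simp add: algebra_simps)
    qed
    from this[OF order.refl] scale[OF one(1), of 0] have
      "(\<lambda>i. e (ev k) i - (\<Sum>j<k. al j (ev j) (ev k) i)) = (\<lambda>i. 0 * e (ev k) i)"
    proof (rule uniq)
      fix i assume i: "i < k"
      have "al j (ev j) (ev i) m = (if i = j then ev i m else 0)" if "j < k" for j m
        using al(2)[of "ev j" i j] that i evC by auto
      then have "(\<Sum>j<k. al j (ev j) (ev i) m) = ev i m" for m
        using i by simp
      then show "(\<lambda>m. e (ev i) m - (\<Sum>j<k. al j (ev j) (ev i) m)) = (\<lambda>m. 0 * e (ev i) m)"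
        using one(2)[of "ev i"] evC i by simp
    qed
    from fun_cong[OF this, of k] have "ev k k = (\<Sum>j<k. c j * ev j k)"
      using one(2)[of "ev k"] evC c by simp
    then show False by (simp add: ev_def)
  qed
  then obtain a0 where a0: "a0 \<in> A" "\<forall>i<k. a0 (ev i) = (\<lambda>_. 0)" "a0 (ev k) \<noteq> (\<lambda>_. 0)" by blast
  let ?u = "a0 (ev k)"
  have u: "?u \<in> Cn n" using lin_Cn[OF lin[OF a0(1)]] evC by blast
  \<comment> \<open>The orbit of a nonzero vector under \<open>A\<close> is an invariant subspace,
    hence everything.\<close>
  have W: "(\<lambda>a. a ?u) ` A = Cn n"
  proof (rule irredD[OF irr, where x = ?u])
    show "(\<lambda>a. a ?u) ` A \<subseteq> Cn n" using lin_Cn[OF lin u] by auto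
    show "(\<lambda>_. 0) \<in> (\<lambda>a. a ?u) ` A" using scale[OF one(1), of 0] by force
    show "?u \<in> (\<lambda>a. a ?u) ` A" using one(1) one(2)[OF u] by (intro image_eqI[where x = e]) auto
    show "(\<lambda>i. v i + w i) \<in> (\<lambda>a. a ?u) ` A" if "v \<in> (\<lambda>a. a ?u) ` A" "w \<in> (\<lambda>a. a ?u) ` A" for v w
      using that add by force
    show "(\<lambda>i. c * v i) \<in> (\<lambda>a. a ?u) ` A" if "v \<in> (\<lambda>a. a ?u) ` A" for v c
      using that scale by force
    show "a v \<in> (\<lambda>a. a ?u) ` A" if "a \<in> A" "v \<in> (\<lambda>a. a ?u) ` A" for a v
    proof -
      obtain b where b: "b \<in> A" "v = b ?u" using \<open>v \<in> _\<close> by blast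
      obtain d where "d \<in> A" "\<forall>v\<in>Cn n. d v = a (b v)" using comp[OF \<open>a \<in> A\<close> b(1)] by blast
      then show ?thesis using u b(2) by (intro image_eqI[where x = d]) auto
    qed
  qed (use a0 in auto)
  show ?case
  proof (intro allI impI)
    fix y assume y: "\<forall>i<Suc k. y i \<in> Cn n"
    then obtain a where a: "a \<in> A" "\<forall>i<k. a (ev i) = y i" using IH[of y] by auto
    have "(\<lambda>i. y k i - a (ev k) i) \<in> Cn n"
      using y lin_Cn[OF lin[OF a(1)] evC[of k]] by (intro Cn_diff) auto
    then obtain b where b: "b \<in> A" "b ?u = (\<lambda>i. y k i - a (ev k) i)"
      unfolding W[symmetric] by (elim imageE) auto
    obtain d where d: "d \<in> A" "\<forall>v\<in>Cn n. d v = b (a0 v)" using comp[OF b(1) a0(1)] by blast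
    show "\<exists>a\<in>A. \<forall>i<Suc k. a (ev i) = y i"
    proof (rule bexI[OF _ add[OF a(1) d(1)]], intro allI impI)
      fix i assume "i < Suc k"
      then consider "i < k" | "i = k" by linarith
      then show "(\<lambda>m. a (ev i) m + d (ev i) m) = y i"
        by cases (use a a0(1,2) b d evC lin_zero[OF lin[OF b(1)]] in simp_all)
    qed
  qed
qed

text \<open>The algebraic part of \<open>K_module\<close>; the arguments with the group algebra
  involve no topology on the group.\<close>

definition rep :: "('k, 'r) monoid_scheme \<Rightarrow> nat \<Rightarrow> ('k \<Rightarrow> (nat \<Rightarrow> complex) \<Rightarrow> nat \<Rightarrow> complex) \<Rightarrow> bool" where
  "rep K n R \<longleftrightarrow> (\<forall>g\<in>carrier K. lin n n (R g)) \<and> (\<forall>v\<in>Cn n. R \<one>\<^bsub>K\<^esub> v = v) \<and>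
     (\<forall>g\<in>carrier K. \<forall>h\<in>carrier K. \<forall>v\<in>Cn n. R (g \<otimes>\<^bsub>K\<^esub> h) v = R g (R h v))"

text \<open>Elements of the group algebra are represented by lists of coefficient-element pairs.\<close>

definition galg :: "('k, 'r) monoid_scheme \<Rightarrow> (complex \<times> 'k) list set" where
  "galg K = {z. snd ` set z \<subseteq> carrier K}"

definition opl :: "('k \<Rightarrow> (nat \<Rightarrow> complex) \<Rightarrow> nat \<Rightarrow> complex) \<Rightarrow> (complex \<times> 'k) list \<Rightarrow>
    (nat \<Rightarrow> complex) \<Rightarrow> nat \<Rightarrow> complex" where
  "opl R z v = (\<lambda>i. \<Sum>(c, h)\<leftarrow>z. c * R h v i)"

definition gscale :: "complex \<Rightarrow> (complex \<times> 'k) list \<Rightarrow> (complex \<times> 'k) list" where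
  "gscale c z = map (\<lambda>(d, h). (c * d, h)) z"

definition gmul :: "('k, 'r) monoid_scheme \<Rightarrow> (complex \<times> 'k) list \<Rightarrow> (complex \<times> 'k) list \<Rightarrow> (complex \<times> 'k) list" where
  "gmul K z z' = concat (map (\<lambda>(c, h). map (\<lambda>(d, k). (c * d, h \<otimes>\<^bsub>K\<^esub> k)) z') z)"

lemma opl_Nil [simp]: "opl R [] v = (\<lambda>_. 0)"
  and opl_Cons: "opl R ((c, h) # z) v = (\<lambda>i. c * R h v i + opl R z v i)"
  and opl_append: "opl R (z @ z') v = (\<lambda>i. opl R z v i + opl R z' v i)"
  by (simp_all add: opl_def)

lemma opl_gscale: "opl R (gscale c z) v = (\<lambda>i. c * opl R z v i)"
  by (induction z) (auto simp: gscale_def opl_Cons algebra_simps)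

lemma galg_Nil [simp]: "[] \<in> galg K"
  and galg_Cons [simp]: "(c, h) # z \<in> galg K \<longleftrightarrow> h \<in> carrier K \<and> z \<in> galg K"
  and galg_append: "z @ z' \<in> galg K \<longleftrightarrow> z \<in> galg K \<and> z' \<in> galg K"
  and galg_gscale: "z \<in> galg K \<Longrightarrow> gscale c z \<in> galg K"
  by (auto simp: galg_def gscale_def)

lemma galg_gmul: "monoid K \<Longrightarrow> z \<in> galg K \<Longrightarrow> z' \<in> galg K \<Longrightarrow> gmul K z z' \<in> galg K"
  by (fastforce simp: galg_def gmul_def intro: monoid.m_closed)

lemma lin_opl:
  assumes "rep K n R" "z \<in> galg K"
  shows "lin n n (opl R z)"
  using assms(2)
proof (induction z)
  case Nil
  then show ?case by (simp add: lin_def)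
next
  case (Cons a z)
  obtain c h where [simp]: "a = (c, h)" by force
  have "lin n n (R h)" "lin n n (opl R z)" using Cons assms(1) by (auto simp: rep_def)
  then show ?case
    by (simp add: lin_def opl_Cons Cn_add Cn_scale algebra_simps)
qed

lemma opl_gmul:
  assumes "rep K n R" "z \<in> galg K" "z' \<in> galg K" "v \<in> Cn n"
  shows "opl R (gmul K z z') v = opl R z (opl R z' v)"
  using assms(2)
proof (induction z)
  case Nil
  then show ?case by (simp add: gmul_def)
next
  case (Cons a z)
  obtain c h where [simp]: "a = (c, h)" by force
  have h: "h \<in> carrier K" using Cons by simp
  have R: "lin n n (R h)" using h assms(1) by (auto simp: rep_def)
  have "opl R (map (\<lambda>(d, k). (c * d, h \<otimes>\<^bsub>K\<^esub> k)) z') v = (\<lambda>i. c * R h (opl R z' v) i)"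
    using assms(3)
  proof (induction z')
    case Nil
    then show ?case using lin_zero[OF R] by simp
  next
    case (Cons b z')
    obtain d k where [simp]: "b = (d, k)" by force
    have k: "k \<in> carrier K" "z' \<in> galg K" using Cons by auto
    have C: "R k v \<in> Cn n" "opl R z' v \<in> Cn n"
      using k assms(1,4) lin_opl[OF assms(1) k(2)] by (auto simp: rep_def intro: lin_Cn)
    have "R (h \<otimes>\<^bsub>K\<^esub> k) v = R h (R k v)" using assms(1,4) h k by (auto simp: rep_def)
    then show ?case
      using Cons.IH[OF k(2)] C by (simp add: opl_Cons lin_add[OF R] lin_scale[OF R] Cn_scale algebra_simps)
  qed
  then show ?case using Cons by (simp add: gmul_def opl_append opl_Cons)
qed

text \<open>Density with all \<open>n\<close> basis vectors prescribed: on an irreducible module the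
  group algebra realizes every matrix, in particular the matrix units.\<close>

lemma group_algebra_density:
  assumes "monoid K" "rep K n R" "irred n (R ` carrier K)" "\<And>i. i < n \<Longrightarrow> y i \<in> Cn n"
  obtains z where "z \<in> galg K" "\<And>i. i < n \<Longrightarrow> opl R z (ev i) = y i"
proof -
  let ?A = "opl R ` galg K"
  have single: "opl R [(1, h)] = R h" for h by (auto simp: opl_def)
  have sub: "R ` carrier K \<subseteq> ?A"
    using single[symmetric] by (intro image_subsetI) (metis galg_Cons galg_Nil imageI)
  have irr: "irred n ?A"
    by (rule irred_mono[OF assms(3) sub])
  have "\<exists>a\<in>?A. \<forall>i<n. a (ev i) = y i"
  proof (rule density[where A = ?A and n = n and k = n and e = "R \<one>\<^bsub>K\<^esub>", rule_format])
    show "R \<one>\<^bsub>K\<^esub> \<in> ?A" using sub monoid.one_closed[OF assms(1)] by blast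
    show "(\<lambda>v i. a v i + b v i) \<in> ?A" if ab: "a \<in> ?A" "b \<in> ?A" for a b
    proof -
      obtain z z' where "a = opl R z" "b = opl R z'" "z @ z' \<in> galg K" using ab by (auto simp: galg_append)
      then show ?thesis by (auto simp: opl_append[symmetric] image_iff)
    qed
    show "(\<lambda>v i. c * a v i) \<in> ?A" if "a \<in> ?A" for a c
      using that galg_gscale[of _ K c] by (auto simp: opl_gscale[symmetric] image_iff)
    show "\<exists>c\<in>?A. \<forall>v\<in>Cn n. c v = a (b v)" if "a \<in> ?A" "b \<in> ?A" for a b
      using that galg_gmul[OF assms(1)] opl_gmul[OF assms(2)] by (auto simp: image_iff) metis
  qed (use assms irr lin_opl[OF assms(2)] in \<open>auto simp: rep_def\<close>)
  then show ?thesis using that by blast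
qed

definition tr :: "nat \<Rightarrow> ((nat \<Rightarrow> complex) \<Rightarrow> nat \<Rightarrow> complex) \<Rightarrow> complex" where
  "tr n f = (\<Sum>i<n. f (ev i) i)"

lemma module_character_tr: "module_character n R g = tr n (R g)"
  by (simp add: module_character_def tr_def ev_def)

lemma tr_opl: "tr n (opl R z) = (\<Sum>(c, h)\<leftarrow>z. c * tr n (R h))"
  by (induction z) (auto simp: tr_def opl_Cons sum.distrib sum_distrib_left)

lemma tr_comp_commute:
  assumes "lin n n f" "lin n n g"
  shows "tr n (\<lambda>v. f (g v)) = tr n (\<lambda>v. g (f v))"
proof -
  have *: "f (g (ev i)) i = (\<Sum>j<n. g (ev i) j * f (ev j) i)" if "lin n n f" "lin n n g" "i < n" for f g i
    using fun_cong[OF lin_expand[OF that(1) lin_Cn[OF that(2) ev_Cn[OF that(3)]]], of i] .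
  have "tr n (\<lambda>v. f (g v)) = (\<Sum>i<n. \<Sum>j<n. g (ev i) j * f (ev j) i)"
    by (simp add: tr_def *[OF assms])
  also have "\<dots> = (\<Sum>j<n. \<Sum>i<n. f (ev j) i * g (ev i) j)"
    by (subst sum.swap) (simp add: mult.commute)
  also have "\<dots> = tr n (\<lambda>v. g (f v))"
    by (simp add: tr_def *[OF assms(2,1)])
  finally show ?thesis .
qed

text \<open>The trace form is nondegenerate on the full matrix algebra, so an element of the group algebra
  which acts as zero on \<open>R\<close> acts as zero on the irreducible module \<open>R0\<close>. Hence the image of the
  group algebra on \<open>R\<close> has dimension at least \<open>n\<^sup>2\<close>, and the two kernels agree.\<close>

lemma same_character_kernel:
  assumes K: "monoid K" and R0: "rep K n R0" "irred n (R0 ` carrier K)" and R: "rep K n R"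
    and tr: "\<And>h. h \<in> carrier K \<Longrightarrow> tr n (R h) = tr n (R0 h)"
    and z: "z \<in> galg K"
  shows "(\<forall>v\<in>Cn n. opl R z v = (\<lambda>_. 0)) \<longleftrightarrow> (\<forall>v\<in>Cn n. opl R0 z v = (\<lambda>_. 0))"
proof -
  have n: "0 < n" using R0(2) by (simp add: irred_def)
  have index_less: "i * n + j < n * n" if "i < n" "j < n" for i j
  proof -
    have "i * n + j < Suc i * n" using that by simp
    also have "\<dots> \<le> n * n" by (rule mult_le_mono1) (use that in simp)
    finally show ?thesis .
  qed
  have tr_eq: "tr n (opl R z) = tr n (opl R0 z)" if "z \<in> galg K" for z
    unfolding tr_opl
    by (rule arg_cong[where f = sum_list], rule map_cong[OF refl])
      (use that tr in \<open>auto simp: galg_def\<close>)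
  \<comment> \<open>\<open>a k\<close> acts on \<open>R0\<close> as the matrix unit with row
    \<open>k div n\<close> and column \<open>k mod n\<close>; matrices are flattened to vectors of
    length \<open>n * n\<close> in this order.\<close>
  have "\<exists>a. a \<in> galg K \<and> (\<forall>l<n. opl R0 a (ev l) = (if l = k mod n then ev (k div n) else (\<lambda>_. 0)))"
    if "k < n * n" for k
  proof -
    have "k div n < n" using that n by (simp add: less_mult_imp_div_less)
    then show ?thesis
      using group_algebra_density[OF K R0, of "\<lambda>l. if l = k mod n then ev (k div n) else (\<lambda>_. 0)"]
      by (metis (mono_tags, lifting) Cn_zero ev_Cn)
  qed
  then obtain a where a: "\<And>k. k < n * n \<Longrightarrow> a k \<in> galg K"
    "\<And>k l. k < n * n \<Longrightarrow> l < n \<Longrightarrow> opl R0 (a k) (ev l) = (if l = k mod n then ev (k div n) else (\<lambda>_. 0))"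
    by metis
  \<comment> \<open>Pairing \<open>z\<close> with a matrix unit under the trace isolates one matrix
    entry of \<open>z\<close> on \<open>R0\<close>. Traces are the same on \<open>R\<close> and on
    \<open>R0\<close>, so each entry vanishes.\<close>
  have one: "opl R0 z v = (\<lambda>_. 0)"
    if z: "z \<in> galg K" and zero: "\<And>v. v \<in> Cn n \<Longrightarrow> opl R z v = (\<lambda>_. 0)" and v: "v \<in> Cn n" for z v
  proof -
    have "opl R0 z (ev i) j = 0" if ij: "i < n" "j < n" for i j
    proof -
      define k where "k = i * n + j"
      have k: "k < n * n" "k div n = i" "k mod n = j"
        using ij n index_less[OF ij] by (auto simp: k_def)
      have "tr n (opl R (gmul K z (a k))) = 0"
        by (simp add: tr_def opl_gmul[OF R z a(1)[OF k(1)]] zero lin_Cn[OF lin_opl[OF R a(1)[OF k(1)]]])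
      then have "tr n (opl R0 (gmul K z (a k))) = 0"
        using tr_eq galg_gmul[OF K z a(1)[OF k(1)]] by simp
      moreover have "opl R0 (gmul K z (a k)) (ev l) = (if l = j then opl R0 z (ev i) else (\<lambda>_. 0))" if "l < n" for l
        using that k a(2)[OF k(1) that] lin_zero[OF lin_opl[OF R0(1) z]]
        by (simp add: opl_gmul[OF R0(1) z a(1)[OF k(1)]])
      ultimately show ?thesis using ij by (simp add: tr_def if_distrib[of "\<lambda>f. f _"] cong: if_cong)
    qed
    then have "opl R0 z (ev i) = (\<lambda>_. 0)" if "i < n" for i
      by (intro Cn_eqI[OF lin_Cn[OF lin_opl[OF R0(1) z] ev_Cn[OF that]] Cn_zero]) (use that in auto)
    then show ?thesis using lin_expand[OF lin_opl[OF R0(1) z] v] by simp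
  qed
  define comb where "comb c = concat (map (\<lambda>k. gscale (c k) (a k)) [0..<n * n])" for c :: "nat \<Rightarrow> complex"
  have comb_opl: "opl R' (comb c) v = (\<lambda>i. \<Sum>k<n * n. c k * opl R' (a k) v i)" for c v R'
  proof -
    have "opl R' (concat (map (\<lambda>k. gscale (c k) (a k)) [0..<N])) v = (\<lambda>i. \<Sum>k<N. c k * opl R' (a k) v i)" for N
      by (induction N) (auto simp: opl_append opl_gscale)
    then show ?thesis by (simp add: comb_def)
  qed
  have comb_galg: "comb c \<in> galg K" for c
    using a(1) galg_gscale by (fastforce simp: comb_def galg_def)
  have comb0: "c k = 0" if c: "\<And>v. v \<in> Cn n \<Longrightarrow> opl R0 (comb c) v = (\<lambda>_. 0)" and k: "k < n * n" for c k
  proof -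
    have kl: "k div n < n" "k mod n < n" using k n by (auto simp: less_mult_imp_div_less)
    have "c l * opl R0 (a l) (ev (k mod n)) (k div n) = (if l = k then c k else 0)" if "l < n * n" for l
    proof (cases "l = k")
      case False
      then have "l mod n \<noteq> k mod n \<or> l div n \<noteq> k div n" by (metis div_mult_mod_eq)
      then show ?thesis using a(2)[OF that kl(2)] False by (auto simp: ev_def)
    qed (use a(2)[OF k kl(2)] in \<open>simp add: ev_def\<close>)
    then have "opl R0 (comb c) (ev (k mod n)) (k div n) = c k"
      using k by (simp add: comb_opl)
    then show ?thesis using c kl by simp
  qed
  \<comment> \<open>The matrix on \<open>R\<close> of the combination with coefficients
    \<open>c\<close>. By \<open>one\<close> no nonzero combination acts as zero on \<open>R\<close>,
    so \<open>f\<close> is injective and, between spaces of equal dimension, onto.\<close>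
  define f where "f c = (\<lambda>k. if k < n * n then opl R (comb c) (ev (k mod n)) (k div n) else 0)" for c
  have ext: "opl R z v = (\<lambda>_. 0)" if z: "z \<in> galg K"
    and zero: "\<And>k. k < n * n \<Longrightarrow> opl R z (ev (k mod n)) (k div n) = 0" and v: "v \<in> Cn n" for z v
  proof -
    have "opl R z (ev i) j = 0" if ij: "i < n" "j < n" for i j
    proof -
      have "j * n + i < n * n" by (rule index_less[OF ij(2,1)])
      then show ?thesis using zero[of "j * n + i"] ij by simp
    qed
    then have "opl R z (ev i) = (\<lambda>_. 0)" if "i < n" for i
      by (intro Cn_eqI[OF lin_Cn[OF lin_opl[OF R z] ev_Cn[OF that]] Cn_zero]) (use that in auto)
    then show ?thesis using lin_expand[OF lin_opl[OF R z] v] by simp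
  qed
  have "lin (n * n) (n * n) f"
    by (rule linI) (auto simp: f_def comb_opl Cn_def fun_eq_iff distrib_right sum.distrib sum_distrib_left mult.assoc)
  moreover have "inj_on f (Cn (n * n))"
    unfolding lin_inj_iff[OF \<open>lin (n * n) (n * n) f\<close>]
  proof (intro ballI impI)
    fix c assume c: "c \<in> Cn (n * n)" "f c = (\<lambda>_. 0)"
    have "opl R (comb c) v = (\<lambda>_. 0)" if "v \<in> Cn n" for v
    proof (rule ext[OF comb_galg _ that])
      show "opl R (comb c) (ev (k mod n)) (k div n) = 0" if "k < n * n" for k
        using fun_cong[OF c(2), of k] that by (simp add: f_def)
    qed
    then have "c k = 0" if "k < n * n" for k
      using one[OF comb_galg] comb0[OF _ that] by blast
    then show "c = (\<lambda>_. 0)" by (intro Cn_eqI[OF c(1) Cn_zero]) auto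
  qed
  ultimately have bij: "f ` Cn (n * n) = Cn (n * n)" using lin_inj_bij by (auto simp: bij_betw_def)
  show ?thesis
  proof
    assume zero: "\<forall>v\<in>Cn n. opl R0 z v = (\<lambda>_. 0)"
    \<comment> \<open>For the converse, \<open>z\<close> acts on \<open>R\<close> like some
      combination \<open>comb c\<close>. Their difference acts as zero on \<open>R\<close>, hence on
      \<open>R0\<close>; there \<open>z\<close> is zero too, so \<open>comb c\<close> is zero on
      \<open>R0\<close> and \<open>c\<close> vanishes.\<close>
    define y where "y = (\<lambda>k. if k < n * n then opl R z (ev (k mod n)) (k div n) else 0)"
    have "y \<in> Cn (n * n)" by (auto simp: y_def Cn_def)
    then obtain c where c: "c \<in> Cn (n * n)" "f c = y" using bij by (metis imageE)
    define z' where "z' = z @ gscale (-1) (comb c)"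
    have z'g: "z' \<in> galg K" using z comb_galg galg_gscale by (auto simp: z'_def galg_append)
    have "opl R z' v = (\<lambda>_. 0)" if "v \<in> Cn n" for v
    proof (rule ext[OF z'g _ that])
      show "opl R z' (ev (k mod n)) (k div n) = 0" if "k < n * n" for k
        using fun_cong[OF c(2), of k] that by (simp add: f_def y_def z'_def opl_append opl_gscale)
    qed
    then have "opl R0 z' v = (\<lambda>_. 0)" if "v \<in> Cn n" for v using one[OF z'g] that by blast
    then have "opl R0 (comb c) v = (\<lambda>_. 0)" if "v \<in> Cn n" for v
      using zero that by (simp add: z'_def opl_append opl_gscale fun_eq_iff)
    then have "c k = 0" if "k < n * n" for k using comb0[OF _ that] by blast
    then have "c = (\<lambda>_. 0)" by (intro Cn_eqI[OF c(1) Cn_zero]) auto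
    then have "f c = (\<lambda>_. 0)" by (simp add: f_def comb_opl fun_eq_iff)
    then have "y = (\<lambda>_. 0)" using c(2) by simp
    then have "opl R z (ev (k mod n)) (k div n) = 0" if "k < n * n" for k
      using that unfolding y_def fun_eq_iff by metis
    then show "\<forall>v\<in>Cn n. opl R z v = (\<lambda>_. 0)" using ext[OF z] by blast
  qed (use one[OF z] in blast)
qed

section \<open>Frames of vector bundles\<close>

lemma continuous_map_Cspace:
  "continuous_map X (Cspace n) f \<longleftrightarrow>
     (\<forall>x\<in>topspace X. f x \<in> Cn n) \<and> (\<forall>i. continuous_map X euclidean (\<lambda>x. f x i))"
  by (auto simp: Cspace_def Cn_def continuous_map_in_subtopology continuous_map_componentwise_UNIV Pi_iff)

lemma continuous_map_Cspace_coord: "continuous_map (Cspace n) euclidean (\<lambda>v. v i)"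
  using continuous_map_Cspace[of "Cspace n" n id] by simp

lemma continuous_mapI_metric:
  fixes f :: "'a \<Rightarrow> 'b::metric_space"
  assumes "\<And>x e. x \<in> topspace X \<Longrightarrow> e > 0 \<Longrightarrow> \<exists>U. openin X U \<and> x \<in> U \<and> (\<forall>y\<in>U. dist (f y) (f x) < e)"
  shows "continuous_map X euclidean f"
  unfolding continuous_map_def
proof (intro conjI allI impI)
  fix V :: "'b set" assume "openin euclidean V"
  then have V: "open V" by simp
  show "openin X {x \<in> topspace X. f x \<in> V}"
  proof (subst openin_subopen, intro ballI)
    fix x assume x: "x \<in> {x \<in> topspace X. f x \<in> V}"
    then obtain e where e: "e > 0" "\<forall>y. dist y (f x) < e \<longrightarrow> y \<in> V" using V by (auto simp: open_dist)
    then obtain U where "openin X U" "x \<in> U" "\<forall>y\<in>U. dist (f y) (f x) < e" using assms[of x e] x by auto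
    then show "\<exists>T. openin X T \<and> x \<in> T \<and> T \<subseteq> {x \<in> topspace X. f x \<in> V}"
      using e openin_subset[of X U] by (intro exI[of _ U]) auto
  qed
qed auto

lemma continuous_map_unop:
  fixes h :: "'b::topological_space \<Rightarrow> 'd::topological_space"
  assumes "continuous_on UNIV h" "continuous_map X euclidean f"
  shows "continuous_map X euclidean (\<lambda>x. h (f x))"
  using continuous_map_compose[OF assms(2), of euclidean h] assms(1) by (simp add: o_def)

lemma continuous_map_binop:
  fixes h :: "'b::topological_space \<Rightarrow> 'c::topological_space \<Rightarrow> 'd::topological_space"
  assumes "continuous_on UNIV (\<lambda>z. h (fst z) (snd z))"
    and "continuous_map X euclidean f" "continuous_map X euclidean g"
  shows "continuous_map X euclidean (\<lambda>x. h (f x) (g x))"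
proof -
  have "continuous_map X (prod_topology euclidean euclidean) (\<lambda>x. (f x, g x))"
    by (rule continuous_map_pairedI[OF assms(2,3)])
  then have "continuous_map X euclidean (\<lambda>x. (f x, g x))"
    by simp
  from continuous_map_unop[OF assms(1) this] show ?thesis by simp
qed

lemma continuous_map_mult:
  fixes f g :: "'a \<Rightarrow> 'b::real_normed_algebra"
  assumes "continuous_map X euclidean f" "continuous_map X euclidean g"
  shows "continuous_map X euclidean (\<lambda>x. f x * g x)"
  by (rule continuous_map_binop[OF _ assms]) (intro continuous_intros)

lemma continuous_map_plus:
  fixes f g :: "'a \<Rightarrow> 'b::real_normed_vector"
  assumes "continuous_map X euclidean f" "continuous_map X euclidean g"
  shows "continuous_map X euclidean (\<lambda>x. f x + g x)"
  by (rule continuous_map_binop[OF _ assms]) (intro continuous_intros)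

lemma continuous_map_minus':
  fixes f g :: "'a \<Rightarrow> 'b::real_normed_vector"
  assumes "continuous_map X euclidean f" "continuous_map X euclidean g"
  shows "continuous_map X euclidean (\<lambda>x. f x - g x)"
  by (rule continuous_map_binop[OF _ assms]) (intro continuous_intros)

lemma continuous_map_sum':
  fixes f :: "'i \<Rightarrow> 'a \<Rightarrow> 'b::real_normed_vector"
  assumes "\<And>j. j \<in> J \<Longrightarrow> continuous_map X euclidean (f j)"
  shows "continuous_map X euclidean (\<lambda>x. \<Sum>j\<in>J. f j x)"
  using assms by (induction J rule: infinite_finite_induct) (auto intro: continuous_map_plus)

text \<open>A linear parametrization of one fiber that intertwines the model \<open>R\<close> with
  the action of the elements of \<open>S\<close>, which are meant to fix \<open>x\<close>. For
  \<open>S = {}\<close> it is a plain basis and \<open>R\<close> is arbitrary.\<close>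

definition fframe :: "('k, 'x, 'e) vbundle \<Rightarrow> 'x \<Rightarrow> nat \<Rightarrow> 'k set \<Rightarrow>
    ('k \<Rightarrow> (nat \<Rightarrow> complex) \<Rightarrow> nat \<Rightarrow> complex) \<Rightarrow> ((nat \<Rightarrow> complex) \<Rightarrow> 'e) \<Rightarrow> bool" where
  "fframe E x n S R f \<longleftrightarrow> bij_betw f (Cn n) (fiber E x) \<and>
     (\<forall>v\<in>Cn n. (\<forall>w\<in>Cn n. f (\<lambda>i. v i + w i) = fadd E (f v) (f w)) \<and>
        (\<forall>c. f (\<lambda>i. c * v i) = fscale E c (f v)) \<and> (\<forall>h\<in>S. act E h (f v) = f (R h v)))"

text \<open>The base map \<open>\<gamma>\<close> allows frames along a path as well as frames over
  an open set. Only the parametrization is required to be continuous; continuity of the coordinates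
  is proved in \<open>continuous_map_frame_coord\<close>.\<close>

definition frame :: "'y topology \<Rightarrow> ('y \<Rightarrow> 'x) \<Rightarrow> ('k, 'x, 'e) vbundle \<Rightarrow> nat \<Rightarrow> 'k set \<Rightarrow>
    ('k \<Rightarrow> (nat \<Rightarrow> complex) \<Rightarrow> nat \<Rightarrow> complex) \<Rightarrow> ('y \<Rightarrow> (nat \<Rightarrow> complex) \<Rightarrow> 'e) \<Rightarrow> bool" where
  "frame Y \<gamma> E n S R \<Phi> \<longleftrightarrow>
     continuous_map (prod_topology Y (Cspace n)) (total E) (\<lambda>(y, w). \<Phi> y w) \<and>
     (\<forall>y\<in>topspace Y. fframe E (\<gamma> y) n S R (\<Phi> y))"

lemma fframe_bij: "fframe E x n S R f \<Longrightarrow> bij_betw f (Cn n) (fiber E x)"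
  and fframe_fiber: "fframe E x n S R f \<Longrightarrow> v \<in> Cn n \<Longrightarrow> f v \<in> fiber E x"
  and fframe_add: "fframe E x n S R f \<Longrightarrow> v \<in> Cn n \<Longrightarrow> w \<in> Cn n \<Longrightarrow> f (\<lambda>i. v i + w i) = fadd E (f v) (f w)"
  and fframe_scale: "fframe E x n S R f \<Longrightarrow> v \<in> Cn n \<Longrightarrow> f (\<lambda>i. c * v i) = fscale E c (f v)"
  and fframe_act: "fframe E x n S R f \<Longrightarrow> v \<in> Cn n \<Longrightarrow> h \<in> S \<Longrightarrow> act E h (f v) = f (R h v)"
  and fframe_inj: "fframe E x n S R f \<Longrightarrow> f v = f w \<Longrightarrow> v \<in> Cn n \<Longrightarrow> w \<in> Cn n \<Longrightarrow> v = w"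
  by (auto simp: fframe_def bij_betw_def dest: inj_onD)

lemma fframe_inv:
  assumes "fframe E x n S R f" "e \<in> fiber E x"
  shows "inv_into (Cn n) f e \<in> Cn n" "f (inv_into (Cn n) f e) = e"
  using fframe_bij[OF assms(1)] assms(2) by (auto simp: bij_betw_def inv_into_into f_inv_into_f)

lemma fframe_inv_f: "fframe E x n S R f \<Longrightarrow> v \<in> Cn n \<Longrightarrow> inv_into (Cn n) f (f v) = v"
  by (auto simp: fframe_def bij_betw_def)

lemma frame_fframe: "frame Y \<gamma> E n S R \<Phi> \<Longrightarrow> y \<in> topspace Y \<Longrightarrow> fframe E (\<gamma> y) n S R (\<Phi> y)"
  and frame_cont: "frame Y \<gamma> E n S R \<Phi> \<Longrightarrow>
    continuous_map (prod_topology Y (Cspace n)) (total E) (\<lambda>(y, w). \<Phi> y w)"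
  by (auto simp: frame_def)

lemma frame_cont_compose:
  assumes "frame Y \<gamma> E n S R \<Phi>" "continuous_map Z Y a" "continuous_map Z (Cspace n) b"
  shows "continuous_map Z (total E) (\<lambda>z. \<Phi> (a z) (b z))"
  using continuous_map_compose[OF continuous_map_pairedI[OF assms(2,3)] frame_cont[OF assms(1)]]
  by (simp add: o_def)

lemma frame_precompose:
  assumes "frame Y \<gamma> E n S R \<Phi>" "continuous_map Z Y q"
  shows "frame Z (\<lambda>z. \<gamma> (q z)) E n S R (\<lambda>z. \<Phi> (q z))"
  unfolding frame_def
proof (intro conjI ballI)
  show "continuous_map (prod_topology Z (Cspace n)) (total E) (\<lambda>(z, w). \<Phi> (q z) w)"
    unfolding case_prod_unfold
    by (intro frame_cont_compose[OF assms(1)] continuous_map_compose[OF continuous_map_fst assms(2), unfolded o_def]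
        continuous_map_snd)
  show "fframe E (\<gamma> (q z)) n S R (\<Phi> (q z))" if "z \<in> topspace Z" for z
    by (rule frame_fframe[OF assms(1)]) (use that assms(2) in \<open>auto simp: continuous_map_def\<close>)
qed

lemma fframe_transition:
  assumes f: "fframe E x m S R f" and g: "fframe E x n S' R' g"
  shows "lin m n (\<lambda>v. inv_into (Cn n) g (f v))" "bij_betw (\<lambda>v. inv_into (Cn n) g (f v)) (Cn m) (Cn n)"
proof -
  let ?h = "\<lambda>v. inv_into (Cn n) g (f v)"
  have h: "?h v \<in> Cn n" "g (?h v) = f v" if "v \<in> Cn m" for v
    using fframe_inv[OF g fframe_fiber[OF f that]] by auto
  show "lin m n ?h"
  proof (rule linI)
    fix v assume v: "v \<in> Cn m"
    show "?h v \<in> Cn n" using h v by blast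
    show "?h (\<lambda>i. v i + w i) = (\<lambda>i. ?h v i + ?h w i)" if w: "w \<in> Cn m" for w
      using h[OF v] h[OF w] fframe_inv_f[OF g Cn_add[OF h(1)[OF v] h(1)[OF w]]]
      by (simp add: fframe_add[OF f v w] fframe_add[OF g])
    show "?h (\<lambda>i. c * v i) = (\<lambda>i. c * ?h v i)" for c
      using h[OF v] fframe_inv_f[OF g Cn_scale[OF h(1)[OF v], of c]]
      by (simp add: fframe_scale[OF f v] fframe_scale[OF g])
  qed
  show "bij_betw ?h (Cn m) (Cn n)"
    using bij_betw_trans[OF fframe_bij[OF f] bij_betw_inv_into[OF fframe_bij[OF g]]] by (simp add: o_def)
qed

definition schurian :: "nat \<Rightarrow> 'k set \<Rightarrow> ('k \<Rightarrow> (nat \<Rightarrow> complex) \<Rightarrow> nat \<Rightarrow> complex) \<Rightarrow> bool" where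
  "schurian n S R \<longleftrightarrow> irred n (R ` S) \<and> (\<forall>h\<in>S. lin n n (R h))"

lemma schurian_pos: "schurian n S R \<Longrightarrow> 0 < n"
  by (auto simp: schurian_def irred_def)

lemma schurian_scalar:
  assumes "schurian n S R" "lin n n T" "bij_betw T (Cn n) (Cn n)"
    and "\<And>h v. h \<in> S \<Longrightarrow> v \<in> Cn n \<Longrightarrow> T (R h v) = R h (T v)"
  obtains c where "c \<noteq> 0" "\<And>v. v \<in> Cn n \<Longrightarrow> T v = (\<lambda>i. c * v i)"
proof -
  obtain c where c: "\<And>v. v \<in> Cn n \<Longrightarrow> T v = (\<lambda>i. c * v i)"
    by (rule Schur[of n "R ` S" T]) (use assms in \<open>auto simp: schurian_def\<close>)
  have "ev 0 \<in> Cn n" "ev 0 \<noteq> (\<lambda>_. 0)"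
    using schurian_pos[OF assms(1)] by (auto simp: fun_eq_iff) (auto simp: ev_def)
  then have "T (ev 0) \<noteq> (\<lambda>_. 0)"
    using assms(2,3) lin_inj_iff[OF assms(2)] by (auto simp: bij_betw_def)
  then have "c \<noteq> 0" using c[OF \<open>ev 0 \<in> Cn n\<close>] by auto
  then show ?thesis using c that by blast
qed

text \<open>The change of frame commutes with all \<open>R h\<close>, so it is a scalar by Schur's
  lemma. This is what makes gluing possible: two equivariant frames differ by a function, not by a
  matrix.\<close>

lemma fframe_ratio:
  assumes S: "schurian n S R" and f: "fframe E x n S R f" and g: "fframe E x n S R g"
  obtains c where "c \<noteq> 0" "\<And>w. w \<in> Cn n \<Longrightarrow> f w = g (\<lambda>i. c * w i)"
proof -
  let ?T = "\<lambda>v. inv_into (Cn n) g (f v)"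
  have T: "?T v \<in> Cn n" "g (?T v) = f v" if "v \<in> Cn n" for v
    using fframe_inv[OF g fframe_fiber[OF f that]] by auto
  have RC: "R h v \<in> Cn n" if "h \<in> S" "v \<in> Cn n" for h v
    using S that by (auto simp: schurian_def intro: lin_Cn)
  have "?T (R h v) = R h (?T v)" if "h \<in> S" "v \<in> Cn n" for h v
  proof -
    have "f (R h v) = g (R h (?T v))"
      using fframe_act[OF f that(2,1)] fframe_act[OF g T(1)[OF that(2)] that(1)] T(2)[OF that(2)] by simp
    then show ?thesis using fframe_inv_f[OF g RC[OF that(1) T(1)[OF that(2)]]] by simp
  qed
  then obtain c where "c \<noteq> 0" "\<And>v. v \<in> Cn n \<Longrightarrow> ?T v = (\<lambda>i. c * v i)"
    using schurian_scalar[OF S fframe_transition[OF f g]] by blast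
  then show ?thesis using that T(2) by metis
qed

lemma fframe_rescale:
  assumes S: "schurian n S R" and f: "fframe E x n S R f" and c: "c \<noteq> 0"
  shows "fframe E x n S R (\<lambda>w. f (\<lambda>i. c * w i))"
proof -
  have b: "bij_betw (\<lambda>w i. c * w i) (Cn n) (Cn n)"
    by (rule bij_betwI[where g = "\<lambda>w i. inverse c * w i"]) (use c in \<open>auto simp: Cn_def\<close>)
  have R: "R h (\<lambda>i. c * v i) = (\<lambda>i. c * R h v i)" if "h \<in> S" "v \<in> Cn n" for h v
    using S that by (auto simp: schurian_def intro: lin_scale)
  have "bij_betw (\<lambda>w. f (\<lambda>i. c * w i)) (Cn n) (fiber E x)"
    using bij_betw_trans[OF b fframe_bij[OF f]] by (simp add: o_def)
  moreover have "f (\<lambda>i. c * (v i + w i)) = fadd E (f (\<lambda>i. c * v i)) (f (\<lambda>i. c * w i))" if "v \<in> Cn n" "w \<in> Cn n" for v w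
    using fframe_add[OF f Cn_scale[OF that(1)] Cn_scale[OF that(2)]] by (simp add: distrib_left)
  moreover have "f (\<lambda>i. c * (d * v i)) = fscale E d (f (\<lambda>i. c * v i))" if "v \<in> Cn n" for v d
    using fframe_scale[OF f Cn_scale[OF that, of c], of d] by (simp add: mult.left_commute)
  moreover have "act E h (f (\<lambda>i. c * v i)) = f (\<lambda>i. c * R h v i)" if "v \<in> Cn n" "h \<in> S" for v h
    using fframe_act[OF f Cn_scale[OF that(1)] that(2)] R[OF that(2,1)] by simp
  ultimately show ?thesis unfolding fframe_def by blast
qed

lemma frame_rescale:
  assumes S: "schurian n S R" and \<Phi>: "frame Y \<gamma> E n S R \<Phi>"
    and u: "continuous_map Y euclidean u" "\<And>y. y \<in> topspace Y \<Longrightarrow> u y \<noteq> (0::complex)"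
  shows "frame Y \<gamma> E n S R (\<lambda>y w. \<Phi> y (\<lambda>i. u y * w i))"
  unfolding frame_def
proof (intro conjI ballI)
  have "continuous_map (prod_topology Y (Cspace n)) (Cspace n) (\<lambda>z i. u (fst z) * snd z i)"
    unfolding continuous_map_Cspace
    by (intro conjI ballI allI continuous_map_mult
        continuous_map_compose[OF continuous_map_fst u(1), unfolded o_def]
        continuous_map_compose[OF continuous_map_snd continuous_map_Cspace_coord, unfolded o_def])
      (auto intro!: Cn_scale)
  then show "continuous_map (prod_topology Y (Cspace n)) (total E) (\<lambda>(y, w). \<Phi> y (\<lambda>i. u y * w i))"
    unfolding case_prod_unfold
    by (intro frame_cont_compose[OF \<Phi>] continuous_map_fst)
  show "fframe E (\<gamma> y) n S R (\<lambda>w. \<Phi> y (\<lambda>i. u y * w i))" if "y \<in> topspace Y" for y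
    using fframe_rescale[OF S frame_fframe[OF \<Phi> that] u(2)[OF that]] .
qed

text \<open>Bolzano's bisection principle needs frames on all short intervals, which local frames
  supply, and a way to join two adjacent intervals. At the common endpoint the frames differ by a
  constant, and one of them is rescaled by it.\<close>

lemma frame_on_interval:
  fixes \<gamma> :: "real \<Rightarrow> 'x"
  assumes S: "schurian n S R"
    and loc: "\<And>x. x \<in> topspace X \<Longrightarrow> \<exists>U \<Phi>. openin X U \<and> x \<in> U \<and> frame (subtopology X U) (\<lambda>x. x) E n S R \<Phi>"
    and \<gamma>: "continuous_map (top_of_set {0..1}) X \<gamma>"
  shows "\<exists>\<Phi>. frame (top_of_set {0..1}) \<gamma> E n S R \<Phi>"
proof -
  have "0 \<le> (0::real) \<and> (1::real) \<le> 1 \<longrightarrow> (\<exists>\<Phi>. frame (top_of_set {0..1}) \<gamma> E n S R \<Phi>)"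
  proof (rule Bolzano[where P = "\<lambda>a b. 0 \<le> a \<and> b \<le> 1 \<longrightarrow> (\<exists>\<Phi>. frame (top_of_set {a..b}) \<gamma> E n S R \<Phi>)"])
    fix a b c :: real
    assume ab: "0 \<le> a \<and> b \<le> 1 \<longrightarrow> (\<exists>\<Phi>. frame (top_of_set {a..b}) \<gamma> E n S R \<Phi>)"
      and bc: "0 \<le> b \<and> c \<le> 1 \<longrightarrow> (\<exists>\<Phi>. frame (top_of_set {b..c}) \<gamma> E n S R \<Phi>)"
      and le: "a \<le> b" "b \<le> c"
    show "0 \<le> a \<and> c \<le> 1 \<longrightarrow> (\<exists>\<Phi>. frame (top_of_set {a..c}) \<gamma> E n S R \<Phi>)"
    proof
      assume ac: "0 \<le> a \<and> c \<le> 1"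
      obtain \<Phi> where \<Phi>: "frame (top_of_set {a..b}) \<gamma> E n S R \<Phi>" using ab ac le by auto
      obtain \<Psi> where \<Psi>: "frame (top_of_set {b..c}) \<gamma> E n S R \<Psi>" using bc ac le by auto
      \<comment> \<open>The ratio of the two frames at the junction \<open>b\<close>; rescaling
        \<open>\<Psi>\<close> by this constant on its whole interval makes them agree there.\<close>
      obtain d where d: "d \<noteq> 0" "\<And>w. w \<in> Cn n \<Longrightarrow> \<Phi> b w = \<Psi> b (\<lambda>i. d * w i)"
        using fframe_ratio[OF S frame_fframe[OF \<Phi>, of b] frame_fframe[OF \<Psi>, of b]] le by auto
      define \<Psi>' where "\<Psi>' = (\<lambda>y w. \<Psi> y (\<lambda>i. d * w i))"
      have \<Psi>': "frame (top_of_set {b..c}) \<gamma> E n S R \<Psi>'"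
        unfolding \<Psi>'_def by (rule frame_rescale[OF S \<Psi>]) (use d in auto)
      let ?P = "prod_topology (top_of_set {a..c}) (Cspace n)"
      have sub: "subtopology ?P (T \<times> UNIV) = prod_topology (top_of_set ({a..c} \<inter> T)) (Cspace n)" for T
        by (simp add: subtopology_Times subtopology_subtopology)
      have 1: "{z \<in> topspace ?P. fst z \<le> b} = topspace ?P \<inter> ({a..b} \<times> UNIV)"
        and 2: "{z \<in> topspace ?P. b \<le> fst z} = topspace ?P \<inter> ({b..c} \<times> UNIV)"
        using le by auto
      have i: "{a..c} \<inter> {a..b} = {a..b}" "{a..c} \<inter> {b..c} = {b..c}" using le by auto
      have "continuous_map ?P (total E)
          (\<lambda>z. if fst z \<le> b then (\<lambda>(y, w). \<Phi> y w) z else (\<lambda>(y, w). \<Psi>' y w) z)"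
      proof (rule continuous_map_cases_le)
        show "continuous_map ?P euclideanreal fst"
          using continuous_map_fst continuous_map_into_fulltopology by blast
        show "continuous_map (subtopology ?P {z \<in> topspace ?P. fst z \<le> b}) (total E) (\<lambda>(y, w). \<Phi> y w)"
          unfolding 1 subtopology_restrict sub i by (rule frame_cont[OF \<Phi>])
        show "continuous_map (subtopology ?P {z \<in> topspace ?P. b \<le> fst z}) (total E) (\<lambda>(y, w). \<Psi>' y w)"
          unfolding 2 subtopology_restrict sub i by (rule frame_cont[OF \<Psi>'])
        show "(\<lambda>(y, w). \<Phi> y w) z = (\<lambda>(y, w). \<Psi>' y w) z" if "z \<in> topspace ?P" "fst z = b" for z
          using that d(2) by (auto simp: \<Psi>'_def)
      qed auto
      then have "frame (top_of_set {a..c}) \<gamma> E n S R (\<lambda>y w. if y \<le> b then \<Phi> y w else \<Psi>' y w)"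
        unfolding frame_def case_prod_unfold
      proof (intro conjI ballI)
        fix y assume "y \<in> topspace (top_of_set {a..c})"
        then show "fframe E (\<gamma> y) n S R (\<lambda>w. if y \<le> b then \<Phi> y w else \<Psi>' y w)"
          using frame_fframe[OF \<Phi>, of y] frame_fframe[OF \<Psi>', of y] by (cases "y \<le> b") simp_all
      qed
      then show "\<exists>\<Phi>. frame (top_of_set {a..c}) \<gamma> E n S R \<Phi>" by blast
    qed
  next
    fix x :: real assume x: "0 \<le> x" "x \<le> 1"
    have "\<gamma> x \<in> topspace X" using \<gamma> x by (auto simp: continuous_map_def)
    then obtain U \<Phi> where U: "openin X U" "\<gamma> x \<in> U" and \<Phi>: "frame (subtopology X U) (\<lambda>x. x) E n S R \<Phi>"
      using loc by blast
    have "openin (top_of_set {0..1}) {t \<in> {0..1}. \<gamma> t \<in> U}"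
      using openin_continuous_map_preimage[OF \<gamma> U(1)] by simp
    then obtain d where d: "d > 0" "\<And>t. t \<in> {0..1} \<Longrightarrow> dist t x < d \<Longrightarrow> \<gamma> t \<in> U"
      using U(2) x unfolding openin_euclidean_subtopology_iff by auto
    show "\<exists>d>0. \<forall>a b. a \<le> x \<and> x \<le> b \<and> b - a < d \<longrightarrow>
        0 \<le> a \<and> b \<le> 1 \<longrightarrow> (\<exists>\<Phi>. frame (top_of_set {a..b}) \<gamma> E n S R \<Phi>)"
    proof (intro exI[of _ d] conjI allI impI d(1))
      fix a b assume ab: "a \<le> x \<and> x \<le> b \<and> b - a < d" "0 \<le> a \<and> b \<le> 1"
      have "continuous_map (top_of_set {a..b}) (subtopology X U) \<gamma>"
      proof (subst continuous_map_in_subtopology, intro conjI)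
        show "continuous_map (top_of_set {a..b}) X \<gamma>"
          using continuous_map_from_subtopology[OF \<gamma>, of "{a..b}"] ab
          by (simp add: subtopology_subtopology Int_absorb1)
        show "\<gamma> \<in> topspace (top_of_set {a..b}) \<rightarrow> U"
          using ab d(2) by (auto simp: dist_real_def)
      qed
      from frame_precompose[OF \<Phi> this] show "\<exists>\<Phi>. frame (top_of_set {a..b}) \<gamma> E n S R \<Phi>" by blast
    qed
  qed simp
  then show ?thesis by simp
qed

text \<open>The monodromy around the loop is a nonzero scalar \<open>exp l\<close>; spreading it
  along the path as \<open>exp (y * l)\<close> makes the end values agree.\<close>

lemma frame_on_loop:
  fixes \<gamma> :: "real \<Rightarrow> 'x"
  assumes S: "schurian n S R"
    and loc: "\<And>x. x \<in> topspace X \<Longrightarrow> \<exists>U \<Phi>. openin X U \<and> x \<in> U \<and> frame (subtopology X U) (\<lambda>x. x) E n S R \<Phi>"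
    and \<gamma>: "continuous_map (top_of_set {0..1}) X \<gamma>" "\<gamma> 0 = \<gamma> 1"
  obtains \<Phi> where "frame (top_of_set {0..1}) \<gamma> E n S R \<Phi>" "\<And>w. w \<in> Cn n \<Longrightarrow> \<Phi> 0 w = \<Phi> 1 w"
proof -
  obtain \<Phi> where \<Phi>: "frame (top_of_set {0..1}) \<gamma> E n S R \<Phi>"
    using frame_on_interval[OF S loc \<gamma>(1)] by blast
  obtain d where d: "d \<noteq> 0" "\<And>w. w \<in> Cn n \<Longrightarrow> \<Phi> 0 w = \<Phi> 1 (\<lambda>i. d * w i)"
    using fframe_ratio[OF S frame_fframe[OF \<Phi>, of 0]] frame_fframe[OF \<Phi>, of 1] \<gamma>(2) by auto
  obtain l where l: "d = exp l" using d(1) exp_Ln by metis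
  have "frame (top_of_set {0..1}) \<gamma> E n S R (\<lambda>y w. \<Phi> y (\<lambda>i. exp (of_real y * l) * w i))"
    by (rule frame_rescale[OF S \<Phi>]) (auto intro!: continuous_intros)
  then show ?thesis using that d l by force
qed

text \<open>Repackages a bundle chart as a frame \<open>\<zeta>\<close> together with its continuous
  coordinate map \<open>\<kappa>\<close>. With no group elements to intertwine, \<open>R\<close> may
  be anything.\<close>

lemma vector_bundle_local:
  assumes E: "vector_bundle X E" and x: "x \<in> topspace X"
  obtains U m \<zeta> \<kappa> where "openin X U" "x \<in> U" "\<And>R. frame (subtopology X U) (\<lambda>x. x) E m {} R \<zeta>"
    "continuous_map (subtopology (total E) {e \<in> topspace (total E). proj E e \<in> U}) (Cspace m) \<kappa>"
    "\<And>e. e \<in> topspace (total E) \<Longrightarrow> proj E e \<in> U \<Longrightarrow> \<kappa> e \<in> Cn m \<and> \<zeta> (proj E e) (\<kappa> e) = e"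
    "\<And>y w. y \<in> U \<Longrightarrow> w \<in> Cn m \<Longrightarrow> \<kappa> (\<zeta> y w) = w"
proof -
  obtain U m \<phi> where U: "openin X U" "x \<in> U"
    and hom: "homeomorphic_map (subtopology (total E) {e \<in> topspace (total E). proj E e \<in> U})
          (prod_topology (subtopology X U) (Cspace m)) \<phi>"
    and fst': "\<forall>e\<in>topspace (total E). proj E e \<in> U \<longrightarrow> fst (\<phi> e) = proj E e"
    and fc': "\<forall>y\<in>U. fiber_coord E y m (\<lambda>e. snd (\<phi> e))"
    using E[unfolded vector_bundle_def, THEN conjunct2, THEN conjunct2, THEN bspec, OF x]
    by (elim exE conjE) (rule that)
  note fst = fst'[rule_format] and fc = fc'[rule_format]
  let ?M = "subtopology (total E) {e \<in> topspace (total E). proj E e \<in> U}"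
  let ?P = "prod_topology (subtopology X U) (Cspace m)"
  obtain \<psi> where \<psi>: "homeomorphic_maps ?M ?P \<phi> \<psi>"
    using hom homeomorphic_map_maps by blast
  have UX: "U \<subseteq> topspace X" using U(1) openin_subset by blast
  have tU: "topspace X \<inter> U = U" using UX by blast
  have tM: "topspace ?M = {e \<in> topspace (total E). proj E e \<in> U}" by auto
  have c\<phi>: "continuous_map ?M ?P \<phi>" and c\<psi>: "continuous_map ?P ?M \<psi>"
    and inv1: "\<And>e. e \<in> topspace ?M \<Longrightarrow> \<psi> (\<phi> e) = e" and inv2: "\<And>z. z \<in> topspace ?P \<Longrightarrow> \<phi> (\<psi> z) = z"
    using \<psi> by (auto simp: homeomorphic_maps_def)
  define \<zeta> where "\<zeta> = (\<lambda>y w. \<psi> (y, w))"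
  have \<zeta>M: "\<zeta> y w \<in> topspace (total E)" "proj E (\<zeta> y w) = y" "snd (\<phi> (\<zeta> y w)) = w" if "y \<in> U" "w \<in> Cn m" for y w
  proof -
    have z: "(y, w) \<in> topspace ?P" using that UX by auto
    then have "\<psi> (y, w) \<in> topspace ?M" using c\<psi> by (auto simp: continuous_map_def)
    then show "\<zeta> y w \<in> topspace (total E)" "proj E (\<zeta> y w) = y" "snd (\<phi> (\<zeta> y w)) = w"
      using inv2[OF z] fst[of "\<psi> (y, w)"] by (auto simp: \<zeta>_def)
  qed
  have \<kappa>: "snd (\<phi> e) \<in> Cn m \<and> \<zeta> (proj E e) (snd (\<phi> e)) = e" if e: "e \<in> topspace (total E)" "proj E e \<in> U" for e
  proof -
    have "e \<in> topspace ?M" using e by auto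
    moreover from this have "\<phi> e \<in> topspace ?P" using c\<phi> by (auto simp: continuous_map_def)
    ultimately show ?thesis using inv1[of e] fst[OF e] by (auto simp: \<zeta>_def mem_Times_iff) (metis prod.collapse)
  qed
  have fr: "frame (subtopology X U) (\<lambda>x. x) E m {} R \<zeta>" for R :: "'b \<Rightarrow> (nat \<Rightarrow> complex) \<Rightarrow> nat \<Rightarrow> complex"
    unfolding frame_def
  proof (intro conjI ballI)
    show "continuous_map ?P (total E) (\<lambda>(y, w). \<zeta> y w)"
      using c\<psi> continuous_map_into_fulltopology by (auto simp: \<zeta>_def)
    fix y assume "y \<in> topspace (subtopology X U)"
    then have y: "y \<in> U" by simp
    have inj: "e = e'" if "e \<in> fiber E y" "e' \<in> fiber E y" "snd (\<phi> e) = snd (\<phi> e')" for e e'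
      using fc[OF y] that unfolding fiber_coord_def bij_betw_def by (blast dest: inj_onD)
    have z: "\<zeta> y w \<in> fiber E y" if "w \<in> Cn m" for w using \<zeta>M[OF y that] by (auto simp: fiber_def)
    have cl: "fadd E e e' \<in> fiber E y" "fscale E c e \<in> fiber E y" if "e \<in> fiber E y" "e' \<in> fiber E y" for e e' c
      using E[unfolded vector_bundle_def, THEN conjunct2, THEN conjunct1, THEN bspec, of y,
          THEN bspec, of e] that y UX by (simp_all add: subset_iff)
    show "fframe E y m {} R (\<zeta> y)"
      unfolding fframe_def
    proof (intro conjI ballI allI)
      show "bij_betw (\<zeta> y) (Cn m) (fiber E y)"
        by (rule bij_betwI[where g = "\<lambda>e. snd (\<phi> e)"])
          (use z \<kappa> \<zeta>M[OF y] y in \<open>auto simp: fiber_def\<close>)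
      show "\<zeta> y (\<lambda>i. v i + w i) = fadd E (\<zeta> y v) (\<zeta> y w)" if v: "v \<in> Cn m" and w: "w \<in> Cn m" for v w
        by (rule inj[OF z[OF Cn_add[OF v w]] cl(1)[OF z[OF v] z[OF w]]])
          (use fc[OF y] z[OF v] z[OF w] \<zeta>M(3)[OF y] v w in \<open>simp add: fiber_coord_def Cn_add\<close>)
      show "\<zeta> y (\<lambda>i. c * v i) = fscale E c (\<zeta> y v)" if v: "v \<in> Cn m" for v c
        by (rule inj[OF z[OF Cn_scale[OF v]] cl(2)[OF z[OF v] z[OF v]]])
          (use fc[OF y] z[OF v] \<zeta>M(3)[OF y] v in \<open>simp add: fiber_coord_def Cn_scale\<close>)
    qed auto
  qed
  show ?thesis
    by (rule that[OF U fr continuous_map_compose[OF c\<phi> continuous_map_snd, unfolded o_def] \<kappa>])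
      (use \<zeta>M in auto)
qed

text \<open>In a chart the frame becomes a family of invertible matrices \<open>A x\<close> that is
  continuous in \<open>x\<close>, so the claim amounts to continuity of matrix inversion. It is
  obtained by a direct estimate: with \<open>L\<close> the inverse of \<open>A x0\<close> and
  \<open>D x\<close> the matrix of \<open>L A x - 1\<close>, a coordinate difference
  \<open>z\<close> satisfies \<open>z = L A z - D z\<close>, and \<open>D\<close> is small near
  \<open>x0\<close>.\<close>

lemma continuous_map_frame_coord:
  fixes E :: "('k, 'x, 'e) vbundle"
  assumes E: "vector_bundle X E" and \<Phi>: "frame X (\<lambda>x. x) E n S R \<Phi>"
  shows "continuous_map (total E) (Cspace n) (\<lambda>e. inv_into (Cn n) (\<Phi> (proj E e)) e)"
  unfolding continuous_map_Cspace
proof (intro conjI ballI allI)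
  let ?co = "\<lambda>e. inv_into (Cn n) (\<Phi> (proj E e)) e"
  have pX: "continuous_map (total E) X (proj E)" using E by (simp add: vector_bundle_def)
  have pr: "proj E e \<in> topspace X" if "e \<in> topspace (total E)" for e
    using pX that by (auto simp: continuous_map_def)
  have co: "?co e \<in> Cn n" "\<Phi> (proj E e) (?co e) = e" if "e \<in> topspace (total E)" for e
    using fframe_inv[OF frame_fframe[OF \<Phi> pr[OF that]], of e] that by (auto simp: fiber_def)
  show "?co e \<in> Cn n" if "e \<in> topspace (total E)" for e using co that by blast
  fix k
  show "continuous_map (total E) euclidean (\<lambda>e. ?co e k)"
  proof (rule continuous_mapI_metric)
    fix e0 and eps :: real assume e0: "e0 \<in> topspace (total E)" and eps: "eps > 0"
    define x0 where "x0 = proj E e0"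
    have x0: "x0 \<in> topspace X" using pr[OF e0] by (simp add: x0_def)
    obtain U m \<zeta> \<kappa> where U: "openin X U" "x0 \<in> U"
      and \<zeta>: "frame (subtopology X U) (\<lambda>x. x) E m {} R \<zeta>"
      and c\<kappa>: "continuous_map (subtopology (total E) {e \<in> topspace (total E). proj E e \<in> U}) (Cspace m) \<kappa>"
      and \<kappa>\<zeta>: "\<And>e. e \<in> topspace (total E) \<Longrightarrow> proj E e \<in> U \<Longrightarrow> \<kappa> e \<in> Cn m \<and> \<zeta> (proj E e) (\<kappa> e) = e"
      and \<zeta>\<kappa>: "\<And>y w. y \<in> U \<Longrightarrow> w \<in> Cn m \<Longrightarrow> \<kappa> (\<zeta> y w) = w"
      by (rule vector_bundle_local[OF E x0]) blast
    have UX: "U \<subseteq> topspace X" using U(1) openin_subset by blast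
    let ?M = "subtopology (total E) {e \<in> topspace (total E). proj E e \<in> U}"
    have oM: "openin (total E) {e \<in> topspace (total E). proj E e \<in> U}"
      by (rule openin_continuous_map_preimage[OF pX U(1)])
    have tM: "topspace ?M = {e \<in> topspace (total E). proj E e \<in> U}" by auto
    define A where "A = (\<lambda>x v. \<kappa> (\<Phi> x v))"
    have Afib: "\<Phi> x v \<in> topspace (total E)" "proj E (\<Phi> x v) = x" if "x \<in> U" "v \<in> Cn n" for x v
      using fframe_fiber[OF frame_fframe[OF \<Phi>] that(2), of x] that(1) UX by (auto simp: fiber_def)
    have Ainv: "A x v = inv_into (Cn m) (\<zeta> x) (\<Phi> x v)" if x: "x \<in> U" and v: "v \<in> Cn n" for x v
    proof -
      have 1: "\<Phi> x v \<in> topspace (total E)" "proj E (\<Phi> x v) \<in> U" using Afib[OF x v] x by auto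
      have fr: "fframe E x m {} R (\<zeta> x)" using frame_fframe[OF \<zeta>, of x] x UX by auto
      show ?thesis
        using \<kappa>\<zeta>[OF 1] Afib[OF x v] fframe_inv_f[OF fr, of "A x v"] by (simp add: A_def)
    qed
    have fx: "fframe E x n S R (\<Phi> x)" "fframe E x m {} R (\<zeta> x)" if "x \<in> U" for x
      using frame_fframe[OF \<Phi>, of x] frame_fframe[OF \<zeta>, of x] that UX by auto
    have linA: "lin n m (A x)" and bijA: "bij_betw (A x) (Cn n) (Cn m)" if x: "x \<in> U" for x
    proof -
      have eq: "A x v = inv_into (Cn m) (\<zeta> x) (\<Phi> x v)" if "v \<in> Cn n" for v using Ainv x that by blast
      show "lin n m (A x)"
        using fframe_transition(1)[OF fx[OF x]] by (simp add: lin_def eq Cn_add Cn_scale)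
      show "bij_betw (A x) (Cn n) (Cn m)"
        using fframe_transition(2)[OF fx[OF x]] eq by (subst bij_betw_cong) auto
    qed
    have Aco: "A (proj E e) (?co e) = \<kappa> e" if "e \<in> topspace (total E)" for e
      using co[OF that] by (simp add: A_def)
    define L where "L = inv_into (Cn n) (A x0)"
    have linL: "lin m n L" unfolding L_def by (rule lin_inv_into[OF linA[OF U(2)] bijA[OF U(2)]])
    have LA: "L (A x0 v) = v" if "v \<in> Cn n" for v
      using bijA[OF U(2)] that by (auto simp: L_def bij_betw_def)
    have cA: "continuous_map (subtopology X U) (Cspace m) (\<lambda>x. A x v)" if v: "v \<in> Cn n" for v
    proof -
      have "continuous_map (subtopology X U) (total E) (\<lambda>x. \<Phi> x v)"
        by (rule frame_cont_compose[OF \<Phi>]) (use v in \<open>auto simp: continuous_map_from_subtopology\<close>)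
      then have "continuous_map (subtopology X U) ?M (\<lambda>x. \<Phi> x v)"
        using Afib v by (auto simp: continuous_map_in_subtopology Pi_iff)
      from continuous_map_compose[OF this c\<kappa>] show ?thesis by (simp add: A_def o_def)
    qed
    have cL: "continuous_map Z euclidean (\<lambda>z. L (f z) i)" if "continuous_map Z (Cspace m) f" for Z :: "'z topology" and f i
    proof -
      have "continuous_map Z euclidean (\<lambda>z. \<Sum>j<m. f z j * L (ev j) i)"
        using that unfolding continuous_map_Cspace
        by (intro continuous_map_sum' continuous_map_mult) auto
      moreover have "L (f z) i = (\<Sum>j<m. f z j * L (ev j) i)" if "z \<in> topspace Z" for z
        using fun_cong[OF lin_expand[OF linL, of "f z"], of i] that \<open>continuous_map Z (Cspace m) f\<close>
        by (auto simp: continuous_map_Cspace)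
      ultimately show ?thesis by (subst continuous_map_eq) auto
    qed
    define v0 where "v0 = ?co e0"
    have v0: "v0 \<in> Cn n" using co(1)[OF e0] by (simp add: v0_def)
    define D where "D = (\<lambda>x j i. L (A x (ev j)) i - ev j i)"
    \<comment> \<open>The part of the error that does not involve the unknown coordinates of
      \<open>e\<close>; it is continuous and vanishes at \<open>e0\<close>.\<close>
    define Q where "Q = (\<lambda>e. \<Sum>i<n. norm (L (\<lambda>l. \<kappa> e l - A (proj E e) v0 l) i))"
    have cpU: "continuous_map ?M (subtopology X U) (proj E)"
      using continuous_map_from_subtopology[OF pX] by (auto simp: continuous_map_in_subtopology)
    have cD: "continuous_map ?M euclidean (\<lambda>e. D (proj E e) j i)" if "j < n" for j i
      unfolding D_def
      by (intro continuous_map_minus' cL continuous_map_compose[OF cpU cA, unfolded o_def]) (use that in auto)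
    have "continuous_map ?M (Cspace m) (\<lambda>e l. \<kappa> e l - A (proj E e) v0 l)"
      using c\<kappa> continuous_map_compose[OF cpU cA[OF v0], unfolded o_def]
      unfolding continuous_map_Cspace by (auto intro!: continuous_map_minus' Cn_diff)
    then have cQ: "continuous_map ?M euclidean Q"
      unfolding Q_def by (intro continuous_map_sum' continuous_map_unop[OF continuous_on_norm_id] cL)
    \<comment> \<open>The bound \<open>1 / (2 (n + 1))\<close> on each of the \<open>n\<close>
      entries in a row makes \<open>D\<close> contribute at most half of the norm of
      \<open>z\<close>; \<open>Suc n\<close> also keeps the bound meaningful for
      \<open>n = 0\<close>.\<close>
    define V where "V = {e \<in> topspace ?M. Q e < eps / 2} \<inter>
       (\<Inter>j\<in>{..<n}. \<Inter>i\<in>{..<n}. {e \<in> topspace ?M. D (proj E e) j i \<in> ball 0 (1 / (2 * real (Suc n)))}) \<inter> topspace ?M"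
    have "openin ?M V"
    proof -
      have o1: "openin ?M {e \<in> topspace ?M. Q e < eps / 2}"
        using openin_continuous_map_preimage[OF cQ, of "{..<eps/2}"] by simp
      have o2: "openin ?M {e \<in> topspace ?M. D (proj E e) j i \<in> ball 0 (1 / (2 * real (Suc n)))}" if "j < n" for j i
        using openin_continuous_map_preimage[OF cD[OF that], of "ball 0 (1 / (2 * real (Suc n)))" i] by simp
      have o3: "openin ?M ((\<Inter>p\<in>{..<n} \<times> {..<n}. {e \<in> topspace ?M. D (proj E e) (fst p) (snd p) \<in> ball 0 (1 / (2 * real (Suc n)))}) \<inter> topspace ?M)"
      \<comment> \<open>\<open>openin_INT2\<close> needs a nonempty index set; for
        \<open>n = 0\<close> the intersection over the entries is \<open>UNIV\<close>.\<close>
      proof (cases "n = 0")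
        case False
        then show ?thesis by (intro openin_Int openin_INT2 openin_topspace o2) auto
      qed (simp only: lessThan_0 Sigma_empty1 INT_empty Int_UNIV_left openin_topspace)
      have "V = {e \<in> topspace ?M. Q e < eps / 2} \<inter> ((\<Inter>p\<in>{..<n} \<times> {..<n}. {e \<in> topspace ?M. D (proj E e) (fst p) (snd p) \<in> ball 0 (1 / (2 * real (Suc n)))}) \<inter> topspace ?M)"
        unfolding V_def by fastforce
      then show ?thesis using openin_Int[OF o1 o3] by simp
    qed
    then have oV: "openin (total E) V" using oM openin_open_subtopology by blast
    have \<kappa>A0: "\<kappa> e0 = A x0 v0" using Aco[OF e0] by (simp add: x0_def v0_def)
    have "e0 \<in> V"
      using e0 U(2) eps LA lin_zero[OF linL] by (auto simp: V_def Q_def D_def x0_def[symmetric] \<kappa>A0)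
    moreover have "dist (?co e k) (?co e0 k) < eps" if eV: "e \<in> V" for e
    proof -
      have e: "e \<in> topspace (total E)" "proj E e \<in> U" "Q e < eps / 2"
        and De: "\<And>i j. i < n \<Longrightarrow> j < n \<Longrightarrow> norm (D (proj E e) j i) < 1 / (2 * real (Suc n))"
        using eV unfolding V_def by (auto simp: Ball_def)
      define z where "z = (\<lambda>i. ?co e i - v0 i)"
      have z: "z \<in> Cn n" unfolding z_def by (rule Cn_diff[OF co(1)[OF e(1)] v0])
      let ?N = "\<Sum>i<n. norm (z i)"
      have Az: "A (proj E e) z = (\<lambda>l. \<kappa> e l - A (proj E e) v0 l)"
        unfolding z_def using lin_diff[OF linA[OF e(2)] co(1)[OF e(1)] v0] Aco[OF e(1)] by simp
      have Lz: "L (A (proj E e) z) i = z i + (\<Sum>j<n. z j * D (proj E e) j i)" if "i < n" for i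
      proof -
        have "L (A (proj E e) z) i = (\<Sum>j<n. z j * L (A (proj E e) (ev j)) i)"
          using fun_cong[OF lin_expand[OF lin_comp[OF linA[OF e(2)] linL] z], of i] by simp
        moreover have "z i = (\<Sum>j<n. z j * ev j i)" using fun_cong[OF Cn_expand[OF z], of i] .
        ultimately show ?thesis by (simp add: D_def right_diff_distrib sum_subtractf)
      qed
      have "norm (z i) \<le> norm (L (A (proj E e) z) i) + ?N / (2 * real (Suc n))" if "i < n" for i
      proof -
        have "norm (\<Sum>j<n. z j * D (proj E e) j i) \<le> (\<Sum>j<n. norm (z j) * (1 / (2 * real (Suc n))))"
          by (rule sum_norm_le, subst norm_mult, rule mult_left_mono, rule less_imp_le, rule De[OF that]) auto
        also have "\<dots> = ?N / (2 * real (Suc n))" by (simp add: sum_divide_distrib)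
        finally have "norm (\<Sum>j<n. z j * D (proj E e) j i) \<le> ?N / (2 * real (Suc n))" .
        moreover have "norm (z i) \<le> norm (L (A (proj E e) z) i) + norm (\<Sum>j<n. z j * D (proj E e) j i)"
          using Lz[OF that] norm_triangle_ineq4[of "L (A (proj E e) z) i" "\<Sum>j<n. z j * D (proj E e) j i"] by simp
        ultimately show ?thesis by simp
      qed
      \<comment> \<open>Summing over the coordinates gives \<open>?N \<le> Q e + ?N / 2\<close>,
        hence \<open>?N \<le> 2 * Q e < eps\<close>.\<close>
      then have "?N \<le> (\<Sum>i<n. norm (L (A (proj E e) z) i) + ?N / (2 * real (Suc n)))"
        by (intro sum_mono) auto
      also have "\<dots> = Q e + real n * ?N / (2 * real (Suc n))"
        by (simp add: sum.distrib Q_def Az)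
      also have "real n * ?N / (2 * real (Suc n)) \<le> ?N / 2"
      proof -
        have "real n * ?N \<le> real (Suc n) * ?N" by (intro mult_right_mono sum_nonneg) auto
        then show ?thesis by (simp add: field_simps)
      qed
      finally have N: "?N < eps" using e(3) by simp
      have "norm (z k) \<le> ?N"
      proof (cases "k < n")
        case True
        then show ?thesis by (intro member_le_sum) auto
      next
        case False
        then have "z k = 0" using z by (auto simp: Cn_def)
        then show ?thesis by (simp add: sum_nonneg)
      qed
      then show ?thesis using N by (simp add: dist_norm z_def v0_def)
    qed
    ultimately show "\<exists>U. openin (total E) U \<and> e0 \<in> U \<and> (\<forall>e\<in>U. dist (?co e k) (?co e0 k) < eps)"
      using oV by blast
  qed
qed

section \<open>Functions and scalar cocycles on the circle\<close>

definition circ :: "real \<Rightarrow> real^2" where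
  "circ t = vector [cos t, sin t]"

lemma circ_nth [simp]: "circ t $ 1 = cos t" "circ t $ 2 = sin t"
  by (simp_all add: circ_def)

lemma vec2_eq_iff: "(x :: real^2) = y \<longleftrightarrow> x $ 1 = y $ 1 \<and> x $ 2 = y $ 2"
  by (simp add: vec_eq_iff forall_2)

lemma topspace_unit_circle [simp]: "topspace unit_circle = sphere 0 1"
  by (simp add: unit_circle_def)

lemma norm_vec2: "norm (x :: real^2) = sqrt ((x $ 1)\<^sup>2 + (x $ 2)\<^sup>2)"
  by (simp add: norm_eq_sqrt_inner inner_vec_def sum_2 power2_eq_square)

lemma norm_circ [simp]: "norm (circ t) = 1"
  by (simp add: norm_vec2)

lemma circ_in_sphere: "circ t \<in> sphere 0 1"
  by simp

lemma circ_surj: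
  assumes "x \<in> sphere 0 1"
  obtains t where "0 \<le> t" "t < 2 * pi" "x = circ t"
proof -
  have "(x $ 1)\<^sup>2 + (x $ 2)\<^sup>2 = 1" using assms by (simp add: norm_vec2)
  then obtain t where "0 \<le> t" "t < 2 * pi" "x $ 1 = cos t" "x $ 2 = sin t"
    using sincos_total_2pi by metis
  then show ?thesis using that by (auto simp: vec2_eq_iff)
qed

lemma circ_eq_iff: "circ s = circ t \<longleftrightarrow> (\<exists>k::int. s = t + 2 * pi * k)"
  using sin_cos_eq_iff[of s t] by (auto simp: vec2_eq_iff algebra_simps)

lemma circ_periodic [simp]: "circ (t + 2 * pi) = circ t"
  by (simp add: vec2_eq_iff)

lemma continuous_on_circ: "continuous_on A circ"
proof -
  have "circ = (\<lambda>t. cos t *\<^sub>R vector [1, 0] + sin t *\<^sub>R vector [0, 1])"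
    by (rule ext) (simp add: vec2_eq_iff)
  moreover have "continuous_on A (\<lambda>t. cos t *\<^sub>R (vector [1, 0] :: real^2) + sin t *\<^sub>R vector [0, 1])"
    by (intro continuous_intros)
  ultimately show ?thesis by metis
qed

lemma continuous_map_circ:
  assumes "continuous_map Z euclideanreal f"
  shows "continuous_map Z unit_circle (\<lambda>z. circ (f z))"
  unfolding unit_circle_def continuous_map_in_subtopology
  using continuous_map_unop[OF continuous_on_circ assms] by auto

text \<open>A product with \<open>Y\<close> need not preserve quotient maps in general. Here the
  interval is compact and the circle is Hausdorff, so the wrapping map is proper; products of proper
  maps are proper, and proper maps are closed.\<close>

lemma circle_quotient:
  "quotient_map (prod_topology (top_of_set {0..1}) Y) (prod_topology unit_circle Y) (\<lambda>(t, y). (circ (2 * pi * t), y))"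
proof -
  let ?q = "\<lambda>t::real. circ (2 * pi * t)"
  have c: "continuous_map (top_of_set {0..1}) unit_circle ?q"
    by (rule continuous_map_circ) (auto intro!: continuous_intros)
  have "Hausdorff_space unit_circle"
    unfolding unit_circle_def by (rule Hausdorff_space_subtopology) (simp add: Hausdorff_space_euclidean)
  then have "proper_map (top_of_set {0..1}) unit_circle ?q"
    using continuous_imp_proper_map[OF _ Hausdorff_imp_kc_space c] by (simp add: compact_space_subtopology)
  then have "proper_map (prod_topology (top_of_set {0..1}) Y) (prod_topology unit_circle Y) (\<lambda>(t, y). (?q t, id y))"
    unfolding proper_map_prod using proper_map_id[of Y] by blast
  then have cl: "closed_map (prod_topology (top_of_set {0..1}) Y) (prod_topology unit_circle Y) (\<lambda>(t, y). (?q t, y))"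
    using proper_imp_closed_map by simp
  show ?thesis
  proof (rule continuous_closed_imp_quotient_map[OF _ cl])
    show "continuous_map (prod_topology (top_of_set {0..1}) Y) (prod_topology unit_circle Y) (\<lambda>(t, y). (?q t, y))"
      unfolding case_prod_unfold
      by (intro continuous_map_pairedI continuous_map_snd continuous_map_compose[OF continuous_map_fst c, unfolded o_def])
    show "(\<lambda>(t, y). (?q t, y)) ` topspace (prod_topology (top_of_set {0..1}) Y) = topspace (prod_topology unit_circle Y)"
    proof (intro equalityI subsetI)
      fix z assume "z \<in> topspace (prod_topology unit_circle Y)"
      then obtain x y where z: "z = (x, y)" "x \<in> sphere 0 1" "y \<in> topspace Y" by auto
      obtain t where t: "0 \<le> t" "t < 2 * pi" "x = circ t" using circ_surj[OF z(2)] .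
      then show "z \<in> (\<lambda>(t, y). (?q t, y)) ` topspace (prod_topology (top_of_set {0..1}) Y)"
        using z by (intro image_eqI[where x = "(t / (2 * pi), y)"]) auto
    qed auto
  qed
qed

text \<open>The wrapping map identifies only the two ends of the interval, so the arbitrary choice
  of a preimage in \<open>h\<close> is harmless. The extra variable \<open>y\<close> serves for the
  vectors of a frame.\<close>

lemma circle_descend:
  fixes f :: "real \<Rightarrow> 'y \<Rightarrow> 'z"
  assumes f: "continuous_map (prod_topology (top_of_set {0..1}) Y) Z (\<lambda>(t, y). f t y)"
    and eq: "\<And>y. y \<in> topspace Y \<Longrightarrow> f 0 y = f 1 y"
  obtains h where "continuous_map (prod_topology unit_circle Y) Z (\<lambda>(x, y). h x y)"
    "\<And>t y. t \<in> {0..1} \<Longrightarrow> y \<in> topspace Y \<Longrightarrow> h (circ (2 * pi * t)) y = f t y"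
proof -
  define h where "h x = f (SOME t. t \<in> {0..1} \<and> circ (2 * pi * t) = x)" for x
  have h: "h (circ (2 * pi * t)) y = f t y" if t: "t \<in> {0..1}" and y: "y \<in> topspace Y" for t y
  proof -
    define s where "s = (SOME s. s \<in> {0..1} \<and> circ (2 * pi * s) = circ (2 * pi * t))"
    have s: "s \<in> {0..1}" "circ (2 * pi * s) = circ (2 * pi * t)"
      unfolding s_def by (rule someI2[of _ t]; use t in auto)+
    then obtain k :: int where "2 * pi * s = 2 * pi * t + 2 * pi * k" by (auto simp: circ_eq_iff)
    then have "2 * pi * s = 2 * pi * (t + k)" by (simp add: distrib_left)
    then have k: "s = t + k" by simp
    then have "real_of_int k \<le> 1" "real_of_int k \<ge> -1" using s(1) t by auto
    then have "k = 0 \<or> k = 1 \<or> k = -1" by linarith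
    then have "f s y = f t y"
    proof (elim disjE)
      assume "k = 1"
      then have "s = 1" "t = 0" using k s(1) t by auto
      then show ?thesis using eq y by simp
    next
      assume "k = -1"
      then have "s = 0" "t = 1" using k s(1) t by auto
      then show ?thesis using eq y by simp
    qed (use k in simp)
    then show ?thesis by (simp add: h_def s_def)
  qed
  have "continuous_map (prod_topology (top_of_set {0..1}) Y) Z ((\<lambda>(x, y). h x y) \<circ> (\<lambda>(t, y). (circ (2 * pi * t), y)))"
    by (rule continuous_map_eq[OF f]) (use h in auto)
  from continuous_compose_quotient_map[OF circle_quotient this] show ?thesis using that h by blast
qed

section \<open>Periodic functions and continuous logarithms\<close>

lemma periodic_int:
  fixes u :: "real \<Rightarrow> 'a"
  assumes "\<And>t. u (t + p) = u t"
  shows "u (t + p * of_int k) = u t"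
proof -
  have nat: "u (t + p * real j) = u t" for j t
  proof (induction j arbitrary: t)
    case (Suc j)
    have "u (t + p * real (Suc j)) = u ((t + p * real j) + p)" by (simp add: algebra_simps)
    then show ?case using assms Suc by simp
  qed simp
  show ?thesis
  proof (cases k)
    case (nonneg j)
    then show ?thesis using nat by simp
  next
    case (neg j)
    then have "real_of_int k = - real (Suc j)" by simp
    then have "t + p * of_int k + p * real (Suc j) = t" by (simp del: of_nat_Suc)
    then show ?thesis using nat[of "t + p * of_int k" "Suc j"] by metis
  qed
qed

text \<open>The offset \<open>t0\<close> lets angles be measured from a fixed point of a reflection,
  where the reflection becomes \<open>t \<mapsto> - t\<close>.\<close>

lemma circle_function:
  fixes u :: "real \<Rightarrow> complex"
  assumes "continuous_on UNIV u" "\<And>t. u (t + 2 * pi) = u t"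
  obtains h where "continuous_map unit_circle euclidean h" "\<And>t. h (circ (t0 + t)) = u t"
proof -
  \<comment> \<open>The type \<open>unit\<close> is a dummy for the second factor in
    \<open>circle_descend\<close>.\<close>
  let ?f = "\<lambda>t (y::unit). u (2 * pi * t - t0)"
  have c: "continuous_map (prod_topology (top_of_set {0..1}) (discrete_topology UNIV)) euclidean (\<lambda>(t, y). ?f t y)"
    unfolding case_prod_unfold
    by (rule continuous_map_compose[OF continuous_map_fst, unfolded o_def])
      (auto intro!: continuous_on_compose2[OF assms(1)] continuous_intros)
  have e: "?f 0 y = ?f 1 y" for y using assms(2)[of "-t0"] by (simp add: algebra_simps)
  obtain h where h: "continuous_map (prod_topology unit_circle (discrete_topology UNIV)) euclidean (\<lambda>(x, y::unit). h x y)"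
    "\<And>t y. t \<in> {0..1} \<Longrightarrow> h (circ (2 * pi * t)) y = ?f t y"
    using circle_descend[OF c e] by auto
  have "continuous_map unit_circle euclidean (\<lambda>x. h x ())"
    using continuous_map_compose[OF continuous_map_pairedI[OF continuous_map_id[of unit_circle], of "discrete_topology UNIV" "\<lambda>_. ()"] h(1)]
    by (simp add: o_def)
  moreover have "h (circ (t0 + t)) () = u t" for t
  proof -
    obtain s where s: "0 \<le> s" "s < 2 * pi" "circ (t0 + t) = circ s"
      by (rule circ_surj[OF circ_in_sphere])
    then obtain k :: int where k: "t0 + t = s + 2 * pi * k" by (auto simp: circ_eq_iff)
    have "h (circ (t0 + t)) () = u (s - t0)"
      using h(2)[of "s / (2 * pi)" "()"] s by simp
    also have "\<dots> = u (t + 2 * pi * of_int (-k))"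
    proof -
      have "s - t0 = t + 2 * pi * of_int (-k)" using k by simp
      then show ?thesis by (simp only:)
    qed
    also have "\<dots> = u t" by (rule periodic_int[of u, OF assms(2)])
    finally show ?thesis .
  qed
  ultimately show ?thesis using that by blast
qed

lemma continuous_on_circle_pullback:
  assumes "continuous_map unit_circle euclidean h"
  shows "continuous_on UNIV (\<lambda>t. h (circ (t0 + t)))"
proof -
  have "continuous_map euclideanreal unit_circle (\<lambda>t. circ (t0 + t))"
    by (rule continuous_map_circ) (simp add: continuous_intros)
  from continuous_map_compose[OF this assms] show ?thesis by (simp add: o_def)
qed

text \<open>The values differ by multiples of \<open>2 pi i\<close>, so distinct ones are at
  distance at least 1. It converts multiplicative identities into exact additive identities between
  logarithms.\<close>

lemma continuous_exp_constant:
  fixes f :: "'a::topological_space \<Rightarrow> complex"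
  assumes "connected (UNIV :: 'a set)" "continuous_on UNIV f" "\<And>x y. exp (f x) = exp (f y)"
  shows "f x = f y"
proof -
  have "f constant_on UNIV"
  proof (rule continuous_discrete_range_constant[OF assms(1,2)])
    fix x
    show "\<exists>e>0. \<forall>y. y \<in> UNIV \<and> f y \<noteq> f x \<longrightarrow> e \<le> norm (f y - f x)"
    proof (intro exI[of _ 1] conjI allI impI)
      fix y assume y: "y \<in> UNIV \<and> f y \<noteq> f x"
      obtain k :: int where k: "f y = f x + complex_of_real (2 * of_int k * pi) * \<i>"
        using assms(3)[of y x] by (auto simp: exp_eq mult.commute mult.left_commute)
      then have "k \<noteq> 0" using y by auto
      then have "1 \<le> \<bar>real_of_int k\<bar>" by linarith
      moreover have "norm (f y - f x) = 2 * pi * \<bar>real_of_int k\<bar>"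
        using k by (simp add: norm_mult)
      moreover have "1 \<le> 2 * pi" using pi_ge_two by simp
      ultimately show "1 \<le> norm (f y - f x)" by (metis mult_mono' mult_1 zero_le_one)
    qed simp
  qed
  then show ?thesis by (auto simp: constant_on_def)
qed

lemma continuous_log_lift:
  fixes c :: "'a::real_normed_vector \<Rightarrow> complex"
  assumes "continuous_on UNIV c" "\<And>t. c t \<noteq> 0"
  obtains \<phi> where "continuous_on UNIV \<phi>" "\<And>t. c t = exp (\<phi> t)"
  using continuous_logarithm_on_contractible[OF assms(1) contractible_UNIV] assms(2) by auto

lemma continuous_on_shift:
  fixes f :: "real \<Rightarrow> 'b::topological_space"
  assumes "continuous_on UNIV f"
  shows "continuous_on UNIV (\<lambda>t. f (t + a))" "continuous_on UNIV (\<lambda>t. f (- t))"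
  by (rule continuous_on_compose2[OF assms], auto intro!: continuous_intros)+

text \<open>An additive form of Hilbert 90 for the cyclic group of rotations. Here \<open>c\<close>
  is the multiplier of the generator, and \<open>prod\<close> expresses that its \<open>m\<close>-th
  power acts by a constant. The logarithm minus its mean over the rotations has sum zero, hence is a
  difference \<open>\<eta> (t + l) - \<eta> t\<close>.\<close>

lemma cyclic_cocycle_trivial:
  fixes c :: "real \<Rightarrow> complex" and m :: nat
  assumes c: "continuous_on UNIV c" "\<And>t. c t \<noteq> 0" "\<And>t. c (t + 2 * pi) = c t"
    and m: "0 < m" and prod: "\<And>s t. (\<Prod>k<m. c (s + k * (2 * pi / m))) = (\<Prod>k<m. c (t + k * (2 * pi / m)))"
  obtains u \<kappa> where "continuous_on UNIV u" "\<And>t. u t \<noteq> 0" "\<And>t. u (t + 2 * pi) = u t" "\<kappa> \<noteq> 0"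
    "\<And>t. u t * c t = \<kappa> * u (t + 2 * pi / m)"
proof -
  define l where "l = 2 * pi / m"
  have ml: "m * l = 2 * pi" using m by (simp add: l_def)
  obtain \<phi> where \<phi>: "continuous_on UNIV \<phi>" "\<And>t. c t = exp (\<phi> t)" using continuous_log_lift[OF c(1,2)] by blast
  define \<Sigma> where "\<Sigma> = (\<lambda>t. \<Sum>k<m. \<phi> (t + k * l))"
  have \<Sigma>c: "\<Sigma> s = \<Sigma> t" for s t
  proof (rule continuous_exp_constant[OF connected_UNIV, where f = \<Sigma>])
    show "continuous_on UNIV \<Sigma>" unfolding \<Sigma>_def by (intro continuous_on_sum continuous_on_shift(1)[OF \<phi>(1)])
    show "exp (\<Sigma> x) = exp (\<Sigma> y)" for x y
    proof -
      have "exp (\<Sum>k<j. \<phi> (z + k * l)) = (\<Prod>k<j. c (z + k * l))" for j :: nat and z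
        by (induction j) (auto simp: exp_add \<phi>(2))
      then show ?thesis using prod[of x y] by (simp add: \<Sigma>_def l_def)
    qed
  qed
  \<comment> \<open>The sums \<open>\<Sigma> (t + l)\<close> and \<open>\<Sigma> t\<close> share all
    terms except \<open>\<phi> (t + 2 * pi)\<close> and \<open>\<phi> t\<close>. Thus
    \<open>c\<close> has winding number 0, which makes \<open>\<eta>\<close> periodic.\<close>
  have per: "\<phi> (t + 2 * pi) = \<phi> t" for t
  proof -
    have "\<Sigma> (t + l) = (\<Sum>k<m. \<phi> (t + Suc k * l))"
      unfolding \<Sigma>_def by (intro sum.cong refl arg_cong[of _ _ \<phi>]) (simp add: algebra_simps)
    then have "\<Sigma> (t + l) + \<phi> t = (\<Sum>k<Suc m. \<phi> (t + k * l))"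
      by (subst sum.lessThan_Suc_shift) simp
    also have "\<dots> = \<Sigma> t + \<phi> (t + 2 * pi)" by (simp add: \<Sigma>_def ml)
    finally show ?thesis using \<Sigma>c[of "t + l" t] by simp
  qed
  \<comment> \<open>The weights \<open>k\<close> are chosen so that shifting by \<open>l\<close>
    lowers each weight by 1. This subtracts the constant sum \<open>\<Sigma> 0\<close>, while the
    wrapped-around term leaves \<open>m * \<phi> t\<close>.\<close>
  define \<eta> where "\<eta> = (\<lambda>t. (\<Sum>k<m. of_nat k * \<phi> (t + k * l)) / of_nat m)"
  have \<eta>: "\<eta> (t + l) - \<eta> t = \<phi> t - \<Sigma> 0 / of_nat m" for t
  proof -
    have "(\<Sum>k<m. of_nat k * \<phi> ((t + l) + k * l)) = (\<Sum>k<m. of_nat k * \<phi> (t + Suc k * l))"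
      by (intro sum.cong refl arg_cong2[of _ _ _ _ "(*)"] arg_cong[of _ _ \<phi>]) (simp add: algebra_simps)
    also have "\<dots> = (\<Sum>k<m. (of_nat (Suc k) * \<phi> (t + Suc k * l) - \<phi> (t + Suc k * l)))"
      by (simp add: algebra_simps)
    also have "\<dots> = (\<Sum>k<m. of_nat (Suc k) * \<phi> (t + Suc k * l)) - (\<Sum>k<m. \<phi> (t + Suc k * l))"
      by (rule sum_subtractf)
    also have "(\<Sum>k<m. of_nat (Suc k) * \<phi> (t + Suc k * l)) = (\<Sum>k<Suc m. of_nat k * \<phi> (t + k * l))"
      by (subst sum.lessThan_Suc_shift) simp
    also have "\<dots> = (\<Sum>k<m. of_nat k * \<phi> (t + k * l)) + of_nat m * \<phi> t"
      by (simp add: ml per)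
    also have "(\<Sum>k<m. \<phi> (t + Suc k * l)) = \<Sigma> 0"
    proof -
      have "(\<Sum>k<m. \<phi> (t + Suc k * l)) = \<Sigma> (t + l)"
        unfolding \<Sigma>_def by (intro sum.cong refl arg_cong[of _ _ \<phi>]) (simp add: algebra_simps)
      then show ?thesis using \<Sigma>c[of "t + l" 0] by simp
    qed
    finally show ?thesis using m by (simp add: \<eta>_def field_simps)
  qed
  show ?thesis
  proof (rule that[of "\<lambda>t. exp (\<eta> t)" "exp (\<Sigma> 0 / of_nat m)"])
    show "continuous_on UNIV (\<lambda>t. exp (\<eta> t))"
      unfolding \<eta>_def using m by (intro continuous_intros continuous_on_shift(1)[OF \<phi>(1)]) auto
    show "exp (\<eta> (t + 2 * pi)) = exp (\<eta> t)" for t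
    proof -
      have "\<phi> (t + 2 * pi + k * l) = \<phi> (t + k * l)" for k :: nat
        using per[of "t + k * l"] by (simp add: algebra_simps)
      then show ?thesis by (simp add: \<eta>_def)
    qed
    show "exp (\<eta> t) * c t = exp (\<Sigma> 0 / of_nat m) * exp (\<eta> (t + 2 * pi / m))" for t
      using \<eta>[of t] by (simp add: \<phi>(2) l_def exp_add[symmetric] algebra_simps)
  qed auto
qed

text \<open>\<open>c s t\<close> is the multiplier of the rotation by \<open>s\<close> at angle
  \<open>t\<close>, normalized at angle 0; the factor \<open>c r s\<close> in \<open>coc\<close>
  comes from this normalization. After lifting to a logarithm \<open>\<beta>\<close>, integration
  over the rotation angle gives \<open>U\<close> with
  \<open>U t + U s = U (t + s) + \<beta> s t\<close>, and \<open>exp (- U)\<close>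
  trivializes.\<close>

lemma circle_cocycle_trivial:
  fixes c :: "real \<Rightarrow> real \<Rightarrow> complex"
  assumes c: "continuous_on UNIV (\<lambda>z. c (fst z) (snd z))" "\<And>s t. c s t \<noteq> 0"
    and per: "\<And>s t. c (s + 2 * pi) t = c s t" "\<And>s t. c s (t + 2 * pi) = c s t"
    and norm: "\<And>s. c s 0 = 1"
    and coc: "\<And>r s t. c (r + s) t * c r s = c r (t + s) * c s t"
  obtains u where "continuous_on UNIV u" "\<And>t. u t \<noteq> 0" "\<And>t. u (t + 2 * pi) = u t"
    "\<And>s. \<exists>\<kappa>. \<kappa> \<noteq> 0 \<and> (\<forall>t. u t * c s t = \<kappa> * u (t + s))"
proof -
  obtain b where b: "continuous_on UNIV b" "\<And>z. c (fst z) (snd z) = exp (b z)"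
    using continuous_log_lift[OF c(1) c(2)] by metis
  define \<beta> where "\<beta> s t = b (s, t) - b (0, 0)" for s t
  have c00: "c 0 t = 1" for t using coc[of 0 0 t] c(2)[of 0 t] norm by simp
  have eb: "exp (\<beta> s t) = c s t" for s t
    using b(2)[of "(s, t)"] b(2)[of "(0, 0)"] norm[of 0] by (simp add: \<beta>_def exp_diff)
  have c\<beta>: "continuous_on A (\<lambda>z. \<beta> (f z) (g z))" if "continuous_on A f" "continuous_on A g"
    for f g and A :: "'z::topological_space set"
    unfolding \<beta>_def using that by (intro continuous_intros continuous_on_compose2[OF b(1)]) auto
  \<comment> \<open>The same principle for one, two and three real variables. Each identity for
    \<open>c\<close> then holds for \<open>\<beta>\<close> up to a constant, which is read off at
    the origin.\<close>
  have C1: "f x = f y" if "continuous_on UNIV f" "\<And>x. exp (f x) = 1" for f :: "real \<Rightarrow> complex" and x y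
    by (rule continuous_exp_constant[OF connected_UNIV that(1)]) (simp add: that(2))
  have C2: "f x = f y" if "continuous_on UNIV f" "\<And>x. exp (f x) = 1" for f :: "real \<times> real \<Rightarrow> complex" and x y
    by (rule continuous_exp_constant[OF connected_UNIV that(1)]) (simp add: that(2))
  have C3: "f x = f y" if "continuous_on UNIV f" "\<And>x. exp (f x) = 1" for f :: "real \<times> real \<times> real \<Rightarrow> complex" and x y
    by (rule continuous_exp_constant[OF connected_UNIV that(1)]) (simp add: that(2))
  have z00: "\<beta> 0 0 = 0" by (simp add: \<beta>_def)
  have z0: "\<beta> s 0 = 0" for s
    using C1[of "\<lambda>s. \<beta> s 0" s 0] z00 by (simp add: c\<beta> eb norm)
  have p1: "\<beta> (s + 2 * pi) t = \<beta> s t" for s t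
  proof -
    have "\<beta> (s + 2 * pi) t - \<beta> s t = \<beta> (0 + 2 * pi) 0 - \<beta> 0 0"
      using C2[of "\<lambda>z. \<beta> (fst z + 2 * pi) (snd z) - \<beta> (fst z) (snd z)" "(s, t)" "(0, 0)"]
      by (simp add: exp_diff eb per c(2) continuous_on_diff c\<beta> continuous_intros)
    then show ?thesis using z0 by simp
  qed
  have co: "\<beta> (r + s) t + \<beta> r s = \<beta> r (t + s) + \<beta> s t" for r s t
  proof -
    let ?f = "\<lambda>z. \<beta> (fst z + fst (snd z)) (snd (snd z)) + \<beta> (fst z) (fst (snd z))
       - \<beta> (fst z) (snd (snd z) + fst (snd z)) - \<beta> (fst (snd z)) (snd (snd z))"
    have "?f (r, s, t) = ?f (0, 0, 0)"
    proof (rule C3)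
      show "continuous_on UNIV ?f" by (intro continuous_intros c\<beta>)
      show "exp (?f z) = 1" for z
        using coc[of "fst z" "fst (snd z)" "snd (snd z)"] c(2) by (simp add: exp_diff exp_add eb field_simps)
    qed
    then show ?thesis by (simp add: z00 algebra_simps)
  qed
  define U where "U t = integral {0..2 * pi} (\<lambda>s. \<beta> s t) / (2 * pi)" for t
  have ib: "(\<lambda>s. \<beta> (s + a) t) integrable_on {x..y}" for a t x y
    by (intro integrable_continuous_real c\<beta> continuous_intros)
  have ib2: "(\<lambda>s. \<beta> s t) integrable_on {x..y}" for t x y
    by (intro integrable_continuous_real c\<beta> continuous_intros)
  have cU: "continuous_on UNIV U"
  proof -
    have "continuous_on UNIV (\<lambda>t. integral (cbox 0 (2 * pi)) (\<lambda>s. \<beta> s t))"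
      by (rule integral_continuous_on_param) (auto simp: case_prod_unfold intro!: c\<beta> continuous_intros)
    then show ?thesis unfolding U_def by (auto intro!: continuous_intros)
  qed
  \<comment> \<open>The integral of a periodic function over a period does not depend on the
    starting point: first for shifts within one period, then after reduction modulo
    \<open>2 * pi\<close>.\<close>
  have shift: "integral {0..2 * pi} (\<lambda>s. \<beta> (s + a) t) = integral {0..2 * pi} (\<lambda>s. \<beta> s t)" for a t
  proof -
    have sh: "integral {x..y} (\<lambda>s. \<beta> (s + a) t) = integral {x + a..y + a} (\<lambda>s. \<beta> s t)" for a x y
      using integral_shift_Icc_real[of x y "\<lambda>s. \<beta> s t" a] by (simp add: o_def add.commute)
    have base: "integral {0..2 * pi} (\<lambda>s. \<beta> (s + a) t) = integral {0..2 * pi} (\<lambda>s. \<beta> s t)" if "0 \<le> a" "a \<le> 2 * pi" for a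
    proof -
      have "integral {0..2 * pi} (\<lambda>s. \<beta> (s + a) t) = integral {a..2 * pi + a} (\<lambda>s. \<beta> s t)"
        using sh[of 0 "2 * pi" a] by simp
      also have "\<dots> = integral {a..2 * pi} (\<lambda>s. \<beta> s t) + integral {2 * pi..2 * pi + a} (\<lambda>s. \<beta> s t)"
        by (rule Henstock_Kurzweil_Integration.integral_combine[symmetric]) (use that ib2 in auto)
      also have "integral {2 * pi..2 * pi + a} (\<lambda>s. \<beta> s t) = integral {0..a} (\<lambda>s. \<beta> s t)"
        using sh[of 0 a "2 * pi"] by (simp add: p1 add.commute)
      also have "integral {a..2 * pi} (\<lambda>s. \<beta> s t) + integral {0..a} (\<lambda>s. \<beta> s t) = integral {0..2 * pi} (\<lambda>s. \<beta> s t)"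
        by (subst add.commute, rule Henstock_Kurzweil_Integration.integral_combine) (use that ib2 in auto)
      finally show ?thesis .
    qed
    define k where "k = \<lfloor>a / (2 * pi)\<rfloor>"
    have k: "0 \<le> a - 2 * pi * k" "a - 2 * pi * k \<le> 2 * pi"
    proof -
      have "real_of_int k \<le> a / (2 * pi)" "a / (2 * pi) < real_of_int k + 1" by (simp_all add: k_def)
      then show "0 \<le> a - 2 * pi * k" "a - 2 * pi * k \<le> 2 * pi"
        by (simp_all add: pos_le_divide_eq pos_divide_less_eq algebra_simps)
    qed
    have "\<beta> (s + a) t = \<beta> (s + (a - 2 * pi * k)) t" for s
      using periodic_int[of "\<lambda>s. \<beta> s t" "2 * pi" "s + (a - 2 * pi * k)" k] p1 by simp
    then show ?thesis using base[OF k] by simp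
  qed
  \<comment> \<open>The identity \<open>co\<close> integrated over \<open>r\<close>; by
    \<open>shift\<close> the rotated integrand contributes the same mean as the unrotated
    one.\<close>
  have U: "U t = U (t + s) + \<beta> s t - U s" for s t
  proof -
    have "integral {0..2 * pi} (\<lambda>r. \<beta> (r + s) t) + integral {0..2 * pi} (\<lambda>r. \<beta> r s)
        = integral {0..2 * pi} (\<lambda>r. \<beta> r (t + s)) + integral {0..2 * pi} (\<lambda>r. \<beta> s t)"
      by (subst (1 2) Henstock_Kurzweil_Integration.integral_add[symmetric])
        (auto simp: co ib ib2 intro!: integrable_const_ivl)
    then have "integral {0..2 * pi} (\<lambda>r. \<beta> r t) + integral {0..2 * pi} (\<lambda>r. \<beta> r s)
        = integral {0..2 * pi} (\<lambda>r. \<beta> r (t + s)) + 2 * pi * \<beta> s t"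
      by (simp add: shift scaleR_conv_of_real)
    then have "U t + U s = U (t + s) + \<beta> s t"
      unfolding U_def add_divide_distrib[symmetric] by (simp add: add_divide_distrib)
    then show ?thesis by (simp add: algebra_simps)
  qed
  show ?thesis
  proof (rule that[of "\<lambda>t. exp (- U t)"])
    show "continuous_on UNIV (\<lambda>t. exp (- U t))" by (intro continuous_intros cU)
    show "exp (- U (t + 2 * pi)) = exp (- U t)" for t
    proof -
      have "\<beta> s (t + 2 * pi) = \<beta> s t" for s
      proof -
        have "\<beta> s (t + 2 * pi) - \<beta> s t = \<beta> 0 (t + 2 * pi) - \<beta> 0 t"
          using C1[of "\<lambda>s. \<beta> s (t + 2 * pi) - \<beta> s t" s 0]
          by (simp add: exp_diff eb per c(2) continuous_on_diff c\<beta>)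
        moreover have "\<beta> 0 t = 0" for t using C1[of "\<beta> 0" t 0] z00 by (simp add: c\<beta> eb c00)
        ultimately show ?thesis by simp
      qed
      then show ?thesis by (simp add: U_def)
    qed
    show "\<exists>\<kappa>. \<kappa> \<noteq> 0 \<and> (\<forall>t. exp (- U t) * c s t = \<kappa> * exp (- U (t + s)))" for s
    proof (intro exI[of _ "exp (U s)"] conjI allI)
      show "exp (- U t) * c s t = exp (U s) * exp (- U (t + s))" for t
      proof -
        have "- U t + \<beta> s t = U s + - U (t + s)" using U[of t s] by simp
        then show ?thesis by (simp only: eb[symmetric] exp_add[symmetric])
      qed
    qed simp
  qed auto
qed

text \<open>The square root of \<open>C\<close> taken along a lift of \<open>C\<close> to the logarithm: the hypothesis \<open>C pi = C 0\<close>
  says that the winding number of \<open>C\<close> is even, so that the square root is \<open>2 pi\<close>-periodic.\<close>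

lemma reflection_cocycle_trivial:
  fixes C :: "real \<Rightarrow> complex"
  assumes C: "continuous_on UNIV C" "\<And>t. C t \<noteq> 0" "\<And>t. C (t + 2 * pi) = C t"
    and refl: "\<And>s t. C s * C (- s) = C t * C (- t)"
    and rotl: "\<And>s t. C (s + l) * C t = C (t + l) * C s"
    and pi: "C pi = C 0"
  obtains v where "continuous_on UNIV v" "\<And>t. v t \<noteq> 0" "\<And>t. v (t + 2 * pi) = v t"
    "\<exists>\<kappa>. \<kappa> \<noteq> 0 \<and> (\<forall>t. v t * C t = \<kappa> * v (- t))" "\<exists>\<kappa>. \<kappa> \<noteq> 0 \<and> (\<forall>t. v t = \<kappa> * v (t + l))"
proof -
  obtain \<psi> where \<psi>: "continuous_on UNIV \<psi>" "\<And>t. C t = exp (\<psi> t)" using continuous_log_lift[OF C(1,2)] by blast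
  note shift = continuous_on_shift[OF \<psi>(1)]
  have odd: "\<psi> t + \<psi> (- t) = 2 * \<psi> 0" for t
    using continuous_exp_constant[OF connected_UNIV, of "\<lambda>t. \<psi> t + \<psi> (- t)" t 0] refl
    by (simp add: exp_add \<psi>(2)[symmetric] continuous_on_add \<psi>(1) shift)
  have rl: "\<psi> (t + l) - \<psi> t = \<psi> (0 + l) - \<psi> 0" for t
    using rotl C(2)
    by (intro continuous_exp_constant[OF connected_UNIV, of "\<lambda>t. \<psi> (t + l) - \<psi> t" t 0])
      (auto simp: exp_diff \<psi>(2)[symmetric] field_simps intro!: continuous_on_diff \<psi>(1) shift)
  \<comment> \<open>The increment over a full turn is constant, and it is evaluated on the turn from
    \<open>- pi\<close> to \<open>pi\<close>, where \<open>odd\<close> expresses it through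
    \<open>\<psi> pi - \<psi> 0\<close>.\<close>
  have r2: "\<psi> (t + 2 * pi) - \<psi> t = \<psi> (- pi + 2 * pi) - \<psi> (- pi)" for t
    by (intro continuous_exp_constant[OF connected_UNIV, of "\<lambda>t. \<psi> (t + 2 * pi) - \<psi> t" t])
      (auto simp: exp_diff \<psi>(2)[symmetric] C intro!: continuous_on_diff \<psi>(1) shift)
  have "exp ((\<psi> (t + 2 * pi) - \<psi> t) / 2) = 1" for t
  proof -
    have "(\<psi> (t + 2 * pi) - \<psi> t) / 2 = \<psi> pi - \<psi> 0"
    proof -
      have "\<psi> (- pi) = 2 * \<psi> 0 - \<psi> pi" using odd[of pi] by (simp add: algebra_simps)
      then have "\<psi> (t + 2 * pi) - \<psi> t = 2 * (\<psi> pi - \<psi> 0)" using r2[of t] by simp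
      then show ?thesis by simp
    qed
    then show ?thesis using pi C(2) by (simp only: exp_diff \<psi>(2)[symmetric]) simp
  qed
  then have ev: "exp (\<psi> (t + 2 * pi) / 2) = exp (\<psi> t / 2)" for t
    by (simp add: diff_divide_distrib exp_diff)
  show ?thesis
  \<comment> \<open>This is \<open>1 / sqrt C\<close>: multiplication by \<open>C\<close> turns it
    into \<open>sqrt C\<close>, which by \<open>odd\<close> is a constant times its own
    reflection.\<close>
  proof (rule that[of "\<lambda>t. exp (- (\<psi> t / 2))"])
    show "continuous_on UNIV (\<lambda>t. exp (- (\<psi> t / 2)))" by (intro continuous_intros \<psi>(1)) simp
    show "exp (- (\<psi> (t + 2 * pi) / 2)) = exp (- (\<psi> t / 2))" for t
      using ev by (simp add: exp_minus)
    show "\<exists>\<kappa>. \<kappa> \<noteq> 0 \<and> (\<forall>t. exp (- (\<psi> t / 2)) * C t = \<kappa> * exp (- (\<psi> (- t) / 2)))"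
    proof (intro exI[of _ "exp (\<psi> 0)"] conjI allI)
      show "exp (- (\<psi> t / 2)) * C t = exp (\<psi> 0) * exp (- (\<psi> (- t) / 2))" for t
      proof -
        have "- (\<psi> t / 2) + \<psi> t = \<psi> 0 + - (\<psi> (- t) / 2)" using odd[of t] by (simp add: field_simps)
        then show ?thesis by (simp only: \<psi>(2) exp_add[symmetric])
      qed
    qed simp
    show "\<exists>\<kappa>. \<kappa> \<noteq> 0 \<and> (\<forall>t. exp (- (\<psi> t / 2)) = \<kappa> * exp (- (\<psi> (t + l) / 2)))"
    proof (intro exI[of _ "exp ((\<psi> (0 + l) - \<psi> 0) / 2)"] conjI allI)
      show "exp (- (\<psi> t / 2)) = exp ((\<psi> (0 + l) - \<psi> 0) / 2) * exp (- (\<psi> (t + l) / 2))" for t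
        using rl[of t] by (simp add: exp_add[symmetric] diff_divide_distrib[symmetric] field_simps)
    qed simp
  qed auto
qed

section \<open>Equivariant frames of irreducible bundles\<close>

lemma lin_cong: "(\<And>v. v \<in> Cn m \<Longrightarrow> f v = g v) \<Longrightarrow> lin m n f \<Longrightarrow> lin m n g"
  by (simp add: lin_def Cn_add Cn_scale)

lemma tr_cong: "(\<And>v. v \<in> Cn n \<Longrightarrow> f v = g v) \<Longrightarrow> tr n f = tr n g"
  by (simp add: tr_def)

lemma rep_conjugate:
  assumes R: "rep K n R" and T: "lin n n T" "bij_betw T (Cn n) (Cn n)"
    and D: "\<And>h v. h \<in> carrier K \<Longrightarrow> v \<in> Cn n \<Longrightarrow> D h (T v) = T (R h v)" and K: "monoid K"
  shows "rep K n D" and "\<And>h. h \<in> carrier K \<Longrightarrow> tr n (D h) = tr n (R h)"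
proof -
  let ?I = "inv_into (Cn n) T"
  have I: "?I v \<in> Cn n" "T (?I v) = v" "?I (T v) = v" if "v \<in> Cn n" for v
    using T(2) that by (auto simp: bij_betw_def inv_into_into f_inv_into_f)
  have linI: "lin n n ?I" by (rule lin_inv_into[OF T])
  have linR: "lin n n (R h)" if "h \<in> carrier K" for h using R that by (auto simp: rep_def)
  have De: "D h v = T (R h (?I v))" if "h \<in> carrier K" "v \<in> Cn n" for h v
    using D[OF that(1) I(1)[OF that(2)]] I(2)[OF that(2)] by simp
  show "rep K n D"
    unfolding rep_def
  proof (intro conjI ballI)
    show "lin n n (D h)" if h: "h \<in> carrier K" for h
      by (rule lin_cong[OF _ lin_comp[OF lin_comp[OF linI linR[OF h]] T(1)]]) (simp add: De h)
    show "D \<one>\<^bsub>K\<^esub> v = v" if v: "v \<in> Cn n" for v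
      using De[OF monoid.one_closed[OF K] v] R I[OF v] by (simp add: rep_def)
    show "D (g \<otimes>\<^bsub>K\<^esub> h) v = D g (D h v)" if g: "g \<in> carrier K" and h: "h \<in> carrier K" and v: "v \<in> Cn n" for g h v
    proof -
      have RC: "R h (?I v) \<in> Cn n" using lin_Cn[OF linR[OF h] I(1)[OF v]] .
      have "D (g \<otimes>\<^bsub>K\<^esub> h) v = T (R g (R h (?I v)))"
        using De[OF monoid.m_closed[OF K g h] v] R g h I(1)[OF v] by (simp add: rep_def)
      then show ?thesis using De[OF h v] De[OF g lin_Cn[OF T(1) RC]] I(3)[OF RC] by simp
    qed
  qed
  fix h assume h: "h \<in> carrier K"
  have "tr n (D h) = tr n (\<lambda>v. T ((\<lambda>v. R h (?I v)) v))" by (rule tr_cong) (simp add: De h)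
  also have "\<dots> = tr n (\<lambda>v. R h (?I (T v)))"
    by (rule tr_comp_commute[OF T(1) lin_comp[OF linI linR[OF h]]])
  also have "\<dots> = tr n (R h)" by (rule tr_cong) (simp add: I)
  finally show "tr n (D h) = tr n (R h)" .
qed

lemma K_module_rep:
  assumes "K_module K T n R" "topspace T = carrier K"
  shows "rep K n R"
proof -
  have c: "continuous_map (prod_topology T (Cspace n)) (Cspace n) (\<lambda>(g, x). R g x)"
    using assms by (auto simp: K_module_def K_space_def)
  have "R g v \<in> Cn n" if "g \<in> carrier K" "v \<in> Cn n" for g v
  proof -
    have "(\<lambda>(g, x). R g x) (g, v) \<in> topspace (Cspace n)"
      by (rule funcset_mem[OF continuous_map_funspace[OF c]]) (use that assms(2) in auto)
    then show ?thesis by simp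
  qed
  then show ?thesis using assms(1) by (auto simp: rep_def lin_def K_module_def K_space_def)
qed

lemma rep_tr_one: "rep K n R \<Longrightarrow> tr n (R \<one>\<^bsub>K\<^esub>) = of_nat n"
  by (simp add: tr_def rep_def) (simp add: ev_def)

lemma fiber_coord_fframe:
  assumes E: "vector_bundle X E" and x: "x \<in> topspace X" and \<psi>: "fiber_coord E x n \<psi>"
    and act: "\<And>h e. h \<in> S \<Longrightarrow> e \<in> fiber E x \<Longrightarrow> act E h e \<in> fiber E x \<and> \<psi> (act E h e) = R h (\<psi> e)"
  shows "fframe E x n S R (inv_into (fiber E x) \<psi>)"
proof -
  let ?g = "inv_into (fiber E x) \<psi>"
  have b: "bij_betw \<psi> (fiber E x) (Cn n)" using \<psi> by (simp add: fiber_coord_def)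
  have g: "?g v \<in> fiber E x" "\<psi> (?g v) = v" if "v \<in> Cn n" for v
    using b that by (auto simp: bij_betw_def inv_into_into f_inv_into_f)
  have inj: "?g (\<psi> e) = e" if "e \<in> fiber E x" for e using b that by (auto simp: bij_betw_def)
  have cl: "fadd E e e' \<in> fiber E x" "fscale E c e \<in> fiber E x" if "e \<in> fiber E x" "e' \<in> fiber E x" for e e' c
    using E[unfolded vector_bundle_def, THEN conjunct2, THEN conjunct1, THEN bspec, OF x, THEN bspec, OF that(1)]
      that(2) by simp_all
  have lin: "\<psi> (fadd E e e') = (\<lambda>i. \<psi> e i + \<psi> e' i)" "\<psi> (fscale E c e) = (\<lambda>i. c * \<psi> e i)"
    if "e \<in> fiber E x" "e' \<in> fiber E x" for e e' c
    using \<psi> that by (auto simp: fiber_coord_def)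
  show ?thesis
    unfolding fframe_def
  proof (intro conjI ballI allI)
    show "bij_betw ?g (Cn n) (fiber E x)" by (rule bij_betw_inv_into[OF b])
    fix v assume v: "v \<in> Cn n"
    show "?g (\<lambda>i. v i + w i) = fadd E (?g v) (?g w)" if w: "w \<in> Cn n" for w
      using inj[OF cl(1)[OF g(1)[OF v] g(1)[OF w]]] lin(1)[OF g(1)[OF v] g(1)[OF w]] g(2)[OF v] g(2)[OF w] by simp
    show "?g (\<lambda>i. c * v i) = fscale E c (?g v)" for c
      using inj[OF cl(2)[OF g(1)[OF v] g(1)[OF v]]] lin(2)[OF g(1)[OF v] g(1)[OF v]] g(2)[OF v] by metis
    show "act E h (?g v) = ?g (R h v)" if h: "h \<in> S" for h
      using act[OF h g(1)[OF v]] inj[of "act E h (?g v)"] g(2)[OF v] by simp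
  qed
qed

lemma K_bundle_act_fiber:
  assumes "K_bundle K T X a E" "topspace T = carrier K" "g \<in> carrier K" "e \<in> fiber E x"
  shows "act E g e \<in> fiber E (a g x)"
proof -
  have c: "continuous_map (prod_topology T (total E)) (total E) (\<lambda>(g, x). act E g x)"
    using assms(1) by (auto simp: K_bundle_def K_space_def)
  have "(\<lambda>(g, x). act E g x) (g, e) \<in> topspace (total E)"
    by (rule funcset_mem[OF continuous_map_funspace[OF c]]) (use assms in \<open>auto simp: fiber_def\<close>)
  then show ?thesis using assms by (auto simp: K_bundle_def fiber_def)
qed

lemma K_bundle_act_cont:
  assumes "K_bundle K T X a E" "topspace T = carrier K" "g \<in> carrier K"
  shows "continuous_map (total E) (total E) (act E g)"
proof -
  have c: "continuous_map (prod_topology T (total E)) (total E) (\<lambda>(g, x). act E g x)"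
    using assms(1) by (auto simp: K_bundle_def K_space_def)
  have "continuous_map (total E) (prod_topology T (total E)) (\<lambda>e. (g, e))"
    by (intro continuous_map_pairedI) (use assms in auto)
  from continuous_map_compose[OF this c] show ?thesis by (simp add: o_def)
qed

lemma K_bundle_act_lin:
  assumes "K_bundle K T X a E" "g \<in> carrier K" "x \<in> topspace X" "e \<in> fiber E x"
  shows "\<And>e'. e' \<in> fiber E x \<Longrightarrow> act E g (fadd E e e') = fadd E (act E g e) (act E g e')"
    and "act E g (fscale E c e) = fscale E c (act E g e)"
  using assms by (auto simp: K_bundle_def)

text \<open>Near a point \<open>x0\<close>, elements of the group algebra which act on the model \<open>R0\<close> as the matrix units
  of the first column turn one suitable vector \<open>v0\<close> of the fibers into an equivariant frame.\<close>

lemma K_bundle_local_frame: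
  fixes L :: "('k, 'x, 'l) vbundle" and K :: "('k, 'r) monoid_scheme" and H :: "'k set"
  defines "K' \<equiv> K\<lparr>carrier := H\<rparr>"
  assumes L: "K_bundle K T X a L" and T: "topspace T = carrier K" and H: "H \<subseteq> carrier K"
    and K': "monoid K'"
    and triv: "\<And>h x. h \<in> H \<Longrightarrow> x \<in> topspace X \<Longrightarrow> a h x = x"
    and R0: "rep K' n R0" "irred n (R0 ` H)"
    and fib: "\<And>x. x \<in> topspace X \<Longrightarrow> \<exists>m R. rep K' m R \<and> (\<forall>h\<in>H. tr m (R h) = tr n (R0 h)) \<and> fiber_module_iso K' L x m R"
    and x0: "x0 \<in> topspace X"
  shows "\<exists>U \<Phi>. openin X U \<and> x0 \<in> U \<and> frame (subtopology X U) (\<lambda>x. x) L n H R0 \<Phi>"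
proof -
  have car: "carrier K' = H" by (simp add: K'_def)
  have VB: "vector_bundle X L" using L by (simp add: K_bundle_def)
  have n: "0 < n" by (rule irred_pos[OF R0(2)])
  have actf: "act L h e \<in> fiber L x" if "h \<in> H" "x \<in> topspace X" "e \<in> fiber L x" for h e x
    using K_bundle_act_fiber[OF L T, of h e x] that H triv by auto
  obtain U m \<zeta> \<kappa> where U: "openin X U" "x0 \<in> U"
    and \<zeta>: "frame (subtopology X U) (\<lambda>x. x) L m {} R0 \<zeta>"
    and c\<kappa>: "continuous_map (subtopology (total L) {e \<in> topspace (total L). proj L e \<in> U}) (Cspace m) \<kappa>"
    and \<kappa>\<zeta>: "\<And>e. e \<in> topspace (total L) \<Longrightarrow> proj L e \<in> U \<Longrightarrow> \<kappa> e \<in> Cn m \<and> \<zeta> (proj L e) (\<kappa> e) = e"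
    and \<zeta>\<kappa>: "\<And>y w. y \<in> U \<Longrightarrow> w \<in> Cn m \<Longrightarrow> \<kappa> (\<zeta> y w) = w"
    by (rule vector_bundle_local[OF VB x0]) blast
  have UX: "U \<subseteq> topspace X" using U(1) openin_subset by blast
  have \<zeta>f: "fframe L y m {} R0 (\<zeta> y)" if "y \<in> U" for y using frame_fframe[OF \<zeta>, of y] that UX by auto
  have \<kappa>f: "\<kappa> e \<in> Cn m" "\<zeta> y (\<kappa> e) = e" if "e \<in> fiber L y" "y \<in> U" for e y
    using \<kappa>\<zeta>[of e] that by (auto simp: fiber_def)
  \<comment> \<open>The matrix of \<open>h\<close> on the fiber at \<open>y\<close> in chart
    coordinates. It is continuous in \<open>y\<close>, unlike the isomorphisms with a model
    module.\<close>
  define D where "D = (\<lambda>y h v. \<kappa> (act L h (\<zeta> y v)))"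
  have DC: "D y h v \<in> Cn m" "\<zeta> y (D y h v) = act L h (\<zeta> y v)" if "y \<in> U" "h \<in> H" "v \<in> Cn m" for y h v
    using \<kappa>f[OF actf[OF that(2) _ fframe_fiber[OF \<zeta>f[OF that(1)] that(3)]] that(1)] that UX
    by (auto simp: D_def)
  \<comment> \<open>The fiber isomorphism is used only at the single point \<open>y\<close>: traces
    at the neutral element give \<open>m = n\<close>, and conjugation gives \<open>D y\<close> the
    character of \<open>R0\<close>.\<close>
  have mn: "m = n \<and> rep K' n (D y) \<and> (\<forall>h\<in>H. tr n (D y h) = tr n (R0 h))" if y: "y \<in> U" for y
  proof -
    have yX: "y \<in> topspace X" using y UX by blast
    obtain k R \<psi> where R: "rep K' k R" "\<And>h. h \<in> H \<Longrightarrow> tr k (R h) = tr n (R0 h)"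
      and \<psi>: "fiber_coord L y k \<psi>" "\<And>h e. h \<in> H \<Longrightarrow> e \<in> fiber L y \<Longrightarrow> \<psi> (act L h e) = R h (\<psi> e)"
      using fib[OF yX] unfolding fiber_module_iso_def car by blast
    have "\<one>\<^bsub>K'\<^esub> \<in> H" using monoid.one_closed[OF K'] car by simp
    then have "(of_nat k :: complex) = of_nat n"
      using R rep_tr_one[OF R(1)] rep_tr_one[OF R0(1)] by metis
    then have kn: "k = n" by simp
    let ?g = "inv_into (fiber L y) \<psi>"
    have g: "fframe L y n H R ?g"
      using fiber_coord_fframe[OF VB yX \<psi>(1), of H R] \<psi>(2) actf[OF _ yX] kn by blast
    let ?T = "\<lambda>v. inv_into (Cn m) (\<zeta> y) (?g v)"
    note T = fframe_transition[OF g \<zeta>f[OF y]]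
    have mn: "m = n" using lin_bij_dim[OF T] by simp
    have TC: "?T v \<in> Cn m" "\<zeta> y (?T v) = ?g v" if "v \<in> Cn n" for v
      using fframe_inv[OF \<zeta>f[OF y] fframe_fiber[OF g that]] by auto
    have RC: "R h v \<in> Cn n" if "h \<in> H" "v \<in> Cn n" for h v
      using R(1) that kn car by (auto simp: rep_def intro: lin_Cn)
    have "D y h (?T v) = ?T (R h v)" if h: "h \<in> H" and v: "v \<in> Cn n" for h v
    proof -
      have "D y h (?T v) = \<kappa> (\<zeta> y (?T (R h v)))"
        using TC[OF v] TC(2)[OF RC[OF h v]] fframe_act[OF g v h] by (simp add: D_def)
      then show ?thesis using \<zeta>\<kappa>[OF y TC(1)[OF RC[OF h v]]] by simp
    qed
    then show ?thesis
      using rep_conjugate[of K' n R ?T "D y"] T R kn mn K' car by auto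
  qed
  have mn': "m = n" and Drep: "\<And>y. y \<in> U \<Longrightarrow> rep K' n (D y)"
    and Dtr: "\<And>y h. y \<in> U \<Longrightarrow> h \<in> H \<Longrightarrow> tr n (D y h) = tr n (R0 h)"
    using mn U(2) by auto
  note DC = DC[unfolded mn'] and \<zeta>f = \<zeta>f[unfolded mn'] and c\<kappa> = c\<kappa>[unfolded mn']
    and \<zeta> = \<zeta>[unfolded mn'] and \<zeta>\<kappa> = \<zeta>\<kappa>[unfolded mn']
  have ker: "(\<forall>v\<in>Cn n. opl (D y) z v = (\<lambda>_. 0)) \<longleftrightarrow> (\<forall>v\<in>Cn n. opl R0 z v = (\<lambda>_. 0))"
    if "y \<in> U" "z \<in> galg K'" for y z
    by (rule same_character_kernel[OF K' R0(1) _ Drep[OF that(1)] _ that(2)])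
      (use R0(2) Dtr[OF that(1)] car in auto)
  \<comment> \<open>\<open>z i\<close> acts on \<open>R0\<close> as the matrix unit that moves
    \<open>ev 0\<close> to \<open>ev i\<close>.\<close>
  have "\<exists>z. z \<in> galg K' \<and> (\<forall>j<n. opl R0 z (ev j) = (if j = 0 then ev i else (\<lambda>_. 0)))" if "i < n" for i
    using group_algebra_density[OF K' R0(1), of "\<lambda>j. if j = 0 then ev i else (\<lambda>_. 0)"] R0(2) that car
    by (metis (mono_tags, lifting) Cn_zero ev_Cn)
  then obtain z where z: "\<And>i. i < n \<Longrightarrow> z i \<in> galg K'"
    "\<And>i j. i < n \<Longrightarrow> j < n \<Longrightarrow> opl R0 (z i) (ev j) = (if j = 0 then ev i else (\<lambda>_. 0))"
    by metis
  have "opl R0 (z 0) (ev 0) 0 \<noteq> 0" using z(2)[OF n n] by (simp add: ev_def)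
  then have "\<not> (\<forall>v\<in>Cn n. opl R0 (z 0) v = (\<lambda>_. 0))" using ev_Cn[OF n] by fastforce
  \<comment> \<open>By equality of kernels \<open>z 0\<close> is not zero on the fiber at
    \<open>x0\<close>, so some vector survives it; \<open>l0\<close> is a coordinate that witnesses
    this and will define an open condition.\<close>
  then obtain v0 l0 where v0: "v0 \<in> Cn n" "opl (D x0) (z 0) v0 l0 \<noteq> 0"
    using ker[OF U(2) z(1)[OF n]] by (auto simp: fun_eq_iff)
  define comb where "comb w = concat (map (\<lambda>i. gscale (w i) (z i)) [0..<n])" for w :: "nat \<Rightarrow> complex"
  have comb_opl: "opl R' (comb w) v = (\<lambda>l. \<Sum>i<n. w i * opl R' (z i) v l)" for w v R'
  proof -
    have "opl R' (concat (map (\<lambda>i. gscale (w i) (z i)) [0..<N])) v = (\<lambda>l. \<Sum>i<N. w i * opl R' (z i) v l)" for N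
      by (induction N) (auto simp: opl_append opl_gscale)
    then show ?thesis by (simp add: comb_def)
  qed
  have comb_galg: "comb w \<in> galg K'" for w
    using z(1) galg_gscale by (fastforce simp: comb_def galg_def)
  \<comment> \<open>In the model, \<open>comb w\<close> sends \<open>ev 0\<close> to
    \<open>w\<close>. Applying the same element to \<open>v0\<close> transports the model vector
    \<open>w\<close> into the fiber.\<close>
  define A where "A = (\<lambda>y w. opl (D y) (comb w) v0)"
  have AC: "A y w \<in> Cn n" if "y \<in> U" for y w
    unfolding A_def by (rule lin_Cn[OF lin_opl[OF Drep[OF that] comb_galg] v0(1)])
  have Alin: "lin n n (A y)" if y: "y \<in> U" for y
    by (rule linI) (simp_all add: AC y, simp_all add: A_def comb_opl distrib_right sum.distrib sum_distrib_left mult.assoc)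
  have linR0: "lin n n (R0 h)" if "h \<in> H" for h using R0(1) that car by (auto simp: rep_def)
  have comb0: "opl R0 (comb w) (ev j) = (if j = 0 then w else (\<lambda>_. 0))" if "w \<in> Cn n" "j < n" for w j
    using Cn_expand[OF that(1)] z(2)[OF _ that(2)] by (auto simp: comb_opl)
  have Aeq: "A y (R0 h w) = D y h (A y w)" if y: "y \<in> U" and h: "h \<in> H" and w: "w \<in> Cn n" for y h w
  proof -
    \<comment> \<open>The group algebra element \<open>h (comb w) - comb (R0 h w)\<close>. It acts
      as zero on the model, hence on every fiber, and this is the equivariance of
      \<open>A y\<close>.\<close>
    define q where "q = gmul K' [(1, h)] (comb w) @ gscale (-1) (comb (R0 h w))"
    have hg: "[(1, h)] \<in> galg K'" using h car by simp
    have q: "q \<in> galg K'"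
      unfolding q_def galg_append by (intro conjI galg_gmul[OF K' hg comb_galg] galg_gscale[OF comb_galg])
    have single: "opl R' [(1, h)] v = R' h v" for R' v by (simp add: opl_def)
    have qo: "opl R' q v = (\<lambda>l. R' h (opl R' (comb w) v) l - opl R' (comb (R0 h w)) v l)"
      if "rep K' n R'" "v \<in> Cn n" for R' v
      using opl_gmul[OF that(1) hg comb_galg that(2)] by (simp add: q_def opl_append opl_gscale single)
    have "opl R0 q (ev j) = (\<lambda>_. 0)" if "j < n" for j
      using qo[OF R0(1) ev_Cn[OF that]] comb0[OF w that] comb0[OF lin_Cn[OF linR0[OF h] w] that]
        lin_zero[OF linR0[OF h]] by auto
    then have "\<forall>v\<in>Cn n. opl R0 q v = (\<lambda>_. 0)"
      by (intro ballI, subst lin_expand[OF lin_opl[OF R0(1) q]]) simp_all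
    then have "opl (D y) q v0 = (\<lambda>_. 0)" using ker[OF y q] v0(1) by blast
    then show ?thesis using qo[OF Drep[OF y] v0(1)] by (simp add: A_def fun_eq_iff)
  qed
  \<comment> \<open>The kernel of \<open>A y\<close> is invariant under \<open>R0\<close>; by
    irreducibility it is zero as soon as \<open>A y\<close> is not.\<close>
  have Ainj: "inj_on (A y) (Cn n)" if y: "y \<in> U" and nz: "A y (ev 0) \<noteq> (\<lambda>_. 0)" for y
    unfolding lin_inj_iff[OF Alin[OF y]]
  proof (intro ballI impI, rule ccontr)
    fix w assume w: "w \<in> Cn n" "A y w = (\<lambda>_. 0)" "w \<noteq> (\<lambda>_. 0)"
    have linD: "lin n n (D y h)" if "h \<in> H" for h using Drep[OF y] that car by (auto simp: rep_def)
    have "{w \<in> Cn n. A y w = (\<lambda>_. 0)} = Cn n"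
      by (rule irredD[OF R0(2), where x = w])
        (use w in \<open>auto simp: Cn_add Cn_scale lin_add[OF Alin[OF y]] lin_scale[OF Alin[OF y]] lin_zero[OF Alin[OF y]]
           lin_Cn[OF linR0] Aeq[OF y] lin_zero[OF linD]\<close>)
    then show False using nz ev_Cn[OF n] by blast
  qed
  have cD: "continuous_map (subtopology X U) euclidean (\<lambda>y. D y h v0 l)" if h: "h \<in> H" for h l
  proof -
    have "continuous_map (subtopology X U) (total L) (\<lambda>y. \<zeta> y v0)"
      by (rule frame_cont_compose[OF \<zeta>]) (use v0 in auto)
    from continuous_map_compose[OF this K_bundle_act_cont[OF L T]]
    have "continuous_map (subtopology X U) (total L) (\<lambda>y. act L h (\<zeta> y v0))" using h H by (auto simp: o_def)
    moreover have "proj L (act L h (\<zeta> y v0)) = y" if "y \<in> U" for y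
      using actf[OF h _ fframe_fiber[OF \<zeta>f[OF that] v0(1)]] that UX by (auto simp: fiber_def)
    ultimately have "continuous_map (subtopology X U) (subtopology (total L) {e \<in> topspace (total L). proj L e \<in> U})
       (\<lambda>y. act L h (\<zeta> y v0))"
      unfolding continuous_map_in_subtopology using UX by (auto simp: continuous_map_def)
    from continuous_map_compose[OF this c\<kappa>] show ?thesis
      unfolding D_def continuous_map_Cspace by (simp add: o_def)
  qed
  have copl: "continuous_map (subtopology X U) euclidean (\<lambda>y. opl (D y) q v0 l)" if "q \<in> galg K'" for q l
    using that
  proof (induction q)
    case (Cons p q)
    obtain c h where "p = (c, h)" by force
    then show ?case using Cons car
      by (auto simp: opl_Cons intro!: continuous_map_plus continuous_map_mult cD)
  qed simp
  \<comment> \<open>Nonvanishing of one continuous coordinate of \<open>A y (ev 0)\<close> is an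
    open condition that ensures invertibility of \<open>A y\<close>.\<close>
  define V where "V = {y \<in> U. opl (D y) (z 0) v0 l0 \<noteq> 0}"
  have "openin (subtopology X U) V"
    using openin_continuous_map_preimage[OF copl[OF z(1)[OF n], of l0], of "- {0}"] UX
    by (simp add: V_def Int_absorb1 open_Compl)
  then have V: "openin X V" using openin_open_subtopology[OF U(1)] by blast
  have VU: "V \<subseteq> U" by (auto simp: V_def)
  have Abij: "bij_betw (A y) (Cn n) (Cn n)" if y: "y \<in> V" for y
  proof (rule lin_inj_bij[OF Alin Ainj])
    show "y \<in> U" using y VU by blast
    then show "y \<in> U" .
    have "A y (ev 0) = opl (D y) (z 0) v0"
      using n by (simp add: A_def comb_opl ev_def if_distrib[of "\<lambda>c. c * _"] cong: if_cong)
    then show "A y (ev 0) \<noteq> (\<lambda>_. 0)" using y by (auto simp: V_def fun_eq_iff)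
  qed
  have "frame (subtopology X V) (\<lambda>x. x) L n H R0 (\<lambda>y w. \<zeta> y (A y w))"
    unfolding frame_def
  proof (intro conjI ballI)
    let ?P = "prod_topology (subtopology X V) (Cspace n)"
    have fV: "continuous_map ?P (subtopology X U) fst"
      using continuous_map_fst[of "subtopology X V" "Cspace n"] VU
      by (auto simp: continuous_map_in_subtopology)
    have "continuous_map ?P (Cspace n) (\<lambda>p. A (fst p) (snd p))"
      unfolding continuous_map_Cspace
    proof (intro conjI ballI allI)
      show "A (fst p) (snd p) \<in> Cn n" if "p \<in> topspace ?P" for p using AC that VU by auto
      show "continuous_map ?P euclidean (\<lambda>p. A (fst p) (snd p) l)" for l
        unfolding A_def comb_opl
        by (intro continuous_map_sum' continuous_map_mult
            continuous_map_compose[OF fV copl[OF z(1)], unfolded o_def]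
            continuous_map_compose[OF continuous_map_snd continuous_map_Cspace_coord, unfolded o_def]) auto
    qed
    then show "continuous_map ?P (total L) (\<lambda>(y, w). \<zeta> y (A y w))"
      unfolding case_prod_unfold by (rule frame_cont_compose[OF \<zeta> fV])
    fix y assume "y \<in> topspace (subtopology X V)"
    then have yV: "y \<in> V" and y: "y \<in> U" using VU by auto
    show "fframe L y n H R0 (\<lambda>w. \<zeta> y (A y w))"
      unfolding fframe_def
    proof (intro conjI ballI allI)
      show "bij_betw (\<lambda>w. \<zeta> y (A y w)) (Cn n) (fiber L y)"
        using bij_betw_trans[OF Abij[OF yV] fframe_bij[OF \<zeta>f[OF y]]] by (simp add: o_def)
    qed (use y AC fframe_add[OF \<zeta>f[OF y]] fframe_scale[OF \<zeta>f[OF y]] lin_add[OF Alin[OF y]] lin_scale[OF Alin[OF y]]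
           Aeq[OF y] DC(2)[OF y] in auto)
  qed
  moreover have "x0 \<in> V" using U(2) v0(2) by (simp add: V_def)
  ultimately show ?thesis using V by blast
qed

text \<open>A frame along the loop with matching ends descends to the circle because wrapping an
  interval, times \<open>Cspace n\<close>, is a quotient map.\<close>

lemma circle_frame:
  assumes S: "schurian n S R"
    and loc: "\<And>x. x \<in> sphere 0 1 \<Longrightarrow> \<exists>U \<Phi>. openin unit_circle U \<and> x \<in> U \<and> frame (subtopology unit_circle U) (\<lambda>x. x) E n S R \<Phi>"
  obtains \<Phi> where "frame unit_circle (\<lambda>x. x) E n S R \<Phi>"
proof -
  have \<gamma>: "continuous_map (top_of_set {0..1}) unit_circle (\<lambda>t. circ (2 * pi * t))"
    by (rule continuous_map_circ) (auto intro!: continuous_intros)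
  have "circ (2 * pi * 0) = circ (2 * pi * 1)" using circ_periodic[of 0] by simp
  then obtain \<Phi> where \<Phi>: "frame (top_of_set {0..1}) (\<lambda>t. circ (2 * pi * t)) E n S R \<Phi>"
    "\<And>w. w \<in> Cn n \<Longrightarrow> \<Phi> 0 w = \<Phi> 1 w"
    using frame_on_loop[OF S _ \<gamma>] loc by (metis topspace_unit_circle)
  obtain h where h: "continuous_map (prod_topology unit_circle (Cspace n)) (total E) (\<lambda>(x, w). h x w)"
    "\<And>t w. t \<in> {0..1} \<Longrightarrow> w \<in> Cn n \<Longrightarrow> h (circ (2 * pi * t)) w = \<Phi> t w"
    using circle_descend[OF frame_cont[OF \<Phi>(1)]] \<Phi>(2) by auto
  have "fframe E x n S R (h x)" if x: "x \<in> sphere 0 1" for x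
  proof -
    obtain s where s: "0 \<le> s" "s < 2 * pi" "x = circ s" using circ_surj[OF x] by blast
    define t where "t = s / (2 * pi)"
    have t: "t \<in> {0..1}" "x = circ (2 * pi * t)" using s by (auto simp: t_def)
    have f: "fframe E x n S R (\<Phi> t)" using frame_fframe[OF \<Phi>(1)] t by auto
    have RC: "R g v \<in> Cn n" if "g \<in> S" "v \<in> Cn n" for g v
      using S that by (auto simp: schurian_def intro: lin_Cn)
    have eq: "h x w = \<Phi> t w" if "w \<in> Cn n" for w using h(2)[OF t(1) that] t(2) by simp
    show ?thesis
      using f unfolding fframe_def by (simp add: eq Cn_add Cn_scale RC cong: bij_betw_cong)
  qed
  then have "frame unit_circle (\<lambda>x. x) E n S R h" using h(1) by (simp add: frame_def)
  then show ?thesis by (rule that)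
qed

lemma fframe_inv_add:
  assumes f: "fframe E x k S R f" and e: "e \<in> fiber E x" "e' \<in> fiber E x"
  shows "inv_into (Cn k) f (fadd E e e') = (\<lambda>i. inv_into (Cn k) f e i + inv_into (Cn k) f e' i)"
proof -
  note i = fframe_inv[OF f e(1)] fframe_inv[OF f e(2)]
  show ?thesis using fframe_add[OF f i(1,3)] fframe_inv_f[OF f Cn_add[OF i(1,3)]] i(2,4) by simp
qed

lemma fframe_inv_scale:
  assumes f: "fframe E x k S R f" and e: "e \<in> fiber E x"
  shows "inv_into (Cn k) f (fscale E c e) = (\<lambda>i. c * inv_into (Cn k) f e i)"
proof -
  note i = fframe_inv[OF f e]
  show ?thesis using fframe_scale[OF f i(1), of c] fframe_inv_f[OF f Cn_scale[OF i(1), of c]] i(2) by simp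
qed

text \<open>Only the universal property of \<open>\<tau>\<close> is available. Existence of
  functionals for the products of coordinates gives injectivity; uniqueness of the functional for
  the zero form gives surjectivity. Since \<open>H\<close> fixes the frame vector of the line
  bundle, it acts on the product through \<open>R0\<close>.\<close>

lemma tensor_frame:
  assumes M: "vector_bundle X M"
    and \<tau>c: "continuous_map (subtopology (prod_topology (total L) (total F)) {(e, f). proj L e = proj F f})
            (total M) (\<lambda>(e, f). \<tau> e f)"
    and \<tau>: "\<And>x e f. x \<in> topspace X \<Longrightarrow> e \<in> fiber L x \<Longrightarrow> f \<in> fiber F x \<Longrightarrow>
              \<tau> e f \<in> fiber M x \<and>
              (\<forall>e'\<in>fiber L x. \<tau> (fadd L e e') f = fadd M (\<tau> e f) (\<tau> e' f)) \<and>
              (\<forall>c. \<tau> (fscale L c e) f = fscale M c (\<tau> e f) \<and> \<tau> e (fscale F c f) = fscale M c (\<tau> e f))"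
    and univ: "\<And>x b. x \<in> topspace X \<Longrightarrow> fiber_bilinear_form L F x b \<Longrightarrow>
              \<exists>!l. l \<in> extensional (fiber M x) \<and> fiber_functional M x l \<and>
                    (\<forall>e\<in>fiber L x. \<forall>f\<in>fiber F x. l (\<tau> e f) = b e f)"
    and act: "\<And>x e f g. x \<in> topspace X \<Longrightarrow> e \<in> fiber L x \<Longrightarrow> f \<in> fiber F x \<Longrightarrow> g \<in> H \<Longrightarrow>
              \<tau> (act L g e) (act F g f) = act M g (\<tau> e f)"
    and \<Phi>: "frame X (\<lambda>x. x) L n H R0 \<Phi>" and \<Theta>: "frame X (\<lambda>x. x) F 1 {} R1 \<Theta>"
    and trivF: "\<And>x h. x \<in> topspace X \<Longrightarrow> h \<in> H \<Longrightarrow> act F h (\<Theta> x (ev 0)) = \<Theta> x (ev 0)"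
  shows "frame X (\<lambda>x. x) M n H R0 (\<lambda>x w. \<tau> (\<Phi> x w) (\<Theta> x (ev 0)))"
  unfolding frame_def
proof (intro conjI ballI)
  let ?P = "prod_topology X (Cspace n)"
  have ev1: "ev 0 \<in> Cn 1" by simp
  have c1: "continuous_map ?P (total L) (\<lambda>p. \<Phi> (fst p) (snd p))"
    by (intro frame_cont_compose[OF \<Phi>] continuous_map_fst continuous_map_snd)
  have c2: "continuous_map ?P (total F) (\<lambda>p. \<Theta> (fst p) (ev 0))"
    by (intro frame_cont_compose[OF \<Theta>] continuous_map_fst) simp
  have "continuous_map ?P (subtopology (prod_topology (total L) (total F)) {(e, f). proj L e = proj F f})
      (\<lambda>p. (\<Phi> (fst p) (snd p), \<Theta> (fst p) (ev 0)))"
    unfolding continuous_map_in_subtopology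
    using c1 c2 fframe_fiber[OF frame_fframe[OF \<Phi>]] fframe_fiber[OF frame_fframe[OF \<Theta>] ev1]
    by (auto simp: continuous_map_pairedI fiber_def)
  from continuous_map_compose[OF this \<tau>c]
  show "continuous_map ?P (total M) (\<lambda>(x, w). \<tau> (\<Phi> x w) (\<Theta> x (ev 0)))"
    by (simp add: o_def case_prod_unfold)
  fix x assume x: "x \<in> topspace X"
  note f\<Phi> = frame_fframe[OF \<Phi> x] and f\<Theta> = frame_fframe[OF \<Theta> x]
  let ?\<nu> = "\<Theta> x (ev 0)" let ?T = "\<lambda>w. \<tau> (\<Phi> x w) ?\<nu>"
  have \<nu>: "?\<nu> \<in> fiber F x" by (rule fframe_fiber[OF f\<Theta> ev1])
  have TM: "?T w \<in> fiber M x" if "w \<in> Cn n" for w using \<tau>[OF x fframe_fiber[OF f\<Phi> that] \<nu>] by blast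
  have Tadd: "?T (\<lambda>i. v i + w i) = fadd M (?T v) (?T w)" if v: "v \<in> Cn n" and w: "w \<in> Cn n" for v w
    using \<tau>[OF x fframe_fiber[OF f\<Phi> v] \<nu>] fframe_fiber[OF f\<Phi> w] fframe_add[OF f\<Phi> v w] by simp
  have Tscale: "?T (\<lambda>i. c * v i) = fscale M c (?T v)" if v: "v \<in> Cn n" for v c
    using \<tau>[OF x fframe_fiber[OF f\<Phi> v] \<nu>] fframe_scale[OF f\<Phi> v] by simp
  obtain U m \<zeta> where "x \<in> U" "openin X U" "frame (subtopology X U) (\<lambda>x. x) M m {} R0 \<zeta>"
    by (rule vector_bundle_local[OF M x]) blast
  then have \<zeta>: "fframe M x m {} R0 (\<zeta> x)"
    using frame_fframe[of "subtopology X U" "\<lambda>x. x" M m "{}" R0 \<zeta> x] x by simp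
  let ?cM = "inv_into (Cn m) (\<zeta> x)"
  let ?c\<Phi> = "inv_into (Cn n) (\<Phi> x)"
  let ?c\<Theta> = "inv_into (Cn 1) (\<Theta> x)"
  note cadd = fframe_inv_add and cscale = fframe_inv_scale
  have inj: "inj_on ?T (Cn n)"
  proof (rule inj_onI)
    fix v w assume v: "v \<in> Cn n" and w: "w \<in> Cn n" and eq: "?T v = ?T w"
    have "v i = w i" for i
    proof -
      \<comment> \<open>The induced functional reads off the \<open>i\<close>-th coordinate of
        \<open>w\<close> from \<open>\<tau> (\<Phi> x w)\<close> paired with the frame vector of
        \<open>F\<close>.\<close>
      define b where "b e f = ?c\<Phi> e i * ?c\<Theta> f 0" for e f
      have "fiber_bilinear_form L F x b"
        unfolding fiber_bilinear_form_def fiber_functional_def b_def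
        by (auto simp: cadd[OF f\<Phi>] cscale[OF f\<Phi>] cadd[OF f\<Theta>, unfolded One_nat_def]
            cscale[OF f\<Theta>, unfolded One_nat_def] algebra_simps)
      then obtain l where "\<forall>e\<in>fiber L x. \<forall>f\<in>fiber F x. l (\<tau> e f) = b e f"
        using univ[OF x] by blast
      then have "l (?T u) = u i" if "u \<in> Cn n" for u
        using that fframe_fiber[OF f\<Phi> that] \<nu> fframe_inv_f[OF f\<Phi> that] fframe_inv_f[OF f\<Theta> ev1]
        by (simp add: b_def) (simp add: ev_def)
      then show ?thesis using v w eq by metis
    qed
    then show "v = w" by auto
  qed
  have surj: "?T ` Cn n = fiber M x"
  proof (rule ccontr)
    assume "?T ` Cn n \<noteq> fiber M x"
    then obtain e where e: "e \<in> fiber M x" "e \<notin> ?T ` Cn n" using TM by blast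
    let ?W = "(\<lambda>w. ?cM (?T w)) ` Cn n"
    have cT: "?cM (?T w) \<in> Cn m" "\<zeta> x (?cM (?T w)) = ?T w" if "w \<in> Cn n" for w
      using fframe_inv[OF \<zeta> TM[OF that]] by auto
    have "?cM e \<notin> ?W"
    proof
      assume "?cM e \<in> ?W"
      then obtain w where w: "w \<in> Cn n" "?cM e = ?cM (?T w)" by blast
      then have "e = ?T w" using cT(2)[OF w(1)] fframe_inv(2)[OF \<zeta> e(1)] by metis
      then show False using e(2) w(1) by blast
    qed
    moreover have "(\<lambda>_. 0) \<in> ?W"
    proof -
      have "?cM (?T (\<lambda>i. 0 * (\<lambda>_. 0) i)) = (\<lambda>i. 0 * ?cM (?T (\<lambda>_. 0)) i)"
        by (simp only: Tscale[OF Cn_zero] cscale[OF \<zeta> TM[OF Cn_zero]])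
      then show ?thesis by (intro image_eqI[of _ _ "\<lambda>_. 0"]) simp_all
    qed
    moreover have "(\<lambda>i. p i + q i) \<in> ?W" if pq: "p \<in> ?W" "q \<in> ?W" for p q
    proof -
      obtain v w where vw: "v \<in> Cn n" "w \<in> Cn n" "p = ?cM (?T v)" "q = ?cM (?T w)" using pq by blast
      then have "(\<lambda>i. p i + q i) = ?cM (?T (\<lambda>i. v i + w i))" by (simp add: Tadd cadd[OF \<zeta> TM TM])
      then show ?thesis using Cn_add[OF vw(1,2)] by blast
    qed
    moreover have "(\<lambda>i. c * p i) \<in> ?W" if p: "p \<in> ?W" for p c
    proof -
      obtain v where v: "v \<in> Cn n" "p = ?cM (?T v)" using p by blast
      then have "(\<lambda>i. c * p i) = ?cM (?T (\<lambda>i. c * v i))" by (simp add: Tscale cscale[OF \<zeta> TM])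
      then show ?thesis using Cn_scale[OF v(1)] by blast
    qed
    ultimately obtain a where a: "(\<Sum>i<m. ?cM e i * a i) \<noteq> 0" "\<And>w. w \<in> ?W \<Longrightarrow> (\<Sum>i<m. w i * a i) = 0"
      using functional_separating[of ?W m "?cM e"] cT(1) fframe_inv(1)[OF \<zeta> e(1)] by blast
    \<comment> \<open>A functional that vanishes on all tensors without being zero. Together with
      the zero functional \<open>l0\<close> it would give two extensions of the zero form.\<close>
    define l where "l = restrict (\<lambda>e. \<Sum>i<m. ?cM e i * a i) (fiber M x)"
    define l0 where "l0 = restrict (\<lambda>e. 0 :: complex) (fiber M x)"
    have clM: "fadd M e e' \<in> fiber M x" "fscale M c e \<in> fiber M x" if "e \<in> fiber M x" "e' \<in> fiber M x" for e e' c
      using M[unfolded vector_bundle_def, THEN conjunct2, THEN conjunct1, THEN bspec, OF x, THEN bspec, OF that(1)]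
        that(2) by simp_all
    have bil: "fiber_bilinear_form L F x (\<lambda>_ _. 0)"
      by (simp add: fiber_bilinear_form_def fiber_functional_def)
    have "fiber_functional M x l" "fiber_functional M x l0"
      by (auto simp: fiber_functional_def l_def l0_def clM cadd[OF \<zeta>] cscale[OF \<zeta>] distrib_right sum.distrib
          sum_distrib_left mult.assoc)
    moreover have "l (\<tau> e f) = 0" "l0 (\<tau> e f) = 0" if e: "e \<in> fiber L x" and f: "f \<in> fiber F x" for e f
    proof -
      define w where "w = ?c\<Phi> e"
      define c where "c = ?c\<Theta> f 0"
      have w: "w \<in> Cn n" "\<Phi> x w = e" using fframe_inv[OF f\<Phi> e] by (auto simp: w_def)
      have "?c\<Theta> f = (\<lambda>i. c * ev 0 i)"
        using fframe_inv(1)[OF f\<Theta> f] by (auto simp: Cn_def c_def ev_def fun_eq_iff)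
      then have "f = fscale F c ?\<nu>"
        using fframe_inv(2)[OF f\<Theta> f] fframe_scale[OF f\<Theta> ev1] by metis
      then have "\<tau> e f = fscale M c (?T w)" using \<tau>[OF x e \<nu>] w by simp
      then have "\<tau> e f = ?T (\<lambda>i. c * w i)" using Tscale[OF w(1)] by simp
      then have "?cM (\<tau> e f) \<in> ?W" "\<tau> e f \<in> fiber M x" using Cn_scale[OF w(1)] TM by auto
      then show "l (\<tau> e f) = 0" "l0 (\<tau> e f) = 0" using a(2) by (simp_all add: l_def l0_def)
    qed
    ultimately have "l = l0"
      using univ[OF x bil] by (metis (no_types, lifting) l_def l0_def restrict_extensional)
    then have "l e = l0 e" by simp
    then show False using a(1) e(1) by (simp add: l_def l0_def)
  qed
  show "fframe M x n H R0 ?T"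
    unfolding fframe_def
  proof (intro conjI ballI allI)
    show "bij_betw ?T (Cn n) (fiber M x)" using inj surj by (simp add: bij_betw_def)
    show "act M h (?T v) = ?T (R0 h v)" if v: "v \<in> Cn n" and h: "h \<in> H" for v h
      using act[OF x fframe_fiber[OF f\<Phi> v] \<nu> h] fframe_act[OF f\<Phi> v h] trivF[OF x h] by simp
  qed (use Tadd Tscale in auto)
qed

section \<open>The action on the circle in a frame\<close>

lemma orthogonal_matrix_norm:
  fixes A :: "real^2^2"
  assumes "A \<in> O2"
  shows "norm (A *v x) = norm x"
proof -
  have "orthogonal_transformation ((*v) A)"
    using assms by (simp add: orthogonal_transformation_matrix O2_def matrix_vector_mul_linear)
  then show ?thesis by (rule orthogonal_transformation_norm)
qed

text \<open>Instantiated twice: for \<open>G\<close>, to show that the isotropy group is a closed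
  subgroup, and for the isotropy group itself, which acts on the bundles.\<close>

locale circle_rep =
  fixes K :: "('k, 'r) monoid_scheme" and T :: "'k topology" and \<rho> :: "'k \<Rightarrow> real^2^2" and H :: "'k set"
  assumes topological: "topological_group K T" and rho: "orthogonal_rep K T \<rho>"
    and H: "H = {g \<in> carrier K. \<rho> g = mat 1}"
begin

abbreviation ca :: "'k \<Rightarrow> real^2 \<Rightarrow> real^2" where
  "ca \<equiv> circle_action \<rho>"

lemma group: "group K" and top [simp]: "topspace T = carrier K"
  using topological by (auto simp: topological_group_def)

sublocale group K by (rule group)

lemma rho_mult: "g \<in> carrier K \<Longrightarrow> h \<in> carrier K \<Longrightarrow> \<rho> (g \<otimes>\<^bsub>K\<^esub> h) = \<rho> g ** \<rho> h"
  and rho_O2: "g \<in> carrier K \<Longrightarrow> \<rho> g \<in> O2"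
  and rho_cont: "continuous_map T euclidean \<rho>"
  using rho by (auto simp: orthogonal_rep_def)

text \<open>\<open>orthogonal_rep\<close> asks only for multiplicativity; an idempotent orthogonal
  matrix is the identity.\<close>

lemma rho_one: "\<rho> \<one>\<^bsub>K\<^esub> = mat 1"
proof -
  have "transpose (\<rho> \<one>\<^bsub>K\<^esub>) ** \<rho> \<one>\<^bsub>K\<^esub> = mat 1"
    using rho_O2[OF one_closed] by (simp add: O2_def orthogonal_matrix)
  moreover have "\<rho> \<one>\<^bsub>K\<^esub> ** \<rho> \<one>\<^bsub>K\<^esub> = \<rho> \<one>\<^bsub>K\<^esub>" using rho_mult[of "\<one>\<^bsub>K\<^esub>" "\<one>\<^bsub>K\<^esub>"] by simp
  ultimately show ?thesis by (metis matrix_mul_assoc matrix_mul_lid)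
qed

lemma rho_inv: "g \<in> carrier K \<Longrightarrow> \<rho> g ** \<rho> (inv\<^bsub>K\<^esub> g) = mat 1"
  "g \<in> carrier K \<Longrightarrow> \<rho> (inv\<^bsub>K\<^esub> g) ** \<rho> g = mat 1"
  using rho_mult[of g "inv\<^bsub>K\<^esub> g"] rho_mult[of "inv\<^bsub>K\<^esub> g" g] by (simp_all add: rho_one)

lemma H_subset: "H \<subseteq> carrier K" and one_H: "\<one>\<^bsub>K\<^esub> \<in> H"
  using H by (auto simp: rho_one)

lemma H_mult: "g \<in> H \<Longrightarrow> h \<in> H \<Longrightarrow> g \<otimes>\<^bsub>K\<^esub> h \<in> H"
  using H by (auto simp: rho_mult)

lemma H_iff: "g \<in> carrier K \<Longrightarrow> h \<in> carrier K \<Longrightarrow> inv\<^bsub>K\<^esub> g \<otimes>\<^bsub>K\<^esub> h \<in> H \<longleftrightarrow> \<rho> g = \<rho> h"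
proof
  assume gh: "g \<in> carrier K" "h \<in> carrier K"
  show "inv\<^bsub>K\<^esub> g \<otimes>\<^bsub>K\<^esub> h \<in> H" if "\<rho> g = \<rho> h"
    using gh rho_inv(2)[OF gh(2)] rho_inv(2)[OF gh(1)] that by (simp add: H rho_mult)
  show "\<rho> g = \<rho> h" if "inv\<^bsub>K\<^esub> g \<otimes>\<^bsub>K\<^esub> h \<in> H"
  proof -
    have "\<rho> h = \<rho> (g \<otimes>\<^bsub>K\<^esub> (inv\<^bsub>K\<^esub> g \<otimes>\<^bsub>K\<^esub> h))" using gh by (simp add: m_assoc[symmetric])
    also have "\<dots> = \<rho> g" using that gh by (simp add: rho_mult[of g "inv\<^bsub>K\<^esub> g \<otimes>\<^bsub>K\<^esub> h"] H)
    finally show ?thesis by simp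
  qed
qed

lemma H_conj: "g \<in> carrier K \<Longrightarrow> h \<in> H \<Longrightarrow> g \<otimes>\<^bsub>K\<^esub> h \<otimes>\<^bsub>K\<^esub> inv\<^bsub>K\<^esub> g \<in> H"
  using rho_inv(1)[of g] by (auto simp: H rho_mult)

lemma H_monoid: "monoid (K\<lparr>carrier := H\<rparr>)"
  by (rule monoidI) (use H_subset H_mult one_H in \<open>auto simp: m_assoc subset_iff\<close>)

lemma ca_sphere: "g \<in> carrier K \<Longrightarrow> x \<in> sphere 0 1 \<Longrightarrow> ca g x \<in> sphere 0 1"
  using orthogonal_matrix_norm[OF rho_O2] by (simp add: circle_action_def)

lemma ca_mult: "g \<in> carrier K \<Longrightarrow> h \<in> carrier K \<Longrightarrow> ca (g \<otimes>\<^bsub>K\<^esub> h) x = ca g (ca h x)"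
  by (simp add: circle_action_def rho_mult matrix_vector_mul_assoc)

lemma ca_one: "ca \<one>\<^bsub>K\<^esub> x = x" and ca_H: "h \<in> H \<Longrightarrow> ca h x = x"
  by (auto simp: circle_action_def rho_one H)

lemma ca_inv: "g \<in> carrier K \<Longrightarrow> ca (inv\<^bsub>K\<^esub> g) (ca g x) = x"
  using ca_mult[of "inv\<^bsub>K\<^esub> g" g x] by (simp add: ca_one)

lemma ca_cont: "continuous_map (prod_topology T unit_circle) unit_circle (\<lambda>(g, x). ca g x)"
proof -
  have 1: "continuous_map (prod_topology T unit_circle) euclidean (\<lambda>z. \<rho> (fst z))"
    by (rule continuous_map_compose[OF continuous_map_fst rho_cont, unfolded o_def])
  have 2: "continuous_map (prod_topology T unit_circle) euclidean snd"
    using continuous_map_snd[of T unit_circle] by (simp add: unit_circle_def continuous_map_in_subtopology)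
  have "continuous_on UNIV (\<lambda>z :: (real^2^2) \<times> (real^2). fst z *v snd z)"
    unfolding matrix_vector_mult_def by (intro continuous_intros)
  from continuous_map_binop[OF this 1 2] show ?thesis
    unfolding unit_circle_def continuous_map_in_subtopology
    using ca_sphere by (auto simp: case_prod_unfold circle_action_def unit_circle_def)
qed

lemma ca_cont1: "g \<in> carrier K \<Longrightarrow> continuous_map unit_circle unit_circle (ca g)"
  using continuous_map_compose[OF continuous_map_pairedI[of unit_circle T "\<lambda>_. g" unit_circle "\<lambda>x. x"] ca_cont]
  by (simp add: o_def)

text \<open>Each \<open>act E g\<close> is required to be continuous separately, instead of jointly
  with the group element. In this form the conditions are checked directly for line bundles pulled
  back from the orbit space.\<close>

definition ebundle :: "('k, real^2, 'e) vbundle \<Rightarrow> bool" where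
  "ebundle E \<longleftrightarrow> vector_bundle unit_circle E \<and>
     (\<forall>g\<in>carrier K. continuous_map (total E) (total E) (act E g)) \<and>
     (\<forall>g\<in>carrier K. \<forall>x\<in>sphere 0 1. \<forall>e\<in>fiber E x. act E g e \<in> fiber E (ca g x) \<and>
        (\<forall>e'\<in>fiber E x. act E g (fadd E e e') = fadd E (act E g e) (act E g e')) \<and>
        (\<forall>c. act E g (fscale E c e) = fscale E c (act E g e))) \<and>
     (\<forall>e\<in>topspace (total E). act E \<one>\<^bsub>K\<^esub> e = e) \<and>
     (\<forall>g\<in>carrier K. \<forall>h\<in>carrier K. \<forall>e\<in>topspace (total E). act E (g \<otimes>\<^bsub>K\<^esub> h) e = act E g (act E h e))"

lemma K_bundle_ebundle:
  assumes E: "K_bundle K T unit_circle ca E"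
  shows "ebundle E"
  unfolding ebundle_def
proof (intro conjI ballI allI)
  show "vector_bundle unit_circle E" using E by (simp add: K_bundle_def)
  show "continuous_map (total E) (total E) (act E g)" if "g \<in> carrier K" for g
    by (rule K_bundle_act_cont[OF E top that])
  show "act E \<one>\<^bsub>K\<^esub> e = e" if "e \<in> topspace (total E)" for e
    using E that by (auto simp: K_bundle_def K_space_def)
  show "act E (g \<otimes>\<^bsub>K\<^esub> h) e = act E g (act E h e)" if "g \<in> carrier K" "h \<in> carrier K" "e \<in> topspace (total E)" for g h e
    using E that by (auto simp: K_bundle_def K_space_def)
  fix g and x :: "real^2" and e assume g: "g \<in> carrier K" and x: "x \<in> sphere 0 1" and e: "e \<in> fiber E x"
  show "act E g e \<in> fiber E (ca g x)" by (rule K_bundle_act_fiber[OF E top g e])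
  show "act E g (fadd E e e') = fadd E (act E g e) (act E g e')" if "e' \<in> fiber E x" for e'
    using K_bundle_act_lin(1)[OF E g _ e that] x by simp
  show "act E g (fscale E c e) = fscale E c (act E g e)" for c
    using K_bundle_act_lin(2)[OF E g _ e] x by simp
qed

lemma
  assumes E: "ebundle E"
  shows eb_vb: "vector_bundle unit_circle E"
    and eb_cont: "g \<in> carrier K \<Longrightarrow> continuous_map (total E) (total E) (act E g)"
    and eb_fiber: "g \<in> carrier K \<Longrightarrow> x \<in> sphere 0 1 \<Longrightarrow> e \<in> fiber E x \<Longrightarrow> act E g e \<in> fiber E (ca g x)"
    and eb_add: "g \<in> carrier K \<Longrightarrow> x \<in> sphere 0 1 \<Longrightarrow> e \<in> fiber E x \<Longrightarrow> e' \<in> fiber E x \<Longrightarrow>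
      act E g (fadd E e e') = fadd E (act E g e) (act E g e')"
    and eb_scale: "g \<in> carrier K \<Longrightarrow> x \<in> sphere 0 1 \<Longrightarrow> e \<in> fiber E x \<Longrightarrow>
      act E g (fscale E c e) = fscale E c (act E g e)"
    and eb_one: "e \<in> fiber E x \<Longrightarrow> act E \<one>\<^bsub>K\<^esub> e = e"
    and eb_mult: "g \<in> carrier K \<Longrightarrow> h \<in> carrier K \<Longrightarrow> e \<in> fiber E x \<Longrightarrow> act E (g \<otimes>\<^bsub>K\<^esub> h) e = act E g (act E h e)"
proof -
  note E = E[unfolded ebundle_def]
  show "vector_bundle unit_circle E" using E by blast
  show "g \<in> carrier K \<Longrightarrow> continuous_map (total E) (total E) (act E g)" using E by blast
  note E3 = E[THEN conjunct2, THEN conjunct2, THEN conjunct1, rule_format]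
  show "g \<in> carrier K \<Longrightarrow> x \<in> sphere 0 1 \<Longrightarrow> e \<in> fiber E x \<Longrightarrow> act E g e \<in> fiber E (ca g x)"
    using E3[of g x e] by blast
  show "g \<in> carrier K \<Longrightarrow> x \<in> sphere 0 1 \<Longrightarrow> e \<in> fiber E x \<Longrightarrow> e' \<in> fiber E x \<Longrightarrow>
      act E g (fadd E e e') = fadd E (act E g e) (act E g e')"
    using E3[of g x e] by blast
  show "g \<in> carrier K \<Longrightarrow> x \<in> sphere 0 1 \<Longrightarrow> e \<in> fiber E x \<Longrightarrow> act E g (fscale E c e) = fscale E c (act E g e)"
    using E3[of g x e] by blast
  show "e \<in> fiber E x \<Longrightarrow> act E \<one>\<^bsub>K\<^esub> e = e" using E by (auto simp: fiber_def)
  show "g \<in> carrier K \<Longrightarrow> h \<in> carrier K \<Longrightarrow> e \<in> fiber E x \<Longrightarrow> act E (g \<otimes>\<^bsub>K\<^esub> h) e = act E g (act E h e)"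
    using E[THEN conjunct2, THEN conjunct2, THEN conjunct2, THEN conjunct2, rule_format, of g h e]
    by (auto simp: fiber_def)
qed

text \<open>The transition cocycle of the action: the matrix of \<open>g\<close> from the fiber at
  \<open>x\<close> to the fiber at \<open>ca g x\<close>, in the frame
  \<open>\<Phi>\<close>.\<close>

definition coc :: "('k, real^2, 'e) vbundle \<Rightarrow> nat \<Rightarrow> (real^2 \<Rightarrow> (nat \<Rightarrow> complex) \<Rightarrow> 'e) \<Rightarrow>
    'k \<Rightarrow> real^2 \<Rightarrow> (nat \<Rightarrow> complex) \<Rightarrow> nat \<Rightarrow> complex" where
  "coc E n \<Phi> g x w = inv_into (Cn n) (\<Phi> (ca g x)) (act E g (\<Phi> x w))"

context
  fixes E :: "('k, real^2, 'e) vbundle" and n R \<Phi>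
  assumes E: "ebundle E" and \<Phi>: "frame unit_circle (\<lambda>x. x) E n H R \<Phi>"
begin

lemma frame_at: "x \<in> sphere 0 1 \<Longrightarrow> fframe E x n H R (\<Phi> x)"
  using frame_fframe[OF \<Phi>] by simp

lemma coc_Cn: "g \<in> carrier K \<Longrightarrow> x \<in> sphere 0 1 \<Longrightarrow> w \<in> Cn n \<Longrightarrow> coc E n \<Phi> g x w \<in> Cn n"
  and coc_act: "g \<in> carrier K \<Longrightarrow> x \<in> sphere 0 1 \<Longrightarrow> w \<in> Cn n \<Longrightarrow> act E g (\<Phi> x w) = \<Phi> (ca g x) (coc E n \<Phi> g x w)"
  using fframe_inv[OF frame_at eb_fiber[OF E _ _ fframe_fiber[OF frame_at]]] ca_sphere by (auto simp: coc_def)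

lemma coc_eqI: "g \<in> carrier K \<Longrightarrow> x \<in> sphere 0 1 \<Longrightarrow> v \<in> Cn n \<Longrightarrow> act E g (\<Phi> x w) = \<Phi> (ca g x) v \<Longrightarrow> coc E n \<Phi> g x w = v"
  using fframe_inv_f[OF frame_at[OF ca_sphere]] by (simp add: coc_def)

lemma coc_lin:
  assumes g: "g \<in> carrier K" and x: "x \<in> sphere 0 1"
  shows "lin n n (coc E n \<Phi> g x)"
proof (rule linI)
  note f = frame_at[OF x] and fg = frame_at[OF ca_sphere[OF g x]]
  fix v assume v: "v \<in> Cn n"
  show "coc E n \<Phi> g x v \<in> Cn n" using coc_Cn g x v by blast
  show "coc E n \<Phi> g x (\<lambda>i. v i + w i) = (\<lambda>i. coc E n \<Phi> g x v i + coc E n \<Phi> g x w i)" if w: "w \<in> Cn n" for w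
    by (rule coc_eqI[OF g x])
      (use v w g x in \<open>simp_all add: Cn_add coc_Cn fframe_add[OF f] fframe_add[OF fg] coc_act
         eb_add[OF E g x fframe_fiber[OF f] fframe_fiber[OF f]]\<close>)
  show "coc E n \<Phi> g x (\<lambda>i. c * v i) = (\<lambda>i. c * coc E n \<Phi> g x v i)" for c
    by (rule coc_eqI[OF g x])
      (use v g x in \<open>simp_all add: Cn_scale coc_Cn fframe_scale[OF f] fframe_scale[OF fg] coc_act
         eb_scale[OF E g x fframe_fiber[OF f]]\<close>)
qed

lemma coc_mult:
  assumes g: "g \<in> carrier K" and h: "h \<in> carrier K" and x: "x \<in> sphere 0 1" and w: "w \<in> Cn n"
  shows "coc E n \<Phi> (g \<otimes>\<^bsub>K\<^esub> h) x w = coc E n \<Phi> g (ca h x) (coc E n \<Phi> h x w)"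
  by (rule coc_eqI)
    (use assms in \<open>simp_all add: coc_Cn ca_sphere[unfolded mem_sphere_0] coc_act ca_mult
       eb_mult[OF E g h fframe_fiber[OF frame_at[OF x] w]] coc_act[OF h x w]
       coc_act[OF g ca_sphere[OF h x] coc_Cn[OF h x w]] coc_Cn[OF g ca_sphere[OF h x] coc_Cn[OF h x w]]\<close>)

lemma coc_H: "h \<in> H \<Longrightarrow> x \<in> sphere 0 1 \<Longrightarrow> w \<in> Cn n \<Longrightarrow> R h w \<in> Cn n \<Longrightarrow> coc E n \<Phi> h x w = R h w"
  by (rule coc_eqI) (use H_subset in \<open>auto simp: ca_H fframe_act[OF frame_at]\<close>)

lemma coc_one: "x \<in> sphere 0 1 \<Longrightarrow> w \<in> Cn n \<Longrightarrow> coc E n \<Phi> \<one>\<^bsub>K\<^esub> x w = w"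
  by (rule coc_eqI) (auto simp: ca_one eb_one[OF E fframe_fiber[OF frame_at]])

lemma coc_inv:
  assumes g: "g \<in> carrier K" and x: "x \<in> sphere 0 1" and w: "w \<in> Cn n"
  shows "coc E n \<Phi> (inv\<^bsub>K\<^esub> g) (ca g x) (coc E n \<Phi> g x w) = w"
    and "coc E n \<Phi> g x (coc E n \<Phi> (inv\<^bsub>K\<^esub> g) (ca g x) w) = w"
proof -
  show "coc E n \<Phi> (inv\<^bsub>K\<^esub> g) (ca g x) (coc E n \<Phi> g x w) = w"
    using coc_mult[of "inv\<^bsub>K\<^esub> g" g x w] coc_one[of x w] g x w by simp
  show "coc E n \<Phi> g x (coc E n \<Phi> (inv\<^bsub>K\<^esub> g) (ca g x) w) = w"
    using coc_mult[of g "inv\<^bsub>K\<^esub> g" "ca g x" w] coc_one[OF ca_sphere[OF g x] w] g ca_sphere[OF g x] w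
    by (simp add: ca_inv)
qed

lemma coc_bij:
  assumes g: "g \<in> carrier K" and x: "x \<in> sphere 0 1"
  shows "bij_betw (coc E n \<Phi> g x) (Cn n) (Cn n)"
  by (rule bij_betwI[where g = "coc E n \<Phi> (inv\<^bsub>K\<^esub> g) (ca g x)"])
    (use coc_inv coc_Cn ca_sphere g x in auto)

lemma coc_nonzero:
  assumes "g \<in> carrier K" "x \<in> sphere 0 1" "w \<in> Cn n" "w \<noteq> (\<lambda>_. 0)"
  shows "coc E n \<Phi> g x w \<noteq> (\<lambda>_. 0)"
  using coc_bij[OF assms(1,2)] lin_inj_iff[OF coc_lin[OF assms(1,2)]] assms(3,4) by (auto simp: bij_betw_def)

lemma coord_eq_coc:
  assumes "g \<in> carrier K" "x \<in> sphere 0 1" "w \<in> Cn n"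
  shows "inv_into (Cn n) (\<Phi> (proj E (act E g (\<Phi> x w)))) (act E g (\<Phi> x w)) = coc E n \<Phi> g x w"
  using eb_fiber[OF E assms(1,2) fframe_fiber[OF frame_at[OF assms(2)] assms(3)]]
  by (simp add: coc_def fiber_def)

lemma coc_cont:
  assumes g: "g \<in> carrier K" and w: "w \<in> Cn n"
  shows "continuous_map unit_circle euclidean (\<lambda>x. coc E n \<Phi> g x w i)"
proof -
  have "continuous_map unit_circle (total E) (\<lambda>x. act E g (\<Phi> x w))"
    by (rule continuous_map_compose[OF frame_cont_compose[OF \<Phi>] eb_cont[OF E g], unfolded o_def])
      (use w in auto)
  from continuous_map_compose[OF this continuous_map_frame_coord[OF eb_vb[OF E] \<Phi>]]
  have "continuous_map unit_circle (Cspace n)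
     (\<lambda>x. inv_into (Cn n) (\<Phi> (proj E (act E g (\<Phi> x w)))) (act E g (\<Phi> x w)))" by (simp add: o_def)
  then have "continuous_map unit_circle (Cspace n) (\<lambda>x. coc E n \<Phi> g x w)"
    by (rule continuous_map_eq) (use coord_eq_coc g w in auto)
  then show ?thesis by (simp add: continuous_map_Cspace)
qed

lemma coc_cont_joint:
  assumes EK: "K_bundle K T unit_circle ca E"
    and a: "continuous_map Z T a" and b: "continuous_map Z unit_circle b" and c: "continuous_map Z (Cspace n) c"
  shows "continuous_map Z (Cspace n) (\<lambda>z. coc E n \<Phi> (a z) (b z) (c z))"
proof -
  have "continuous_map (prod_topology T (total E)) (total E) (\<lambda>(g, x). act E g x)"
    using EK by (auto simp: K_bundle_def K_space_def)
  from continuous_map_compose[OF continuous_map_pairedI[OF a frame_cont_compose[OF \<Phi> b c]] this]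
  have "continuous_map Z (total E) (\<lambda>z. act E (a z) (\<Phi> (b z) (c z)))" by (simp add: o_def)
  from continuous_map_compose[OF this continuous_map_frame_coord[OF eb_vb[OF E] \<Phi>]]
  have "continuous_map Z (Cspace n) (\<lambda>z. inv_into (Cn n) (\<Phi> (proj E (act E (a z) (\<Phi> (b z) (c z)))))
     (act E (a z) (\<Phi> (b z) (c z))))" by (simp add: o_def)
  then show ?thesis
  proof (rule continuous_map_eq)
    fix z assume z: "z \<in> topspace Z"
    have "a z \<in> carrier K" "b z \<in> sphere 0 1" "c z \<in> Cn n"
      using funcset_mem[OF continuous_map_funspace[OF a] z] funcset_mem[OF continuous_map_funspace[OF b] z]
        funcset_mem[OF continuous_map_funspace[OF c] z] by simp_all
    then show "inv_into (Cn n) (\<Phi> (proj E (act E (a z) (\<Phi> (b z) (c z))))) (act E (a z) (\<Phi> (b z) (c z)))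
      = coc E n \<Phi> (a z) (b z) (c z)" by (rule coord_eq_coc)
  qed
qed

end

text \<open>For an irreducible frame the coordinate matrices at different base points are proportional by
  Schur's lemma; \<open>mul\<close> is the factor relative to the base point \<open>circ 0\<close>.\<close>

definition mul :: "('k, real^2, 'e) vbundle \<Rightarrow> nat \<Rightarrow> (real^2 \<Rightarrow> (nat \<Rightarrow> complex) \<Rightarrow> 'e) \<Rightarrow>
    'k \<Rightarrow> real^2 \<Rightarrow> complex" where
  "mul E n \<Phi> g x = coc E n \<Phi> (inv\<^bsub>K\<^esub> g) (ca g (circ 0)) (coc E n \<Phi> g x (ev 0)) 0"

context
  fixes E :: "('k, real^2, 'e) vbundle" and n R \<Phi>
  assumes E: "ebundle E" and \<Phi>: "frame unit_circle (\<lambda>x. x) E n H R \<Phi>" and S: "schurian n H R"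
begin

lemma RC: "h \<in> H \<Longrightarrow> v \<in> Cn n \<Longrightarrow> R h v \<in> Cn n"
  using S by (auto simp: schurian_def intro: lin_Cn)

lemma ev0: "ev 0 \<in> Cn n" "ev 0 \<noteq> (\<lambda>_. 0)"
  using schurian_pos[OF S] by (auto simp: fun_eq_iff) (auto simp: ev_def)

text \<open>At every base point the matrix of \<open>g\<close> intertwines \<open>R h\<close> with
  the same conjugate of it. Comparing \<open>x\<close> with \<open>circ 0\<close> cancels the
  conjugation, so the comparison \<open>?T\<close> commutes with all \<open>R h\<close> and is a
  scalar.\<close>

lemma mul_nonzero_eq:
  assumes g: "g \<in> carrier K" and x: "x \<in> sphere 0 1"
  shows "mul E n \<Phi> g x \<noteq> 0 \<and> (\<forall>w\<in>Cn n. coc E n \<Phi> g x w = (\<lambda>i. mul E n \<Phi> g x * coc E n \<Phi> g (circ 0) w i))"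
proof -
  let ?x0 = "circ 0"
  note x0 = circ_in_sphere[of 0]
  let ?T = "\<lambda>w. coc E n \<Phi> (inv\<^bsub>K\<^esub> g) (ca g ?x0) (coc E n \<Phi> g x w)"
  note gx0 = ca_sphere[OF g x0] and ig = inv_closed[OF g]
  have linT: "lin n n ?T" by (rule lin_comp[OF coc_lin[OF E \<Phi> g x] coc_lin[OF E \<Phi> ig gx0]])
  have bijT: "bij_betw ?T (Cn n) (Cn n)"
    using bij_betw_trans[OF coc_bij[OF E \<Phi> g x] coc_bij[OF E \<Phi> ig gx0]] by (simp add: o_def)
  have com: "coc E n \<Phi> g y (R h w) = R (g \<otimes>\<^bsub>K\<^esub> h \<otimes>\<^bsub>K\<^esub> inv\<^bsub>K\<^esub> g) (coc E n \<Phi> g y w)"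
    if g: "g \<in> carrier K" and h: "h \<in> H" and w: "w \<in> Cn n" and y: "y \<in> sphere 0 1" for g h w y
  proof -
    let ?k = "g \<otimes>\<^bsub>K\<^esub> h \<otimes>\<^bsub>K\<^esub> inv\<^bsub>K\<^esub> g"
    have hK: "h \<in> carrier K" using h H_subset by blast
    have k: "?k \<in> H" "?k \<in> carrier K" using H_conj[OF g h] H_subset by auto
    have e: "?k \<otimes>\<^bsub>K\<^esub> g = g \<otimes>\<^bsub>K\<^esub> h" using g hK by (simp add: m_assoc)
    have "coc E n \<Phi> (g \<otimes>\<^bsub>K\<^esub> h) y w = coc E n \<Phi> g y (R h w)"
      using coc_mult[OF E \<Phi> g hK y w] coc_H[OF E \<Phi> h y w RC[OF h w]] by (simp add: ca_H h)
    moreover have "coc E n \<Phi> (?k \<otimes>\<^bsub>K\<^esub> g) y w = R ?k (coc E n \<Phi> g y w)"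
      using coc_mult[OF E \<Phi> k(2) g y w] coc_H[OF E \<Phi> k(1) ca_sphere[OF g y] coc_Cn[OF E \<Phi> g y w]]
        RC[OF k(1) coc_Cn[OF E \<Phi> g y w]] by simp
    ultimately show ?thesis by (simp only: e)
  qed
  have comT: "?T (R h w) = R h (?T w)" if h: "h \<in> H" and w: "w \<in> Cn n" for h w
  proof -
    let ?k = "g \<otimes>\<^bsub>K\<^esub> h \<otimes>\<^bsub>K\<^esub> inv\<^bsub>K\<^esub> g"
    have hK: "h \<in> carrier K" using h H_subset by blast
    have "inv\<^bsub>K\<^esub> g \<otimes>\<^bsub>K\<^esub> ?k \<otimes>\<^bsub>K\<^esub> inv\<^bsub>K\<^esub> (inv\<^bsub>K\<^esub> g) = h"
      using g hK by (simp add: m_assoc) (simp add: m_assoc[symmetric])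
    then show ?thesis
      using com[OF g h w x] com[OF ig H_conj[OF g h] coc_Cn[OF E \<Phi> g x w] gx0] by simp
  qed
  obtain c where c: "c \<noteq> 0" "\<And>w. w \<in> Cn n \<Longrightarrow> ?T w = (\<lambda>i. c * w i)"
    using schurian_scalar[OF S linT bijT comT] by blast
  have "mul E n \<Phi> g x = c" using c(2)[OF ev0(1)] by (simp add: mul_def) (simp add: ev_def)
  moreover have "coc E n \<Phi> g x w = (\<lambda>i. c * coc E n \<Phi> g ?x0 w i)" if w: "w \<in> Cn n" for w
    using coc_inv(2)[OF E \<Phi> g x0 coc_Cn[OF E \<Phi> g x w]] c(2)[OF w] lin_scale[OF coc_lin[OF E \<Phi> g x0] w] by simp
  ultimately show ?thesis using c(1) by blast
qed

lemma mul_nonzero: "g \<in> carrier K \<Longrightarrow> x \<in> sphere 0 1 \<Longrightarrow> mul E n \<Phi> g x \<noteq> 0"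
  and mul_eq: "g \<in> carrier K \<Longrightarrow> x \<in> sphere 0 1 \<Longrightarrow> w \<in> Cn n \<Longrightarrow>
     coc E n \<Phi> g x w = (\<lambda>i. mul E n \<Phi> g x * coc E n \<Phi> g (circ 0) w i)"
  using mul_nonzero_eq by blast+

lemma mul_base: "g \<in> carrier K \<Longrightarrow> mul E n \<Phi> g (circ 0) = 1"
  using coc_inv(1)[OF E \<Phi> _ circ_in_sphere ev0(1)] by (simp add: mul_def) (simp add: ev_def)

text \<open>The second factor on the left compensates for the normalization at
  \<open>circ 0\<close>, which \<open>h\<close> moves. It does not depend on \<open>x\<close>, so
  \<open>mul\<close> is a cocycle up to constants.\<close>

lemma mul_mult:
  assumes g: "g \<in> carrier K" and h: "h \<in> carrier K" and x: "x \<in> sphere 0 1"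
  shows "mul E n \<Phi> (g \<otimes>\<^bsub>K\<^esub> h) x * mul E n \<Phi> g (ca h (circ 0)) = mul E n \<Phi> g (ca h x) * mul E n \<Phi> h x"
proof -
  note x0 = circ_in_sphere[of 0]
  let ?u = "coc E n \<Phi> h (circ 0) (ev 0)" and ?b = "\<lambda>w. coc E n \<Phi> g (circ 0) w"
  have u: "?u \<in> Cn n" by (rule coc_Cn[OF E \<Phi> h x0 ev0(1)])
  have gh: "g \<otimes>\<^bsub>K\<^esub> h \<in> carrier K" using g h by simp
  have "?b ?u \<noteq> (\<lambda>_. 0)"
    by (rule coc_nonzero[OF E \<Phi> g x0 u coc_nonzero[OF E \<Phi> h x0 ev0]])
  then obtain i where i: "?b ?u i \<noteq> 0" by (auto simp: fun_eq_iff)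
  have 0: "coc E n \<Phi> (g \<otimes>\<^bsub>K\<^esub> h) (circ 0) (ev 0) = (\<lambda>i. mul E n \<Phi> g (ca h (circ 0)) * ?b ?u i)"
    using coc_mult[OF E \<Phi> g h x0 ev0(1)] mul_eq[OF g ca_sphere[OF h x0] u] by simp
  have "coc E n \<Phi> (g \<otimes>\<^bsub>K\<^esub> h) x (ev 0) = coc E n \<Phi> g (ca h x) (\<lambda>i. mul E n \<Phi> h x * ?u i)"
    using coc_mult[OF E \<Phi> g h x ev0(1)] mul_eq[OF h x ev0(1)] by simp
  also have "\<dots> = (\<lambda>i. mul E n \<Phi> h x * (mul E n \<Phi> g (ca h x) * ?b ?u i))"
    using lin_scale[OF coc_lin[OF E \<Phi> g ca_sphere[OF h x]] u] mul_eq[OF g ca_sphere[OF h x] u] by simp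
  finally have fin: "coc E n \<Phi> (g \<otimes>\<^bsub>K\<^esub> h) x (ev 0) = (\<lambda>i. mul E n \<Phi> h x * (mul E n \<Phi> g (ca h x) * ?b ?u i))" .
  have "mul E n \<Phi> (g \<otimes>\<^bsub>K\<^esub> h) x * (mul E n \<Phi> g (ca h (circ 0)) * ?b ?u i)
      = mul E n \<Phi> h x * (mul E n \<Phi> g (ca h x) * ?b ?u i)"
    using fun_cong[OF mul_eq[OF gh x ev0(1)], of i] unfolding 0 fin by (rule sym)
  then have "(mul E n \<Phi> (g \<otimes>\<^bsub>K\<^esub> h) x * mul E n \<Phi> g (ca h (circ 0))) * ?b ?u i
      = (mul E n \<Phi> g (ca h x) * mul E n \<Phi> h x) * ?b ?u i"
    by (simp only: ac_simps)
  then show ?thesis using i by simp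
qed

lemma mul_H: "h \<in> H \<Longrightarrow> x \<in> sphere 0 1 \<Longrightarrow> mul E n \<Phi> h x = 1"
proof -
  assume h: "h \<in> H" and x: "x \<in> sphere 0 1"
  have hK: "h \<in> carrier K" using h H_subset by blast
  have "mul E n \<Phi> h x = coc E n \<Phi> (inv\<^bsub>K\<^esub> h) (ca h (circ 0)) (coc E n \<Phi> h (circ 0) (ev 0)) 0"
    using coc_H[OF E \<Phi> h x ev0(1) RC[OF h ev0(1)]] coc_H[OF E \<Phi> h circ_in_sphere ev0(1) RC[OF h ev0(1)]]
    by (simp add: mul_def)
  then show ?thesis using mul_base[OF hK] by (simp add: mul_def)
qed

lemma mul_cont:
  assumes g: "g \<in> carrier K"
  shows "continuous_map unit_circle euclidean (mul E n \<Phi> g)"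
proof -
  let ?L = "coc E n \<Phi> (inv\<^bsub>K\<^esub> g) (ca g (circ 0))"
  have "lin n n ?L" by (rule coc_lin[OF E \<Phi> inv_closed[OF g] ca_sphere[OF g circ_in_sphere]])
  then have "mul E n \<Phi> g x = (\<Sum>j<n. coc E n \<Phi> g x (ev 0) j * ?L (ev j) 0)" if "x \<in> sphere 0 1" for x
    unfolding mul_def using fun_cong[OF lin_expand[OF _ coc_Cn[OF E \<Phi> g that ev0(1)]], of n ?L 0] by simp
  moreover have "continuous_map unit_circle euclidean (\<lambda>x. \<Sum>j<n. coc E n \<Phi> g x (ev 0) j * ?L (ev j) 0)"
    by (intro continuous_map_sum' continuous_map_mult coc_cont[OF E \<Phi> g ev0(1)]) auto
  ultimately show ?thesis by (subst continuous_map_eq) auto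
qed

lemma mul_cont_joint:
  assumes EK: "K_bundle K T unit_circle ca E"
    and a: "continuous_map Z T a" and b: "continuous_map Z unit_circle b"
  shows "continuous_map Z euclidean (\<lambda>z. mul E n \<Phi> (a z) (b z))"
proof -
  have inv: "continuous_map T T (\<lambda>x. inv\<^bsub>K\<^esub> x)" using topological by (simp add: topological_group_def)
  have ev: "continuous_map Z (Cspace n) (\<lambda>z. ev 0)" using ev0 by simp
  have c0: "continuous_map Z unit_circle (\<lambda>z. circ 0)" using circ_in_sphere[of 0] by simp
  have "continuous_map Z unit_circle (\<lambda>z. ca (a z) (circ 0))"
    using continuous_map_compose[OF continuous_map_pairedI[OF a c0] ca_cont] by (simp add: o_def)
  then have "continuous_map Z (Cspace n) (\<lambda>z. coc E n \<Phi> (inv\<^bsub>K\<^esub> (a z)) (ca (a z) (circ 0)) (coc E n \<Phi> (a z) (b z) (ev 0)))"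
    by (intro coc_cont_joint[OF E \<Phi> EK] continuous_map_compose[OF a inv, unfolded o_def] a b ev)
  then show ?thesis by (simp add: mul_def continuous_map_Cspace)
qed

end

text \<open>After rescaling the frame by \<open>u\<close>, the matrix of \<open>g\<close> no longer
  depends on the base point. A constant \<open>\<kappa>\<close> may remain because the module of a
  trivial bundle is free to contain it.\<close>

definition flat :: "(real^2 \<Rightarrow> complex) \<Rightarrow> 'k \<Rightarrow> (real^2 \<Rightarrow> complex) \<Rightarrow> bool" where
  "flat u g f \<longleftrightarrow> (\<exists>\<kappa>. \<kappa> \<noteq> 0 \<and> (\<forall>x\<in>sphere 0 1. u x * f x = \<kappa> * u (ca g x)))"

definition coboundary :: "('k \<Rightarrow> real^2 \<Rightarrow> complex) \<Rightarrow> bool" where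
  "coboundary q \<longleftrightarrow> (\<exists>u. continuous_map unit_circle euclidean u \<and> (\<forall>x\<in>sphere 0 1. u x \<noteq> 0) \<and>
     (\<forall>g\<in>carrier K. flat u g (q g)))"

end

context circle_rep begin

text \<open>Matrices independent of the base point form a module \<open>B\<close>, and the frame
  identifies the bundle with the product with \<open>B\<close>. Continuity of \<open>B\<close> in
  the group element comes from joint continuity of the action.\<close>

lemma flat_frame_trivial:
  assumes MK: "K_bundle K T unit_circle ca M" and \<Psi>: "frame unit_circle (\<lambda>x. x) M n H R \<Psi>"
    and flat: "\<And>g x w. g \<in> carrier K \<Longrightarrow> x \<in> sphere 0 1 \<Longrightarrow> w \<in> Cn n \<Longrightarrow>
      coc M n \<Psi> g x w = coc M n \<Psi> g (circ 0) w"
  shows "trivial_bundle K T unit_circle ca M"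
proof -
  note M = K_bundle_ebundle[OF MK] and x0 = circ_in_sphere[of 0]
  define B where "B g = coc M n \<Psi> g (circ 0)" for g
  have BC: "B g w \<in> Cn n" if "g \<in> carrier K" "w \<in> Cn n" for g w
    unfolding B_def by (rule coc_Cn[OF M \<Psi> that(1) x0 that(2)])
  have Bact: "act M g (\<Psi> x w) = \<Psi> (ca g x) (B g w)"
    if "g \<in> carrier K" "w \<in> Cn n" "x \<in> sphere 0 1" for g x w
    unfolding B_def coc_act[OF M \<Psi> that(1,3,2)] flat[OF that(1,3,2)] ..
  have Blin: "lin n n (B g)" if "g \<in> carrier K" for g
    unfolding B_def by (rule coc_lin[OF M \<Psi> that x0])
  have "K_module K T n B"
    unfolding K_module_def K_space_def
  proof (intro conjI ballI allI)
    show "continuous_map (prod_topology T (Cspace n)) (Cspace n) (\<lambda>(g, x). B g x)"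
      unfolding case_prod_unfold B_def
      by (intro coc_cont_joint[OF M \<Psi> MK] continuous_map_fst continuous_map_snd) (use x0 in auto)
    show "B \<one>\<^bsub>K\<^esub> x = x" if "x \<in> topspace (Cspace n)" for x
      using coc_one[OF M \<Psi> x0] that by (simp add: B_def)
    show "B (g \<otimes>\<^bsub>K\<^esub> h) x = B g (B h x)" if g: "g \<in> carrier K" and h: "h \<in> carrier K" and x: "x \<in> topspace (Cspace n)" for g h x
    proof -
      have x: "x \<in> Cn n" using x by simp
      show ?thesis
        using coc_mult[OF M \<Psi> g h x0 x] flat[OF g ca_sphere[OF h x0] coc_Cn[OF M \<Psi> h x0 x]]
        by (simp add: B_def)
    qed
  qed (use Blin in \<open>auto simp: lin_def\<close>)
  moreover have "bundle_iso K unit_circle M (product_bundle unit_circle ca n B)"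
  proof -
    define f where "f = (\<lambda>e. (proj M e, inv_into (Cn n) (\<Psi> (proj M e)) e))"
    have pM: "proj M e \<in> sphere 0 1" if "e \<in> topspace (total M)" for e
      using funcset_mem[OF continuous_map_funspace[of "total M" unit_circle "proj M"] that] eb_vb[OF M]
      by (simp add: vector_bundle_def)
    have fib: "e \<in> fiber M (proj M e)" if "e \<in> topspace (total M)" for e using that by (simp add: fiber_def)
    have f\<Psi>: "f (\<Psi> x w) = (x, w)" if "x \<in> sphere 0 1" "w \<in> Cn n" for x w
      using fframe_fiber[OF frame_at[OF M \<Psi> that(1)] that(2)] fframe_inv_f[OF frame_at[OF M \<Psi> that(1)] that(2)]
      by (simp add: f_def fiber_def)
    have ex: "\<exists>w. w \<in> Cn n \<and> e = \<Psi> x w" if "e \<in> fiber M x" "x \<in> sphere 0 1" for e x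
      using fframe_inv[OF frame_at[OF M \<Psi> that(2)] that(1)] by metis
    have "homeomorphic_maps (total M) (prod_topology unit_circle (Cspace n)) f (\<lambda>(x, w). \<Psi> x w)"
      unfolding homeomorphic_maps_def
    proof (intro conjI ballI)
      show "continuous_map (total M) (prod_topology unit_circle (Cspace n)) f"
        unfolding f_def using eb_vb[OF M] continuous_map_frame_coord[OF eb_vb[OF M] \<Psi>]
        by (intro continuous_map_pairedI) (auto simp: vector_bundle_def)
      show "continuous_map (prod_topology unit_circle (Cspace n)) (total M) (\<lambda>(x, w). \<Psi> x w)"
        by (rule frame_cont[OF \<Psi>])
      show "(\<lambda>(x, w). \<Psi> x w) (f e) = e" if "e \<in> topspace (total M)" for e
        using fframe_inv[OF frame_at[OF M \<Psi> pM[OF that]] fib[OF that]] by (simp add: f_def)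
      show "f ((\<lambda>(x, w). \<Psi> x w) z) = z" if "z \<in> topspace (prod_topology unit_circle (Cspace n))" for z
        using that f\<Psi> by auto
    qed
    then have "homeomorphic_map (total M) (prod_topology unit_circle (Cspace n)) f"
      using homeomorphic_maps_map by blast
    moreover have "f e \<in> fiber (product_bundle unit_circle ca n B) x \<and>
      (\<forall>e'\<in>fiber M x. f (fadd M e e') = fadd (product_bundle unit_circle ca n B) (f e) (f e')) \<and>
      (\<forall>c. f (fscale M c e) = fscale (product_bundle unit_circle ca n B) c (f e)) \<and>
      (\<forall>g\<in>carrier K. f (act M g e) = act (product_bundle unit_circle ca n B) g (f e))"
      if x: "x \<in> sphere 0 1" and e: "e \<in> fiber M x" for x e
    proof -
      note F = frame_at[OF M \<Psi> x]
      obtain w where w: "w \<in> Cn n" "e = \<Psi> x w" using ex[OF e x] by blast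
      have "f (fadd M e e') = fadd (product_bundle unit_circle ca n B) (f e) (f e')" if "e' \<in> fiber M x" for e'
      proof -
        obtain w' where w': "w' \<in> Cn n" "e' = \<Psi> x w'" using ex[OF \<open>e' \<in> fiber M x\<close> x] by blast
        show ?thesis
          using f\<Psi>[OF x Cn_add[OF w(1) w'(1)]] f\<Psi>[OF x w(1)] f\<Psi>[OF x w'(1)]
          by (simp add: w w' fframe_add[OF F] product_bundle_def)
      qed
      moreover have "f (fscale M c e) = fscale (product_bundle unit_circle ca n B) c (f e)" for c
        using f\<Psi>[OF x Cn_scale[OF w(1), of c]] f\<Psi>[OF x w(1)]
        by (simp add: w fframe_scale[OF F] product_bundle_def)
      moreover have "f (act M g e) = act (product_bundle unit_circle ca n B) g (f e)" if g: "g \<in> carrier K" for g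
        using f\<Psi>[OF ca_sphere[OF g x] BC[OF g w(1)]] f\<Psi>[OF x w(1)]
        by (simp add: w Bact[OF g w(1) x] product_bundle_def)
      ultimately show ?thesis
        using f\<Psi>[OF x w(1)] x w by (simp add: product_bundle_def fiber_def)
    qed
    ultimately show ?thesis
      unfolding bundle_iso_def by (intro exI[of _ f]) (auto simp: product_bundle_def)
  qed
  ultimately show ?thesis unfolding trivial_bundle_def by blast
qed

text \<open>Given a trivialization, its matrices \<open>A x\<close> all intertwine \<open>R\<close>
  with the restriction of the model to \<open>H\<close>, so by Schur's lemma they differ from
  \<open>A (circ 0)\<close> by a scalar \<open>u x\<close>; the inverse of \<open>u\<close> is the
  required rescaling. Conversely, rescaling the frame makes all matrices constant.\<close>

lemma trivial_iff_coboundary: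
  assumes MK: "K_bundle K T unit_circle ca M" and \<Psi>: "frame unit_circle (\<lambda>x. x) M n H R \<Psi>"
    and S: "schurian n H R"
    and q: "\<And>g x. g \<in> carrier K \<Longrightarrow> x \<in> sphere 0 1 \<Longrightarrow> q g x \<noteq> 0"
      "\<And>g x w. g \<in> carrier K \<Longrightarrow> x \<in> sphere 0 1 \<Longrightarrow> w \<in> Cn n \<Longrightarrow> coc M n \<Psi> g x w = (\<lambda>i. q g x * B g w i)"
  shows "trivial_bundle K T unit_circle ca M \<longleftrightarrow> coboundary q"
proof
  note M = K_bundle_ebundle[OF MK] and x0 = circ_in_sphere[of 0]
  note ev0 = ev0[OF M \<Psi> S]
  assume "trivial_bundle K T unit_circle ca M"
  then obtain m R' f where R': "K_module K T m R'"
    and hf: "homeomorphic_map (total M) (total (product_bundle unit_circle ca m R')) f"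
    and f0: "\<forall>x\<in>topspace unit_circle. \<forall>e\<in>fiber M x.
           f e \<in> fiber (product_bundle unit_circle ca m R') x \<and>
           (\<forall>e'\<in>fiber M x. f (fadd M e e') = fadd (product_bundle unit_circle ca m R') (f e) (f e')) \<and>
           (\<forall>c. f (fscale M c e) = fscale (product_bundle unit_circle ca m R') c (f e)) \<and>
           (\<forall>g\<in>carrier K. f (act M g e) = act (product_bundle unit_circle ca m R') g (f e))"
    unfolding trivial_bundle_def bundle_iso_def by (elim exE conjE) (rule that)
  have rep: "rep K m R'" by (rule K_module_rep[OF R' top])
  have tot: "total (product_bundle unit_circle ca m R') = prod_topology unit_circle (Cspace m)"
    by (simp add: product_bundle_def)
  \<comment> \<open>The trivialization written in the frame. That the rank of the model equals
    \<open>n\<close> follows only from the bijectivity of \<open>A x\<close>.\<close>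
  define A where "A x w = snd (f (\<Psi> x w))" for x w
  have f1: "f e = (x, snd (f e)) \<and> snd (f e) \<in> Cn m" if "x \<in> sphere 0 1" "e \<in> fiber M x" for x e
    using f0[rule_format, of x e] that by (auto simp: product_bundle_def fiber_def prod_eq_iff)
  have fA: "f (\<Psi> x w) = (x, A x w)" "A x w \<in> Cn m" if "x \<in> sphere 0 1" "w \<in> Cn n" for x w
    using f1[OF that(1) fframe_fiber[OF frame_at[OF M \<Psi> that(1)] that(2)]] by (simp_all add: A_def)
  have linA: "lin n m (A x)" if x: "x \<in> sphere 0 1" for x
  proof (rule linI)
    note F = frame_at[OF M \<Psi> x]
    fix v assume v: "v \<in> Cn n"
    note fv = f0[rule_format, of x "\<Psi> x v"]
    have fv': "x \<in> topspace unit_circle" "\<Psi> x v \<in> fiber M x" using x fframe_fiber[OF F v] by auto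
    show "A x v \<in> Cn m" using fA(2)[OF x v] .
    show "A x (\<lambda>i. v i + w i) = (\<lambda>i. A x v i + A x w i)" if w: "w \<in> Cn n" for w
    proof -
      have "f (fadd M (\<Psi> x v) (\<Psi> x w)) = fadd (product_bundle unit_circle ca m R') (f (\<Psi> x v)) (f (\<Psi> x w))"
        using f0 fv' fframe_fiber[OF F w] by blast
      then show ?thesis using fA(1)[OF x v] fA(1)[OF x w] fA(1)[OF x Cn_add[OF v w]]
        by (simp add: fframe_add[OF F v w] product_bundle_def)
    qed
    show "A x (\<lambda>i. c * v i) = (\<lambda>i. c * A x v i)" for c
    proof -
      have "f (fscale M c (\<Psi> x v)) = fscale (product_bundle unit_circle ca m R') c (f (\<Psi> x v))"
        using f0 fv' by blast
      then show ?thesis using fA(1)[OF x v] fA(1)[OF x Cn_scale[OF v, of c]]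
        by (simp add: fframe_scale[OF F v] product_bundle_def)
    qed
  qed
  have bijA: "bij_betw (A x) (Cn n) (Cn m)" if x: "x \<in> sphere 0 1" for x
    unfolding bij_betw_def
  proof (intro conjI inj_onI equalityI subsetI)
    note F = frame_at[OF M \<Psi> x]
    have injf: "inj_on f (topspace (total M))" and surjf: "f ` topspace (total M) = topspace (prod_topology unit_circle (Cspace m))"
      using hf tot by (auto simp: homeomorphic_eq_everything_map)
    show "v = w" if "v \<in> Cn n" "w \<in> Cn n" "A x v = A x w" for v w
    proof -
      have "f (\<Psi> x v) = f (\<Psi> x w)" using fA(1)[OF x that(1)] fA(1)[OF x that(2)] that(3) by simp
      then have "\<Psi> x v = \<Psi> x w"
        using injf fframe_fiber[OF F that(1)] fframe_fiber[OF F that(2)] by (auto simp: fiber_def dest: inj_onD)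
      then show ?thesis using fframe_inj[OF F] that by blast
    qed
    show "y \<in> A x ` Cn n" if y: "y \<in> Cn m" for y
    proof -
      have "(x, y) \<in> f ` topspace (total M)" using surjf x y by simp
      then obtain e where e: "e \<in> topspace (total M)" "f e = (x, y)" by force
      have pe: "proj M e \<in> sphere 0 1"
        using funcset_mem[OF continuous_map_funspace[of "total M" unit_circle "proj M"] e(1)] eb_vb[OF M]
        by (simp add: vector_bundle_def)
      have "e \<in> fiber M (proj M e)" using e by (simp add: fiber_def)
      from f1[OF pe this] have ex: "e \<in> fiber M x" using e by (simp add: fiber_def)
      obtain w where "w \<in> Cn n" "e = \<Psi> x w" using fframe_inv[OF F ex] by metis
      then show ?thesis using fA(1)[OF x, of w] e(2) by auto
    qed
    show "y \<in> Cn m" if "y \<in> A x ` Cn n" for y using that fA(2)[OF x] by auto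
  qed
  have Aact: "A (ca g x) (\<lambda>i. q g x * B g w i) = R' g (A x w)"
    if g: "g \<in> carrier K" and x: "x \<in> sphere 0 1" and w: "w \<in> Cn n" for g x w
  proof -
    have "f (act M g (\<Psi> x w)) = act (product_bundle unit_circle ca m R') g (f (\<Psi> x w))"
      using f0 x g fframe_fiber[OF frame_at[OF M \<Psi> x] w] by simp
    then show ?thesis
      using fA(1)[OF ca_sphere[OF g x] coc_Cn[OF M \<Psi> g x w]] fA(1)[OF x w]
      by (simp add: coc_act[OF M \<Psi> g x w] product_bundle_def q(2)[OF g x w])
  qed
  have AH: "A x (R h w) = R' h (A x w)" if h: "h \<in> H" and x: "x \<in> sphere 0 1" and w: "w \<in> Cn n" for h x w
  proof -
    have hK: "h \<in> carrier K" using h H_subset by blast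
    have "coc M n \<Psi> h x w = R h w" by (rule coc_H[OF M \<Psi> h x w RC[OF M \<Psi> S h w]])
    then show ?thesis using Aact[OF hK x w] q(2)[OF hK x w] by (simp add: ca_H h)
  qed
  let ?I = "inv_into (Cn n) (A (circ 0))"
  have I: "?I v \<in> Cn n" "A (circ 0) (?I v) = v" if "v \<in> Cn m" for v
    using bijA[OF x0] that by (auto simp: bij_betw_def inv_into_into f_inv_into_f)
  have II: "?I (A (circ 0) v) = v" if "v \<in> Cn n" for v
    using bijA[OF x0] that by (auto simp: bij_betw_def)
  have "\<exists>c. c \<noteq> 0 \<and> (\<forall>w\<in>Cn n. A x w = (\<lambda>i. c * A (circ 0) w i))" if x: "x \<in> sphere 0 1" for x
  proof -
    have "?I (A x (R h w)) = R h (?I (A x w))" if h: "h \<in> H" and w: "w \<in> Cn n" for h w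
    proof -
      have "A x (R h w) = A (circ 0) (R h (?I (A x w)))"
        using AH[OF h x w] AH[OF h x0 I(1)[OF fA(2)[OF x w]]] I(2)[OF fA(2)[OF x w]] by simp
      then show ?thesis using II[OF RC[OF M \<Psi> S h I(1)[OF fA(2)[OF x w]]]] by simp
    qed
    moreover have "lin n n (\<lambda>w. ?I (A x w))"
      by (rule lin_comp[OF linA[OF x] lin_inv_into[OF linA[OF x0] bijA[OF x0]]])
    moreover have "bij_betw (\<lambda>w. ?I (A x w)) (Cn n) (Cn n)"
      using bij_betw_trans[OF bijA[OF x] bij_betw_inv_into[OF bijA[OF x0]]] by (simp add: o_def)
    ultimately obtain c where c: "c \<noteq> 0" "\<And>w. w \<in> Cn n \<Longrightarrow> ?I (A x w) = (\<lambda>i. c * w i)"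
      using schurian_scalar[OF S, of "\<lambda>w. ?I (A x w)"] by blast
    have "A x w = (\<lambda>i. c * A (circ 0) w i)" if w: "w \<in> Cn n" for w
      using c(2)[OF w] I(2)[OF fA(2)[OF x w]] lin_scale[OF linA[OF x0] w] by metis
    then show ?thesis using c(1) by blast
  qed
  then obtain u where u: "\<And>x. x \<in> sphere 0 1 \<Longrightarrow> u x \<noteq> 0"
    "\<And>x w. x \<in> sphere 0 1 \<Longrightarrow> w \<in> Cn n \<Longrightarrow> A x w = (\<lambda>i. u x * A (circ 0) w i)" by metis
  have Anz: "A (circ 0) w \<noteq> (\<lambda>_. 0)" if "w \<in> Cn n" "w \<noteq> (\<lambda>_. 0)" for w
    using bijA[OF x0] lin_inj_iff[OF linA[OF x0]] that by (auto simp: bij_betw_def)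
  obtain l where l: "A (circ 0) (ev 0) l \<noteq> 0" using Anz[OF ev0] by (auto simp: fun_eq_iff)
  have cA: "continuous_map unit_circle euclidean (\<lambda>x. A x (ev 0) l)"
  proof -
    have "continuous_map unit_circle (total M) (\<lambda>x. \<Psi> x (ev 0))"
      by (rule frame_cont_compose[OF \<Psi>]) (use ev0 in auto)
    moreover have "continuous_map (total M) (prod_topology unit_circle (Cspace m)) f"
      using hf tot by (simp add: homeomorphic_imp_continuous_map)
    ultimately have "continuous_map unit_circle (prod_topology unit_circle (Cspace m)) (\<lambda>x. f (\<Psi> x (ev 0)))"
      using continuous_map_compose by (fastforce simp: o_def)
    from continuous_map_compose[OF this continuous_map_snd]
    show ?thesis by (simp add: o_def A_def continuous_map_Cspace)
  qed
  \<comment> \<open>This is \<open>1 / u\<close>, written through a fixed coordinate that never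
    vanishes, which makes its continuity visible.\<close>
  define v where "v x = A (circ 0) (ev 0) l / A x (ev 0) l" for x
  have Al: "A x (ev 0) l \<noteq> 0" and vu: "v x = inverse (u x)" if "x \<in> sphere 0 1" for x
    using u[OF that] ev0(1) l by (simp_all add: v_def field_simps)
  have "continuous_map unit_circle euclidean v"
  proof -
    have c: "continuous_on (- {0}) (\<lambda>z::complex. A (circ 0) (ev 0) l / z)"
      by (intro continuous_intros) auto
    have "continuous_map unit_circle (top_of_set (- {0})) (\<lambda>x. A x (ev 0) l)"
      using cA Al by (auto simp: continuous_map_in_subtopology)
    from continuous_map_compose[OF this, of euclidean "\<lambda>z. A (circ 0) (ev 0) l / z"] c
    show ?thesis by (simp add: v_def[abs_def] o_def)
  qed
  moreover have "flat v g (q g)" if g: "g \<in> carrier K" for g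
  proof -
    let ?b = "B g (ev 0)"
    have bC: "?b \<in> Cn n" "?b \<noteq> (\<lambda>_. 0)"
    proof -
      have 1: "?b = (\<lambda>i. inverse (q g (circ 0)) * coc M n \<Psi> g (circ 0) (ev 0) i)"
        using q(2)[OF g x0 ev0(1)] q(1)[OF g x0] by (simp add: mult.assoc[symmetric])
      show "?b \<in> Cn n" unfolding 1 by (rule Cn_scale[OF coc_Cn[OF M \<Psi> g x0 ev0(1)]])
      show "?b \<noteq> (\<lambda>_. 0)"
        using coc_nonzero[OF M \<Psi> g x0 ev0] q(2)[OF g x0 ev0(1)] by (auto simp: fun_eq_iff)
    qed
    obtain k where k: "A (circ 0) ?b k \<noteq> 0" using Anz[OF bC] by (auto simp: fun_eq_iff)
    let ?r = "R' g (A (circ 0) (ev 0)) k"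
    \<comment> \<open>One coordinate of the equivariance of \<open>A\<close>: the factors that
      depend on \<open>x\<close> separate from the constants \<open>A (circ 0) ?b k\<close> and
      \<open>?r\<close>.\<close>
    have eq: "q g x * u (ca g x) * A (circ 0) ?b k = u x * ?r" if x: "x \<in> sphere 0 1" for x
    proof -
      have linR': "lin m m (R' g)" using rep g by (simp add: rep_def)
      have "A (ca g x) (\<lambda>i. q g x * ?b i) = (\<lambda>i. q g x * (u (ca g x) * A (circ 0) ?b i))"
        using lin_scale[OF linA[OF ca_sphere[OF g x]] bC(1)] u(2)[OF ca_sphere[OF g x] bC(1)] by simp
      moreover have "R' g (A x (ev 0)) = (\<lambda>i. u x * R' g (A (circ 0) (ev 0)) i)"
        using u(2)[OF x ev0(1)] lin_scale[OF linR' fA(2)[OF x0 ev0(1)]] by simp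
      ultimately show ?thesis
        using fun_cong[OF Aact[OF g x ev0(1)], of k] by (simp add: mult.assoc)
    qed
    have "?r \<noteq> 0"
      using eq[OF x0] q(1)[OF g x0] u(1)[OF ca_sphere[OF g x0]] k by auto
    then show ?thesis
      unfolding flat_def
    proof (intro exI[of _ "?r / A (circ 0) ?b k"] conjI ballI)
      show "v x * q g x = ?r / A (circ 0) ?b k * v (ca g x)" if x: "x \<in> sphere 0 1" for x
        using eq[OF x] u(1)[OF x] u(1)[OF ca_sphere[OF g x]] k
        unfolding vu[OF x] vu[OF ca_sphere[OF g x]] by (simp add: field_simps)
    qed (use k in auto)
  qed
  ultimately show "coboundary q"
    unfolding coboundary_def using vu u(1) by (intro exI[of _ v]) auto
next
  note M = K_bundle_ebundle[OF MK] and x0 = circ_in_sphere[of 0]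
  assume "coboundary q"
  then obtain u where u: "continuous_map unit_circle euclidean u" "\<And>x. x \<in> sphere 0 1 \<Longrightarrow> u x \<noteq> 0"
    "\<And>g. g \<in> carrier K \<Longrightarrow> flat u g (q g)" unfolding coboundary_def by blast
  define \<Psi>' where "\<Psi>' x w = \<Psi> x (\<lambda>i. u x * w i)" for x w
  have \<Psi>': "frame unit_circle (\<lambda>x. x) M n H R \<Psi>'"
    unfolding \<Psi>'_def by (rule frame_rescale[OF S \<Psi> u(1)]) (use u(2) in auto)
  show "trivial_bundle K T unit_circle ca M"
  proof (rule flat_frame_trivial[OF MK \<Psi>'])
    fix g w and x :: "real^2" assume g: "g \<in> carrier K" and x: "x \<in> sphere 0 1" and w: "w \<in> Cn n"
    obtain \<kappa> where \<kappa>: "\<And>x. x \<in> sphere 0 1 \<Longrightarrow> u x * q g x = \<kappa> * u (ca g x)"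
      using u(3)[OF g] unfolding flat_def by blast
    have BC: "B g w \<in> Cn n"
    proof -
      have "B g w = (\<lambda>i. inverse (q g x) * coc M n \<Psi> g x w i)" using q(2)[OF g x w] q(1)[OF g x] by (simp add: mult.assoc[symmetric])
      then show ?thesis using Cn_scale[OF coc_Cn[OF M \<Psi> g x w]] by simp
    qed
    have "coc M n \<Psi>' g y w = (\<lambda>i. \<kappa> * B g w i)" if y: "y \<in> sphere 0 1" for y
    proof (rule coc_eqI[OF M \<Psi>' g y Cn_scale[OF BC]])
      have "coc M n \<Psi> g y (\<lambda>i. u y * w i) = (\<lambda>i. u y * (q g y * B g w i))"
        using lin_scale[OF coc_lin[OF M \<Psi> g y] w] q(2)[OF g y w] by simp
      also have "\<dots> = (\<lambda>i. u (ca g y) * (\<kappa> * B g w i))"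
        using \<kappa>[OF y] by (auto simp: fun_eq_iff mult.assoc[symmetric])
      finally show "act M g (\<Psi>' y w) = \<Psi>' (ca g y) (\<lambda>i. \<kappa> * B g w i)"
        using coc_act[OF M \<Psi> g y Cn_scale[OF w]] by (simp add: \<Psi>'_def)
    qed
    then show "coc M n \<Psi>' g x w = coc M n \<Psi>' g (circ 0) w" using x x0 by simp
  qed
qed

text \<open>In the product frame the scalars of \<open>L\<close> and of the line bundle multiply.
  The condition \<open>r h x = 1\<close> on \<open>H\<close> keeps the frame equivariant for the
  original model \<open>R\<close>.\<close>

lemma tensor_trivial_iff:
  assumes LK: "K_bundle K T unit_circle ca L" and \<Phi>: "frame unit_circle (\<lambda>x. x) L n H R \<Phi>"
    and S: "schurian n H R" and M: "is_tensor_bundle K T unit_circle ca L F M"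
    and \<Theta>: "frame unit_circle (\<lambda>x. x) F 1 {} R1 \<Theta>"
    and r: "\<And>g x. g \<in> carrier K \<Longrightarrow> x \<in> sphere 0 1 \<Longrightarrow> r g x \<noteq> 0"
      "\<And>g x. g \<in> carrier K \<Longrightarrow> x \<in> sphere 0 1 \<Longrightarrow> act F g (\<Theta> x (ev 0)) = \<Theta> (ca g x) (\<lambda>i. r g x * ev 0 i)"
      "\<And>h x. h \<in> H \<Longrightarrow> x \<in> sphere 0 1 \<Longrightarrow> r h x = 1"
  shows "trivial_bundle K T unit_circle ca M \<longleftrightarrow> coboundary (\<lambda>g x. r g x * mul L n \<Phi> g x)"
proof -
  note L = K_bundle_ebundle[OF LK]
  have MK: "K_bundle K T unit_circle ca M" using M by (simp add: is_tensor_bundle_def)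
  note ME = K_bundle_ebundle[OF MK]
  obtain \<tau> where \<tau>c: "continuous_map
            (subtopology (prod_topology (total L) (total F)) {(e, f). proj L e = proj F f})
            (total M) (\<lambda>(e, f). \<tau> e f)"
    and \<tau>: "\<And>x. x \<in> topspace unit_circle \<Longrightarrow>
           (\<forall>e\<in>fiber L x. \<forall>f\<in>fiber F x.
              \<tau> e f \<in> fiber M x \<and>
              (\<forall>e'\<in>fiber L x. \<tau> (fadd L e e') f = fadd M (\<tau> e f) (\<tau> e' f)) \<and>
              (\<forall>f'\<in>fiber F x. \<tau> e (fadd F f f') = fadd M (\<tau> e f) (\<tau> e f')) \<and>
              (\<forall>c. \<tau> (fscale L c e) f = fscale M c (\<tau> e f) \<and>
                   \<tau> e (fscale F c f) = fscale M c (\<tau> e f)) \<and>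
              (\<forall>g\<in>carrier K. \<tau> (act L g e) (act F g f) = act M g (\<tau> e f)))"
    and univ: "\<And>x. x \<in> topspace unit_circle \<Longrightarrow>
           (\<forall>b. fiber_bilinear_form L F x b \<longrightarrow>
              (\<exists>!l. l \<in> extensional (fiber M x) \<and> fiber_functional M x l \<and>
                    (\<forall>e\<in>fiber L x. \<forall>f\<in>fiber F x. l (\<tau> e f) = b e f)))"
    using M unfolding is_tensor_bundle_def by (elim exE conjE) (rule that, assumption, simp_all)
  define \<Psi> where "\<Psi> x w = \<tau> (\<Phi> x w) (\<Theta> x (ev 0))" for x w
  have ev1: "ev 0 \<in> Cn 1" by simp
  have \<Psi>: "frame unit_circle (\<lambda>x. x) M n H R \<Psi>"
    unfolding \<Psi>_def
  proof (rule tensor_frame[OF eb_vb[OF ME] \<tau>c _ _ _ \<Phi> \<Theta>])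
    fix x and e f assume x: "x \<in> topspace unit_circle" and e: "e \<in> fiber L x" and f: "f \<in> fiber F x"
    show "\<tau> e f \<in> fiber M x \<and>
              (\<forall>e'\<in>fiber L x. \<tau> (fadd L e e') f = fadd M (\<tau> e f) (\<tau> e' f)) \<and>
              (\<forall>c. \<tau> (fscale L c e) f = fscale M c (\<tau> e f) \<and> \<tau> e (fscale F c f) = fscale M c (\<tau> e f))"
      using \<tau>[OF x, rule_format, OF e f] by blast
    show "\<tau> (act L g e) (act F g f) = act M g (\<tau> e f)" if "g \<in> H" for g
      using \<tau>[OF x, rule_format, OF e f] that H_subset by blast
  next
    fix x b assume "x \<in> topspace unit_circle" "fiber_bilinear_form L F x b"
    then show "\<exists>!l. l \<in> extensional (fiber M x) \<and> fiber_functional M x l \<and>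
                    (\<forall>e\<in>fiber L x. \<forall>f\<in>fiber F x. l (\<tau> e f) = b e f)"
      using univ by blast
  next
    fix x h assume "x \<in> topspace unit_circle" "h \<in> H"
    then show "act F h (\<Theta> x (ev 0)) = \<Theta> x (ev 0)"
      using r(2)[of h x] r(3)[of h x] H_subset by (auto simp: ca_H)
  qed
  show ?thesis
  proof (rule trivial_iff_coboundary[OF MK \<Psi> S, where B = "\<lambda>g. coc L n \<Phi> g (circ 0)"])
    fix g and x :: "real^2" assume g: "g \<in> carrier K" and x: "x \<in> sphere 0 1"
    show "r g x * mul L n \<Phi> g x \<noteq> 0" using r(1)[OF g x] mul_nonzero[OF L \<Phi> S g x] by simp
    fix w assume w: "w \<in> Cn n"
    note gx = ca_sphere[OF g x]
    note F\<Theta> = frame_fframe[OF \<Theta>, unfolded topspace_unit_circle]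
    note cw = coc_Cn[OF L \<Phi> g x w]
    note C0 = coc_Cn[OF L \<Phi> g circ_in_sphere[of 0] w]
    have "act M g (\<Psi> x w) = \<tau> (act L g (\<Phi> x w)) (act F g (\<Theta> x (ev 0)))"
      using \<tau>[of x, rule_format, OF _ fframe_fiber[OF frame_at[OF L \<Phi> x] w] fframe_fiber[OF F\<Theta>[OF x] ev1]] x g
      by (simp add: \<Psi>_def)
    also have "\<dots> = \<tau> (\<Phi> (ca g x) (coc L n \<Phi> g x w)) (fscale F (r g x) (\<Theta> (ca g x) (ev 0)))"
      by (simp only: coc_act[OF L \<Phi> g x w] r(2)[OF g x] fframe_scale[OF F\<Theta>[OF gx] ev1])
    also have "\<dots> = fscale M (r g x) (\<Psi> (ca g x) (coc L n \<Phi> g x w))"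
      using \<tau>[of "ca g x", rule_format, OF _ fframe_fiber[OF frame_at[OF L \<Phi> gx] cw] fframe_fiber[OF F\<Theta>[OF gx] ev1]] gx
      by (simp add: \<Psi>_def)
    also have "\<dots> = \<Psi> (ca g x) (\<lambda>i. r g x * coc L n \<Phi> g x w i)"
      by (rule fframe_scale[OF frame_at[OF ME \<Psi> gx] cw, symmetric])
    also have "(\<lambda>i. r g x * coc L n \<Phi> g x w i) = (\<lambda>i. r g x * mul L n \<Phi> g x * coc L n \<Phi> g (circ 0) w i)"
      using fun_cong[OF mul_eq[OF L \<Phi> S g x w]] by (simp add: mult.assoc)
    finally show "coc M n \<Psi> g x w = (\<lambda>i. r g x * mul L n \<Phi> g x * coc L n \<Phi> g (circ 0) w i)"
      by (intro coc_eqI[OF ME \<Psi> g x] Cn_scale[OF C0])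
  qed
qed

end

section \<open>Coboundaries for subgroups of the orthogonal group\<close>

lemma mat2_eq_iff: "(A :: real^2^2) = B \<longleftrightarrow>
    A $ 1 $ 1 = B $ 1 $ 1 \<and> A $ 1 $ 2 = B $ 1 $ 2 \<and> A $ 2 $ 1 = B $ 2 $ 1 \<and> A $ 2 $ 2 = B $ 2 $ 2"
  by (auto simp: vec_eq_iff forall_2)

lemma rot_nth [simp]: "rot t $ 1 $ 1 = cos t" "rot t $ 1 $ 2 = - sin t" "rot t $ 2 $ 1 = sin t" "rot t $ 2 $ 2 = cos t"
  by (simp_all add: rot_def)

lemma rot_circ: "rot s *v circ t = circ (t + s)"
  by (simp add: vec2_eq_iff matrix_vector_mult_def sum_2 cos_add sin_add algebra_simps)

lemma rot_mult: "rot s ** rot t = rot (s + t)"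
  by (simp add: mat2_eq_iff matrix_matrix_mult_def sum_2 cos_add sin_add algebra_simps)

lemma rot_0: "rot 0 = mat 1" and rot_2pi: "rot (2 * pi) = mat 1" and rot_periodic: "rot (t + 2 * pi) = rot t"
  by (simp_all add: mat2_eq_iff mat_def)

lemma rot_SO2: "rot t \<in> SO2"
  by (simp add: SO2_def rotation_matrix_def orthogonal_matrix det_2 mat2_eq_iff matrix_matrix_mult_def
      transpose_def sum_2 mat_def power2_eq_square[symmetric])

lemma rot_inj: "rot s = rot t \<longleftrightarrow> (\<exists>k::int. s = t + 2 * pi * k)"
  using circ_eq_iff[of s t] by (auto simp: mat2_eq_iff vec2_eq_iff)

lemma continuous_on_rot: "continuous_on UNIV rot"
proof -
  have "rot = (\<lambda>t. cos t *\<^sub>R rot 0 + sin t *\<^sub>R rot (pi / 2))"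
    by (rule ext) (simp add: mat2_eq_iff)
  moreover have "continuous_on UNIV (\<lambda>t. cos t *\<^sub>R rot 0 + sin t *\<^sub>R rot (pi / 2))"
    by (intro continuous_intros)
  ultimately show ?thesis by metis
qed

lemma O2_entries:
  assumes "A \<in> O2"
  shows "A $ 1 $ 1 * A $ 1 $ 1 + A $ 2 $ 1 * A $ 2 $ 1 = 1" "A $ 1 $ 1 * A $ 1 $ 2 + A $ 2 $ 1 * A $ 2 $ 2 = 0"
  using assms by (auto simp: O2_def orthogonal_matrix mat2_eq_iff matrix_matrix_mult_def transpose_def sum_2 mat_def)

lemma SO2_rot:
  assumes "A \<in> SO2"
  obtains t where "A = rot t"
proof -
  let ?a = "A $ 1 $ 1" and ?b = "A $ 1 $ 2" and ?c = "A $ 2 $ 1" and ?d = "A $ 2 $ 2"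
  have "A \<in> O2" using assms by (simp add: SO2_def O2_def rotation_matrix_def)
  note e = O2_entries[OF this]
  have det: "?a * ?d - ?b * ?c = 1" using assms by (simp add: SO2_def rotation_matrix_def det_2)
  have "?d = (?a * ?a + ?c * ?c) * ?d" using e(1) by simp
  also have "\<dots> = ?a * (?a * ?d - ?b * ?c) + ?c * (?a * ?b + ?c * ?d)" by (simp add: algebra_simps)
  finally have d: "?d = ?a" using e(2) det by simp
  have "?b = (?a * ?a + ?c * ?c) * ?b" using e(1) by simp
  also have "\<dots> = ?a * (?a * ?b + ?c * ?d) - ?c * (?a * ?d - ?b * ?c)" by (simp add: algebra_simps)
  finally have b: "?b = - ?c" using e(2) det by simp
  obtain t where "?a = cos t" "?c = sin t" using sincos_total_2pi[of ?a ?c] e(1) by (metis power2_eq_square)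
  then have "A = rot t" using b d by (simp add: mat2_eq_iff)
  then show ?thesis using that by blast
qed

lemma O2_reflection:
  assumes "A \<in> O2" "A \<notin> SO2"
  obtains t where "\<And>s. A *v circ s = circ (t - s)"
proof -
  let ?a = "A $ 1 $ 1" and ?b = "A $ 1 $ 2" and ?c = "A $ 2 $ 1" and ?d = "A $ 2 $ 2"
  note e = O2_entries[OF assms(1)]
  have "det A \<noteq> 1" "det A = 1 \<or> det A = -1"
    using assms det_orthogonal_matrix[of A] by (auto simp: O2_def SO2_def rotation_matrix_def)
  then have det: "?a * ?d - ?b * ?c = -1" by (simp add: det_2)
  have "?d = (?a * ?a + ?c * ?c) * ?d" using e(1) by simp
  also have "\<dots> = ?a * (?a * ?d - ?b * ?c) + ?c * (?a * ?b + ?c * ?d)" by (simp add: algebra_simps)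
  finally have d: "?d = - ?a" using e(2) det by simp
  have "?b = (?a * ?a + ?c * ?c) * ?b" using e(1) by simp
  also have "\<dots> = ?a * (?a * ?b + ?c * ?d) - ?c * (?a * ?d - ?b * ?c)" by (simp add: algebra_simps)
  finally have b: "?b = ?c" using e(2) det by simp
  obtain t where "?a = cos t" "?c = sin t" using sincos_total_2pi[of ?a ?c] e(1) by (metis power2_eq_square)
  then have "A *v circ s = circ (t - s)" for s
    using b d by (simp add: vec2_eq_iff matrix_vector_mult_def sum_2 cos_diff sin_diff algebra_simps)
  then show ?thesis using that by blast
qed

text \<open>With arbitrarily small positive elements the subgroup would be dense, hence all of the
  reals. Otherwise its least positive element generates it by division with remainder, and
  \<open>p\<close> is some multiple \<open>m\<close> of that element.\<close>

lemma closed_real_subgroup: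
  fixes \<Gamma> :: "real set"
  assumes cl: "closed \<Gamma>" and zero: "0 \<in> \<Gamma>" and add: "\<And>x y. x \<in> \<Gamma> \<Longrightarrow> y \<in> \<Gamma> \<Longrightarrow> x + y \<in> \<Gamma>"
    and neg: "\<And>x. x \<in> \<Gamma> \<Longrightarrow> - x \<in> \<Gamma>" and p: "p \<in> \<Gamma>" "0 < p" and proper: "\<Gamma> \<noteq> UNIV"
  obtains m :: nat where "0 < m" "\<Gamma> = {of_int k * (p / m) | k. True}"
proof -
  have nat: "of_nat j * x \<in> \<Gamma>" if "x \<in> \<Gamma>" for x and j :: nat
    using that zero add by (induction j) (auto simp: distrib_right)
  have int: "of_int k * x \<in> \<Gamma>" if "x \<in> \<Gamma>" for x and k :: int
    using nat[OF that] neg[OF nat[OF that]] by (cases k) (auto simp del: of_nat_Suc)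
  have "\<exists>e>0. \<forall>x\<in>\<Gamma>. 0 < x \<longrightarrow> e \<le> x"
  proof (rule ccontr)
    assume con: "\<not> ?thesis"
    have "y \<in> \<Gamma>" for y
    proof -
      have "y \<in> closure \<Gamma>"
        unfolding closure_approachable
      proof (intro allI impI)
        fix e :: real assume "e > 0"
        then obtain x where x: "x \<in> \<Gamma>" "0 < x" "x < e" using con by (meson not_le)
        have "of_int \<lfloor>y / x\<rfloor> \<le> y / x" "y / x < of_int \<lfloor>y / x\<rfloor> + 1" by simp_all
        then have "of_int \<lfloor>y / x\<rfloor> * x \<le> y" "y < of_int \<lfloor>y / x\<rfloor> * x + x"
          unfolding pos_le_divide_eq[OF x(2)] pos_divide_less_eq[OF x(2)] by (simp_all add: distrib_right)
        then have "dist (of_int \<lfloor>y / x\<rfloor> * x) y < e" using x(3) by (simp add: dist_real_def)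
        then show "\<exists>z\<in>\<Gamma>. dist z y < e" using int[OF x(1)] by blast
      qed
      then show ?thesis using cl by simp
    qed
    then show False using proper by blast
  qed
  then obtain e where e: "e > 0" "\<And>x. x \<in> \<Gamma> \<Longrightarrow> 0 < x \<Longrightarrow> e \<le> x" by blast
  \<comment> \<open>Cutting at \<open>e\<close> keeps the set closed and excludes 0, so the infimum
    is attained and positive.\<close>
  define X where "X = \<Gamma> \<inter> {e..}"
  define l where "l = Inf X"
  have X: "closed X" "X \<noteq> {}" "bdd_below X"
    using cl p e(2)[OF p] by (auto simp: X_def intro!: closed_Int)
  have lX: "l \<in> X" unfolding l_def by (rule closed_contains_Inf[OF X(2,3,1)])
  then have l: "l \<in> \<Gamma>" "0 < l" using e(1) by (auto simp: X_def)
  have min: "l \<le> x" if "x \<in> \<Gamma>" "0 < x" for x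
    unfolding l_def by (rule cInf_lower[OF _ X(3)]) (use that e(2) in \<open>auto simp: X_def\<close>)
  have mult: "\<exists>k::int. x = of_int k * l" if x: "x \<in> \<Gamma>" for x
  proof (intro exI[of _ "\<lfloor>x / l\<rfloor>"])
    let ?r = "x - of_int \<lfloor>x / l\<rfloor> * l"
    have "?r \<in> \<Gamma>" using add[OF x neg[OF int[OF l(1)]], of "\<lfloor>x / l\<rfloor>"] by simp
    moreover have "of_int \<lfloor>x / l\<rfloor> \<le> x / l" "x / l < of_int \<lfloor>x / l\<rfloor> + 1" by simp_all
    then have "0 \<le> ?r" "?r < l"
      unfolding pos_le_divide_eq[OF l(2)] pos_divide_less_eq[OF l(2)] by (simp_all add: distrib_right)
    ultimately show "x = of_int \<lfloor>x / l\<rfloor> * l" using min[of ?r] by fastforce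
  qed
  obtain k where k: "p = of_int k * l" using mult[OF p(1)] by blast
  then have "0 < k" using p(2) l(2) by (simp add: zero_less_mult_iff)
  then have "l = p / nat k" using k by simp
  moreover have "\<Gamma> = {of_int k * l | k. True}" using mult int[OF l(1)] by auto
  ultimately show ?thesis using that[of "nat k"] \<open>0 < k\<close> by auto
qed

section \<open>Cocycles up to constants and their trivialization\<close>

context circle_rep begin

text \<open>The constant \<open>\<kappa>\<close> depends on \<open>g\<close> and \<open>h\<close>
  but not on \<open>x\<close>; this is the form of cocycle identity that the normalized factors
  \<open>mul\<close> satisfy, and it is stable under products.\<close>

definition pcocycle :: "('k \<Rightarrow> real^2 \<Rightarrow> complex) \<Rightarrow> bool" where
  "pcocycle q \<longleftrightarrow> (\<forall>g\<in>carrier K. continuous_map unit_circle euclidean (q g) \<and> (\<forall>x\<in>sphere 0 1. q g x \<noteq> 0)) \<and>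
     (\<forall>h\<in>H. \<forall>x\<in>sphere 0 1. q h x = 1) \<and>
     (\<forall>g\<in>carrier K. \<forall>h\<in>carrier K. \<exists>\<kappa>. \<kappa> \<noteq> 0 \<and> (\<forall>x\<in>sphere 0 1. q (g \<otimes>\<^bsub>K\<^esub> h) x = \<kappa> * (q g (ca h x) * q h x)))"

lemma
  assumes "pcocycle q"
  shows pcocycle_cont: "g \<in> carrier K \<Longrightarrow> continuous_map unit_circle euclidean (q g)"
    and pcocycle_nonzero: "g \<in> carrier K \<Longrightarrow> x \<in> sphere 0 1 \<Longrightarrow> q g x \<noteq> 0"
    and pcocycle_H: "h \<in> H \<Longrightarrow> x \<in> sphere 0 1 \<Longrightarrow> q h x = 1"
    and pcocycle_mult: "g \<in> carrier K \<Longrightarrow> h \<in> carrier K \<Longrightarrow>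
       \<exists>\<kappa>. \<kappa> \<noteq> 0 \<and> (\<forall>x\<in>sphere 0 1. q (g \<otimes>\<^bsub>K\<^esub> h) x = \<kappa> * (q g (ca h x) * q h x))"
  using assms by (auto simp: pcocycle_def)

lemma pcocycle_times:
  assumes p: "pcocycle p" and q: "pcocycle q"
  shows "pcocycle (\<lambda>g x. p g x * q g x)"
  unfolding pcocycle_def
proof (intro conjI ballI)
  show "continuous_map unit_circle euclidean (\<lambda>x. p g x * q g x)" if "g \<in> carrier K" for g
    by (intro continuous_map_mult pcocycle_cont[OF p that] pcocycle_cont[OF q that])
  show "\<exists>\<kappa>. \<kappa> \<noteq> 0 \<and> (\<forall>x\<in>sphere 0 1. p (g \<otimes>\<^bsub>K\<^esub> h) x * q (g \<otimes>\<^bsub>K\<^esub> h) x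
      = \<kappa> * (p g (ca h x) * q g (ca h x) * (p h x * q h x)))"
    if gh: "g \<in> carrier K" "h \<in> carrier K" for g h
  proof -
    obtain \<kappa> where \<kappa>: "\<kappa> \<noteq> 0" "\<And>x. x \<in> sphere 0 1 \<Longrightarrow> p (g \<otimes>\<^bsub>K\<^esub> h) x = \<kappa> * (p g (ca h x) * p h x)"
      using pcocycle_mult[OF p gh] by blast
    obtain \<mu> where \<mu>: "\<mu> \<noteq> 0" "\<And>x. x \<in> sphere 0 1 \<Longrightarrow> q (g \<otimes>\<^bsub>K\<^esub> h) x = \<mu> * (q g (ca h x) * q h x)"
      using pcocycle_mult[OF q gh] by blast
    show ?thesis by (intro exI[of _ "\<kappa> * \<mu>"] conjI ballI) (use \<kappa>(1) \<mu>(1) in \<open>simp_all add: \<kappa>(2) \<mu>(2) ac_simps\<close>)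
  qed
qed (use pcocycle_nonzero[OF p] pcocycle_nonzero[OF q] pcocycle_H[OF p] pcocycle_H[OF q] in auto)

lemma mul_pcocycle:
  assumes "ebundle E" "frame unit_circle (\<lambda>x. x) E n H R \<Phi>" "schurian n H R"
  shows "pcocycle (mul E n \<Phi>)"
  unfolding pcocycle_def
proof (intro conjI ballI)
  show "\<exists>\<kappa>. \<kappa> \<noteq> 0 \<and> (\<forall>x\<in>sphere 0 1. mul E n \<Phi> (g \<otimes>\<^bsub>K\<^esub> h) x = \<kappa> * (mul E n \<Phi> g (ca h x) * mul E n \<Phi> h x))"
    if g: "g \<in> carrier K" and h: "h \<in> carrier K" for g h
  proof -
    have nz: "mul E n \<Phi> g (ca h (circ 0)) \<noteq> 0"
      by (rule mul_nonzero[OF assms g ca_sphere[OF h circ_in_sphere]])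
    show ?thesis
      by (intro exI[of _ "inverse (mul E n \<Phi> g (ca h (circ 0)))"] conjI ballI)
        (use nz mul_mult[OF assms g h] in \<open>simp_all add: field_simps\<close>)
  qed
qed (use mul_cont[OF assms] mul_nonzero[OF assms] mul_H[OF assms] in auto)

text \<open>Reduces flatness for the whole group to a few generators: one rotation and, in the
  dihedral case, one reflection.\<close>

lemma flat_mult:
  assumes q: "pcocycle q" and g: "g \<in> carrier K" "h \<in> carrier K" and f: "flat u g (q g)" "flat u h (q h)"
  shows "flat u (g \<otimes>\<^bsub>K\<^esub> h) (q (g \<otimes>\<^bsub>K\<^esub> h))"
proof -
  obtain a where a: "a \<noteq> 0" "\<And>x. x \<in> sphere 0 1 \<Longrightarrow> u x * q g x = a * u (ca g x)" using f(1) unfolding flat_def by blast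
  obtain b where b: "b \<noteq> 0" "\<And>x. x \<in> sphere 0 1 \<Longrightarrow> u x * q h x = b * u (ca h x)" using f(2) unfolding flat_def by blast
  obtain \<kappa> where \<kappa>: "\<kappa> \<noteq> 0" "\<And>x. x \<in> sphere 0 1 \<Longrightarrow> q (g \<otimes>\<^bsub>K\<^esub> h) x = \<kappa> * (q g (ca h x) * q h x)"
    using pcocycle_mult[OF q g] by blast
  show ?thesis
    unfolding flat_def
  proof (intro exI[of _ "\<kappa> * b * a"] conjI ballI)
    show "u x * q (g \<otimes>\<^bsub>K\<^esub> h) x = \<kappa> * b * a * u (ca (g \<otimes>\<^bsub>K\<^esub> h) x)" if x: "x \<in> sphere 0 1" for x
    proof -
      have "u x * q (g \<otimes>\<^bsub>K\<^esub> h) x = \<kappa> * (u x * q h x) * q g (ca h x)" by (simp add: \<kappa>(2)[OF x] ac_simps)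
      also have "\<dots> = \<kappa> * b * (u (ca h x) * q g (ca h x))" by (simp add: b(2)[OF x] ac_simps)
      finally show ?thesis by (simp add: a(2)[OF ca_sphere[OF g(2) x]] ca_mult[OF g] ac_simps)
    qed
  qed (use \<kappa>(1) a(1) b(1) in simp)
qed

lemma flat_H: "pcocycle q \<Longrightarrow> h \<in> H \<Longrightarrow> flat u h (q h)"
  unfolding flat_def by (intro exI[of _ 1]) (simp add: pcocycle_H ca_H)

lemma flat_pow:
  assumes q: "pcocycle q" and g: "g \<in> carrier K" and f: "flat u g (q g)"
  shows "flat u (g [^]\<^bsub>K\<^esub> (k::nat)) (q (g [^]\<^bsub>K\<^esub> k))"
  by (induction k) (use flat_H[OF q one_H] flat_mult[OF q nat_pow_closed[OF g] g _ f] in auto)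

text \<open>The two elements differ by an element of \<open>H\<close>, for which any
  \<open>u\<close> is flat; so only the image under \<open>\<rho>\<close> matters.\<close>

lemma flat_factor:
  assumes q: "pcocycle q" and g: "g \<in> carrier K" "g' \<in> carrier K" and f: "flat u g (q g)" and e: "\<rho> g = \<rho> g'"
  shows "flat u g' (q g')"
proof -
  have h: "inv\<^bsub>K\<^esub> g \<otimes>\<^bsub>K\<^esub> g' \<in> H" using H_iff[OF g] e by blast
  have "flat u (g \<otimes>\<^bsub>K\<^esub> (inv\<^bsub>K\<^esub> g \<otimes>\<^bsub>K\<^esub> g')) (q (g \<otimes>\<^bsub>K\<^esub> (inv\<^bsub>K\<^esub> g \<otimes>\<^bsub>K\<^esub> g')))"
    by (rule flat_mult[OF q g(1) _ f flat_H[OF q h]]) (use g in simp)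
  then show ?thesis using g by (simp add: m_assoc[symmetric])
qed

lemma rho_pow: "g \<in> carrier K \<Longrightarrow> \<rho> g = rot l \<Longrightarrow> \<rho> (g [^]\<^bsub>K\<^esub> (k::nat)) = rot (k * l)"
  by (induction k) (auto simp: rho_one rot_0 rho_mult rot_mult algebra_simps)

lemma rot_multiple:
  fixes k :: int and m :: nat
  assumes "0 < m"
  obtains j :: nat where "rot (k * (2 * pi / m)) = rot (j * (2 * pi / m))" "j < m"
proof -
  define j where "j = nat (k mod int m)"
  have j: "int j = k mod int m" using assms by (simp add: j_def)
  have "k = (k div int m) * int m + int j" by (simp add: j)
  then have "real_of_int k = of_int (k div int m) * real m + real j" by (metis of_int_add of_int_mult of_int_of_nat_eq)
  then have "k * (2 * pi / m) = j * (2 * pi / m) + 2 * pi * of_int (k div int m)"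
    using assms by (simp add: field_simps)
  moreover have "j < m" using j assms by (metis of_nat_less_iff pos_mod_bound of_nat_0_less_iff)
  ultimately show ?thesis using that rot_inj by metis
qed

lemma flat_rotations:
  fixes k :: int and m :: nat
  assumes q: "pcocycle q" and g: "g \<in> carrier K" "\<rho> g = rot (2 * pi / m)" and m: "0 < m"
    and f: "flat u g (q g)" and p: "p \<in> carrier K" "\<rho> p = rot (k * (2 * pi / m))"
  shows "flat u p (q p)"
proof -
  obtain j :: nat where j: "rot (k * (2 * pi / m)) = rot (j * (2 * pi / m))" by (rule rot_multiple[OF m])
  show ?thesis
    by (rule flat_factor[OF q nat_pow_closed[OF g(1)] p(1) flat_pow[OF q g(1) f, of j]])
      (simp only: rho_pow[OF g] p(2) j)
qed

text \<open>By the cocycle identity, \<open>q\<close> at the \<open>m\<close>-th power of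
  \<open>g\<close> is a constant times the product of the values of \<open>q g\<close> over all
  rotated points. That power lies in \<open>H\<close>, so the product is constant, as
  \<open>cyclic_cocycle_trivial\<close> demands.\<close>

lemma generator_flat:
  fixes m :: nat
  assumes q: "pcocycle q" and g: "g \<in> carrier K" "\<rho> g = rot (2 * pi / m)" and m: "0 < m"
  obtains u where "continuous_map unit_circle euclidean u" "\<And>x. x \<in> sphere 0 1 \<Longrightarrow> u x \<noteq> 0" "flat u g (q g)"
proof -
  define l where "l = 2 * pi / m"
  define c where "c t = q g (circ t)" for t
  have gl: "ca g (circ t) = circ (t + l)" for t using g(2) by (simp add: circle_action_def rot_circ l_def)
  have cc: "continuous_on UNIV c"
    using continuous_on_circle_pullback[OF pcocycle_cont[OF q g(1)], of 0] by (simp add: c_def[abs_def])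
  have cnz: "c t \<noteq> 0" for t using pcocycle_nonzero[OF q g(1) circ_in_sphere] by (simp add: c_def)
  have "\<exists>\<kappa>. \<kappa> \<noteq> 0 \<and> (\<forall>t. q (g [^]\<^bsub>K\<^esub> k) (circ t) = \<kappa> * (\<Prod>j<k. c (t + j * l)))" for k :: nat
  proof (induction k)
    case 0
    show ?case by (intro exI[of _ 1]) (use pcocycle_H[OF q one_H circ_in_sphere] in simp)
  next
    case (Suc k)
    then obtain \<kappa> where \<kappa>: "\<kappa> \<noteq> 0" "\<And>t. q (g [^]\<^bsub>K\<^esub> k) (circ t) = \<kappa> * (\<Prod>j<k. c (t + j * l))" by blast
    obtain \<mu> where \<mu>: "\<mu> \<noteq> 0" "\<And>x. x \<in> sphere 0 1 \<Longrightarrow> q (g [^]\<^bsub>K\<^esub> k \<otimes>\<^bsub>K\<^esub> g) x = \<mu> * (q (g [^]\<^bsub>K\<^esub> k) (ca g x) * q g x)"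
      using pcocycle_mult[OF q nat_pow_closed[OF g(1)] g(1)] by blast
    show ?case
    proof (intro exI[of _ "\<mu> * \<kappa>"] conjI allI)
      fix t
      have "(\<Prod>j<Suc k. c (t + j * l)) = c t * (\<Prod>j<k. c (t + l + j * l))"
        by (subst prod.lessThan_Suc_shift) (simp add: algebra_simps)
      then show "q (g [^]\<^bsub>K\<^esub> Suc k) (circ t) = \<mu> * \<kappa> * (\<Prod>j<Suc k. c (t + j * l))"
        using \<mu>(2)[OF circ_in_sphere, of t] by (simp add: gl \<kappa>(2) c_def[symmetric])
    qed (use \<kappa>(1) \<mu>(1) in simp)
  qed
  then obtain \<kappa> where \<kappa>: "\<kappa> \<noteq> 0" "\<And>t. q (g [^]\<^bsub>K\<^esub> m) (circ t) = \<kappa> * (\<Prod>j<m. c (t + j * l))" by blast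
  have "\<rho> (g [^]\<^bsub>K\<^esub> m) = mat 1" using rho_pow[OF g, of m] m by (simp add: rot_2pi)
  then have "g [^]\<^bsub>K\<^esub> m \<in> H" using H nat_pow_closed[OF g(1)] by simp
  then have one: "\<kappa> * (\<Prod>j<m. c (t + j * l)) = 1" for t using pcocycle_H[OF q _ circ_in_sphere] \<kappa>(2) by metis
  have prod: "(\<Prod>j<m. c (s + j * l)) = (\<Prod>j<m. c (t + j * l))" for s t
    using one[of s] one[of t] \<kappa>(1) by (metis mult_cancel_left)
  obtain u \<mu> where u: "continuous_on UNIV u" "\<And>t. u t \<noteq> 0" "\<And>t. u (t + 2 * pi) = u t" "\<mu> \<noteq> 0"
    "\<And>t. u t * c t = \<mu> * u (t + l)"
    using cyclic_cocycle_trivial[OF cc cnz _ m] prod unfolding l_def c_def by (metis circ_periodic)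
  obtain h where h: "continuous_map unit_circle euclidean h" "\<And>t. h (circ (0 + t)) = u t"
    using circle_function[OF u(1,3)] by blast
  have hx: "h (circ t) = u t" for t using h(2)[of t] by simp
  show ?thesis
  proof (rule that[OF h(1)])
    show "h x \<noteq> 0" if "x \<in> sphere 0 1" for x using circ_surj[OF that] hx u(2) by metis
    show "flat h g (q g)"
      unfolding flat_def
    proof (intro exI[of _ \<mu>] conjI ballI u(4))
      fix x :: "real^2" assume "x \<in> sphere 0 1"
      then obtain t where "x = circ t" using circ_surj by blast
      then show "h x * q g x = \<mu> * h (ca g x)" using u(5)[of t] by (simp add: hx gl c_def)
    qed
  qed
qed

lemma cyclic_coboundary:
  fixes m :: nat
  assumes q: "pcocycle q" and m: "0 < m"
    and rots: "\<And>p. p \<in> carrier K \<Longrightarrow> \<exists>k::int. \<rho> p = rot (k * (2 * pi / m))"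
    and g: "g \<in> carrier K" "\<rho> g = rot (2 * pi / m)"
  shows "coboundary q"
proof -
  obtain u where u: "continuous_map unit_circle euclidean u" "\<And>x. x \<in> sphere 0 1 \<Longrightarrow> u x \<noteq> 0" "flat u g (q g)"
    using generator_flat[OF q g m] by blast
  have "flat u p (q p)" if p: "p \<in> carrier K" for p
    using rots[OF p] flat_rotations[OF q g m u(3) p] by blast
  then show ?thesis using u unfolding coboundary_def by blast
qed

text \<open>Rotations have lifts \<open>G s\<close>, with no continuity in \<open>s\<close>.
  Normalization at \<open>circ 0\<close> makes the multiplier independent of the lift, and
  compactness of the group then makes it continuous in the angle.\<close>

lemma transitive_coboundary:
  assumes q: "pcocycle q" and base: "\<And>g. g \<in> carrier K \<Longrightarrow> q g (circ 0) = 1"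
    and cont: "continuous_map (prod_topology T unit_circle) euclidean (\<lambda>(g, x). q g x)"
    and comp: "compact_space T" and SO2: "\<rho> ` carrier K = SO2"
  shows "coboundary q"
proof -
  have "\<exists>g. g \<in> carrier K \<and> \<rho> g = rot s" for s using SO2 rot_SO2[of s] by (metis image_iff)
  then obtain G where G: "\<And>s. G s \<in> carrier K" "\<And>s. \<rho> (G s) = rot s" by metis
  define c where "c s t = q (G s) (circ t)" for s t
  \<comment> \<open>Lifts of the same rotation give multipliers that differ by a constant, which
    equals 1 at \<open>circ 0\<close>.\<close>
  have same: "q g x = q g' x" if g: "g \<in> carrier K" "g' \<in> carrier K" and e: "\<rho> g = \<rho> g'" and x: "x \<in> sphere 0 1" for g g' x
  proof -
    let ?h = "inv\<^bsub>K\<^esub> g \<otimes>\<^bsub>K\<^esub> g'"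
    have h: "?h \<in> H" "?h \<in> carrier K" using H_iff[OF g] e g by auto
    obtain \<kappa> where \<kappa>: "\<And>x. x \<in> sphere 0 1 \<Longrightarrow> q (g \<otimes>\<^bsub>K\<^esub> ?h) x = \<kappa> * (q g (ca ?h x) * q ?h x)"
      using pcocycle_mult[OF q g(1) h(2)] by blast
    have e: "g \<otimes>\<^bsub>K\<^esub> ?h = g'" using g by (simp add: m_assoc[symmetric])
    have "q g' x = \<kappa> * q g x" if "x \<in> sphere 0 1" for x
      using \<kappa>[OF that] pcocycle_H[OF q h(1) that] ca_H[OF h(1)] by (simp add: e)
    moreover from this[OF circ_in_sphere[of 0]] have "\<kappa> = 1" using base g by simp
    ultimately show ?thesis using x by simp
  qed
  have Gca: "ca (G s) (circ t) = circ (t + s)" for s t by (simp add: circle_action_def G rot_circ)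
  \<comment> \<open>The preimage of a closed set \<open>B\<close> is the projection of the closed
    set of triples \<open>(g, s, t)\<close> with \<open>\<rho> g = rot s\<close> and
    \<open>q g (circ t)\<close> in \<open>B\<close>. Projection along a compact factor is a closed
    map.\<close>
  have cont_c: "continuous_on UNIV (\<lambda>z. c (fst z) (snd z))"
  proof (subst continuous_on_closed_vimage[OF closed_UNIV], intro allI impI)
    fix B :: "complex set" assume B: "closed B"
    let ?P = "prod_topology T (euclidean :: (real \<times> real) topology)"
    let ?f = "\<lambda>p. \<rho> (fst p) - rot (fst (snd p))" and ?g = "\<lambda>p. q (fst p) (circ (snd (snd p)))"
    have cs: "continuous_map ?P euclidean (\<lambda>p. fst (snd p))" "continuous_map ?P euclidean (\<lambda>p. snd (snd p))"
      by (intro continuous_map_unop[OF _ continuous_map_snd] continuous_intros)+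
    have "continuous_map ?P euclidean ?f"
      by (intro continuous_map_minus' continuous_map_compose[OF continuous_map_fst rho_cont, unfolded o_def]
          continuous_map_unop[OF continuous_on_rot] cs)
    from closedin_continuous_map_preimage[OF this, of "{0}"]
    have 1: "closedin ?P {p \<in> topspace ?P. ?f p \<in> {0}}" by simp
    have "continuous_map ?P euclidean ?g"
      using continuous_map_compose[OF continuous_map_pairedI[OF continuous_map_fst continuous_map_circ[OF cs(2)]] cont]
      by (simp add: o_def)
    from closedin_continuous_map_preimage[OF this, of B] B
    have 2: "closedin ?P {p \<in> topspace ?P. ?g p \<in> B}" by simp
    have "closedin euclidean (snd ` ({p \<in> topspace ?P. ?f p \<in> {0}} \<inter> {p \<in> topspace ?P. ?g p \<in> B}))"
      using closed_map_snd[OF comp] closedin_Int[OF 1 2] unfolding closed_map_def by blast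
    moreover have "snd ` ({p \<in> topspace ?P. ?f p \<in> {0}} \<inter> {p \<in> topspace ?P. ?g p \<in> B})
        = (\<lambda>z. c (fst z) (snd z)) -` B \<inter> UNIV"
    proof (intro equalityI subsetI)
      fix z assume "z \<in> (\<lambda>z. c (fst z) (snd z)) -` B \<inter> UNIV"
      then show "z \<in> snd ` ({p \<in> topspace ?P. ?f p \<in> {0}} \<inter> {p \<in> topspace ?P. ?g p \<in> B})"
        by (intro image_eqI[of _ _ "(G (fst z), z)"]) (auto simp: G c_def)
    next
      fix z assume "z \<in> snd ` ({p \<in> topspace ?P. ?f p \<in> {0}} \<inter> {p \<in> topspace ?P. ?g p \<in> B})"
      then obtain g where "g \<in> carrier K" "\<rho> g = rot (fst z)" "q g (circ (snd z)) \<in> B" by auto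
      then show "z \<in> (\<lambda>z. c (fst z) (snd z)) -` B \<inter> UNIV"
        using same[of g "G (fst z)" "circ (snd z)"] by (simp add: G c_def)
    qed
    ultimately show "closed ((\<lambda>z. c (fst z) (snd z)) -` B \<inter> UNIV)" by simp
  qed
  obtain u where u: "continuous_on UNIV u" "\<And>t. u t \<noteq> 0" "\<And>t. u (t + 2 * pi) = u t"
    "\<And>s. \<exists>\<kappa>. \<kappa> \<noteq> 0 \<and> (\<forall>t. u t * c s t = \<kappa> * u (t + s))"
  proof (rule circle_cocycle_trivial[OF cont_c])
    show "c s t \<noteq> 0" for s t using pcocycle_nonzero[OF q G(1) circ_in_sphere] by (simp add: c_def)
    show "c (s + 2 * pi) t = c s t" for s t
      unfolding c_def by (rule same) (simp_all add: G rot_periodic)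
    show "c s (t + 2 * pi) = c s t" for s t by (simp add: c_def)
    show "c s 0 = 1" for s using base[OF G(1)] by (simp add: c_def)
    show "c (r + s) t * c r s = c r (t + s) * c s t" for r s t
    proof -
      have GG: "G r \<otimes>\<^bsub>K\<^esub> G s \<in> carrier K" using G by simp
      obtain \<kappa> where \<kappa>: "\<And>x. x \<in> sphere 0 1 \<Longrightarrow> q (G r \<otimes>\<^bsub>K\<^esub> G s) x = \<kappa> * (q (G r) (ca (G s) x) * q (G s) x)"
        using pcocycle_mult[OF q G(1) G(1)] by blast
      have "c (r + s) t = \<kappa> * (c r (t + s) * c s t)" for t
        using \<kappa>[OF circ_in_sphere, of t] same[OF GG G(1) _ circ_in_sphere, of "r + s" t]
        by (simp add: rho_mult G rot_mult Gca c_def)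
      \<comment> \<open>Evaluation at angle 0 determines \<open>\<kappa>\<close>, because both sides
        are normalized there.\<close>
      from this[of t] this[of 0] show ?thesis
        using base[OF G(1)] by (simp add: c_def)
    qed
  qed blast
  obtain h where h: "continuous_map unit_circle euclidean h" "\<And>t. h (circ (0 + t)) = u t"
    using circle_function[OF u(1,3)] by blast
  have hx: "h (circ t) = u t" for t using h(2)[of t] by simp
  have "flat h g (q g)" if g: "g \<in> carrier K" for g
  proof -
    obtain s where s: "\<rho> g = rot s" using SO2 g SO2_rot by blast
    have "flat h (G s) (q (G s))"
    proof -
      obtain \<kappa> where \<kappa>: "\<kappa> \<noteq> 0" "\<And>t. u t * c s t = \<kappa> * u (t + s)" using u(4) by blast
      show ?thesis
        unfolding flat_def
      proof (intro exI[of _ \<kappa>] conjI ballI \<kappa>(1))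
        fix x :: "real^2" assume "x \<in> sphere 0 1"
        then obtain t where "x = circ t" using circ_surj by blast
        then show "h x * q (G s) x = \<kappa> * h (ca (G s) x)" using \<kappa>(2)[of t] by (simp add: hx Gca c_def)
      qed
    qed
    then show ?thesis by (rule flat_factor[OF q G(1) g]) (simp add: G s)
  qed
  moreover have "h x \<noteq> 0" if "x \<in> sphere 0 1" for x using circ_surj[OF that] hx u(2) by metis
  ultimately show ?thesis using h(1) unfolding coboundary_def by blast
qed

lemma reflection_square:
  assumes s: "s \<in> carrier K" "\<And>t. ca s (circ (t0 + t)) = circ (t0 - t)"
  shows "s \<otimes>\<^bsub>K\<^esub> s \<in> H"
proof -
  have "ca (s \<otimes>\<^bsub>K\<^esub> s) (circ (t0 + t)) = circ (t0 + t)" for t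
    using s(2)[of t] s(2)[of "- t"] by (simp add: ca_mult s(1))
  from this[of "t - t0" for t] have c: "\<rho> (s \<otimes>\<^bsub>K\<^esub> s) *v circ t = circ t" for t by (simp add: circle_action_def)
  have "\<rho> (s \<otimes>\<^bsub>K\<^esub> s) = mat 1"
    using c[of 0] c[of "pi / 2"]
    by (simp add: vec2_eq_iff mat2_eq_iff matrix_vector_mult_def sum_2 mat_def)
  then show ?thesis using s(1) by (simp add: H)
qed

text \<open>At a fixed point of \<open>s\<close>, flatness says that \<open>q s\<close> equals the
  constant \<open>\<kappa>\<close>, so the values at the two fixed points must agree. For the
  converse, \<open>u\<close> makes the generating rotation flat, and the remaining multiplier
  \<open>C\<close> of \<open>s\<close> is removed by a factor that stays flat under
  rotations.\<close>

lemma dihedral_coboundary_iff: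
  fixes m :: nat
  assumes q: "pcocycle q" and m: "0 < m"
    and rots: "\<And>p. p \<in> carrier K \<Longrightarrow> \<rho> p \<in> SO2 \<Longrightarrow> \<exists>k::int. \<rho> p = rot (k * (2 * pi / m))"
    and g: "g \<in> carrier K" "\<rho> g = rot (2 * pi / m)"
    and s: "s \<in> carrier K" "\<rho> s \<notin> SO2" "\<And>t. ca s (circ (t0 + t)) = circ (t0 - t)"
  shows "coboundary q \<longleftrightarrow> q s (circ (t0 + pi)) = q s (circ t0)"
proof
  have fix0: "ca s (circ t0) = circ t0" using s(3)[of 0] by simp
  have fixpi: "ca s (circ (t0 + pi)) = circ (t0 + pi)"
    using s(3)[of pi] circ_periodic[of "t0 - pi"] by (simp add: algebra_simps)
  assume "coboundary q"
  then obtain u \<kappa> where u: "\<And>x. x \<in> sphere 0 1 \<Longrightarrow> u x \<noteq> 0" "\<And>x. x \<in> sphere 0 1 \<Longrightarrow> u x * q s x = \<kappa> * u (ca s x)"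
    using s(1) unfolding coboundary_def flat_def by blast
  show "q s (circ (t0 + pi)) = q s (circ t0)"
    using u(2)[OF circ_in_sphere, of t0] u(2)[OF circ_in_sphere, of "t0 + pi"]
      u(1)[OF circ_in_sphere, of t0] u(1)[OF circ_in_sphere, of "t0 + pi"] by (simp add: fix0 fixpi)
next
  assume eq: "q s (circ (t0 + pi)) = q s (circ t0)"
  define l where "l = 2 * pi / m"
  obtain u where u: "continuous_map unit_circle euclidean u" "\<And>x. x \<in> sphere 0 1 \<Longrightarrow> u x \<noteq> 0" "flat u g (q g)"
    using generator_flat[OF q g m] by blast
  have gca: "ca g (circ (t0 + t)) = circ (t0 + (t + l))" for t
    using g(2) by (simp add: circle_action_def rot_circ l_def add.assoc)
  define U where "U t = u (circ (t0 + t))" for t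
  define Q where "Q t = q s (circ (t0 + t))" for t
  have U0: "U t \<noteq> 0" and Q0: "Q t \<noteq> 0" for t
    using u(2)[OF circ_in_sphere] pcocycle_nonzero[OF q s(1) circ_in_sphere] by (simp_all add: U_def Q_def)
  have Uc: "continuous_on UNIV U" and Qc: "continuous_on UNIV Q"
    unfolding U_def Q_def by (intro continuous_on_circle_pullback u(1) pcocycle_cont[OF q s(1)])+
  have per: "circ (t0 + (t + 2 * pi)) = circ (t0 + t)" "circ (t0 + (- t - 2 * pi)) = circ (t0 + (- t))" for t
    using circ_periodic[of "t0 + t"] circ_periodic[of "t0 - t - 2 * pi"] by (simp_all add: algebra_simps)
  have sca: "ca s (circ (t0 + t)) = circ (t0 + (- t))" for t using s(3)[of t] by simp
  \<comment> \<open>The multiplier of \<open>s\<close> in the frame rescaled by \<open>u\<close>,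
    with the angle measured from the fixed point \<open>t0\<close>.\<close>
  define C where "C t = U t * Q t / U (- t)" for t
  have C0: "C t \<noteq> 0" for t using U0 Q0 by (simp add: C_def)
  have Cc: "continuous_on UNIV C"
    unfolding C_def by (intro continuous_intros Uc Qc continuous_on_shift(2)[OF Uc]) (use U0 in auto)
  have Cper: "C (t + 2 * pi) = C t" for t
    using per by (simp add: C_def U_def Q_def)
  \<comment> \<open>Comes from \<open>s\<close> having its square in \<open>H\<close>; the factors
    \<open>U\<close> cancel.\<close>
  have Crefl: "C a * C (- a) = C b * C (- b)" for a b
  proof -
    have ss: "s \<otimes>\<^bsub>K\<^esub> s \<in> H" by (rule reflection_square[OF s(1,3)])
    obtain \<kappa> where \<kappa>: "\<kappa> \<noteq> 0" "\<And>x. x \<in> sphere 0 1 \<Longrightarrow> q (s \<otimes>\<^bsub>K\<^esub> s) x = \<kappa> * (q s (ca s x) * q s x)"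
      using pcocycle_mult[OF q s(1) s(1)] by blast
    have QQ: "\<kappa> * (Q (- t) * Q t) = 1" for t
      using \<kappa>(2)[OF circ_in_sphere, of "t0 + t"] pcocycle_H[OF q ss circ_in_sphere, of "t0 + t"]
      by (simp add: sca Q_def)
    have "C t * C (- t) = Q (- t) * Q t" for t using U0[of t] U0[of "- t"] by (simp add: C_def field_simps)
    then show ?thesis using QQ[of a] QQ[of b] \<kappa>(1) by (metis mult_cancel_left)
  qed
  \<comment> \<open>The relation \<open>s g = g' s\<close>, where \<open>g'\<close> is a rotation by
    \<open>- l\<close>, is evaluated in two ways. Both \<open>g\<close> and \<open>g'\<close> are
    flat for \<open>u\<close>, so only constants remain.\<close>
  have "\<exists>\<kappa>. \<forall>t. C (t + l) = \<kappa> * C t"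
  proof -
    let ?g' = "s \<otimes>\<^bsub>K\<^esub> g \<otimes>\<^bsub>K\<^esub> inv\<^bsub>K\<^esub> s"
    have g': "?g' \<in> carrier K" using s(1) g(1) by simp
    have sg: "?g' \<otimes>\<^bsub>K\<^esub> s = s \<otimes>\<^bsub>K\<^esub> g" using s(1) g(1) by (simp add: m_assoc)
    have g'ca: "ca ?g' (circ (t0 + t)) = circ (t0 + (t - l))" for t
    proof -
      have "ca (?g' \<otimes>\<^bsub>K\<^esub> s) (circ (t0 + (- t))) = ca s (ca g (circ (t0 + (- t))))"
        unfolding sg by (rule ca_mult[OF s(1) g(1)])
      then show ?thesis unfolding ca_mult[OF g' s(1)] gca sca by simp
    qed
    have "\<rho> ?g' *v circ t = rot (- l) *v circ t" for t
      using g'ca[of "t - t0"] by (simp add: circle_action_def rot_circ)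
    from this[of 0] this[of "pi / 2"] have "\<rho> ?g' = rot (- l)"
      by (simp add: vec2_eq_iff mat2_eq_iff matrix_vector_mult_def sum_2)
    then have "\<rho> ?g' = rot (of_int (-1) * (2 * pi / m))" by (simp add: l_def)
    from flat_rotations[OF q g m u(3) g' this]
    obtain b where b: "\<And>x. x \<in> sphere 0 1 \<Longrightarrow> u x * q ?g' x = b * u (ca ?g' x)" unfolding flat_def by blast
    obtain a where a: "a \<noteq> 0" "\<And>x. x \<in> sphere 0 1 \<Longrightarrow> u x * q g x = a * u (ca g x)"
      using u(3) unfolding flat_def by blast
    obtain \<kappa> where \<kappa>: "\<kappa> \<noteq> 0" "\<And>x. x \<in> sphere 0 1 \<Longrightarrow> q (s \<otimes>\<^bsub>K\<^esub> g) x = \<kappa> * (q s (ca g x) * q g x)"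
      using pcocycle_mult[OF q s(1) g(1)] by blast
    obtain \<mu> where \<mu>: "\<And>x. x \<in> sphere 0 1 \<Longrightarrow> q (?g' \<otimes>\<^bsub>K\<^esub> s) x = \<mu> * (q ?g' (ca s x) * q s x)"
      using pcocycle_mult[OF q g' s(1)] by blast
    have "C (t + l) = (\<mu> * b / (\<kappa> * a)) * C t" for t
    proof -
      let ?qg = "q g (circ (t0 + t))" and ?qg' = "q ?g' (circ (t0 + (- t)))"
      have 1: "\<kappa> * (Q (t + l) * ?qg) = \<mu> * (?qg' * Q t)"
        using \<kappa>(2)[OF circ_in_sphere, of "t0 + t"] \<mu>[OF circ_in_sphere, of "t0 + t"]
        unfolding sg gca sca Q_def by simp
      have 2: "U t * ?qg = a * U (t + l)"
        using a(2)[OF circ_in_sphere, of "t0 + t"] unfolding gca U_def .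
      have 3: "U (- t) * ?qg' = b * U (- t - l)"
        using b[OF circ_in_sphere, of "t0 + (- t)"] unfolding g'ca U_def .
      have "\<kappa> * Q (t + l) * (a * U (t + l)) * U (- t) = \<kappa> * (Q (t + l) * ?qg) * U t * U (- t)"
        unfolding 2[symmetric] by (simp only: ac_simps)
      also have "\<dots> = \<mu> * Q t * (U (- t) * ?qg') * U t" unfolding 1 by (simp only: ac_simps)
      also have "\<dots> = \<mu> * Q t * (b * U (- t - l)) * U t" unfolding 3 ..
      finally have 4: "\<kappa> * Q (t + l) * (a * U (t + l)) * U (- t) = \<mu> * Q t * (b * U (- t - l)) * U t" .
      have 5: "U (- (t + l)) = U (- t - l)" by simp
      show ?thesis
        using 4 \<kappa>(1) a(1) U0[of "- t"] U0[of "- t - l"] unfolding C_def 5 by (simp add: field_simps)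
    qed
    then show ?thesis by blast
  qed
  then have Crot: "C (a + l) * C b = C (b + l) * C a" for a b by (metis mult.assoc mult.commute)
  \<comment> \<open>At angles 0 and \<open>pi\<close> the factors \<open>U\<close> cancel by
    periodicity, which leaves the hypothesis on the fixed points.\<close>
  have Cpi: "C pi = C 0"
  proof -
    have "U (- pi) = U pi" using per(1)[of "- pi"] by (simp add: U_def)
    then show ?thesis using eq U0[of 0] U0[of pi] by (simp add: C_def Q_def)
  qed
  obtain v where v: "continuous_on UNIV v" "\<And>t. v t \<noteq> 0" "\<And>t. v (t + 2 * pi) = v t"
    "\<exists>\<kappa>. \<kappa> \<noteq> 0 \<and> (\<forall>t. v t * C t = \<kappa> * v (- t))" "\<exists>\<kappa>. \<kappa> \<noteq> 0 \<and> (\<forall>t. v t = \<kappa> * v (t + l))"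
    using reflection_cocycle_trivial[OF Cc C0 Cper Crefl Crot Cpi] by blast
  obtain h where h: "continuous_map unit_circle euclidean h" "\<And>t. h (circ (t0 + t)) = v t"
    using circle_function[OF v(1,3)] by blast
  have par: "\<exists>t. x = circ (t0 + t)" if "x \<in> sphere 0 1" for x
  proof -
    obtain t where "x = circ t" using circ_surj[OF \<open>x \<in> sphere 0 1\<close>] by blast
    then show ?thesis by (intro exI[of _ "t - t0"]) simp
  qed
  define w where "w x = u x * h x" for x
  have fs: "flat w s (q s)"
  proof -
    obtain \<kappa> where \<kappa>: "\<kappa> \<noteq> 0" "\<And>t. v t * C t = \<kappa> * v (- t)" using v(4) by blast
    have "w x * q s x = \<kappa> * w (ca s x)" if x: "x \<in> sphere 0 1" for x
    proof -
      obtain t where t: "x = circ (t0 + t)" using par[OF x] by blast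
      have "U t * v t * Q t = \<kappa> * (U (- t) * v (- t))"
        using \<kappa>(2)[of t] U0[of "- t"] by (simp add: C_def field_simps)
      then show ?thesis unfolding t sca w_def h(2) by (simp add: U_def Q_def)
    qed
    then show ?thesis using \<kappa>(1) unfolding flat_def by blast
  qed
  have fg: "flat w g (q g)"
  proof -
    obtain \<kappa> where \<kappa>: "\<kappa> \<noteq> 0" "\<And>t. v t = \<kappa> * v (t + l)" using v(5) by blast
    obtain a where a: "a \<noteq> 0" "\<And>x. x \<in> sphere 0 1 \<Longrightarrow> u x * q g x = a * u (ca g x)"
      using u(3) unfolding flat_def by blast
    have "w x * q g x = (a * \<kappa>) * w (ca g x)" if x: "x \<in> sphere 0 1" for x
    proof -
      obtain t where t: "x = circ (t0 + t)" using par[OF x] by blast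
      have "w x * q g x = (u x * q g x) * v t" by (simp add: w_def t h(2))
      also have "\<dots> = a * u (ca g x) * (\<kappa> * v (t + l))" using a(2)[OF x] \<kappa>(2)[of t] by simp
      finally show ?thesis unfolding t gca w_def h(2) by (simp add: ac_simps)
    qed
    then show ?thesis using \<kappa>(1) a(1) unfolding flat_def by (intro exI[of _ "a * \<kappa>"]) auto
  qed
  have "flat w p (q p)" if p: "p \<in> carrier K" for p
  proof (cases "\<rho> p \<in> SO2")
    case True
    then show ?thesis using rots[OF p] flat_rotations[OF q g m fg p] by blast
  next
    case False
    \<comment> \<open>An orientation reversing element is \<open>s\<close> times a rotation, so
      flatness for \<open>s\<close> and for rotations suffices.\<close>
    let ?p = "inv\<^bsub>K\<^esub> s \<otimes>\<^bsub>K\<^esub> p"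
    have pK: "?p \<in> carrier K" using s(1) p by simp
    have sp: "s \<otimes>\<^bsub>K\<^esub> ?p = p" using s(1) p by (simp add: m_assoc[symmetric])
    have det: "det A = -1" if "A \<in> O2" "A \<notin> SO2" for A
      using that det_orthogonal_matrix[of A] by (auto simp: O2_def SO2_def rotation_matrix_def)
    have "det (\<rho> p) = det (\<rho> s) * det (\<rho> ?p)" using rho_mult[OF s(1) pK] by (simp add: sp det_mul)
    then have "det (\<rho> ?p) = 1" using det[OF rho_O2[OF p] False] det[OF rho_O2[OF s(1)] s(2)] by simp
    then have "\<rho> ?p \<in> SO2" using rho_O2[OF pK] by (simp add: SO2_def O2_def rotation_matrix_def)
    then have "flat w ?p (q ?p)" using rots[OF pK] flat_rotations[OF q g m fg pK] by blast
    from flat_mult[OF q s(1) pK fs this] show ?thesis by (simp add: sp)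
  qed
  moreover have "continuous_map unit_circle euclidean w"
    unfolding w_def by (intro continuous_map_mult u(1) h(1))
  moreover have "w x \<noteq> 0" if "x \<in> sphere 0 1" for x
    using u(2)[OF that] par[OF that] h(2) v(2) by (auto simp: w_def)
  ultimately show "coboundary q" unfolding coboundary_def by blast
qed

end

section \<open>Image bundles of the line bundle generators\<close>

lemma fiber_pullback:
  "x \<in> topspace X \<Longrightarrow> fiber (pullback_bundle X a f \<pi> N) x = {x} \<times> fiber N (f x)"
  by (auto simp: fiber_def pullback_bundle_def)

lemma vector_bundle_fiber_closed:
  assumes "vector_bundle X E" "x \<in> topspace X" "e \<in> fiber E x"
  shows "e' \<in> fiber E x \<Longrightarrow> fadd E e e' \<in> fiber E x" "fscale E c e \<in> fiber E x"
  using assms(1)[unfolded vector_bundle_def, THEN conjunct2, THEN conjunct1, THEN bspec, OF assms(2),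
      THEN bspec, OF assms(3)] by simp_all

text \<open>A chart of \<open>N\<close> over \<open>U\<close> yields one of the pullback over the
  preimage of \<open>U\<close>: keep the base point and take the coordinates of the second
  component.\<close>

lemma vector_bundle_pullback:
  assumes N: "vector_bundle Y N" and f: "continuous_map X Y f"
  shows "vector_bundle X (pullback_bundle X a f \<pi> N)"
proof -
  let ?B = "pullback_bundle X a f \<pi> N"
  have fY: "f x \<in> topspace Y" if "x \<in> topspace X" for x
    by (rule funcset_mem[OF continuous_map_funspace[OF f] that])
  have tot: "total ?B = subtopology (prod_topology X (total N)) {(x, e). f x = proj N e}"
    and pr: "proj ?B = fst"
    by (simp_all add: pullback_bundle_def)
  show ?thesis
    unfolding vector_bundle_def
  proof (intro conjI ballI allI)
    show "continuous_map (total ?B) X (proj ?B)"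
      unfolding tot pr by (rule continuous_map_from_subtopology[OF continuous_map_fst])
    fix x assume x: "x \<in> topspace X"
    show "fadd ?B e e' \<in> fiber ?B x" if e: "e \<in> fiber ?B x" and e': "e' \<in> fiber ?B x" for e e'
      using that vector_bundle_fiber_closed(1)[OF N fY[OF x]] unfolding fiber_pullback[OF x]
      by (auto simp: pullback_bundle_def)
    show "fscale ?B c e \<in> fiber ?B x" if e: "e \<in> fiber ?B x" for c e
      using that vector_bundle_fiber_closed(2)[OF N fY[OF x]] unfolding fiber_pullback[OF x]
      by (auto simp: pullback_bundle_def)
    obtain U m \<zeta> \<kappa> where U: "openin Y U" "f x \<in> U"
      and \<zeta>: "frame (subtopology Y U) (\<lambda>x. x) N m {} undefined \<zeta>"
      and c\<kappa>: "continuous_map (subtopology (total N) {e \<in> topspace (total N). proj N e \<in> U}) (Cspace m) \<kappa>"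
      and \<kappa>\<zeta>: "\<And>e. e \<in> topspace (total N) \<Longrightarrow> proj N e \<in> U \<Longrightarrow> \<kappa> e \<in> Cn m \<and> \<zeta> (proj N e) (\<kappa> e) = e"
      and \<zeta>\<kappa>: "\<And>y w. y \<in> U \<Longrightarrow> w \<in> Cn m \<Longrightarrow> \<kappa> (\<zeta> y w) = w"
      by (rule vector_bundle_local[OF N fY[OF x]]) blast
    have UY: "U \<subseteq> topspace Y" using U(1) openin_subset by blast
    have F: "fframe N y m {} undefined (\<zeta> y)" if "y \<in> U" for y using frame_fframe[OF \<zeta>, of y] that UY by auto
    have \<zeta>N: "\<zeta> y w \<in> topspace (total N)" "proj N (\<zeta> y w) = y" if "y \<in> U" "w \<in> Cn m" for y w
      using fframe_fiber[OF F[OF that(1)] that(2)] by (auto simp: fiber_def)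
    define V where "V = {x \<in> topspace X. f x \<in> U}"
    have V: "openin X V" unfolding V_def by (rule openin_continuous_map_preimage[OF f U(1)])
    have VX: "V \<subseteq> topspace X" by (auto simp: V_def)
    let ?M = "subtopology (total ?B) {e \<in> topspace (total ?B). proj ?B e \<in> V}"
    let ?P = "prod_topology (subtopology X V) (Cspace m)"
    have tM: "z \<in> topspace ?M \<longleftrightarrow> fst z \<in> V \<and> snd z \<in> topspace (total N) \<and> f (fst z) = proj N (snd z)" for z
      using VX by (auto simp: tot pr mem_Times_iff)
    have "homeomorphic_maps ?M ?P (\<lambda>z. (fst z, \<kappa> (snd z))) (\<lambda>z. (fst z, \<zeta> (f (fst z)) (snd z)))"
      unfolding homeomorphic_maps_def
    proof (intro conjI ballI)
      have M1: "continuous_map ?M X fst" and M2: "continuous_map ?M (total N) snd"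
        unfolding tot by (intro continuous_map_from_subtopology continuous_map_fst continuous_map_snd)+
      have "continuous_map ?M (subtopology X V) fst"
        using M1 tM by (auto simp: continuous_map_in_subtopology)
      moreover have "continuous_map ?M (subtopology (total N) {e \<in> topspace (total N). proj N e \<in> U}) snd"
        unfolding continuous_map_in_subtopology using M2 tM by (auto simp: V_def)
      from continuous_map_compose[OF this c\<kappa>] have "continuous_map ?M (Cspace m) (\<lambda>z. \<kappa> (snd z))" by (simp add: o_def)
      ultimately show "continuous_map ?M ?P (\<lambda>z. (fst z, \<kappa> (snd z)))" by (rule continuous_map_pairedI)
      have P1: "continuous_map ?P X fst"
        using continuous_map_fst[of "subtopology X V" "Cspace m"] by (simp add: continuous_map_in_subtopology)
      have "continuous_map ?P (subtopology Y U) (\<lambda>z. f (fst z))"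
        unfolding continuous_map_in_subtopology
        using continuous_map_compose[OF P1 f] by (auto simp: o_def V_def)
      from frame_cont_compose[OF \<zeta> this continuous_map_snd]
      have "continuous_map ?P (total N) (\<lambda>z. \<zeta> (f (fst z)) (snd z))" .
      from continuous_map_pairedI[OF P1 this]
      show "continuous_map ?P ?M (\<lambda>z. (fst z, \<zeta> (f (fst z)) (snd z)))"
        unfolding tot pr subtopology_subtopology continuous_map_in_subtopology
        using \<zeta>N by (auto simp: V_def)
      show "(fst (fst z, \<kappa> (snd z)), \<zeta> (f (fst (fst z, \<kappa> (snd z)))) (snd (fst z, \<kappa> (snd z)))) = z"
        if "z \<in> topspace ?M" for z
      proof -
        have z: "fst z \<in> V" "snd z \<in> topspace (total N)" "f (fst z) = proj N (snd z)" using that tM by auto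
        then have "\<zeta> (f (fst z)) (\<kappa> (snd z)) = snd z" using \<kappa>\<zeta>[OF z(2)] by (simp add: V_def)
        then show ?thesis by simp
      qed
      show "(fst (fst z, \<zeta> (f (fst z)) (snd z)), \<kappa> (snd (fst z, \<zeta> (f (fst z)) (snd z)))) = z" if "z \<in> topspace ?P" for z
      proof -
        have "f (fst z) \<in> U" "snd z \<in> Cn m" using that by (auto simp: V_def)
        then show ?thesis using \<zeta>\<kappa> by simp
      qed
    qed
    then have hom: "homeomorphic_map ?M ?P (\<lambda>z. (fst z, \<kappa> (snd z)))"
      using homeomorphic_maps_map by blast
    have fc: "fiber_coord ?B y m (\<lambda>e. \<kappa> (snd e))" if y: "y \<in> V" for y
    proof -
      have yX: "y \<in> topspace X" and fyU: "f y \<in> U" using y by (auto simp: V_def)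
      have k: "\<kappa> e = inv_into (Cn m) (\<zeta> (f y)) e" if "e \<in> fiber N (f y)" for e
        using \<kappa>\<zeta>[of e] fframe_inv_f[OF F[OF fyU], of "\<kappa> e"] that fyU by (auto simp: fiber_def)
      have b: "bij_betw \<kappa> (fiber N (f y)) (Cn m)"
        using bij_betw_inv_into[OF fframe_bij[OF F[OF fyU]]] by (subst bij_betw_cong[OF k])
      have b2: "bij_betw snd ({y} \<times> fiber N (f y)) (fiber N (f y))"
        by (auto simp: bij_betw_def inj_on_def)
      have "bij_betw (\<lambda>e. \<kappa> (snd e)) (fiber ?B y) (Cn m)"
        using bij_betw_trans[OF b2 b] unfolding fiber_pullback[OF yX] by (simp add: o_def)
      moreover have "\<kappa> (snd (fadd ?B e e')) = (\<lambda>i. \<kappa> (snd e) i + \<kappa> (snd e') i)"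
        "\<kappa> (snd (fscale ?B c e)) = (\<lambda>i. c * \<kappa> (snd e) i)"
        if e: "e \<in> fiber ?B y" "e' \<in> fiber ?B y" for e e' c
      proof -
        have e2: "snd e \<in> fiber N (f y)" "snd e' \<in> fiber N (f y)" using e unfolding fiber_pullback[OF yX] by auto
        have s: "snd (fadd ?B e e') = fadd N (snd e) (snd e')" "snd (fscale ?B c e) = fscale N c (snd e)"
          by (auto simp: pullback_bundle_def case_prod_unfold)
        show "\<kappa> (snd (fadd ?B e e')) = (\<lambda>i. \<kappa> (snd e) i + \<kappa> (snd e') i)"
          unfolding s using fframe_inv_add[OF F[OF fyU] e2] k[OF e2(1)] k[OF e2(2)]
            k[OF vector_bundle_fiber_closed(1)[OF N fY[OF yX] e2]] by simp
        show "\<kappa> (snd (fscale ?B c e)) = (\<lambda>i. c * \<kappa> (snd e) i)"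
          unfolding s using fframe_inv_scale[OF F[OF fyU] e2(1)] k[OF e2(1)]
            k[OF vector_bundle_fiber_closed(2)[OF N fY[OF yX] e2(1)]] by simp
      qed
      ultimately show ?thesis unfolding fiber_coord_def by simp
    qed
    show "\<exists>U n \<phi>. openin X U \<and> x \<in> U \<and>
        homeomorphic_map (subtopology (total ?B) {e \<in> topspace (total ?B). proj ?B e \<in> U})
          (prod_topology (subtopology X U) (Cspace n)) \<phi> \<and>
        (\<forall>e\<in>topspace (total ?B). proj ?B e \<in> U \<longrightarrow> fst (\<phi> e) = proj ?B e) \<and>
        (\<forall>y\<in>U. fiber_coord ?B y n (\<lambda>e. snd (\<phi> e)))"
      by (intro exI[of _ V] exI[of _ m] exI[of _ "\<lambda>z. (fst z, \<kappa> (snd z))"] conjI V hom ballI impI)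
        (use x U(2) fc in \<open>simp_all add: V_def pr\<close>)
  qed
qed

lemma frame_no_group: "frame Y \<gamma> E n S R \<Phi> \<Longrightarrow> frame Y \<gamma> E n {} R' \<Phi>"
  by (auto simp: frame_def fframe_def)

text \<open>In dimension one the identity operators are already irreducible. Thus the gluing of
  equivariant frames also applies to line bundles on which \<open>H\<close> acts trivially.\<close>

lemma schurian_line: "schurian 1 S (\<lambda>_ w. w)"
  unfolding schurian_def irred_def
proof (intro conjI allI impI ballI)
  fix W assume W: "W \<subseteq> Cn 1 \<and> (\<lambda>_. 0) \<in> W \<and> (\<forall>v\<in>W. \<forall>w\<in>W. (\<lambda>i. v i + w i) \<in> W) \<and>
          (\<forall>v\<in>W. \<forall>c. (\<lambda>i. c * v i) \<in> W) \<and> (\<forall>a\<in>(\<lambda>_ w. w) ` S. \<forall>v\<in>W. a v \<in> W)"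
  show "W = {\<lambda>_. 0} \<or> W = Cn 1"
  proof (cases "W = {\<lambda>_. 0}")
    case False
    then obtain v where v: "v \<in> W" "v \<noteq> (\<lambda>_. 0)" using W by blast
    have "v \<in> Cn 1" using W v(1) by blast
    then have v0: "v 0 \<noteq> 0" using v(2) Cn_eqI[of v 1 "\<lambda>_. 0"] by auto
    have "w \<in> W" if w: "w \<in> Cn 1" for w
    proof -
      have "w = (\<lambda>i. (w 0 / v 0) * v i)"
      proof (rule Cn_eqI[OF w Cn_scale])
        show "v \<in> Cn 1" using v(1) W by blast
      qed (use v0 in simp)
      moreover have "(\<lambda>i. (w 0 / v 0) * v i) \<in> W" using W v(1) by blast
      ultimately show ?thesis by simp
    qed
    then show ?thesis using W by blast
  qed simp
qed (auto simp: lin_def)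

lemma Cn_1: "w \<in> Cn 1 \<Longrightarrow> w = (\<lambda>i. w 0 * ev 0 i)"
  by (auto simp: Cn_def ev_def fun_eq_iff)

lemma O2_det: "A \<in> O2 \<Longrightarrow> A \<notin> SO2 \<Longrightarrow> det A = -1" and SO2_det: "A \<in> SO2 \<Longrightarrow> det A = 1"
  and O2_SO2: "A \<in> O2 \<Longrightarrow> det A = 1 \<Longrightarrow> A \<in> SO2"
  using det_orthogonal_matrix[of A] by (auto simp: O2_def SO2_def rotation_matrix_def)

section \<open>The rotation subgroup and the factor groups\<close>

context circle_rep begin

definition P :: "'k set" where "P = {g \<in> carrier K. \<rho> g \<in> SO2}"

lemma P_iff: "g \<in> carrier K \<Longrightarrow> g \<in> P \<longleftrightarrow> det (\<rho> g) = 1"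
  using O2_det[OF rho_O2] SO2_det by (fastforce simp: P_def)

lemma P_det: "g \<in> P \<Longrightarrow> det (\<rho> g) = 1"
  using SO2_det by (auto simp: P_def)

lemma det_cases: "g \<in> carrier K \<Longrightarrow> det (\<rho> g) = 1 \<or> det (\<rho> g) = -1"
  using rho_O2 det_orthogonal_matrix by (auto simp: O2_def)

lemma det_rho_mult: "g \<in> carrier K \<Longrightarrow> h \<in> carrier K \<Longrightarrow> det (\<rho> (g \<otimes>\<^bsub>K\<^esub> h)) = det (\<rho> g) * det (\<rho> h)"
  by (simp add: rho_mult det_mul)

lemma det_rho_inv: "g \<in> carrier K \<Longrightarrow> det (\<rho> (inv\<^bsub>K\<^esub> g)) = det (\<rho> g)"
  using det_rho_mult[of g "inv\<^bsub>K\<^esub> g"] det_cases[of g] by (auto simp: rho_one)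

lemma P_subset: "P \<subseteq> carrier K" by (auto simp: P_def)

lemma H_subset_P: "H \<subseteq> P"
  using H_subset rot_SO2[of 0] by (auto simp: P_def H rot_0)

lemma normal_P: "P \<lhd> K"
proof (rule normal_invI)
  have PK: "g \<in> carrier K" if "g \<in> P" for g using that P_subset by blast
  show "subgroup P K"
  proof (rule subgroupI[OF P_subset])
    show "P \<noteq> {}" using H_subset_P one_H by blast
    show "inv\<^bsub>K\<^esub> a \<in> P" if "a \<in> P" for a
      using PK[OF that] P_det[OF that] by (simp add: P_iff det_rho_inv)
    show "a \<otimes>\<^bsub>K\<^esub> b \<in> P" if "a \<in> P" "b \<in> P" for a b
      using PK[OF that(1)] PK[OF that(2)] P_det[OF that(1)] P_det[OF that(2)] by (simp add: P_iff det_rho_mult)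
  qed
  show "x \<otimes>\<^bsub>K\<^esub> h \<otimes>\<^bsub>K\<^esub> inv\<^bsub>K\<^esub> x \<in> P" if x: "x \<in> carrier K" and h: "h \<in> P" for x h
    using x PK[OF h] P_det[OF h] det_cases[OF x] by (auto simp: P_iff det_rho_mult det_rho_inv)
qed

lemma normal_H: "H \<lhd> K"
proof (rule normal_invI)
  show "subgroup H K"
  proof (rule subgroupI)
    show "inv\<^bsub>K\<^esub> a \<in> H" if "a \<in> H" for a
      using that rho_inv(1)[of a] by (auto simp: H)
  qed (use H_subset one_H H_mult in auto)
qed (rule H_conj)

text \<open>Identifies \<open>C \<mapsto> P <#> C\<close> with the projection from
  \<open>K Mod H\<close> to \<open>K Mod P\<close>, since \<open>H\<close> is contained in
  \<open>P\<close>.\<close>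

lemma P_H_coset: "g \<in> carrier K \<Longrightarrow> P <#>\<^bsub>K\<^esub> (H #>\<^bsub>K\<^esub> g) = P #>\<^bsub>K\<^esub> g"
proof (intro equalityI subsetI)
  fix y assume g: "g \<in> carrier K" and "y \<in> P <#>\<^bsub>K\<^esub> (H #>\<^bsub>K\<^esub> g)"
  then obtain p h where ph: "p \<in> P" "h \<in> H" "y = p \<otimes>\<^bsub>K\<^esub> (h \<otimes>\<^bsub>K\<^esub> g)" by (auto simp: set_mult_def r_coset_def)
  then have "p \<otimes>\<^bsub>K\<^esub> h \<in> P" using normal_P H_subset_P by (auto simp: normal_def intro: subgroup.m_closed)
  moreover have "y = (p \<otimes>\<^bsub>K\<^esub> h) \<otimes>\<^bsub>K\<^esub> g" using ph g P_subset H_subset by (simp add: m_assoc subset_iff)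
  ultimately show "y \<in> P #>\<^bsub>K\<^esub> g" by (auto simp: r_coset_def)
next
  fix y assume g: "g \<in> carrier K" and "y \<in> P #>\<^bsub>K\<^esub> g"
  then obtain p where p: "p \<in> P" "y = p \<otimes>\<^bsub>K\<^esub> g" by (auto simp: r_coset_def)
  have "\<one>\<^bsub>K\<^esub> \<otimes>\<^bsub>K\<^esub> g \<in> H #>\<^bsub>K\<^esub> g" using one_H unfolding r_coset_def by blast
  then have "g \<in> H #>\<^bsub>K\<^esub> g" using g by simp
  then show "y \<in> P <#>\<^bsub>K\<^esub> (H #>\<^bsub>K\<^esub> g)" using p unfolding set_mult_def by blast
qed

lemma coset_ca: "g \<in> carrier K \<Longrightarrow> coset_circle_action \<rho> (H #>\<^bsub>K\<^esub> g) x = ca g x"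
proof -
  assume g: "g \<in> carrier K"
  have "(\<lambda>g. ca g x) ` (H #>\<^bsub>K\<^esub> g) = {ca g x}"
    using g one_H H_subset unfolding r_coset_def by (auto simp: ca_mult ca_H subset_iff)
  then show ?thesis by (simp add: coset_circle_action_def)
qed

lemma FactGroup_carrier: "N \<lhd> K \<Longrightarrow> carrier (K Mod N) = (\<lambda>g. N #>\<^bsub>K\<^esub> g) ` carrier K"
  by (auto simp: FactGroup_def RCOSETS_def)

lemma FactGroup_one: "\<one>\<^bsub>K Mod N\<^esub> = N" by (simp add: FactGroup_def)

lemma FactGroup_mult:
  "N \<lhd> K \<Longrightarrow> g \<in> carrier K \<Longrightarrow> h \<in> carrier K \<Longrightarrow> (N #>\<^bsub>K\<^esub> g) \<otimes>\<^bsub>K Mod N\<^esub> (N #>\<^bsub>K\<^esub> h) = N #>\<^bsub>K\<^esub> (g \<otimes>\<^bsub>K\<^esub> h)"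
  by (simp add: FactGroup_def normal.rcos_sum)

lemma coset_eq_N: "N \<lhd> K \<Longrightarrow> g \<in> N \<Longrightarrow> N #>\<^bsub>K\<^esub> g = N"
  using coset_join2[of g N] by (auto simp: normal_def dest: subgroup.subset)

lemma topspace_quotient_group: "N \<lhd> K \<Longrightarrow> topspace (quotient_group_top K T N) = carrier (K Mod N)"
  by (simp add: quotient_group_top_def topspace_quotient_top FactGroup_carrier)

lemma coboundary_const:
  assumes "\<And>g x. g \<in> carrier K \<Longrightarrow> x \<in> sphere 0 1 \<Longrightarrow> q' g x = k g * q g x" "\<And>g. g \<in> carrier K \<Longrightarrow> k g \<noteq> 0"
    "coboundary q"
  shows "coboundary q'"
proof -
  obtain u where u: "continuous_map unit_circle euclidean u" "\<forall>x\<in>sphere 0 1. u x \<noteq> 0"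
    "\<And>g. g \<in> carrier K \<Longrightarrow> flat u g (q g)" using assms(3) unfolding coboundary_def by blast
  have "flat u g (q' g)" if g: "g \<in> carrier K" for g
  proof -
    obtain \<kappa> where \<kappa>: "\<kappa> \<noteq> 0" "\<And>x. x \<in> sphere 0 1 \<Longrightarrow> u x * q g x = \<kappa> * u (ca g x)"
      using u(3)[OF g] unfolding flat_def by blast
    have "u x * q' g x = (k g * \<kappa>) * u (ca g x)" if "x \<in> sphere 0 1" for x
      using assms(1)[OF g that] \<kappa>(2)[OF that] by (simp add: mult.left_commute)
    then show ?thesis using \<kappa>(1) assms(2)[OF g] unfolding flat_def by (intro exI[of _ "k g * \<kappa>"]) auto
  qed
  then show ?thesis using u unfolding coboundary_def by blast
qed

text \<open>The line bundle contributes scalars \<open>k g\<close> that do not depend on the base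
  point, and flatness absorbs them. The criterion therefore does not see which module
  \<open>R1\<close> was taken.\<close>

lemma product_image_trivial_iff:
  assumes LK: "K_bundle K T unit_circle ca L" and \<Phi>: "frame unit_circle (\<lambda>x. x) L n H R \<Phi>"
    and S: "schurian n H R"
    and R1: "rep (K Mod H) 1 R1"
    and M: "is_image_bundle K T \<rho> H L (product_bundle unit_circle (coset_circle_action \<rho>) 1 R1) M"
  shows "trivial_bundle K T unit_circle ca M \<longleftrightarrow> coboundary (mul L n \<Phi>)"
proof -
  let ?F = "restrict_action (\<lambda>g. H #>\<^bsub>K\<^esub> g) (product_bundle unit_circle (coset_circle_action \<rho>) 1 R1)"
  have \<Theta>: "frame unit_circle (\<lambda>x. x) ?F 1 {} (\<lambda>_ w. w) (\<lambda>x w. (x, w))"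
    unfolding frame_def
  proof (intro conjI ballI)
    show "continuous_map (prod_topology unit_circle (Cspace 1)) (total ?F) (\<lambda>(y, w). (y, w))"
      by (simp add: restrict_action_def product_bundle_def)
    fix x assume x: "x \<in> topspace unit_circle"
    have "fiber ?F x = {x} \<times> Cn 1"
      using x by (auto simp: fiber_def restrict_action_def product_bundle_def)
    moreover have "bij_betw (\<lambda>w. (x, w)) (Cn 1) ({x} \<times> Cn 1)" by (auto simp: bij_betw_def inj_on_def)
    ultimately show "fframe ?F x 1 {} (\<lambda>_ w. w) (\<lambda>w. (x, w))"
      unfolding fframe_def by (simp add: restrict_action_def product_bundle_def)
  qed
  define k where "k g = R1 (H #>\<^bsub>K\<^esub> g) (ev 0) 0" for g
  have HC: "H #>\<^bsub>K\<^esub> g \<in> carrier (K Mod H)" if "g \<in> carrier K" for g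
    using that FactGroup_carrier[OF normal_H] by blast
  have ev1: "ev 0 \<in> Cn 1" by simp
  have lin1: "lin 1 1 (R1 (H #>\<^bsub>K\<^esub> g))" if "g \<in> carrier K" for g
    using R1 HC[OF that] by (simp add: rep_def)
  have k: "R1 (H #>\<^bsub>K\<^esub> g) (ev 0) = (\<lambda>i. k g * ev 0 i)" if "g \<in> carrier K" for g
    unfolding k_def by (rule Cn_1[OF lin_Cn[OF lin1[OF that] ev1]])
  have kH: "k h = 1" if "h \<in> H" for h
  proof -
    have "R1 H (ev 0) = ev 0" using R1 ev1 by (simp add: rep_def FactGroup_one)
    then show ?thesis using that by (simp add: k_def coset_eq_N[OF normal_H]) (simp add: ev_def)
  qed
  have k0: "k g \<noteq> 0" if g: "g \<in> carrier K" for g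
  proof
    assume "k g = 0"
    then have "R1 (H #>\<^bsub>K\<^esub> g) (ev 0) = (\<lambda>_. 0)" using k[OF g] by simp
    then have "R1 (H #>\<^bsub>K\<^esub> inv\<^bsub>K\<^esub> g) (R1 (H #>\<^bsub>K\<^esub> g) (ev 0)) = (\<lambda>_. 0)"
      using lin_zero[OF lin1[OF inv_closed[OF g]]] by simp
    moreover have "R1 (H #>\<^bsub>K\<^esub> inv\<^bsub>K\<^esub> g) (R1 (H #>\<^bsub>K\<^esub> g) (ev 0)) = R1 H (ev 0)"
    proof -
      have "R1 ((H #>\<^bsub>K\<^esub> inv\<^bsub>K\<^esub> g) \<otimes>\<^bsub>K Mod H\<^esub> (H #>\<^bsub>K\<^esub> g)) (ev 0) = R1 (H #>\<^bsub>K\<^esub> inv\<^bsub>K\<^esub> g) (R1 (H #>\<^bsub>K\<^esub> g) (ev 0))"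
        using R1 HC[OF g] HC[OF inv_closed[OF g]] ev1 unfolding rep_def by blast
      then show ?thesis
        unfolding FactGroup_mult[OF normal_H inv_closed[OF g] g] l_inv[OF g] coset_eq_N[OF normal_H one_H] by simp
    qed
    moreover have "R1 H (ev 0) = ev 0" using R1 ev1 by (simp add: rep_def FactGroup_one)
    ultimately show False by (simp add: fun_eq_iff) (metis ev_def zero_neq_one)
  qed
  have "trivial_bundle K T unit_circle ca M \<longleftrightarrow> coboundary (\<lambda>g x. k g * mul L n \<Phi> g x)"
  proof (rule tensor_trivial_iff[OF LK \<Phi> S _ \<Theta>, where r = "\<lambda>g x. k g"])
    show "is_tensor_bundle K T unit_circle ca L ?F M" using M by (simp add: is_image_bundle_def)
    show "act ?F g (x, ev 0) = (ca g x, \<lambda>i. k g * ev 0 i)" if "g \<in> carrier K" "x \<in> sphere 0 1" for g x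
      using that k[OF that(1)] coset_ca[OF that(1)] by (simp add: restrict_action_def product_bundle_def)
  qed (use k0 kH in auto)
  also have "\<dots> \<longleftrightarrow> coboundary (mul L n \<Phi>)"
  proof
    show "coboundary (\<lambda>g x. k g * mul L n \<Phi> g x)" if "coboundary (mul L n \<Phi>)"
      by (rule coboundary_const[OF _ _ that, of _ k]) (use k0 in auto)
    show "coboundary (mul L n \<Phi>)" if "coboundary (\<lambda>g x. k g * mul L n \<Phi> g x)"
      by (rule coboundary_const[OF _ _ that, of _ "\<lambda>g. inverse (k g)"])
        (use k0 in \<open>auto simp: mult.assoc[symmetric]\<close>)
  qed
  finally show ?thesis .
qed

text \<open>The angles of rotations in the image form a subgroup of the reals that contains
  \<open>2 * pi\<close>; it is closed because the image of a compact group is compact.\<close>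

lemma rotation_angles:
  assumes "compact_space T"
  shows "(\<forall>t. rot t \<in> \<rho> ` carrier K) \<or>
    (\<exists>m. (0::nat) < m \<and> (\<exists>g\<in>carrier K. \<rho> g = rot (2 * pi / m)) \<and>
       (\<forall>p\<in>P. \<exists>k::int. \<rho> p = rot (k * (2 * pi / m))))"
proof -
  define \<Gamma> where "\<Gamma> = {t. rot t \<in> \<rho> ` carrier K}"
  have "compactin euclidean (\<rho> ` topspace T)"
    using image_compactin[OF _ rho_cont] assms by (simp add: compact_space_def)
  then have "closed (\<rho> ` carrier K)" by (simp add: compact_imp_closed)
  then have cl: "closed \<Gamma>"
    using continuous_closed_vimage[of "\<rho> ` carrier K" rot] continuous_on_rot
    by (auto simp: \<Gamma>_def vimage_def continuous_on_eq_continuous_at)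
  have \<Gamma>: "t \<in> \<Gamma> \<longleftrightarrow> (\<exists>g\<in>carrier K. \<rho> g = rot t)" for t by (simp add: \<Gamma>_def image_iff eq_commute)
  have zero: "0 \<in> \<Gamma>" unfolding \<Gamma> by (rule bexI[of _ "\<one>\<^bsub>K\<^esub>"]) (simp_all add: rho_one rot_0)
  have add: "s + t \<in> \<Gamma>" if "s \<in> \<Gamma>" "t \<in> \<Gamma>" for s t
    using that unfolding \<Gamma> by (metis m_closed rho_mult rot_mult)
  have neg: "- t \<in> \<Gamma>" if t: "t \<in> \<Gamma>" for t
  proof -
    obtain g where g: "g \<in> carrier K" "\<rho> g = rot t" using t unfolding \<Gamma> by blast
    have "\<rho> (inv\<^bsub>K\<^esub> g) = (rot (- t) ** rot t) ** \<rho> (inv\<^bsub>K\<^esub> g)" by (simp add: rot_mult rot_0)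
    also have "\<dots> = rot (- t)" using rho_inv(1)[OF g(1)] g(2) by (simp add: matrix_mul_assoc[symmetric])
    finally show ?thesis using g(1) unfolding \<Gamma> by blast
  qed
  have p: "2 * pi \<in> \<Gamma>" using zero unfolding \<Gamma> by (simp add: rot_0 rot_2pi)
  show ?thesis
  proof (cases "\<Gamma> = UNIV")
    case True
    then show ?thesis by (auto simp: \<Gamma>_def)
  next
    case False
    obtain m :: nat where m: "0 < m" "\<Gamma> = {of_int k * (2 * pi / m) | k. True}"
      using closed_real_subgroup[OF cl zero add neg p _ False] by auto
    have "2 * pi / m \<in> \<Gamma>" unfolding m(2) by (auto intro: exI[of _ 1])
    moreover have "\<exists>k::int. \<rho> q = rot (k * (2 * pi / m))" if q: "q \<in> P" for q
    proof -
      obtain t where t: "\<rho> q = rot t" using SO2_rot q by (auto simp: P_def)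
      then have "t \<in> \<Gamma>" using q P_subset unfolding \<Gamma> by blast
      then show ?thesis using t m(2) by auto
    qed
    ultimately show ?thesis using m(1) unfolding \<Gamma>
      by (intro disjI2 exI[of _ m] conjI ballI) auto
  qed
qed

lemma rotation_case:
  assumes comp: "compact_space T" and SO2: "\<rho> ` carrier K \<subseteq> SO2"
    and LK: "K_bundle K T unit_circle ca L" and \<Phi>: "frame unit_circle (\<lambda>x. x) L n H R \<Phi>"
    and S: "schurian n H R"
  shows "coboundary (mul L n \<Phi>)"
proof -
  note L = K_bundle_ebundle[OF LK]
  note q = mul_pcocycle[OF L \<Phi> S]
  have PK: "P = carrier K" using SO2 by (auto simp: P_def)
  from rotation_angles[OF comp] show ?thesis
  proof (elim disjE exE conjE bexE)
    assume all: "\<forall>t. rot t \<in> \<rho> ` carrier K"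
    have "SO2 \<subseteq> \<rho> ` carrier K"
    proof
      fix A assume "A \<in> SO2"
      then obtain t where "A = rot t" by (rule SO2_rot)
      then show "A \<in> \<rho> ` carrier K" using all by simp
    qed
    then have "\<rho> ` carrier K = SO2" using SO2 by blast
    moreover have "continuous_map (prod_topology T unit_circle) euclidean (\<lambda>(g, x). mul L n \<Phi> g x)"
      unfolding case_prod_unfold
      by (rule mul_cont_joint[OF L \<Phi> S LK continuous_map_fst continuous_map_snd])
    ultimately show ?thesis
      by (intro transitive_coboundary[OF q mul_base[OF L \<Phi> S] _ comp])
  next
    fix m :: nat and g
    assume m: "0 < m" and g: "g \<in> carrier K" "\<rho> g = rot (2 * pi / m)"
      and rots: "\<forall>p\<in>P. \<exists>k::int. \<rho> p = rot (k * (2 * pi / m))"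
    have rots': "\<exists>k::int. \<rho> p = rot (k * (2 * pi / m))" if "p \<in> carrier K" for p
      using rots that PK by blast
    show ?thesis by (rule cyclic_coboundary[OF q _ rots' g]) (use m in simp_all)
  qed
qed

end

section \<open>Line bundles pulled back from the orbit space\<close>

lemma vector_bundle_restrict_action: "vector_bundle X (restrict_action \<pi> E) \<longleftrightarrow> vector_bundle X E"
  by (simp add: vector_bundle_def fiber_def fiber_coord_def restrict_action_def)

lemma fiber_restrict_action: "fiber (restrict_action \<pi> E) x = fiber E x"
  by (simp add: fiber_def restrict_action_def)

lemma continuous_map_quotient_top: "continuous_map X (quotient_top X q) q"
proof -
  have "{x \<in> topspace X. q x \<in> U} = {x \<in> topspace X. q x \<in> U \<inter> q ` topspace X}" for U by auto
  then show ?thesis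
    unfolding continuous_map_def using openin_quotient_top[of X q] topspace_quotient_top[of X q] by auto
qed

definition sgn_of :: "sign \<Rightarrow> complex" where
  "sgn_of \<epsilon> = (if \<epsilon> = Plus then 1 else - 1)"

context circle_rep begin

abbreviation orb :: "real^2 \<Rightarrow> (real^2) set" where
  "orb \<equiv> circle_orbit \<rho> P"

lemma P_mult: "a \<in> P \<Longrightarrow> b \<in> P \<Longrightarrow> a \<otimes>\<^bsub>K\<^esub> b \<in> P"
  and P_inv: "a \<in> P \<Longrightarrow> inv\<^bsub>K\<^esub> a \<in> P"
  using normal_imp_subgroup[OF normal_P] by (auto intro: subgroup.m_closed subgroup.m_inv_closed)

lemma P_conj: "g \<in> carrier K \<Longrightarrow> p \<in> P \<Longrightarrow> g \<otimes>\<^bsub>K\<^esub> p \<otimes>\<^bsub>K\<^esub> inv\<^bsub>K\<^esub> g \<in> P"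
  using normal_P by (simp add: normal_inv_iff)

lemma orb_self: "x \<in> orb x"
  unfolding circle_orbit_def using H_subset_P one_H ca_one by (metis imageI subsetD rev_image_eqI)

lemma orb_P: "p \<in> P \<Longrightarrow> orb (ca p x) = orb x"
proof -
  assume p: "p \<in> P"
  have pK: "p \<in> carrier K" using p P_subset by blast
  show ?thesis
  proof (intro equalityI subsetI)
    fix y assume "y \<in> orb (ca p x)"
    then obtain a where a: "a \<in> P" "y = ca a (ca p x)" by (auto simp: circle_orbit_def)
    then show "y \<in> orb x" using P_mult[OF a(1) p] pK P_subset
      unfolding circle_orbit_def by (intro image_eqI[of _ _ "a \<otimes>\<^bsub>K\<^esub> p"]) (auto simp: ca_mult subset_iff)
  next
    fix y assume "y \<in> orb x"
    then obtain a where a: "a \<in> P" "y = ca a x" by (auto simp: circle_orbit_def)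
    then have "y = ca (a \<otimes>\<^bsub>K\<^esub> inv\<^bsub>K\<^esub> p) (ca p x)"
      using pK P_subset by (simp add: ca_mult subset_iff ca_inv)
    then show "y \<in> orb (ca p x)" using P_mult[OF a(1) P_inv[OF p]] unfolding circle_orbit_def by blast
  qed
qed

lemma coset_orb:
  assumes g: "g \<in> carrier K"
  shows "coset_orbit_action \<rho> (P #>\<^bsub>K\<^esub> g) (orb x) = orb (ca g x)"
proof (intro equalityI subsetI)
  fix y assume "y \<in> coset_orbit_action \<rho> (P #>\<^bsub>K\<^esub> g) (orb x)"
  then obtain p a where p: "p \<in> P" "a \<in> P" "y = ca (p \<otimes>\<^bsub>K\<^esub> g) (ca a x)"
    by (auto simp: coset_orbit_action_def circle_orbit_def r_coset_def)
  have K: "p \<in> carrier K" "a \<in> carrier K" using p P_subset by auto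
  let ?b = "g \<otimes>\<^bsub>K\<^esub> a \<otimes>\<^bsub>K\<^esub> inv\<^bsub>K\<^esub> g"
  have b: "?b \<in> P" by (rule P_conj[OF g p(2)])
  have "p \<otimes>\<^bsub>K\<^esub> g \<otimes>\<^bsub>K\<^esub> a = p \<otimes>\<^bsub>K\<^esub> ?b \<otimes>\<^bsub>K\<^esub> g" using K g by (simp add: m_assoc)
  then have "y = ca (p \<otimes>\<^bsub>K\<^esub> ?b) (ca g x)"
    using p(3) K g by (simp only: ca_mult[symmetric] m_closed inv_closed)
  then show "y \<in> orb (ca g x)" using P_mult[OF p(1) b] unfolding circle_orbit_def by blast
next
  fix y assume "y \<in> orb (ca g x)"
  then obtain p where p: "p \<in> P" "y = ca p (ca g x)" by (auto simp: circle_orbit_def)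
  then have "y = ca (p \<otimes>\<^bsub>K\<^esub> g) x" using g P_subset by (auto simp: ca_mult subset_iff)
  moreover have "p \<otimes>\<^bsub>K\<^esub> g \<in> P #>\<^bsub>K\<^esub> g" using p(1) by (auto simp: r_coset_def)
  ultimately show "y \<in> coset_orbit_action \<rho> (P #>\<^bsub>K\<^esub> g) (orb x)"
    unfolding coset_orbit_action_def using orb_self[of x] by blast
qed

text \<open>If \<open>g\<close> reverses the orientation, then \<open>g \<otimes> s\<close> lies in
  \<open>P\<close> and moves \<open>x\<close> to the same point as \<open>g\<close>. Hence fixed
  points of a reflection lie over fixed points of the orbit space.\<close>

lemma orb_fixed:
  assumes s: "s \<in> carrier K" "\<rho> s \<notin> SO2" and x: "ca s x = x" and g: "g \<in> carrier K"
  shows "orb (ca g x) = orb x"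
proof (cases "g \<in> P")
  case True
  then show ?thesis by (rule orb_P)
next
  case False
  have "det (\<rho> g) = -1" "det (\<rho> s) = -1"
    using False s det_cases[OF g] det_cases[OF s(1)] P_iff[OF g] P_iff[OF s(1)] by (auto simp: P_def)
  then have "g \<otimes>\<^bsub>K\<^esub> s \<in> P" using g s(1) by (simp add: P_iff det_rho_mult)
  from orb_P[OF this, of x] show ?thesis unfolding ca_mult[OF g s(1)] x .
qed

lemma topspace_orbit_space: "topspace (orbit_space \<rho> P) = orb ` sphere 0 1"
  by (simp add: orbit_space_def topspace_quotient_top)

lemma orb_cont: "continuous_map unit_circle (orbit_space \<rho> P) orb"
  unfolding orbit_space_def by (rule continuous_map_quotient_top)

abbreviation pulled :: "('k set, (real^2) set, 'n) vbundle \<Rightarrow> ('k, real^2, (real^2) \<times> 'n) vbundle" where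
  "pulled N \<equiv> restrict_action (\<lambda>g. H #>\<^bsub>K\<^esub> g) (pullback_bundle unit_circle (coset_circle_action \<rho>)
                     orb (\<lambda>C. P <#>\<^bsub>K\<^esub> C) N)"

context
  fixes N :: "('k set, (real^2) set, 'n) vbundle"
  assumes N: "K_bundle (K Mod P) (quotient_group_top K T P) (orbit_space \<rho> P) (coset_orbit_action \<rho>) N"
    and line: "line_bundle (orbit_space \<rho> P) N"
begin

lemma N_vb: "vector_bundle (orbit_space \<rho> P) N"
  using N by (simp add: K_bundle_def)

lemma coset_in: "g \<in> carrier K \<Longrightarrow> P #>\<^bsub>K\<^esub> g \<in> carrier (K Mod P)"
  using FactGroup_carrier[OF normal_P] by blast

lemma orb_in: "x \<in> sphere 0 1 \<Longrightarrow> orb x \<in> topspace (orbit_space \<rho> P)"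
  unfolding topspace_orbit_space by blast

lemma act_pulled: "g \<in> carrier K \<Longrightarrow> act (pulled N) g (x, e) = (ca g x, act N (P #>\<^bsub>K\<^esub> g) e)"
  by (simp add: restrict_action_def pullback_bundle_def coset_ca P_H_coset)

lemma fiber_pulled: "x \<in> sphere 0 1 \<Longrightarrow> fiber (pulled N) x = {x} \<times> fiber N (orb x)"
  unfolding fiber_restrict_action by (rule fiber_pullback) simp

lemma ops_pulled: "fadd (pulled N) (x, e) (y, e') = (x, fadd N e e')" "fscale (pulled N) c (x, e) = (x, fscale N c e)"
  by (simp_all add: restrict_action_def pullback_bundle_def)

lemma act_N_fiber: "g \<in> carrier K \<Longrightarrow> e \<in> fiber N (orb x) \<Longrightarrow> act N (P #>\<^bsub>K\<^esub> g) e \<in> fiber N (orb (ca g x))"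
  using K_bundle_act_fiber[OF N topspace_quotient_group[OF normal_P] coset_in] coset_orb by metis

lemma act_N_one: "p \<in> P \<Longrightarrow> e \<in> fiber N y \<Longrightarrow> act N (P #>\<^bsub>K\<^esub> p) e = e"
  using N coset_eq_N[OF normal_P] by (auto simp: K_bundle_def K_space_def FactGroup_one fiber_def)

lemma ebundle_pulled: "ebundle (pulled N)"
  unfolding ebundle_def
proof (intro conjI ballI allI)
  show "vector_bundle unit_circle (pulled N)"
    unfolding vector_bundle_restrict_action by (rule vector_bundle_pullback[OF N_vb orb_cont])
  have tot: "total (pulled N) = subtopology (prod_topology unit_circle (total N)) {(x, e). orb x = proj N e}"
    by (simp add: restrict_action_def pullback_bundle_def)
  have in_fib: "fst z \<in> sphere 0 1" "snd z \<in> fiber N (orb (fst z))" if "z \<in> topspace (total (pulled N))" for z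
    using that by (auto simp: tot fiber_def)
  show "continuous_map (total (pulled N)) (total (pulled N)) (act (pulled N) g)" if g: "g \<in> carrier K" for g
  proof -
    have eq: "act (pulled N) g = (\<lambda>z. (ca g (fst z), act N (P #>\<^bsub>K\<^esub> g) (snd z)))"
      using act_pulled[OF g] by (simp add: fun_eq_iff)
    have 1: "continuous_map (total (pulled N)) unit_circle fst" and 2: "continuous_map (total (pulled N)) (total N) snd"
      unfolding tot by (intro continuous_map_from_subtopology continuous_map_fst continuous_map_snd)+
    have "continuous_map (total (pulled N)) (prod_topology unit_circle (total N))
        (\<lambda>z. (ca g (fst z), act N (P #>\<^bsub>K\<^esub> g) (snd z)))"
      by (intro continuous_map_pairedI continuous_map_compose[OF 1 ca_cont1[OF g], unfolded o_def]
          continuous_map_compose[OF 2 K_bundle_act_cont[OF N topspace_quotient_group[OF normal_P] coset_in[OF g]], unfolded o_def])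
    moreover have "orb (ca g (fst z)) = proj N (act N (P #>\<^bsub>K\<^esub> g) (snd z))" if "z \<in> topspace (total (pulled N))" for z
      using act_N_fiber[OF g in_fib(2)[OF that]] by (simp add: fiber_def)
    ultimately show ?thesis
      unfolding eq by (subst (2) tot) (auto simp: continuous_map_in_subtopology)
  qed
  show "act (pulled N) \<one>\<^bsub>K\<^esub> z = z" if "z \<in> topspace (total (pulled N))" for z
    using act_pulled[OF one_closed, of "fst z" "snd z"] act_N_one[OF _ in_fib(2)[OF that], of "\<one>\<^bsub>K\<^esub>"] H_subset_P one_H
    by (auto simp: ca_one)
  show "act (pulled N) (g \<otimes>\<^bsub>K\<^esub> h) z = act (pulled N) g (act (pulled N) h z)"
    if g: "g \<in> carrier K" and h: "h \<in> carrier K" and z: "z \<in> topspace (total (pulled N))" for g h z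
  proof -
    have "snd z \<in> topspace (total N)" using in_fib(2)[OF z] by (simp add: fiber_def)
    then have "act N ((P #>\<^bsub>K\<^esub> g) \<otimes>\<^bsub>K Mod P\<^esub> (P #>\<^bsub>K\<^esub> h)) (snd z) = act N (P #>\<^bsub>K\<^esub> g) (act N (P #>\<^bsub>K\<^esub> h) (snd z))"
      using N coset_in[OF g] coset_in[OF h] unfolding K_bundle_def K_space_def by blast
    then show ?thesis
      using act_pulled[OF m_closed[OF g h], of "fst z" "snd z"] act_pulled[OF h, of "fst z" "snd z"]
        act_pulled[OF g, of "ca h (fst z)" "act N (P #>\<^bsub>K\<^esub> h) (snd z)"] ca_mult[OF g h]
      unfolding FactGroup_mult[OF normal_P g h] by simp
  qed
  fix g and x :: "real^2" and z assume g: "g \<in> carrier K" and x: "x \<in> sphere 0 1" and z: "z \<in> fiber (pulled N) x"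
  obtain e where e: "z = (x, e)" "e \<in> fiber N (orb x)" using z fiber_pulled[OF x] by auto
  note C = coset_in[OF g] and O = orb_in[OF x]
  show "act (pulled N) g z \<in> fiber (pulled N) (ca g x)"
    unfolding fiber_pulled[OF ca_sphere[OF g x]] e(1) act_pulled[OF g] using act_N_fiber[OF g e(2)] by simp
  show "act (pulled N) g (fadd (pulled N) z z') = fadd (pulled N) (act (pulled N) g z) (act (pulled N) g z')"
    if z': "z' \<in> fiber (pulled N) x" for z'
  proof -
    obtain e' where e': "z' = (x, e')" "e' \<in> fiber N (orb x)" using z' fiber_pulled[OF x] by auto
    show ?thesis
      unfolding e e' ops_pulled act_pulled[OF g] K_bundle_act_lin(1)[OF N C O e(2) e'(2)] ..
  qed
  show "act (pulled N) g (fscale (pulled N) c z) = fscale (pulled N) c (act (pulled N) g z)" for c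
    unfolding e ops_pulled act_pulled[OF g] K_bundle_act_lin(2)[OF N C O e(2)] ..
qed

text \<open>The local rank is 1 by comparison with the given line structure of one fiber, and
  \<open>H\<close> acts trivially because it lies in \<open>P\<close>; so local frames glue as for
  an irreducible module.\<close>

lemma pulled_frame:
  obtains \<Theta> where "frame unit_circle (\<lambda>x. x) (pulled N) 1 H (\<lambda>_ w. w) \<Theta>"
proof (rule circle_frame[OF schurian_line])
  fix x :: "real^2" assume x: "x \<in> sphere 0 1"
  obtain U m \<zeta> where U: "openin unit_circle U" "x \<in> U"
    and \<zeta>: "frame (subtopology unit_circle U) (\<lambda>x. x) (pulled N) m {} (\<lambda>_ w. w) \<zeta>"
    by (rule vector_bundle_local[OF eb_vb[OF ebundle_pulled], of x]) (use x in auto)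
  have US: "U \<subseteq> sphere 0 1" using openin_subset[OF U(1)] by simp
  have Z: "fframe (pulled N) y m {} (\<lambda>_ w. w) (\<zeta> y)" if "y \<in> U" for y
    using frame_fframe[OF \<zeta>, of y] that US by auto
  obtain \<psi> where "fiber_coord N (orb x) 1 \<psi>" using line orb_in[OF x] unfolding line_bundle_def by blast
  from fiber_coord_fframe[OF N_vb orb_in[OF x] this, of "{}" undefined]
  have f: "fframe N (orb x) 1 {} undefined (inv_into (fiber N (orb x)) \<psi>)" by simp
  let ?f = "inv_into (fiber N (orb x)) \<psi>"
  have b2: "bij_betw (Pair x) (fiber N (orb x)) ({x} \<times> fiber N (orb x))"
    by (auto simp: bij_betw_def inj_on_def)
  have "fframe (pulled N) x 1 {} (\<lambda>_ w. w) (\<lambda>w. (x, ?f w))"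
    unfolding fframe_def fiber_pulled[OF x] ops_pulled
    using bij_betw_trans[OF fframe_bij[OF f] b2] fframe_add[OF f] fframe_scale[OF f] by (simp add: o_def)
  from fframe_transition[OF this Z[OF U(2)]] have "m = 1" using lin_bij_dim by metis
  note \<zeta> = \<zeta>[unfolded \<open>m = 1\<close>] and Z = Z[unfolded \<open>m = 1\<close>]
  have "frame (subtopology unit_circle U) (\<lambda>x. x) (pulled N) 1 H (\<lambda>_ w. w) \<zeta>"
    unfolding frame_def
  proof (intro conjI ballI)
    show "continuous_map (prod_topology (subtopology unit_circle U) (Cspace 1)) (total (pulled N)) (\<lambda>(y, w). \<zeta> y w)"
      by (rule frame_cont[OF \<zeta>])
    fix y assume "y \<in> topspace (subtopology unit_circle U)"
    then have y: "y \<in> U" "y \<in> sphere 0 1" by auto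
    have "act (pulled N) h (\<zeta> y v) = \<zeta> y v" if h: "h \<in> H" and v: "v \<in> Cn 1" for h v
    proof -
      obtain e where e: "\<zeta> y v = (y, e)" "e \<in> fiber N (orb y)"
        using fframe_fiber[OF Z[OF y(1)] v] fiber_pulled[OF y(2)] by auto
      have hP: "h \<in> P" "h \<in> carrier K" using h H_subset_P H_subset by auto
      show ?thesis unfolding e(1) act_pulled[OF hP(2)] act_N_one[OF hP(1) e(2)] ca_H[OF h] ..
    qed
    then show "fframe (pulled N) y 1 H (\<lambda>_ w. w) (\<zeta> y)"
      using Z[OF y(1)] unfolding fframe_def by simp
  qed
  then show "\<exists>U \<Phi>. openin unit_circle U \<and> x \<in> U \<and> frame (subtopology unit_circle U) (\<lambda>x. x) (pulled N) 1 H (\<lambda>_ w. w) \<Phi>"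
    using U by blast
qed

text \<open>At a point fixed by the reflection \<open>s\<close>, the action of \<open>s\<close> on the pulled back line bundle is given
  by the sign of the fiber module.\<close>

lemma pulled_sign:
  assumes \<Theta>: "frame unit_circle (\<lambda>x. x) (pulled N) 1 H (\<lambda>_ w. w) \<Theta>"
    and s: "s \<in> carrier K" "\<rho> s \<notin> SO2" and x: "x \<in> sphere 0 1" "ca s x = x"
    and sgn: "fiber_module_iso (K Mod P) N (orb x) 1 (sign_module (K Mod P) \<epsilon>)"
  shows "coc (pulled N) 1 \<Theta> s x (ev 0) 0 = sgn_of \<epsilon>"
proof -
  have ev1: "ev 0 \<in> Cn 1" by simp
  note F = frame_at[OF ebundle_pulled \<Theta> x(1)]
  define r where "r = coc (pulled N) 1 \<Theta> s x (ev 0) 0"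
  obtain e where e: "\<Theta> x (ev 0) = (x, e)" "e \<in> fiber N (orb x)"
    using fframe_fiber[OF F ev1] fiber_pulled[OF x(1)] by auto
  obtain \<psi> where \<psi>: "fiber_coord N (orb x) 1 \<psi>"
    "\<And>g e. g \<in> carrier (K Mod P) \<Longrightarrow> e \<in> fiber N (orb x) \<Longrightarrow> \<psi> (act N g e) = sign_module (K Mod P) \<epsilon> g (\<psi> e)"
    using sgn unfolding fiber_module_iso_def by blast
  have scale: "\<psi> (fscale N c e) = (\<lambda>i. c * \<psi> e i)" for c using \<psi>(1) e(2) by (simp add: fiber_coord_def)
  have \<psi>C: "\<psi> e \<in> Cn 1" using \<psi>(1) e(2) by (auto simp: fiber_coord_def bij_betw_def)
  have "act (pulled N) s (\<Theta> x (ev 0)) = \<Theta> x (coc (pulled N) 1 \<Theta> s x (ev 0))"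
    using coc_act[OF ebundle_pulled \<Theta> s(1) x(1) ev1] x(2) by simp
  also have "coc (pulled N) 1 \<Theta> s x (ev 0) = (\<lambda>i. r * ev 0 i)"
    unfolding r_def by (rule Cn_1[OF coc_Cn[OF ebundle_pulled \<Theta> s(1) x(1) ev1]])
  also have "\<Theta> x (\<lambda>i. r * ev 0 i) = (x, fscale N r e)" using fframe_scale[OF F ev1] e(1) by (simp add: ops_pulled)
  finally have "act N (P #>\<^bsub>K\<^esub> s) e = fscale N r e" using act_pulled[OF s(1)] e(1) by simp
  then have sg: "sign_module (K Mod P) \<epsilon> (P #>\<^bsub>K\<^esub> s) (\<psi> e) = (\<lambda>i. r * \<psi> e i)"
    using \<psi>(2)[OF coset_in[OF s(1)] e(2)] scale by simp
  \<comment> \<open>The coset of a reflection is not neutral in \<open>K Mod P\<close>, so the sign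
    module acts on it by \<open>sgn_of \<epsilon>\<close>.\<close>
  have "P #>\<^bsub>K\<^esub> s \<noteq> P"
  proof
    have "\<one>\<^bsub>K\<^esub> \<otimes>\<^bsub>K\<^esub> s \<in> P #>\<^bsub>K\<^esub> s" using H_subset_P one_H unfolding r_coset_def by blast
    then have "s \<in> P #>\<^bsub>K\<^esub> s" using s(1) by simp
    moreover assume "P #>\<^bsub>K\<^esub> s = P"
    ultimately show False using s(2) by (simp add: P_def)
  qed
  then have "sign_module (K Mod P) \<epsilon> (P #>\<^bsub>K\<^esub> s) (\<psi> e) 0 = sgn_of \<epsilon> * \<psi> e 0"
    by (simp add: sign_module_def sgn_of_def FactGroup_one)
  then have eq: "sgn_of \<epsilon> * \<psi> e 0 = r * \<psi> e 0" unfolding sg by (rule sym)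
  \<comment> \<open>The scalars can be compared only if the frame vector is not zero; otherwise
    scaling it by 0 would leave it unchanged, against injectivity of the frame.\<close>
  have "\<psi> e 0 \<noteq> 0"
  proof
    assume "\<psi> e 0 = 0"
    then have z: "\<psi> e = (\<lambda>_. 0)" using Cn_1[OF \<psi>C] by simp
    have "fscale N 0 e \<in> fiber N (orb x)" by (rule vector_bundle_fiber_closed(2)[OF N_vb orb_in[OF x(1)] e(2)])
    moreover have "\<psi> (fscale N 0 e) = \<psi> e" using scale[of 0] z by simp
    moreover have "inj_on \<psi> (fiber N (orb x))" using \<psi>(1) by (simp add: fiber_coord_def bij_betw_def)
    ultimately have "fscale N 0 e = e" using e(2) inj_onD by metis
    then have "\<Theta> x (\<lambda>i. 0 * ev 0 i) = \<Theta> x (ev 0)" using fframe_scale[OF F ev1, of 0] e(1) by (simp add: ops_pulled)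
    then have "(\<lambda>i. 0 * ev 0 i) = ev 0" by (rule fframe_inj[OF F _ Cn_scale[OF ev1] ev1])
    from fun_cong[OF this, of 0] show False by (simp add: ev_def)
  qed
  then show ?thesis using eq by (simp add: r_def)
qed

text \<open>The dihedral criterion is applied to the product of the two cocycles; at the fixed
  points of \<open>s\<close> the factor of the line bundle is the sign of its fiber module.\<close>

lemma pulled_image_trivial_iff:
  fixes m :: nat
  assumes LK: "K_bundle K T unit_circle ca L" and \<Phi>: "frame unit_circle (\<lambda>x. x) L n H R \<Phi>"
    and S: "schurian n H R" and M: "is_image_bundle K T \<rho> H L (pullback_bundle unit_circle (coset_circle_action \<rho>)
                     orb (\<lambda>C. P <#>\<^bsub>K\<^esub> C) N) M"
    and m: "0 < m" and rots: "\<And>p. p \<in> P \<Longrightarrow> \<exists>k::int. \<rho> p = rot (k * (2 * pi / m))"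
    and g: "g \<in> carrier K" "\<rho> g = rot (2 * pi / m)"
    and s: "s \<in> carrier K" "\<rho> s \<notin> SO2" "\<And>t. ca s (circ (t0 + t)) = circ (t0 - t)"
    and sgn0: "fiber_module_iso (K Mod P) N (orb (circ t0)) 1 (sign_module (K Mod P) \<epsilon>)"
    and sgnpi: "fiber_module_iso (K Mod P) N (orb (circ (t0 + pi))) 1 (sign_module (K Mod P) \<delta>)"
  shows "trivial_bundle K T unit_circle ca M \<longleftrightarrow>
    sgn_of \<delta> * mul L n \<Phi> s (circ (t0 + pi)) = sgn_of \<epsilon> * mul L n \<Phi> s (circ t0)"
proof -
  note L = K_bundle_ebundle[OF LK] and E = ebundle_pulled
  obtain \<Theta> where \<Theta>: "frame unit_circle (\<lambda>x. x) (pulled N) 1 H (\<lambda>_ w. w) \<Theta>" by (rule pulled_frame)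
  have ev1: "ev 0 \<in> Cn 1" "ev 0 \<noteq> (\<lambda>_. 0)" by (auto simp: fun_eq_iff) (auto simp: ev_def)
  define r where "r g x = coc (pulled N) 1 \<Theta> g x (ev 0) 0" for g x
  have rc: "coc (pulled N) 1 \<Theta> g x (ev 0) = (\<lambda>i. r g x * ev 0 i)" if "g \<in> carrier K" "x \<in> sphere 0 1" for g x
    unfolding r_def by (rule Cn_1[OF coc_Cn[OF E \<Theta> that ev1(1)]])
  have r0: "r g x \<noteq> 0" if "g \<in> carrier K" "x \<in> sphere 0 1" for g x
    using coc_nonzero[OF E \<Theta> that ev1] rc[OF that] by auto
  have rH: "r h x = 1" if "h \<in> H" "x \<in> sphere 0 1" for h x
    using coc_H[OF E \<Theta> that ev1(1) ev1(1)] by (simp add: r_def) (simp add: ev_def)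
  have rp: "pcocycle r"
    unfolding pcocycle_def
  proof (intro conjI ballI)
    show "continuous_map unit_circle euclidean (r g)" if "g \<in> carrier K" for g
      unfolding r_def by (rule coc_cont[OF E \<Theta> that ev1(1)])
    show "\<exists>\<kappa>. \<kappa> \<noteq> 0 \<and> (\<forall>x\<in>sphere 0 1. r (g \<otimes>\<^bsub>K\<^esub> h) x = \<kappa> * (r g (ca h x) * r h x))"
      if g: "g \<in> carrier K" and h: "h \<in> carrier K" for g h
    \<comment> \<open>The constant is 1: the scalars \<open>r\<close> are matrix entries in a frame
      of rank one and are not normalized at \<open>circ 0\<close>.\<close>
    proof (intro exI[of _ 1] conjI ballI)
      fix x :: "real^2" assume x: "x \<in> sphere 0 1"
      have "coc (pulled N) 1 \<Theta> (g \<otimes>\<^bsub>K\<^esub> h) x (ev 0) = (\<lambda>i. r h x * (r g (ca h x) * ev 0 i))"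
        unfolding coc_mult[OF E \<Theta> g h x ev1(1)] rc[OF h x]
          lin_scale[OF coc_lin[OF E \<Theta> g ca_sphere[OF h x]] ev1(1)] rc[OF g ca_sphere[OF h x]] ..
      then show "r (g \<otimes>\<^bsub>K\<^esub> h) x = 1 * (r g (ca h x) * r h x)"
        by (simp add: r_def[of "g \<otimes>\<^bsub>K\<^esub> h"]) (simp add: ev_def)
    qed simp
  qed (use r0 rH in auto)
  have q: "pcocycle (\<lambda>g x. r g x * mul L n \<Phi> g x)"
    by (rule pcocycle_times[OF rp mul_pcocycle[OF L \<Phi> S]])
  have "trivial_bundle K T unit_circle ca M \<longleftrightarrow> coboundary (\<lambda>g x. r g x * mul L n \<Phi> g x)"
  proof (rule tensor_trivial_iff[OF LK \<Phi> S _ frame_no_group[OF \<Theta>]])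
    show "is_tensor_bundle K T unit_circle ca L (pulled N) M" using M by (simp add: is_image_bundle_def)
    show "act (pulled N) g (\<Theta> x (ev 0)) = \<Theta> (ca g x) (\<lambda>i. r g x * ev 0 i)" if "g \<in> carrier K" "x \<in> sphere 0 1" for g x
      unfolding coc_act[OF E \<Theta> that ev1(1)] rc[OF that] ..
  qed (use r0 rH in auto)
  also have "\<dots> \<longleftrightarrow> r s (circ (t0 + pi)) * mul L n \<Phi> s (circ (t0 + pi)) = r s (circ t0) * mul L n \<Phi> s (circ t0)"
    by (rule dihedral_coboundary_iff[OF q m rots g s]) (auto simp: P_def)
  also have "r s (circ t0) = sgn_of \<epsilon>"
    unfolding r_def by (rule pulled_sign[OF \<Theta> s(1,2) circ_in_sphere _ sgn0]) (use s(3)[of 0] in simp)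
  also have "r s (circ (t0 + pi)) = sgn_of \<delta>"
    unfolding r_def by (rule pulled_sign[OF \<Theta> s(1,2) circ_in_sphere _ sgnpi])
      (use s(3)[of pi] circ_periodic[of "t0 - pi"] in \<open>simp add: algebra_simps\<close>)
  finally show ?thesis .
qed

end

text \<open>If all rotations occurred, one reflection would already generate the rest of
  \<open>O2\<close>. A reflection maps angle \<open>t\<close> to \<open>\<theta> - t\<close>, so
  half of \<open>\<theta>\<close> is the angle \<open>t0\<close> of a fixed point.\<close>

lemma dihedral_structure:
  assumes comp: "compact_space T" and ns: "\<not> \<rho> ` carrier K \<subseteq> SO2" and no: "\<rho> ` carrier K \<noteq> O2"
  obtains m :: nat and g s t0 where "0 < m" "g \<in> carrier K" "\<rho> g = rot (2 * pi / m)"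
    "\<And>p. p \<in> P \<Longrightarrow> \<exists>k::int. \<rho> p = rot (k * (2 * pi / m))"
    "s \<in> carrier K" "\<rho> s \<notin> SO2" "\<And>t. ca s (circ (t0 + t)) = circ (t0 - t)"
proof -
  obtain s where s: "s \<in> carrier K" "\<rho> s \<notin> SO2" using ns by blast
  obtain \<theta> where \<theta>: "\<And>t. \<rho> s *v circ t = circ (\<theta> - t)" using O2_reflection[OF rho_O2[OF s(1)] s(2)] by blast
  have refl: "ca s (circ (\<theta> / 2 + t)) = circ (\<theta> / 2 - t)" for t
    using \<theta>[of "\<theta> / 2 + t"] by (simp add: circle_action_def field_simps)
  from rotation_angles[OF comp] show ?thesis
  proof (elim disjE exE conjE bexE)
    assume all: "\<forall>t. rot t \<in> \<rho> ` carrier K"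
    have SO2: "A \<in> \<rho> ` carrier K" if "A \<in> SO2" for A using SO2_rot[OF that] all by metis
    have "A \<in> \<rho> ` carrier K" if A: "A \<in> O2" for A
    proof (cases "A \<in> SO2")
      case False
      let ?B = "\<rho> (inv\<^bsub>K\<^esub> s) ** A"
      have "?B \<in> O2" using rho_O2[OF inv_closed[OF s(1)]] A by (simp add: O2_def orthogonal_matrix_mul)
      moreover have "det ?B = 1"
        using O2_det[OF A False] O2_det[OF rho_O2[OF s(1)] s(2)] det_rho_inv[OF s(1)] by (simp add: det_mul)
      ultimately obtain h where h: "h \<in> carrier K" "?B = \<rho> h" using SO2 O2_SO2 by blast
      have "A = \<rho> s ** ?B" using rho_inv(1)[OF s(1)] by (simp add: matrix_mul_assoc)
      also have "\<dots> = \<rho> (s \<otimes>\<^bsub>K\<^esub> h)" unfolding h(2) using rho_mult[OF s(1) h(1)] by simp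
      finally show ?thesis using s(1) h(1) by blast
    qed (rule SO2)
    then have "\<rho> ` carrier K = O2" using rho_O2 by blast
    then show ?thesis using no by blast
  next
    fix m :: nat and g
    assume "0 < m" "g \<in> carrier K" "\<rho> g = rot (2 * pi / m)"
      and "\<forall>p\<in>P. \<exists>k::int. \<rho> p = rot (k * (2 * pi / m))"
    then show ?thesis using that[OF _ _ _ _ s refl] by blast
  qed
qed

lemma dihedral_image:
  fixes m :: nat
  assumes m: "0 < m" and g: "g \<in> carrier K" "\<rho> g = rot (2 * pi / m)"
    and rots: "\<And>p. p \<in> P \<Longrightarrow> \<exists>k::int. \<rho> p = rot (k * (2 * pi / m))"
    and s: "s \<in> carrier K" "\<rho> s \<notin> SO2"
  shows "dihedral_subgroup m (\<rho> ` carrier K)" and "card (\<rho> ` carrier K) = 2 * m"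
proof -
  let ?r = "\<lambda>k::nat. rot (2 * pi * real k / real m)"
  have r_eq: "?r k = rot (k * (2 * pi / m))" for k by (simp add: field_simps)
  have rg: "?r k = \<rho> (g [^]\<^bsub>K\<^esub> k)" for k unfolding r_eq by (rule rho_pow[OF g, symmetric])
  have Pr: "\<exists>k<m. \<rho> p = ?r k" if p: "p \<in> P" for p
  proof -
    obtain k :: int where k: "\<rho> p = rot (k * (2 * pi / m))" using rots[OF p] by blast
    obtain j :: nat where "rot (k * (2 * pi / m)) = rot (j * (2 * pi / m))" "j < m" by (rule rot_multiple[OF m])
    then show ?thesis using k r_eq by metis
  qed
  have img: "\<rho> ` carrier K = ?r ` {..<m} \<union> (\<lambda>A. A ** \<rho> s) ` ?r ` {..<m}"
  proof (intro equalityI subsetI)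
    fix A assume "A \<in> \<rho> ` carrier K"
    then obtain p where p: "p \<in> carrier K" "A = \<rho> p" by blast
    show "A \<in> ?r ` {..<m} \<union> (\<lambda>A. A ** \<rho> s) ` ?r ` {..<m}"
    proof (cases "p \<in> P")
      case True
      then show ?thesis using Pr p(2) by auto
    next
      case False
      have "det (\<rho> p) = -1" "det (\<rho> s) = -1"
        using False s det_cases[OF p(1)] det_cases[OF s(1)] P_iff[OF p(1)] P_iff[OF s(1)] by (auto simp: P_def)
      then have "p \<otimes>\<^bsub>K\<^esub> inv\<^bsub>K\<^esub> s \<in> P" using p(1) s(1) by (simp add: P_iff det_rho_mult det_rho_inv)
      then obtain k where k: "k < m" "\<rho> (p \<otimes>\<^bsub>K\<^esub> inv\<^bsub>K\<^esub> s) = ?r k" using Pr by blast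
      have "A = \<rho> (p \<otimes>\<^bsub>K\<^esub> inv\<^bsub>K\<^esub> s \<otimes>\<^bsub>K\<^esub> s)" using p s(1) by (simp add: m_assoc)
      also have "\<dots> = ?r k ** \<rho> s" using rho_mult[of "p \<otimes>\<^bsub>K\<^esub> inv\<^bsub>K\<^esub> s" s] p(1) s(1) k(2) by simp
      finally show ?thesis using k(1) by blast
    qed
  next
    fix A assume "A \<in> ?r ` {..<m} \<union> (\<lambda>A. A ** \<rho> s) ` ?r ` {..<m}"
    then obtain k where "A = ?r k \<or> A = ?r k ** \<rho> s" by blast
    then have "A = \<rho> (g [^]\<^bsub>K\<^esub> k) \<or> A = \<rho> (g [^]\<^bsub>K\<^esub> k \<otimes>\<^bsub>K\<^esub> s)"
      unfolding rg using rho_mult[OF nat_pow_closed[OF g(1)] s(1)] by auto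
    then show "A \<in> \<rho> ` carrier K" using nat_pow_closed[OF g(1)] s(1) by blast
  qed
  have "rotoinversion_matrix (\<rho> s)"
    using rho_O2[OF s(1)] O2_det[OF rho_O2[OF s(1)] s(2)] by (simp add: rotoinversion_matrix_def O2_def)
  then show "dihedral_subgroup m (\<rho> ` carrier K)"
    unfolding dihedral_subgroup_def img using m by (intro conjI exI[of _ "\<rho> s"]) auto
  \<comment> \<open>Equal rotations have indices congruent modulo \<open>m\<close>, and both indices
    are below \<open>m\<close>. Together with disjointness by determinant this gives the order
    \<open>2 * m\<close>.\<close>
  have inj: "inj_on ?r {..<m}"
  proof (rule inj_onI)
    fix i j assume ij: "i \<in> {..<m}" "j \<in> {..<m}" "?r i = ?r j"
    then obtain k :: int where k: "2 * pi * real i / real m = 2 * pi * real j / real m + 2 * pi * k"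
      unfolding rot_inj by blast
    have "2 * pi * (real i) = 2 * pi * (real j + k * real m)"
    proof -
      have "2 * pi * real i = (2 * pi * real i / real m) * real m" using m by simp
      also have "\<dots> = 2 * pi * (real j + k * real m)" unfolding k using m by (simp add: distrib_right distrib_left)
      finally show ?thesis .
    qed
    then have "real i = real j + k * real m" by simp
    then have "real_of_int (int i) = real_of_int (int j + k * int m)" by simp
    then have e: "int i = int j + k * int m" by (simp only: of_int_eq_iff)
    then have "int i mod int m = int j mod int m" by simp
    then show "i = j" using ij(1,2) by simp
  qed
  have inj2: "inj_on (\<lambda>A. A ** \<rho> s) X" for X :: "(real^2^2) set"
  proof (rule inj_onI)
    fix A B :: "real^2^2" assume "A ** \<rho> s = B ** \<rho> s"
    then have "A ** \<rho> s ** \<rho> (inv\<^bsub>K\<^esub> s) = B ** \<rho> s ** \<rho> (inv\<^bsub>K\<^esub> s)" by simp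
    then show "A = B" unfolding matrix_mul_assoc[symmetric] rho_inv(1)[OF s(1)] by simp
  qed
  have "?r ` {..<m} \<inter> (\<lambda>A. A ** \<rho> s) ` ?r ` {..<m} = {}"
  proof -
    have 1: "det A = 1" if "A \<in> ?r ` {..<m}" for A using that SO2_det[OF rot_SO2] by blast
    then have "det (A ** \<rho> s) = -1" if "A \<in> ?r ` {..<m}" for A
      using that O2_det[OF rho_O2[OF s(1)] s(2)] by (simp add: det_mul)
    then have "det A = -1" if "A \<in> (\<lambda>A. A ** \<rho> s) ` ?r ` {..<m}" for A using that by blast
    then show ?thesis using 1 by force
  qed
  then have "card (\<rho> ` carrier K) = card (?r ` {..<m}) + card ((\<lambda>A. A ** \<rho> s) ` ?r ` {..<m})"
    unfolding img by (intro card_Un_disjoint) auto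
  also have "\<dots> = 2 * m" unfolding card_image[OF inj2] card_image[OF inj] by simp
  finally show "card (\<rho> ` carrier K) = 2 * m" .
qed

end

lemma coset_trivial_rep: "rep (K Mod H) 1 trivial_module"
  by (simp add: rep_def trivial_module_def lin_def)

section \<open>Counting the trivial bundles in the dihedral case\<close>

context circle_rep begin

lemma dihedral_case:
  fixes N :: "sign \<Rightarrow> sign \<Rightarrow> ('k set, (real^2) set, 'n) vbundle" and M :: "sign \<Rightarrow> sign \<Rightarrow> ('k, real^2, 'm) vbundle"
  assumes comp: "compact_space T"
    and LK: "K_bundle K T unit_circle ca L" and \<Phi>: "frame unit_circle (\<lambda>x. x) L n H R \<Phi>"
    and S: "schurian n H R"
    and ns: "\<not> \<rho> ` carrier K \<subseteq> SO2" and no: "\<rho> ` carrier K \<noteq> O2"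
    and pq: "p \<noteq> q" "{p, q} = {B \<in> topspace (orbit_space \<rho> P). \<forall>C\<in>carrier (K Mod P). coset_orbit_action \<rho> C B = B}"
    and N: "\<And>\<epsilon> \<delta>. K_bundle (K Mod P) (quotient_group_top K T P) (orbit_space \<rho> P) (coset_orbit_action \<rho>) (N \<epsilon> \<delta>)"
      "\<And>\<epsilon> \<delta>. line_bundle (orbit_space \<rho> P) (N \<epsilon> \<delta>)"
      "\<And>\<epsilon> \<delta>. fiber_module_iso (K Mod P) (N \<epsilon> \<delta>) p 1 (sign_module (K Mod P) \<epsilon>)"
      "\<And>\<epsilon> \<delta>. fiber_module_iso (K Mod P) (N \<epsilon> \<delta>) q 1 (sign_module (K Mod P) \<delta>)"
    and M: "\<And>\<epsilon> \<delta>. is_image_bundle K T \<rho> H L (pullback_bundle unit_circle (coset_circle_action \<rho>)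
                     orb (\<lambda>C. P <#>\<^bsub>K\<^esub> C) (N \<epsilon> \<delta>)) (M \<epsilon> \<delta>)"
  shows "odd (card (\<rho> ` carrier K) div 2) \<Longrightarrow> card {(\<epsilon>, \<delta>). trivial_bundle K T unit_circle ca (M \<epsilon> \<delta>)} = 2"
    and "even (card (\<rho> ` carrier K) div 2) \<Longrightarrow>
      (\<forall>\<epsilon> \<delta>. trivial_bundle K T unit_circle ca (M \<epsilon> \<delta>)) \<or> (\<forall>\<epsilon> \<delta>. \<not> trivial_bundle K T unit_circle ca (M \<epsilon> \<delta>))"
proof -
  note L = K_bundle_ebundle[OF LK]
  obtain m :: nat and g s t0 where m: "0 < m" and g: "g \<in> carrier K" "\<rho> g = rot (2 * pi / m)"
    and rots: "\<And>p. p \<in> P \<Longrightarrow> \<exists>k::int. \<rho> p = rot (k * (2 * pi / m))"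
    and s: "s \<in> carrier K" "\<rho> s \<notin> SO2" "\<And>t. ca s (circ (t0 + t)) = circ (t0 - t)"
    by (rule dihedral_structure[OF comp ns no]) blast
  have card: "card (\<rho> ` carrier K) div 2 = m"
    using dihedral_image(2)[OF m g rots s(1,2)] by simp
  define x0 where "x0 = circ t0"
  define x1 where "x1 = circ (t0 + pi)"
  have f0: "ca s x0 = x0" using s(3)[of 0] by (simp add: x0_def)
  have f1: "ca s x1 = x1" using s(3)[of pi] circ_periodic[of "t0 - pi"] by (simp add: x1_def algebra_simps)
  have xs: "x0 \<in> sphere 0 1" "x1 \<in> sphere 0 1" by (simp_all add: x0_def x1_def)
  have "orb x \<in> {p, q}" if x: "x \<in> sphere 0 1" "ca s x = x" for x
    unfolding pq(2) FactGroup_carrier[OF normal_P]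
    using x(1) coset_orb orb_fixed[OF s(1,2) x(2)] by (auto simp: topspace_orbit_space)
  then have O: "orb x0 = p \<or> orb x0 = q" "orb x1 = p \<or> orb x1 = q" using xs f0 f1 by blast+
  define c0 where "c0 = mul L n \<Phi> s x0"
  define c1 where "c1 = mul L n \<Phi> s x1"
  have c0nz: "c0 \<noteq> 0" unfolding c0_def by (rule mul_nonzero[OF L \<Phi> S s(1) xs(1)])
  \<comment> \<open>The square of \<open>s\<close> lies in \<open>H\<close>, so the squares of its
    multipliers at the two fixed points agree. The sign of \<open>c1\<close> against
    \<open>c0\<close> is the obstruction carried by \<open>L\<close>.\<close>
  have c01: "c1 = c0 \<or> c1 = - c0"
  proof -
    have ss: "s \<otimes>\<^bsub>K\<^esub> s \<in> H" by (rule reflection_square[OF s(1,3)])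
    obtain \<kappa> where \<kappa>: "\<kappa> \<noteq> 0" "\<And>x. x \<in> sphere 0 1 \<Longrightarrow> mul L n \<Phi> (s \<otimes>\<^bsub>K\<^esub> s) x = \<kappa> * (mul L n \<Phi> s (ca s x) * mul L n \<Phi> s x)"
      using pcocycle_mult[OF mul_pcocycle[OF L \<Phi> S] s(1) s(1)] by blast
    have "\<kappa> * (c0 * c0) = \<kappa> * (c1 * c1)"
      using \<kappa>(2)[OF xs(1)] \<kappa>(2)[OF xs(2)] mul_H[OF L \<Phi> S ss xs(1)] mul_H[OF L \<Phi> S ss xs(2)] f0 f1
      by (simp add: c0_def c1_def)
    then have "c0 * c0 = c1 * c1" using \<kappa>(1) by simp
    then show ?thesis using square_eq_iff[of c1 c0] by auto
  qed
  \<comment> \<open>The signs belong to the orbits of \<open>x0\<close> and \<open>x1\<close>. Since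
    \<open>p\<close> and \<open>q\<close> are labelled arbitrarily, these orbits may be
    \<open>p\<close> and \<open>q\<close> in either order.\<close>
  have triv: "trivial_bundle K T unit_circle ca (M \<epsilon> \<delta>) \<longleftrightarrow> sgn_of \<delta>' * c1 = sgn_of \<epsilon>' * c0"
    if "fiber_module_iso (K Mod P) (N \<epsilon> \<delta>) (orb x0) 1 (sign_module (K Mod P) \<epsilon>')"
       "fiber_module_iso (K Mod P) (N \<epsilon> \<delta>) (orb x1) 1 (sign_module (K Mod P) \<delta>')" for \<epsilon> \<delta> \<epsilon>' \<delta>'
    using pulled_image_trivial_iff[OF N(1,2) LK \<Phi> S M m rots g s that[unfolded x0_def x1_def]]
    by (simp add: c0_def c1_def x0_def x1_def)
  have sg: "sgn_of Plus = 1" "sgn_of Minus = -1" by (simp_all add: sgn_of_def)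
  show "card {(\<epsilon>, \<delta>). trivial_bundle K T unit_circle ca (M \<epsilon> \<delta>)} = 2" if odd: "odd (card (\<rho> ` carrier K) div 2)"
  proof -
    \<comment> \<open>A rotation from \<open>x0\<close> to \<open>x1\<close> would be one by
      \<open>pi\<close> modulo full turns, hence \<open>pi\<close> would be a multiple of
      \<open>2 * pi / m\<close> modulo \<open>2 * pi\<close> and \<open>m\<close> would be
      even.\<close>
    have "orb x0 \<noteq> orb x1"
    proof
      assume "orb x0 = orb x1"
      then obtain p where p: "p \<in> P" "x1 = ca p x0" using orb_self[of x1] by (auto simp: circle_orbit_def)
      obtain k :: int where "\<rho> p = rot (k * (2 * pi / m))" using rots[OF p(1)] by blast
      then have "circ (t0 + pi) = circ (t0 + k * (2 * pi / m))"
        using p(2) by (simp add: x0_def x1_def circle_action_def rot_circ)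
      then obtain j :: int where "t0 + pi = t0 + k * (2 * pi / m) + 2 * pi * j" unfolding circ_eq_iff by blast
      then have "pi * real m = pi * (2 * k + 2 * j * real m)" using m by (simp add: field_simps)
      then have "real_of_int (int m) = real_of_int (2 * k + 2 * j * int m)" by simp
      then have "int m = 2 * (k + j * int m)" by (simp only: of_int_eq_iff) simp
      then have "even (int m)" by (metis dvd_triv_left)
      then show False using odd card by simp
    qed
    then have "orb x0 = p \<and> orb x1 = q \<or> orb x0 = q \<and> orb x1 = p" using O by auto
    then have t: "trivial_bundle K T unit_circle ca (M \<epsilon> \<delta>) \<longleftrightarrow> (\<epsilon> = \<delta> \<longleftrightarrow> c1 = c0)" for \<epsilon> \<delta>
    proof (elim disjE conjE)
      assume o: "orb x0 = p" "orb x1 = q"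
      show ?thesis
        using triv[of \<epsilon> \<delta> \<epsilon> \<delta>] N(3,4)[of \<epsilon> \<delta>] c01 c0nz unfolding o
        by (cases \<epsilon>; cases \<delta>) (auto simp: sg)
    next
      assume o: "orb x0 = q" "orb x1 = p"
      show ?thesis
        using triv[of \<epsilon> \<delta> \<delta> \<epsilon>] N(3,4)[of \<epsilon> \<delta>] c01 c0nz unfolding o
        by (cases \<epsilon>; cases \<delta>) (auto simp: sg)
    qed
    have "{(\<epsilon>, \<delta>). trivial_bundle K T unit_circle ca (M \<epsilon> \<delta>)} =
        (if c1 = c0 then {(Plus, Plus), (Minus, Minus)} else {(Plus, Minus), (Minus, Plus)})"
      unfolding t using sign.exhaust by auto
    then show ?thesis by simp
  qed
  show "(\<forall>\<epsilon> \<delta>. trivial_bundle K T unit_circle ca (M \<epsilon> \<delta>)) \<or> (\<forall>\<epsilon> \<delta>. \<not> trivial_bundle K T unit_circle ca (M \<epsilon> \<delta>))"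
    if ev: "even (card (\<rho> ` carrier K) div 2)"
  proof -
    \<comment> \<open>For even \<open>m\<close> the power \<open>g [^] j\<close> is the rotation by
      \<open>pi\<close>, which joins the two fixed points. Both then carry the same sign, and it
      cancels from the criterion.\<close>
    obtain j where j: "m = 2 * j" using ev card by auto
    have "\<rho> (g [^]\<^bsub>K\<^esub> j) = rot pi"
      using rho_pow[OF g, of j] m by (simp add: j)
    then have "g [^]\<^bsub>K\<^esub> j \<in> P" "x1 = ca (g [^]\<^bsub>K\<^esub> j) x0"
      using nat_pow_closed[OF g(1)] rot_SO2 by (simp_all add: P_def circle_action_def rot_circ x0_def x1_def)
    then have "orb x1 = orb x0" using orb_P by simp
    then have "trivial_bundle K T unit_circle ca (M \<epsilon> \<delta>) \<longleftrightarrow> c1 = c0" for \<epsilon> \<delta>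
      using O(1)
    proof (elim disjE)
      assume o: "orb x1 = orb x0" "orb x0 = p"
      show ?thesis using triv[of \<epsilon> \<delta> \<epsilon> \<epsilon>] N(3)[of \<epsilon> \<delta>] unfolding o by (cases \<epsilon>) (auto simp: sg)
    next
      assume o: "orb x1 = orb x0" "orb x0 = q"
      show ?thesis using triv[of \<epsilon> \<delta> \<delta> \<delta>] N(4)[of \<epsilon> \<delta>] unfolding o by (cases \<delta>) (auto simp: sg)
    qed
    then show ?thesis by blast
  qed
qed

end

section \<open>The isotropy group of a character\<close>

lemma topological_subgroup:
  assumes G: "topological_group G T" and A: "subgroup A G"
  shows "topological_group (G\<lparr>carrier := A\<rparr>) (subtopology T A)"
proof -
  have grp: "group G" and top: "topspace T = carrier G" using G by (auto simp: topological_group_def)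
  interpret group G by (rule grp)
  have AG: "A \<subseteq> carrier G" by (rule subgroup.subset[OF A])
  have tA: "topspace (subtopology T A) = A" using AG top by auto
  have "continuous_map (prod_topology (subtopology T A) (subtopology T A)) T (\<lambda>(x, y). x \<otimes>\<^bsub>G\<^esub> y)"
    using G unfolding subtopology_Times[symmetric]
    by (auto simp: topological_group_def intro: continuous_map_from_subtopology)
  then have "continuous_map (prod_topology (subtopology T A) (subtopology T A)) (subtopology T A) (\<lambda>(x, y). x \<otimes>\<^bsub>G\<^esub> y)"
    by (auto simp: continuous_map_in_subtopology intro: subgroup.m_closed[OF A])
  moreover have "continuous_map (subtopology T A) (subtopology T A) (\<lambda>x. inv\<^bsub>G\<^esub> x)"
    using G by (auto simp: topological_group_def continuous_map_in_subtopology
      intro: continuous_map_from_subtopology subgroup.m_inv_closed[OF A])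
  then have "continuous_map (subtopology T A) (subtopology T A) (\<lambda>x. inv\<^bsub>G\<lparr>carrier := A\<rparr>\<^esub> x)"
    by (rule continuous_map_eq) (use m_inv_consistent[OF A] tA in auto)
  ultimately show ?thesis
    using subgroup_imp_group[OF A] tA by (simp add: topological_group_def)
qed

text \<open>\<open>H\<close> lies in the isotropy group because a character is a class function, by
  symmetry of the trace. This makes the kernel of \<open>\<rho>\<close> on the isotropy group equal
  to \<open>H\<close>.\<close>

lemma (in circle_rep) character_isotropy_subgroup:
  assumes R: "rep (K\<lparr>carrier := H\<rparr>) n R" and chi: "\<And>h. h \<in> H \<Longrightarrow> chi h = tr n (R h)"
  shows "subgroup (character_isotropy K H chi) K" "H \<subseteq> character_isotropy K H chi"
proof -
  have conj: "inv\<^bsub>K\<^esub> g \<otimes>\<^bsub>K\<^esub> h \<otimes>\<^bsub>K\<^esub> g \<in> H" if "g \<in> carrier K" "h \<in> H" for g h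
    using H_conj[OF inv_closed[OF that(1)] that(2)] that by simp
  have HK: "h \<in> carrier K" if "h \<in> H" for h using that H_subset by blast
  have chi_conj: "chi (inv\<^bsub>K\<^esub> a \<otimes>\<^bsub>K\<^esub> h \<otimes>\<^bsub>K\<^esub> a) = chi h" if a: "a \<in> H" and h: "h \<in> H" for a h
  proof -
    have ia: "inv\<^bsub>K\<^esub> a \<in> H" using subgroup.m_inv_closed[OF normal_imp_subgroup[OF normal_H] a] .
    have linR: "lin n n (R b)" if "b \<in> H" for b using R that by (simp add: rep_def)
    have mult: "R (b \<otimes>\<^bsub>K\<^esub> c) v = R b (R c v)" if "b \<in> H" "c \<in> H" "v \<in> Cn n" for b c v
      using R that by (simp add: rep_def)
    have "chi (inv\<^bsub>K\<^esub> a \<otimes>\<^bsub>K\<^esub> h \<otimes>\<^bsub>K\<^esub> a) = tr n (R (inv\<^bsub>K\<^esub> a \<otimes>\<^bsub>K\<^esub> h \<otimes>\<^bsub>K\<^esub> a))"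
      by (rule chi[OF H_mult[OF H_mult[OF ia h] a]])
    also have "\<dots> = tr n (\<lambda>v. R (inv\<^bsub>K\<^esub> a) (R (h \<otimes>\<^bsub>K\<^esub> a) v))"
      by (rule tr_cong) (use mult[OF ia H_mult[OF h a]] HK[OF a] HK[OF h] in \<open>simp add: m_assoc\<close>)
    also have "\<dots> = tr n (\<lambda>v. R (h \<otimes>\<^bsub>K\<^esub> a) (R (inv\<^bsub>K\<^esub> a) v))"
      by (rule tr_comp_commute[OF linR[OF ia] linR[OF H_mult[OF h a]]])
    also have "\<dots> = tr n (R h)"
      by (rule tr_cong) (use mult[OF H_mult[OF h a] ia] HK[OF a] HK[OF h] in \<open>simp add: m_assoc\<close>)
    finally show ?thesis using chi[OF h] by simp
  qed
  then show "H \<subseteq> character_isotropy K H chi" using HK by (auto simp: character_isotropy_def)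
  show "subgroup (character_isotropy K H chi) K"
  proof (rule subgroupI)
    show "character_isotropy K H chi \<subseteq> carrier K" by (auto simp: character_isotropy_def)
    show "character_isotropy K H chi \<noteq> {}"
      using one_H chi_conj HK unfolding character_isotropy_def by blast
    show "inv\<^bsub>K\<^esub> a \<in> character_isotropy K H chi" if a: "a \<in> character_isotropy K H chi" for a
    proof -
      have aK: "a \<in> carrier K" using a by (simp add: character_isotropy_def)
      have "chi (inv\<^bsub>K\<^esub> (inv\<^bsub>K\<^esub> a) \<otimes>\<^bsub>K\<^esub> h \<otimes>\<^bsub>K\<^esub> inv\<^bsub>K\<^esub> a) = chi h" if h: "h \<in> H" for h
      proof -
        let ?k = "a \<otimes>\<^bsub>K\<^esub> h \<otimes>\<^bsub>K\<^esub> inv\<^bsub>K\<^esub> a"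
        have "chi (inv\<^bsub>K\<^esub> a \<otimes>\<^bsub>K\<^esub> ?k \<otimes>\<^bsub>K\<^esub> a) = chi ?k"
          using a H_conj[OF aK h] by (simp add: character_isotropy_def)
        moreover have "inv\<^bsub>K\<^esub> a \<otimes>\<^bsub>K\<^esub> ?k \<otimes>\<^bsub>K\<^esub> a = h"
        proof -
          have "inv\<^bsub>K\<^esub> a \<otimes>\<^bsub>K\<^esub> ?k \<otimes>\<^bsub>K\<^esub> a = (inv\<^bsub>K\<^esub> a \<otimes>\<^bsub>K\<^esub> a) \<otimes>\<^bsub>K\<^esub> h \<otimes>\<^bsub>K\<^esub> (inv\<^bsub>K\<^esub> a \<otimes>\<^bsub>K\<^esub> a)"
            using aK HK[OF h] by (simp only: m_assoc m_closed inv_closed)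
          then show ?thesis using aK HK[OF h] by simp
        qed
        ultimately show ?thesis using aK by simp
      qed
      then show ?thesis using aK by (simp add: character_isotropy_def)
    qed
    show "a \<otimes>\<^bsub>K\<^esub> b \<in> character_isotropy K H chi"
      if a: "a \<in> character_isotropy K H chi" and b: "b \<in> character_isotropy K H chi" for a b
    proof -
      have aK: "a \<in> carrier K" "b \<in> carrier K" using a b by (simp_all add: character_isotropy_def)
      have "chi (inv\<^bsub>K\<^esub> (a \<otimes>\<^bsub>K\<^esub> b) \<otimes>\<^bsub>K\<^esub> h \<otimes>\<^bsub>K\<^esub> (a \<otimes>\<^bsub>K\<^esub> b)) = chi h" if h: "h \<in> H" for h
      proof -
        let ?k = "inv\<^bsub>K\<^esub> a \<otimes>\<^bsub>K\<^esub> h \<otimes>\<^bsub>K\<^esub> a"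
        have "inv\<^bsub>K\<^esub> (a \<otimes>\<^bsub>K\<^esub> b) \<otimes>\<^bsub>K\<^esub> h \<otimes>\<^bsub>K\<^esub> (a \<otimes>\<^bsub>K\<^esub> b) = inv\<^bsub>K\<^esub> b \<otimes>\<^bsub>K\<^esub> ?k \<otimes>\<^bsub>K\<^esub> b"
          using aK HK[OF h] by (simp add: inv_mult_group m_assoc)
        then show ?thesis
          using b a conj[OF aK(1) h] h by (simp add: character_isotropy_def)
      qed
      then show ?thesis using aK by (simp add: character_isotropy_def)
    qed
  qed
qed

text \<open>An intersection of closed conditions, one for each element of \<open>H\<close>; as a
  closed subgroup of a compact group the isotropy group is compact.\<close>

lemma (in circle_rep) character_isotropy_closed:
  assumes R: "K_module (K\<lparr>carrier := H\<rparr>) (subtopology T H) n R" and chi: "\<And>h. h \<in> H \<Longrightarrow> chi h = tr n (R h)"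
  shows "closedin T (character_isotropy K H chi)"
proof -
  have tH: "topspace (subtopology T H) = H" using H_subset by auto
  have "continuous_map (prod_topology (subtopology T H) (Cspace n)) (Cspace n) (\<lambda>(g, x). R g x)"
    using R by (auto simp: K_module_def K_space_def)
  from continuous_map_compose[OF continuous_map_pairedI[OF continuous_map_id] this]
  have "continuous_map (subtopology T H) (Cspace n) (\<lambda>h. R h (ev i))" if "i < n" for i
    using that by (simp add: o_def)
  then have "continuous_map (subtopology T H) euclidean (\<lambda>h. tr n (R h))"
    unfolding tr_def by (intro continuous_map_sum') (auto simp: continuous_map_Cspace)
  then have cchi: "continuous_map (subtopology T H) euclidean chi"
    by (rule continuous_map_eq) (use chi tH in auto)
  have mult: "continuous_map (prod_topology T T) T (\<lambda>(x, y). x \<otimes>\<^bsub>K\<^esub> y)" and inv: "continuous_map T T (\<lambda>x. inv\<^bsub>K\<^esub> x)"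
    using topological by (auto simp: topological_group_def)
  have c: "continuous_map T euclidean (\<lambda>g. chi (inv\<^bsub>K\<^esub> g \<otimes>\<^bsub>K\<^esub> h \<otimes>\<^bsub>K\<^esub> g))" if h: "h \<in> H" for h
  proof -
    have "continuous_map T T (\<lambda>g. inv\<^bsub>K\<^esub> g \<otimes>\<^bsub>K\<^esub> h)"
      using continuous_map_compose[OF continuous_map_pairedI[OF inv, of T "\<lambda>_. h"] mult] h H_subset by (auto simp: o_def)
    from continuous_map_compose[OF continuous_map_pairedI[OF this continuous_map_id] mult]
    have "continuous_map T T (\<lambda>g. inv\<^bsub>K\<^esub> g \<otimes>\<^bsub>K\<^esub> h \<otimes>\<^bsub>K\<^esub> g)" by (simp add: o_def)
    moreover have "inv\<^bsub>K\<^esub> g \<otimes>\<^bsub>K\<^esub> h \<otimes>\<^bsub>K\<^esub> g \<in> H" if "g \<in> carrier K" for g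
      using H_conj[OF inv_closed[OF that] h] that by simp
    ultimately have "continuous_map T (subtopology T H) (\<lambda>g. inv\<^bsub>K\<^esub> g \<otimes>\<^bsub>K\<^esub> h \<otimes>\<^bsub>K\<^esub> g)"
      by (auto simp: continuous_map_in_subtopology)
    from continuous_map_compose[OF this cchi] show ?thesis by (simp add: o_def)
  qed
  have "closedin T {g \<in> topspace T. chi (inv\<^bsub>K\<^esub> g \<otimes>\<^bsub>K\<^esub> h \<otimes>\<^bsub>K\<^esub> g) \<in> {chi h}}" if "h \<in> H" for h
    by (rule closedin_continuous_map_preimage[OF c[OF that]]) simp
  then have "closedin T (\<Inter>h\<in>H. {g \<in> topspace T. chi (inv\<^bsub>K\<^esub> g \<otimes>\<^bsub>K\<^esub> h \<otimes>\<^bsub>K\<^esub> g) \<in> {chi h}})"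
    using one_H by (intro closedin_INT) auto
  moreover have "(\<Inter>h\<in>H. {g \<in> topspace T. chi (inv\<^bsub>K\<^esub> g \<otimes>\<^bsub>K\<^esub> h \<otimes>\<^bsub>K\<^esub> g) \<in> {chi h}}) = character_isotropy K H chi"
    using one_H by (auto simp: character_isotropy_def)
  ultimately show ?thesis by simp
qed

text \<open>Images of generators are defined only up to isomorphism, so the claims range over every
  \<open>M\<close> that represents a tensor product with \<open>L\<close>. Likewise (2) takes any
  two non-isomorphic one-dimensional modules, and (3) any labelling of the two fixed points.\<close>

theorem theorem3:
  fixes G :: "'a monoid" and T :: "'a topology"
    and \<rho> :: "'a \<Rightarrow> real^2^2" and chi :: "'a \<Rightarrow> complex"
    and H :: "'a set" and K :: "'a monoid" and TK :: "'a topology"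
    and L :: "('a, real^2, 'l) vbundle"
  assumes G: "compact_lie_group G T"
    and rho: "orthogonal_rep G T \<rho>"
    and H: "H = {g \<in> carrier G. \<rho> g = mat 1}"
    and irr: "\<exists>n R. irreducible_module (G\<lparr>carrier := H\<rparr>) (subtopology T H) n R \<and>
                    (\<forall>h\<in>H. chi h = module_character n R h)"
    and K: "K = G\<lparr>carrier := character_isotropy G H chi\<rparr>"
    and TK: "TK = subtopology T (carrier K)"
    and L: "K_bundle K TK unit_circle (circle_action \<rho>) L"
    and L_fiber: "\<forall>x\<in>topspace unit_circle. \<exists>n R.
                    K_module (G\<lparr>carrier := H\<rparr>) (subtopology T H) n R \<and>
                    (\<forall>h\<in>H. chi h = module_character n R h) \<and>
                    fiber_module_iso (G\<lparr>carrier := H\<rparr>) L x n R"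
  shows
    "(\<rho> ` carrier K \<subseteq> SO2 \<longrightarrow>
       (\<forall>M :: ('a, real^2, 'm) vbundle.
          is_image_bundle K TK \<rho> H L
            (product_bundle unit_circle (coset_circle_action \<rho>) 1 trivial_module) M
          \<longrightarrow> trivial_bundle K TK unit_circle (circle_action \<rho>) M)) \<and>
    (\<rho> ` carrier K = O2 \<longrightarrow>
       (\<forall>R R' (M :: ('a, real^2, 'm) vbundle) (M' :: ('a, real^2, 'm) vbundle).
          K_module (K Mod H) (quotient_group_top K TK H) 1 R \<and>
          K_module (K Mod H) (quotient_group_top K TK H) 1 R' \<and>
          \<not> module_iso (K Mod H) 1 R 1 R' \<and>
          is_image_bundle K TK \<rho> H L
            (product_bundle unit_circle (coset_circle_action \<rho>) 1 R) M \<and>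
          is_image_bundle K TK \<rho> H L
            (product_bundle unit_circle (coset_circle_action \<rho>) 1 R') M'
          \<longrightarrow> trivial_bundle K TK unit_circle (circle_action \<rho>) M \<and>
              trivial_bundle K TK unit_circle (circle_action \<rho>) M' \<or>
              \<not> trivial_bundle K TK unit_circle (circle_action \<rho>) M \<and>
              \<not> trivial_bundle K TK unit_circle (circle_action \<rho>) M')) \<and>
    (\<not> \<rho> ` carrier K \<subseteq> SO2 \<and> \<rho> ` carrier K \<noteq> O2 \<longrightarrow>
       (\<exists>n. dihedral_subgroup n (\<rho> ` carrier K)) \<and>
       (\<forall>P p q
          (N :: sign \<Rightarrow> sign \<Rightarrow> ('a set, (real^2) set, 'n) vbundle)
          (M :: sign \<Rightarrow> sign \<Rightarrow> ('a, real^2, 'm) vbundle).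
          P = {g \<in> carrier K. \<rho> g \<in> SO2} \<and>
          p \<noteq> q \<and>
          {p, q} = {B \<in> topspace (orbit_space \<rho> P).
                      \<forall>C\<in>carrier (K Mod P). coset_orbit_action \<rho> C B = B} \<and>
          (\<forall>\<epsilon> \<delta>.
             K_bundle (K Mod P) (quotient_group_top K TK P)
               (orbit_space \<rho> P) (coset_orbit_action \<rho>) (N \<epsilon> \<delta>) \<and>
             line_bundle (orbit_space \<rho> P) (N \<epsilon> \<delta>) \<and>
             fiber_module_iso (K Mod P) (N \<epsilon> \<delta>) p 1 (sign_module (K Mod P) \<epsilon>) \<and>
             fiber_module_iso (K Mod P) (N \<epsilon> \<delta>) q 1 (sign_module (K Mod P) \<delta>) \<and>
             is_image_bundle K TK \<rho> H L
                  (pullback_bundle unit_circle (coset_circle_action \<rho>)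
                     (circle_orbit \<rho> P) (\<lambda>C. P <#>\<^bsub>K\<^esub> C) (N \<epsilon> \<delta>))
               (M \<epsilon> \<delta>))
          \<longrightarrow>
          (odd (card (\<rho> ` carrier K) div 2) \<longrightarrow>
             card {(\<epsilon>, \<delta>). trivial_bundle K TK unit_circle (circle_action \<rho>) (M \<epsilon> \<delta>)} = 2) \<and>
          (even (card (\<rho> ` carrier K) div 2) \<longrightarrow>
             (\<forall>\<epsilon> \<delta>. trivial_bundle K TK unit_circle (circle_action \<rho>) (M \<epsilon> \<delta>)) \<or>
             (\<forall>\<epsilon> \<delta>. \<not> trivial_bundle K TK unit_circle (circle_action \<rho>) (M \<epsilon> \<delta>)))))"
proof -
  have TG: "topological_group G T" and compG: "compact_space T"
    using G by (auto simp: compact_lie_group_def lie_group_def)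
  \<comment> \<open>First for the full group, in order to establish that the isotropy group is a
    subgroup, contains \<open>H\<close> and is closed.\<close>
  interpret G: circle_rep G T \<rho> H by unfold_locales (use TG rho H in auto)
  obtain n R0 where irrR: "irreducible_module (G\<lparr>carrier := H\<rparr>) (subtopology T H) n R0"
    and chi0: "\<And>h. h \<in> H \<Longrightarrow> chi h = tr n (R0 h)"
    using irr unfolding module_character_tr by blast
  have modR: "K_module (G\<lparr>carrier := H\<rparr>) (subtopology T H) n R0"
    using irrR by (simp add: irreducible_module_def)
  have tH: "topspace (subtopology T H) = carrier (G\<lparr>carrier := H\<rparr>)" using G.H_subset by auto
  have rep0: "rep (G\<lparr>carrier := H\<rparr>) n R0" by (rule K_module_rep[OF modR tH])
  have irr0: "irred n (R0 ` H)"
    using irrR by (simp add: irreducible_module_def irred_def)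
  have S: "schurian n H R0" using irr0 rep0 by (simp add: schurian_def rep_def)
  let ?A = "character_isotropy G H chi"
  have sub: "subgroup ?A G" and HA: "H \<subseteq> ?A"
    by (rule G.character_isotropy_subgroup[OF rep0 chi0]; assumption)+
  have AG: "?A \<subseteq> carrier G" by (rule subgroup.subset[OF sub])
  have carK: "carrier K = ?A" using K by simp
  have TGK: "topological_group K TK"
    using topological_subgroup[OF TG sub] by (simp add: K TK)
  have rhoK: "orthogonal_rep K TK \<rho>"
    using rho AG unfolding orthogonal_rep_def TK carK K
    by (auto intro: continuous_map_from_subtopology)
  have HK: "H = {g \<in> carrier K. \<rho> g = mat 1}" using H HA AG carK by auto
  interpret circle_rep K TK \<rho> H by unfold_locales (rule TGK, rule rhoK, rule HK)
  have comp: "compact_space TK"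
    unfolding TK carK using closedin_compact_space[OF compG G.character_isotropy_closed[OF modR chi0]]
    by (simp add: compact_space_subtopology)
  have GK: "G\<lparr>carrier := H\<rparr> = K\<lparr>carrier := H\<rparr>" by (simp add: K)
  \<comment> \<open>The fibers carry modules that vary with the point, but each has the character of
    \<open>R0\<close>; \<open>K_bundle_local_frame\<close> needs no more than this.\<close>
  have "\<exists>U \<Phi>. openin unit_circle U \<and> x \<in> U \<and> frame (subtopology unit_circle U) (\<lambda>x. x) L n H R0 \<Phi>"
    if x: "x \<in> sphere 0 1" for x
  proof (rule K_bundle_local_frame[OF L top H_subset H_monoid ca_H rep0[unfolded GK] irr0])
    fix y assume "y \<in> topspace unit_circle"
    then obtain m R where R: "K_module (G\<lparr>carrier := H\<rparr>) (subtopology T H) m R"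
      "\<forall>h\<in>H. chi h = module_character m R h" "fiber_module_iso (G\<lparr>carrier := H\<rparr>) L y m R"
      using L_fiber by blast
    have "\<forall>h\<in>H. tr m (R h) = tr n (R0 h)" using R(2) chi0 by (simp add: module_character_tr)
    then show "\<exists>m R. rep (K\<lparr>carrier := H\<rparr>) m R \<and> (\<forall>h\<in>H. tr m (R h) = tr n (R0 h)) \<and> fiber_module_iso (K\<lparr>carrier := H\<rparr>) L y m R"
      using K_module_rep[OF R(1) tH] R(3) unfolding GK by blast
  qed (use x in auto)
  then obtain \<Phi> where \<Phi>: "frame unit_circle (\<lambda>x. x) L n H R0 \<Phi>"
    using circle_frame[OF S] by blast
  show ?thesis
  proof (intro conjI impI allI)
    fix M :: "('a, real^2, 'm) vbundle"
    assume "\<rho> ` carrier K \<subseteq> SO2"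
      and "is_image_bundle K TK \<rho> H L (product_bundle unit_circle (coset_circle_action \<rho>) 1 trivial_module) M"
    then show "trivial_bundle K TK unit_circle (circle_action \<rho>) M"
      using product_image_trivial_iff[OF L \<Phi> S coset_trivial_rep] rotation_case[OF comp _ L \<Phi> S] by blast
  next
    fix R R' and M M' :: "('a, real^2, 'm) vbundle"
    assume a: "K_module (K Mod H) (quotient_group_top K TK H) 1 R \<and>
          K_module (K Mod H) (quotient_group_top K TK H) 1 R' \<and>
          \<not> module_iso (K Mod H) 1 R 1 R' \<and>
          is_image_bundle K TK \<rho> H L
            (product_bundle unit_circle (coset_circle_action \<rho>) 1 R) M \<and>
          is_image_bundle K TK \<rho> H L
            (product_bundle unit_circle (coset_circle_action \<rho>) 1 R') M'"
    have "rep (K Mod H) 1 R" "rep (K Mod H) 1 R'"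
      using a K_module_rep topspace_quotient_group[OF normal_H] by blast+
    then show "trivial_bundle K TK unit_circle (circle_action \<rho>) M \<and>
              trivial_bundle K TK unit_circle (circle_action \<rho>) M' \<or>
              \<not> trivial_bundle K TK unit_circle (circle_action \<rho>) M \<and>
              \<not> trivial_bundle K TK unit_circle (circle_action \<rho>) M'"
      using a product_image_trivial_iff[OF L \<Phi> S] by blast
  next
    assume c: "\<not> \<rho> ` carrier K \<subseteq> SO2 \<and> \<rho> ` carrier K \<noteq> O2"
    show "\<exists>n. dihedral_subgroup n (\<rho> ` carrier K)"
      using dihedral_structure[OF comp] dihedral_image(1) c by metis
  next
    fix P' p q and N :: "sign \<Rightarrow> sign \<Rightarrow> ('a set, (real^2) set, 'n) vbundle"
      and M :: "sign \<Rightarrow> sign \<Rightarrow> ('a, real^2, 'm) vbundle"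
    assume c: "\<not> \<rho> ` carrier K \<subseteq> SO2 \<and> \<rho> ` carrier K \<noteq> O2"
      and a: "P' = {g \<in> carrier K. \<rho> g \<in> SO2} \<and>
          p \<noteq> q \<and>
          {p, q} = {B \<in> topspace (orbit_space \<rho> P').
                      \<forall>C\<in>carrier (K Mod P'). coset_orbit_action \<rho> C B = B} \<and>
          (\<forall>\<epsilon> \<delta>.
             K_bundle (K Mod P') (quotient_group_top K TK P')
               (orbit_space \<rho> P') (coset_orbit_action \<rho>) (N \<epsilon> \<delta>) \<and>
             line_bundle (orbit_space \<rho> P') (N \<epsilon> \<delta>) \<and>
             fiber_module_iso (K Mod P') (N \<epsilon> \<delta>) p 1 (sign_module (K Mod P') \<epsilon>) \<and>
             fiber_module_iso (K Mod P') (N \<epsilon> \<delta>) q 1 (sign_module (K Mod P') \<delta>) \<and>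
             is_image_bundle K TK \<rho> H L
                  (pullback_bundle unit_circle (coset_circle_action \<rho>)
                     (circle_orbit \<rho> P') (\<lambda>C. P' <#>\<^bsub>K\<^esub> C) (N \<epsilon> \<delta>))
               (M \<epsilon> \<delta>))"
    have P': "P' = P" using a by (simp add: P_def)
    have pq: "p \<noteq> q" and fix_pq: "{p, q} = {B \<in> topspace (orbit_space \<rho> P).
                      \<forall>C\<in>carrier (K Mod P). coset_orbit_action \<rho> C B = B}"
      using a unfolding P' by simp_all
    have N: "\<And>\<epsilon> \<delta>. K_bundle (K Mod P) (quotient_group_top K TK P) (orbit_space \<rho> P) (coset_orbit_action \<rho>) (N \<epsilon> \<delta>)"
      "\<And>\<epsilon> \<delta>. line_bundle (orbit_space \<rho> P) (N \<epsilon> \<delta>)"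
      "\<And>\<epsilon> \<delta>. fiber_module_iso (K Mod P) (N \<epsilon> \<delta>) p 1 (sign_module (K Mod P) \<epsilon>)"
      "\<And>\<epsilon> \<delta>. fiber_module_iso (K Mod P) (N \<epsilon> \<delta>) q 1 (sign_module (K Mod P) \<delta>)"
      "\<And>\<epsilon> \<delta>. is_image_bundle K TK \<rho> H L (pullback_bundle unit_circle (coset_circle_action \<rho>)
                     (circle_orbit \<rho> P) (\<lambda>C. P <#>\<^bsub>K\<^esub> C) (N \<epsilon> \<delta>)) (M \<epsilon> \<delta>)"
      using a unfolding P' by blast+
    show "card {(\<epsilon>, \<delta>). trivial_bundle K TK unit_circle (circle_action \<rho>) (M \<epsilon> \<delta>)} = 2"
      if "odd (card (\<rho> ` carrier K) div 2)"
      by (rule dihedral_case(1)[OF comp L \<Phi> S conjunct1[OF c] conjunct2[OF c] pq fix_pq N that])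
    show "(\<forall>\<epsilon> \<delta>. trivial_bundle K TK unit_circle (circle_action \<rho>) (M \<epsilon> \<delta>)) \<or>
             (\<forall>\<epsilon> \<delta>. \<not> trivial_bundle K TK unit_circle (circle_action \<rho>) (M \<epsilon> \<delta>))"
      if "even (card (\<rho> ` carrier K) div 2)"
      by (rule dihedral_case(2)[OF comp L \<Phi> S conjunct1[OF c] conjunct2[OF c] pq fix_pq N that])
  qed
qed

end
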